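(* Let $q=e^{2\pi i/3}$, let $s$ satisfy $s^4=1$, and let $|\Psi_L(z_1,\dots,z_L)\rangle=\sum_{\alpha}\psi_\alpha(z_1,\dots,z_L)|\alpha\rangle\in \mathrm{LP}_L$ be the ground state eigenvector of the two-boundary TL(1) transfer matrix of width $L$, i.e. the eigenvector with eigenvalue $1$, $T_L(w;z_1,\dots,z_L;\zeta_0,\zeta_L)|\Psi_L\rangle=|\Psi_L\rangle$, where the components $\psi_\alpha$ are coprime polynomials in $z_1^{\pm1},\dots,z_L^{\pm1}$. Then $|\Psi_L\rangle$ satisfies the $q$-deformed Knizhnik--Zamolodchikov equation $$\check R_i(z_i/z_{i+1})|\Psi_L\rangle=\pi_i|\Psi_L\rangle\quad(1\le i\le L-1),\qquad \check K_0(1/z_1,\zeta_0)|\Psi_L\rangle=\pi_0|\Psi_L\rangle,\qquad \check K_L(sz_L,s\zeta_L)|\Psi_L\rangle=\pi_L|\Psi_L\rangle .$$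
   Context: Notation: $q=e^{2\pi i/3}$, $[x]=x-x^{-1}$, $k(x,\zeta)=[x/(q\zeta)]\,[x\zeta/q]$. Link patterns. A link pattern of size $L$ is a sequence $\alpha\in\{\text{``('',``)''}\}^L$. Matched parentheses (in the usual sense) are sites linked to each other; an unmatched ``)'' is a site connected to the left boundary and an unmatched ``('' is a site connected to the right boundary. $\mathrm{LP}_L$ is the vector space with basis $|\alpha\rangle$ (dimension $2^L$), with coefficients that are functions of the parameters. Generators $e_0,\dots,e_L$ act linearly on $\mathrm{LP}_L$, mapping link patterns to link patterns. For $1\le i\le L-1$, $e_i$ links sites $i$ and $i+1$ to each other and joins whatever they were previously connected to (two former partner sites become linked; if one of $i,i+1$ was connected to a boundary and the other to a site, that site becomes connected to that boundary; if both were connected to boundaries, or were linked to each other, nothing else changes). $e_0$ replaces the first bracket by ``)'', and $e_L$ replaces the last bracket by ``(''. Baxterised elements: $\check R_i(z)=\dfrac{[q/z]-[z]e_i}{[qz]}$ for $1\le i\le L-1$, and $\check K_i(z,\zeta)=\dfrac{k(z,\zeta)+[q^{-1}][z^2]e_i}{k(1/z,\zeta)}$ for $i=0,L$. The operators $\pi_i$ act on coefficient functions only: for $1\le i\le L-1$, $\pi_i$ exchanges $z_i$ and $z_{i+1}$; $\pi_0$ replaces $z_1$ by $1/z_1$; $\pi_L$ replaces $z_L$ by $1/(s^2z_L)$. Transfer matrix $T_L(w;z_1,\dots,z_L;\zeta_0,\zeta_L)$ on $\mathrm{LP}_L$. Take two rows (lower, upper) of $L$ unit square faces. Each face carries two arcs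 joining the midpoints of its edges: type I joins left edge to top edge and bottom edge to right edge; type II joins left edge to bottom edge and top edge to right edge. Weights: lower face at position $i$: type I $\frac{[qz_i/w]}{[qw/z_i]}$, type II $\frac{[z_i/w]}{[qw/z_i]}$; upper face at position $i$: type II $\frac{[q/(z_iw)]}{[qz_iw]}$, type I $-\frac{[z_iw]}{[qz_iw]}$. On the left, the left edges of the two faces at position 1 are either joined to each other, with weight $\frac{k(q/w,\zeta_0)}{k(w/q,\zeta_0)}$, or both connected to the left boundary, with weight $\frac{[q^{-1}][q^2/w^2]}{k(w/q,\zeta_0)}$. On the right, the right edges of the two faces at position $L$ are either joined to each other, with weight $\frac{k(w,\zeta_L)}{k(1/w,\zeta_L)}$, or both connected to the right boundary, with weight $\frac{[q^{-1}][w^2]}{k(1/w,\zeta_L)}$. The weight of a configuration is the product of all these weights. $T_L|\alpha\rangle$ is the sum over all $2^{2L+2}$ configurations of (weight)$\,|\beta\rangle$, where $\beta$ is obtained by attaching $\alpha$ to the bottom edges of the lower row (site $i$ to the bottom edge of face $i$) and reading off how the top edges of the upper row are connected to each other and to the boundaries; closed loops and paths with both ends on boundaries are discarded (weight 1). The transfer matrices with different $w$ commute, so the eigenvector does not depend on $w$; the eigenvector with eigenvalue 1 is assumed to be unique (up to normalisation) for generic $z_1,\dots,z_L$.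
   Formalization: The boundary parameters ζ_0, ζ_L are taken generic (off the zeros of a nonzero Laurent polynomial), and the monomial freedom in Ψ is fixed by making the exponents of each z_i symmetric about 0; every coprime ground state has such a monomial multiple. *)

theory Defs
  imports Complex_Main "HOL-Library.Poly_Mapping"
begin

definition q :: complex where
  "q = exp (2 * of_real pi * \<i> / 3)"

definition br :: "complex \<Rightarrow> complex" where
  "br x = x - inverse x"

definition kfun :: "complex \<Rightarrow> complex \<Rightarrow> complex" where
  "kfun x \<zeta> = br (x / (q * \<zeta>)) * br (x * \<zeta> / q)"


text \<open>Link patterns. Sites are numbered from 1, so site \<open>i\<close> is the list entry \<open>i - 1\<close>.\<close>

datatype bracket = Opn | Cls

definition LP :: "nat \<Rightarrow> bracket list set" where
  "LP L = {\<alpha>. length \<alpha> = L}"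

inductive balanced :: "bracket list \<Rightarrow> bool" where
  "balanced []"
| "balanced xs \<Longrightarrow> balanced ys \<Longrightarrow> balanced (Opn # xs @ Cls # ys)"

definition matched :: "bracket list \<Rightarrow> nat \<Rightarrow> nat \<Rightarrow> bool" where
  "matched \<alpha> i j \<longleftrightarrow> 1 \<le> i \<and> i < j \<and> j \<le> length \<alpha> \<and>
     \<alpha> ! (i - 1) = Opn \<and> \<alpha> ! (j - 1) = Cls \<and> balanced (take (j - i - 1) (drop i \<alpha>))"

definition linked :: "bracket list \<Rightarrow> nat \<Rightarrow> nat \<Rightarrow> bool" where
  "linked \<alpha> i j \<longleftrightarrow> matched \<alpha> i j \<or> matched \<alpha> j i"

datatype link = Site nat | LeftBdry | RightBdry

definition link_of :: "bracket list \<Rightarrow> nat \<Rightarrow> link" where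
  "link_of \<alpha> i =
     (if \<exists>j. linked \<alpha> i j then Site (THE j. linked \<alpha> i j)
      else if \<alpha> ! (i - 1) = Cls then LeftBdry else RightBdry)"

text \<open>The bracket word encoding a (noncrossing) connectivity; it is inverse to \<^const>\<open>link_of\<close>.\<close>

definition pattern_of :: "nat \<Rightarrow> (nat \<Rightarrow> link) \<Rightarrow> bracket list" where
  "pattern_of L c =
     map (\<lambda>i. case c i of Site j \<Rightarrow> if j < i then Cls else Opn | LeftBdry \<Rightarrow> Cls | RightBdry \<Rightarrow> Opn)
       [1..<Suc L]"


text \<open>The generators. In the bulk case the fourth and fifth branches reconnect the former
  partner of one of the sites \<open>i\<close>, \<open>i + 1\<close> to whatever the other one was connected to; a connection
  of both to boundaries is dropped.\<close>

definition join_sites :: "nat \<Rightarrow> (nat \<Rightarrow> link) \<Rightarrow> nat \<Rightarrow> link" where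
  "join_sites i c j =
     (if j = i then Site (i + 1)
      else if j = i + 1 then Site i
      else if c j = Site i then c (i + 1)
      else if c j = Site (i + 1) then c i
      else c j)"

definition gen :: "nat \<Rightarrow> nat \<Rightarrow> bracket list \<Rightarrow> bracket list" where
  "gen L i \<alpha> =
     (if i = 0 then Cls # tl \<alpha>
      else if i = L then butlast \<alpha> @ [Opn]
      else pattern_of L (join_sites i (link_of \<alpha>)))"


text \<open>A vector is given by its components; only those indexed by \<open>LP L\<close> matter. Below, \<open>gen_op\<close>
  is the linear extension of \<^const>\<open>gen\<close>.\<close>

type_synonym vec = "bracket list \<Rightarrow> complex"

definition vec_eq :: "nat \<Rightarrow> vec \<Rightarrow> vec \<Rightarrow> bool" where
  "vec_eq L u v \<longleftrightarrow> (\<forall>\<alpha>\<in>LP L. u \<alpha> = v \<alpha>)"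

definition gen_op :: "nat \<Rightarrow> nat \<Rightarrow> vec \<Rightarrow> vec" where
  "gen_op L i v \<beta> = (\<Sum>\<alpha> | \<alpha> \<in> LP L \<and> gen L i \<alpha> = \<beta>. v \<alpha>)"

definition R_op :: "nat \<Rightarrow> nat \<Rightarrow> complex \<Rightarrow> vec \<Rightarrow> vec" where
  "R_op L i z v \<beta> = (br (q / z) * v \<beta> - br z * gen_op L i v \<beta>) / br (q * z)"

definition K_op :: "nat \<Rightarrow> nat \<Rightarrow> complex \<Rightarrow> complex \<Rightarrow> vec \<Rightarrow> vec" where
  "K_op L i z \<zeta> v \<beta> =
     (kfun z \<zeta> * v \<beta> + br (inverse q) * br (z\<^sup>2) * gen_op L i v \<beta>) / kfun (1 / z) \<zeta>"


text \<open>The double row of faces. Points are the edge midpoints: \<open>Bottom i\<close>, \<open>Middle i\<close>, \<open>Top i\<close> on the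
  horizontal edges of column \<open>i\<close>, and \<open>Lower i\<close>, \<open>Upper i\<close> on the vertical edges of the two rows
  between columns \<open>i\<close> and \<open>i + 1\<close> (so \<open>0\<close> is the left and \<open>L\<close> the right end). A configuration is
  \<open>(A, B, l, r)\<close>: the columns whose lower, respectively upper, face is of type I, and whether the
  two left, respectively right, ends are joined to each other.\<close>

datatype point = Bottom nat | Middle nat | Top nat | Lower nat | Upper nat

type_synonym config = "nat set \<times> nat set \<times> bool \<times> bool"

definition configs :: "nat \<Rightarrow> config set" where
  "configs L = Pow {1..L} \<times> Pow {1..L} \<times> UNIV \<times> UNIV"

definition lower_arcs :: "nat set \<Rightarrow> nat \<Rightarrow> (point \<times> point) set" where
  "lower_arcs A i =
     (if i \<in> A then {(Lower (i - 1), Middle i), (Bottom i, Lower i)}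
      else {(Lower (i - 1), Bottom i), (Middle i, Lower i)})"

definition upper_arcs :: "nat set \<Rightarrow> nat \<Rightarrow> (point \<times> point) set" where
  "upper_arcs B i =
     (if i \<in> B then {(Upper (i - 1), Top i), (Middle i, Upper i)}
      else {(Upper (i - 1), Middle i), (Top i, Upper i)})"

fun arcs :: "nat \<Rightarrow> config \<Rightarrow> bracket list \<Rightarrow> (point \<times> point) set" where
  "arcs L (A, B, l, r) \<alpha> =
     {(Bottom i, Bottom j) | i j. linked \<alpha> i j}
     \<union> (\<Union>i\<in>{1..L}. lower_arcs A i \<union> upper_arcs B i)
     \<union> (if l then {(Lower 0, Upper 0)} else {})
     \<union> (if r then {(Lower L, Upper L)} else {})"

fun left_ends :: "nat \<Rightarrow> config \<Rightarrow> bracket list \<Rightarrow> point set" where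
  "left_ends L (A, B, l, r) \<alpha> =
     {Bottom i | i. i \<in> {1..L} \<and> link_of \<alpha> i = LeftBdry} \<union> (if l then {} else {Lower 0, Upper 0})"

definition paths :: "nat \<Rightarrow> config \<Rightarrow> bracket list \<Rightarrow> (point \<times> point) set" where
  "paths L C \<alpha> = (arcs L C \<alpha> \<union> (arcs L C \<alpha>)\<inverse>)\<^sup>*"

text \<open>The path starting at a top edge ends at another top edge or at one of the two boundaries, so
  the last branch is the case of the right boundary.\<close>

definition top_link :: "nat \<Rightarrow> config \<Rightarrow> bracket list \<Rightarrow> nat \<Rightarrow> link" where
  "top_link L C \<alpha> i =
     (if \<exists>j\<in>{1..L}. j \<noteq> i \<and> (Top i, Top j) \<in> paths L C \<alpha>
        then Site (THE j. j \<in> {1..L} \<and> j \<noteq> i \<and> (Top i, Top j) \<in> paths L C \<alpha>)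
      else if \<exists>x\<in>left_ends L C \<alpha>. (Top i, x) \<in> paths L C \<alpha> then LeftBdry
      else RightBdry)"

definition out_pattern :: "nat \<Rightarrow> config \<Rightarrow> bracket list \<Rightarrow> bracket list" where
  "out_pattern L C \<alpha> = pattern_of L (top_link L C \<alpha>)"

fun weight :: "nat \<Rightarrow> complex \<Rightarrow> (nat \<Rightarrow> complex) \<Rightarrow> complex \<Rightarrow> complex \<Rightarrow> config \<Rightarrow> complex" where
  "weight L w z \<zeta>0 \<zeta>L (A, B, l, r) =
     (\<Prod>i\<in>{1..L}. (if i \<in> A then br (q * z i / w) else br (z i / w)) / br (q * w / z i)) *
     (\<Prod>i\<in>{1..L}. (if i \<in> B then - br (z i * w) else br (q / (z i * w))) / br (q * z i * w)) *
     ((if l then kfun (q / w) \<zeta>0 else br (inverse q) * br (q\<^sup>2 / w\<^sup>2)) / kfun (w / q) \<zeta>0) *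
     ((if r then kfun w \<zeta>L else br (inverse q) * br (w\<^sup>2)) / kfun (1 / w) \<zeta>L)"

definition T_op ::
  "nat \<Rightarrow> complex \<Rightarrow> (nat \<Rightarrow> complex) \<Rightarrow> complex \<Rightarrow> complex \<Rightarrow> vec \<Rightarrow> vec" where
  "T_op L w z \<zeta>0 \<zeta>L v \<beta> =
     (\<Sum>(\<alpha>, C) | \<alpha> \<in> LP L \<and> C \<in> configs L \<and> out_pattern L C \<alpha> = \<beta>. weight L w z \<zeta>0 \<zeta>L C * v \<alpha>)"

text \<open>Identities of rational functions are stated pointwise at nonzero arguments where no
  denominator vanishes.\<close>

definition T_regular :: "nat \<Rightarrow> complex \<Rightarrow> (nat \<Rightarrow> complex) \<Rightarrow> complex \<Rightarrow> complex \<Rightarrow> bool" where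
  "T_regular L w z \<zeta>0 \<zeta>L \<longleftrightarrow>
     w \<noteq> 0 \<and> (\<forall>i\<in>{1..L}. br (q * w / z i) \<noteq> 0 \<and> br (q * z i * w) \<noteq> 0) \<and>
     kfun (w / q) \<zeta>0 \<noteq> 0 \<and> kfun (1 / w) \<zeta>L \<noteq> 0"

definition fixed_vec :: "nat \<Rightarrow> (nat \<Rightarrow> complex) \<Rightarrow> complex \<Rightarrow> complex \<Rightarrow> vec \<Rightarrow> bool" where
  "fixed_vec L z \<zeta>0 \<zeta>L v \<longleftrightarrow>
     (\<forall>w. T_regular L w z \<zeta>0 \<zeta>L \<longrightarrow> vec_eq L (T_op L w z \<zeta>0 \<zeta>L v) v)"


text \<open>Laurent polynomials, as the group algebra of the exponent vectors.\<close>

type_synonym laurent = "(nat \<Rightarrow>\<^sub>0 int) \<Rightarrow>\<^sub>0 complex"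

definition laurent_in :: "nat set \<Rightarrow> laurent set" where
  "laurent_in V = {p. \<forall>m\<in>Poly_Mapping.keys p. Poly_Mapping.keys m \<subseteq> V}"

definition leval :: "laurent \<Rightarrow> (nat \<Rightarrow> complex) \<Rightarrow> complex" where
  "leval p z = (\<Sum>m\<in>Poly_Mapping.keys p. Poly_Mapping.lookup p m *
     (\<Prod>i\<in>Poly_Mapping.keys m. z i powi Poly_Mapping.lookup m i))"

definition generically :: "nat set \<Rightarrow> ((nat \<Rightarrow> complex) \<Rightarrow> bool) \<Rightarrow> bool" where
  "generically V P \<longleftrightarrow>
     (\<exists>p\<in>laurent_in V. p \<noteq> 0 \<and> (\<forall>x. (\<forall>i\<in>V. x i \<noteq> 0) \<longrightarrow> leval p x \<noteq> 0 \<longrightarrow> P x))"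

definition unique_fixed_vec :: "nat \<Rightarrow> complex \<Rightarrow> complex \<Rightarrow> bool" where
  "unique_fixed_vec L \<zeta>0 \<zeta>L \<longleftrightarrow>
     generically {1..L} (\<lambda>z. \<forall>u v. fixed_vec L z \<zeta>0 \<zeta>L u \<longrightarrow> fixed_vec L z \<zeta>0 \<zeta>L v \<longrightarrow>
       (\<exists>a b. (a \<noteq> 0 \<or> b \<noteq> 0) \<and> vec_eq L (\<lambda>\<alpha>. a * u \<alpha>) (\<lambda>\<alpha>. b * v \<alpha>)))"

type_synonym lvec = "bracket list \<Rightarrow> laurent"

definition vec_at :: "lvec \<Rightarrow> (nat \<Rightarrow> complex) \<Rightarrow> vec" where
  "vec_at \<Psi> z \<alpha> = leval (\<Psi> \<alpha>) z"

definition coprime_components :: "nat \<Rightarrow> lvec \<Rightarrow> bool" where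
  "coprime_components L \<Psi> \<longleftrightarrow>
     (\<forall>g\<in>laurent_in {1..L}. (\<forall>\<alpha>\<in>LP L. g dvd \<Psi> \<alpha>) \<longrightarrow> g dvd 1)"

definition ground_state :: "nat \<Rightarrow> complex \<Rightarrow> complex \<Rightarrow> lvec \<Rightarrow> bool" where
  "ground_state L \<zeta>0 \<zeta>L \<Psi> \<longleftrightarrow>
     (\<forall>\<alpha>\<in>LP L. \<Psi> \<alpha> \<in> laurent_in {1..L}) \<and> coprime_components L \<Psi> \<and>
     (\<forall>z. (\<forall>i\<in>{1..L}. z i \<noteq> 0) \<longrightarrow> fixed_vec L z \<zeta>0 \<zeta>L (vec_at \<Psi> z))"

text \<open>Coprimality determines a vector of Laurent polynomials only up to a unit, that is, up to a
  scalar and a monomial in the \<open>z\<^sub>i\<close>. The monomial is fixed by requiring the range of exponents of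
  each \<open>z\<^sub>i\<close> to be symmetric about 0.\<close>

definition exponents :: "nat \<Rightarrow> lvec \<Rightarrow> nat \<Rightarrow> int set" where
  "exponents L \<Psi> i = {Poly_Mapping.lookup m i | m \<alpha>. \<alpha> \<in> LP L \<and> m \<in> Poly_Mapping.keys (\<Psi> \<alpha>)}"

definition centred :: "nat \<Rightarrow> lvec \<Rightarrow> bool" where
  "centred L \<Psi> \<longleftrightarrow> (\<forall>i\<in>{1..L}. Min (exponents L \<Psi> i) = - Max (exponents L \<Psi> i))"

definition monomial_mult :: "(nat \<Rightarrow>\<^sub>0 int) \<Rightarrow> lvec \<Rightarrow> lvec" where
  "monomial_mult m \<Psi> \<alpha> = Poly_Mapping.single m 1 * \<Psi> \<alpha>"


text \<open>The operators \<open>\<pi>\<^sub>i\<close> and the \<open>q\<close>-deformed Knizhnik--Zamolodchikov equation.\<close>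

definition pi_op ::
  "nat \<Rightarrow> complex \<Rightarrow> nat \<Rightarrow> ((nat \<Rightarrow> complex) \<Rightarrow> vec) \<Rightarrow> (nat \<Rightarrow> complex) \<Rightarrow> vec" where
  "pi_op L s i f z =
     f (if i = 0 then z(1 := 1 / z 1)
        else if i = L then z(L := 1 / (s\<^sup>2 * z L))
        else z(i := z (i + 1), i + 1 := z i))"

definition qKZ :: "nat \<Rightarrow> complex \<Rightarrow> complex \<Rightarrow> complex \<Rightarrow> lvec \<Rightarrow> bool" where
  "qKZ L s \<zeta>0 \<zeta>L \<Psi> \<longleftrightarrow>
     (\<forall>z. (\<forall>i\<in>{1..L}. z i \<noteq> 0) \<longrightarrow>
        (\<forall>i\<in>{1..<L}. br (q * (z i / z (i + 1))) \<noteq> 0 \<longrightarrow>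
           vec_eq L (R_op L i (z i / z (i + 1)) (vec_at \<Psi> z)) (pi_op L s i (vec_at \<Psi>) z)) \<and>
        (kfun (z 1) \<zeta>0 \<noteq> 0 \<longrightarrow>
           vec_eq L (K_op L 0 (1 / z 1) \<zeta>0 (vec_at \<Psi> z)) (pi_op L s 0 (vec_at \<Psi>) z)) \<and>
        (kfun (1 / (s * z L)) (s * \<zeta>L) \<noteq> 0 \<longrightarrow>
           vec_eq L (K_op L L (s * z L) (s * \<zeta>L) (vec_at \<Psi> z)) (pi_op L s L (vec_at \<Psi>) z)))"

end

(* The transfer matrix is a product of elementary tiles, so the intertwining relations of the
   Baxterised generators with it are the Yang-Baxter and reflection equations, checked on the dual
   operators tile by tile. Hence R_i(z_i/z_{i+1}) Psi, and likewise K_0 Psi and K_L Psi, is again a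
   fixed vector, at the transformed parameters, and it has the same coefficient sum S as Psi.

   Two fixed vectors with proportional sums are proportional as soon as no nonzero fixed vector has
   sum zero. This is an open condition. It holds at special points where only one tiling survives,
   hence on generic points and, for generic zeta_0, zeta_L, also on the divisors where b, the
   denominator of R_i or K_i with z_i and z_{i+1} exchanged or z_i inverted, vanishes. Coprimality of
   the components then shows that R_i Psi and pi_i Psi differ by a factor t with t * pi_i t = 1 that
   has no poles, i.e. by a monomial. Setting z_i = z_{i+1} (or z_1 = 1, z_L = 1) and comparing the
   extreme exponents of a centred Psi shows that this monomial is 1. *)
theory Submission
  imports "Jordan_Normal_Form.Determinant" "HOL-Computational_Algebra.Polynomial" Defs
begin

section \<open>Bracket words and planar connectivities\<close>

text \<open>The double row is unfolded into one auxiliary strand: two sites linked to each other are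
  put to the left of the \<open>L\<close> physical ones, the strand of the second runs through the
  lower row, turns at the right end, returns through the upper row and is closed against the first.
  Every tile then acts as the identity or as one generator on \<open>L + 2\<close> sites. The
  coprimality argument yields a factor that must be divisible by a denominator, so \<open>S\<close>
  must not vanish identically on \<open>z_i = q z_(i+1)\<close>,
  \<open>z_1 = 1/(q \<zeta>_0)\<close>, \<open>z_1 = \<zeta>_0/q\<close>,
  \<open>z_L = q \<zeta>_L\<close>, \<open>z_L = q/\<zeta>_L\<close>. This dictates the special
  points. With \<open>w^2 = - q\<close>, a column at \<open>z_j = w\<close> keeps only faces of type
  I, one at \<open>z_j = w / q\<close> only faces of type II; columns at \<open>w\<close> followed
  by columns at \<open>w / q\<close> give a point of the first divisor, constant columns with a
  boundary parameter tuned to \<open>w\<close> give points of the others. The negatives of these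
  divisors follow from parity, as all weights are even in every \<open>z_i\<close>. Parity also
  makes centring possible and absorbs the sign in \<open>\<pi>_L\<close> when
  \<open>s^2 = - 1\<close>.\<close>

fun step :: "bracket \<Rightarrow> int" where
  "step Opn = 1" | "step Cls = - 1"

definition height :: "bracket list \<Rightarrow> nat \<Rightarrow> int" where
  "height w n = (\<Sum>b\<leftarrow>take n w. step b)"

lemma height_0 [simp]: "height w 0 = 0"
  by (simp add: height_def)

lemma height_Suc: "n < length w \<Longrightarrow> height w (Suc n) = height w n + step (w ! n)"
  by (simp add: height_def take_Suc_conv_app_nth)

lemma height_pred: "1 \<le> i \<Longrightarrow> i \<le> length w \<Longrightarrow> height w i = height w (i - 1) + step (w ! (i - 1))"
  using height_Suc[of "i - 1" w] by simp

lemma height_append: "height (u @ v) n = height u n + height v (n - length u)"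
  by (simp add: height_def)

lemma height_long: "length w \<le> n \<Longrightarrow> height w n = height w (length w)"
  by (simp add: height_def)

lemma height_Cons: "height (b # w) (Suc n) = step b + height w n"
  by (simp add: height_def)

lemma height_drop: "n + m \<le> length w \<Longrightarrow> height (drop m w) n = height w (n + m) - height w m"
  by (simp add: height_def take_drop add.commute)
     (metis (no_types, lifting) add.commute add_diff_cancel_left' append_take_drop_id map_append
        min.absorb1 min_def sum_list_append take_add take_drop)

lemma height_take: "n \<le> m \<Longrightarrow> height (take m w) n = height w n"
  by (simp add: height_def min_def)

lemma balanced_height:
  "balanced w \<Longrightarrow> height w (length w) = 0 \<and> (\<forall>n. 0 \<le> height w n)"
proof (induction rule: balanced.induct)
  case (2 xs ys)
  have nn: "0 \<le> height (Opn # xs @ Cls # ys) n" for n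
  proof (cases n)
    case (Suc m)
    have *: "height (Opn # xs @ Cls # ys) n = 1 + height xs m + height (Cls # ys) (m - length xs)"
      by (simp add: Suc height_Cons height_append)
    show ?thesis
    proof (cases "m - length xs")
      case 0
      thus ?thesis using * 2 by (metis add.right_neutral add_nonneg_nonneg height_0 zero_le_one)
    next
      case (Suc p)
      hence "height xs m = 0" using 2 height_long[of xs m] by simp
      moreover have "0 \<le> height ys p" using 2 by simp
      ultimately show ?thesis using * Suc by (simp add: height_Cons)
    qed
  qed simp
  have "height (Opn # xs @ Cls # ys) (length (Opn # xs @ Cls # ys)) =
     1 + (height xs (length xs + length (Cls # ys)) + (- 1 + height ys (length ys)))"
    by (simp add: height_Cons height_append)
  also have "\<dots> = 0" using 2 height_long[of xs "length xs + length (Cls # ys)"] by simp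
  finally show ?case using nn by blast
qed (simp add: height_def)

text \<open>The first return to height 0 is the bracket matching the first one: before it the inner
  word stays nonnegative relative to its own start, after it the word starts afresh at height 0, so
  both parts fall under the induction.\<close>

lemma height_balanced:
  "height w (length w) = 0 \<Longrightarrow> (\<forall>n\<le>length w. 0 \<le> height w n) \<Longrightarrow> balanced w"
proof (induction "length w" arbitrary: w rule: less_induct)
  case less
  show ?case
  proof (cases w)
    case Nil then show ?thesis by (simp add: balanced.intros)
  next
    case (Cons b w')
    have "0 \<le> height w 1" using less.prems(2) Cons by simp
    hence b: "b = Opn" using Cons by (cases b) (simp_all add: height_def)
    have ex: "\<exists>n. 1 \<le> n \<and> n \<le> length w \<and> height w n = 0" using less.prems(1) Cons by force
    define n where "n = (LEAST n. 1 \<le> n \<and> n \<le> length w \<and> height w n = 0)"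
    have n: "1 \<le> n" "n \<le> length w" "height w n = 0" using LeastI_ex[OF ex] unfolding n_def by auto
    have nl: "0 < height w m" if "1 \<le> m" "m < n" for m
      using not_less_Least[of m "\<lambda>n. 1 \<le> n \<and> n \<le> length w \<and> height w n = 0"] that n less.prems(2)
      unfolding n_def[symmetric] by (metis dual_order.trans le_less_linear less_imp_le order_le_less)
    have h1: "height w 1 = 1" using Cons b by (simp add: height_def)
    have n2: "2 \<le> n" using n h1 by (cases "n = 1") auto
    have hn1: "height w (n - 1) > 0" using nl[of "n - 1"] n2 by simp
    have wn: "w ! (n - 1) = Cls"
      using height_pred[of n w] n hn1 by (cases "w ! (n - 1)") auto
    have hn1': "height w (n - 1) = 1" using height_pred[of n w] n wn by auto
    define xs where "xs = take (n - 2) (drop 1 w)"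
    define ys where "ys = drop n w"
    have lx: "length xs = n - 2" using n xs_def by simp
    have w: "w = Opn # xs @ Cls # ys"
    proof -
      have "w = take (n - 1) w @ w ! (n - 1) # drop (Suc (n - 1)) w" using n by (intro id_take_nth_drop) simp
      moreover have "take (n - 1) w = Opn # xs" using n2 Cons b xs_def by (cases n; cases "n - 1") auto
      ultimately show ?thesis using wn ys_def n by simp
    qed
    have hx: "height xs m = height w (m + 1) - 1" if "m \<le> n - 2" for m
      unfolding xs_def using that n n2 by (subst height_take) (auto simp: height_drop h1[simplified] )
    have lw: "length w = length xs + length ys + 2" using arg_cong[OF w, of length] by simp
    have "balanced xs"
    proof (rule less.hyps)
      show "length xs < length w" using lw by simp
      show "height xs (length xs) = 0" using hx[of "n - 2"] lx n2 hn1'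
        by (simp add: numeral_2_eq_2 Suc_diff_Suc)
      show "\<forall>m\<le>length xs. 0 \<le> height xs m"
      proof (intro allI impI)
        fix m assume m: "m \<le> length xs"
        hence "0 < height w (m + 1)" using lx n2 by (intro nl) auto
        thus "0 \<le> height xs m" using hx[of m] lx m by simp
      qed
    qed
    moreover have "balanced ys"
    proof (rule less.hyps)
      show "length ys < length w" using lw by simp
      have hy: "height ys m = height w (m + n)" if "m \<le> length ys" for m
        unfolding ys_def using that n ys_def by (subst height_drop) auto
      show "height ys (length ys) = 0" using hy[of "length ys"] less.prems(1) n ys_def by simp
      show "\<forall>m\<le>length ys. 0 \<le> height ys m" using hy less.prems(2) n ys_def by auto
    qed
    ultimately show ?thesis using w balanced.intros(2) by simp
  qed
qed

text \<open>Trades the inductive predicate \<open>balanced\<close> for inequalities of heights, so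
  that existence, uniqueness and nesting of partners become arguments about first and last passages
  of a lattice path.\<close>

lemma matched_iff_height:
  "matched w i j \<longleftrightarrow> 1 \<le> i \<and> i < j \<and> j \<le> length w \<and> w ! (i - 1) = Opn \<and> w ! (j - 1) = Cls \<and>
     height w (j - 1) = height w i \<and> (\<forall>n. i \<le> n \<and> n < j \<longrightarrow> height w i \<le> height w n)"
proof (cases "1 \<le> i \<and> i < j \<and> j \<le> length w")
  case True
  let ?s = "take (j - i - 1) (drop i w)"
  have l: "length ?s = j - i - 1" using True by auto
  have h: "height ?s m = height w (m + i) - height w i" if "m \<le> j - i - 1" for m
    using that True by (subst height_take) (auto simp: height_drop)
  have "balanced ?s \<longleftrightarrow> height ?s (length ?s) = 0 \<and> (\<forall>n\<le>length ?s. 0 \<le> height ?s n)"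
    using balanced_height height_balanced by blast
  also have "\<dots> \<longleftrightarrow> height w (j - 1) = height w i \<and> (\<forall>n. i \<le> n \<and> n < j \<longrightarrow> height w i \<le> height w n)"
  proof -
    have "height ?s (length ?s) = 0 \<longleftrightarrow> height w (j - 1) = height w i"
      using h[of "j - i - 1"] l True by simp
    moreover have "(\<forall>n\<le>length ?s. 0 \<le> height ?s n) \<longleftrightarrow> (\<forall>n. i \<le> n \<and> n < j \<longrightarrow> height w i \<le> height w n)"
    proof (intro iffI allI impI)
      fix n assume a: "\<forall>n\<le>length ?s. 0 \<le> height ?s n" and n: "i \<le> n \<and> n < j"
      have "n - i \<le> length ?s" using l n by auto
      hence "0 \<le> height ?s (n - i)" using a by blast
      moreover have "n - i \<le> j - i - 1" using n by auto
      ultimately show "height w i \<le> height w n" using h[of "n - i"] n by simp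
    next
      fix n assume a: "\<forall>n. i \<le> n \<and> n < j \<longrightarrow> height w i \<le> height w n" and n: "n \<le> length ?s"
      hence "n \<le> j - i - 1" using l by simp
      moreover from this have "i \<le> n + i \<and> n + i < j" using True by linarith
      ultimately show "0 \<le> height ?s n" using a[rule_format, of "n + i"] h[of n] by simp
    qed
    ultimately show ?thesis by simp
  qed
  finally show ?thesis using True by (simp add: matched_def)
qed (auto simp: matched_def)

text \<open>The partner is the first passage below the level \<open>height w i\<close>.\<close>

lemma matched_next:
  assumes "1 \<le> i" "i \<le> length w" "w ! (i - 1) = Opn" "i < n" "n \<le> length w" "height w n < height w i"
  shows "\<exists>j. matched w i j \<and> j \<le> n"
proof -
  define j where "j = (LEAST n. i < n \<and> n \<le> length w \<and> height w n < height w i)"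
  have j: "i < j" "j \<le> length w" "height w j < height w i" and jn: "j \<le> n"
    using LeastI[of "\<lambda>n. i < n \<and> n \<le> length w \<and> height w n < height w i" n] assms
    unfolding j_def by (auto intro: Least_le)
  have l: "height w i \<le> height w m" if "i \<le> m" "m < j" for m
    using not_less_Least[of m "\<lambda>n. i < n \<and> n \<le> length w \<and> height w n < height w i"] that j
    unfolding j_def[symmetric] by (cases "m = i") auto
  have "height w i \<le> height w (j - 1)" using l j by simp
  moreover have "height w j = height w (j - 1) + step (w ! (j - 1))" using height_pred j by simp
  ultimately have "w ! (j - 1) = Cls" "height w (j - 1) = height w i" using j
    by (cases "w ! (j - 1)"; simp)+
  hence "matched w i j" unfolding matched_iff_height using assms j l by auto
  thus ?thesis using jn by auto
qed

text \<open>The partner is the step that leaves the last index before \<open>j\<close> whose level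
  is not above \<open>height w j\<close>.\<close>

lemma matched_prev:
  assumes "1 \<le> j" "j \<le> length w" "w ! (j - 1) = Cls" "n < j" "height w n \<le> height w j"
  shows "\<exists>i. matched w i j \<and> n < i"
proof -
  define S where "S = {m. m < j \<and> height w m \<le> height w j}"
  define k where "k = Max S"
  have fS: "finite S" "n \<in> S" unfolding S_def using assms by auto
  have "k \<in> S" using fS unfolding k_def by (metis Max_in empty_iff)
  hence k: "k < j" "height w k \<le> height w j" unfolding S_def by auto
  have kn: "n \<le> k" using fS unfolding k_def by simp
  have l: "height w j < height w m" if "k < m" "m < j" for m
  proof (rule ccontr)
    assume "\<not> height w j < height w m"
    hence "m \<in> S" using that unfolding S_def by simp
    thus False using Max_ge[OF fS(1), of m] that unfolding k_def by simp
  qed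
  have hj: "height w j = height w (j - 1) - 1" using height_pred[of j w] assms by simp
  have kj: "k < j - 1" using k hj by (cases "k = j - 1") auto
  have hk: "height w (Suc k) = height w k + step (w ! k)" using height_Suc[of k w] kj assms by simp
  have "height w j < height w (Suc k)" using l[of "Suc k"] kj by simp
  have sk: "Suc k < j" using kj by simp
  from \<open>height w j < height w (Suc k)\<close> have wk: "w ! k = Opn" "height w (Suc k) = height w j + 1" using hk k by (cases "w ! k"; simp)+
  have "matched w (Suc k) j" unfolding matched_iff_height
    using wk sk assms(1-3) hj by (auto simp: Suc_le_eq dest!: l)
  thus ?thesis using kn by auto
qed

lemma matched_unique_right: "matched w i j \<Longrightarrow> matched w i j' \<Longrightarrow> j = j'"
proof (rule ccontr)
  have *: False if "matched w i j" "matched w i j'" "j < j'" for j j'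
  proof -
    have "height w j = height w (j - 1) - 1" using that(1) height_pred[of j w]
      by (simp add: matched_iff_height)
    thus False using that unfolding matched_iff_height by (metis less_imp_le_nat zle_diff1_eq order_less_irrefl diff_less_eq)
  qed
  assume "matched w i j" "matched w i j'" "j \<noteq> j'"
  thus False using * by (metis nat_neq_iff)
qed

lemma matched_unique_left: "matched w i j \<Longrightarrow> matched w i' j \<Longrightarrow> i = i'"
proof (rule ccontr)
  have *: False if "matched w i j" "matched w i' j" "i < i'" for i i'
  proof -
    have h: "height w i' = height w (i' - 1) + 1" using that(2) height_pred[of i' w]
      by (simp add: matched_iff_height)
    have "i \<le> i' - 1" "i' - 1 < j" "i \<le> i'" "i' < j" using that unfolding matched_iff_height by auto
    hence "height w i \<le> height w (i' - 1)" "height w i = height w i'"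
      using that unfolding matched_iff_height by auto
    thus False using h by simp
  qed
  assume "matched w i j" "matched w i' j" "i \<noteq> i'"
  thus False using * by (metis nat_neq_iff)
qed

lemma linked_unique: "linked w i j \<Longrightarrow> linked w i j' \<Longrightarrow> j = j'"
  unfolding linked_def using matched_unique_left matched_unique_right
  by (metis bracket.distinct(1) matched_def)

lemma linked_sym: "linked w i j \<Longrightarrow> linked w j i"
  by (auto simp: linked_def)

lemma linked_range: "linked w i j \<Longrightarrow> i \<in> {1..length w} \<and> j \<in> {1..length w} \<and> i \<noteq> j"
  by (auto simp: linked_def matched_def)

lemma link_of_Site: "link_of w i = Site j \<longleftrightarrow> linked w i j"
proof
  assume "link_of w i = Site j"
  then have "\<exists>j. linked w i j" "j = (THE j. linked w i j)" by (auto simp: link_of_def split: if_splits)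
  then show "linked w i j" using theI'[of "linked w i"] linked_unique by (metis (mono_tags))
next
  assume "linked w i j"
  moreover have "(THE j. linked w i j) = j" using calculation linked_unique by blast
  ultimately show "link_of w i = Site j" by (auto simp: link_of_def)
qed

text \<open>The connectivities of planar diagrams on \<open>N\<close> sites between a left and a right boundary.\<close>

definition planar :: "nat \<Rightarrow> (nat \<Rightarrow> link) \<Rightarrow> bool" where
  "planar N c \<longleftrightarrow>
     (\<forall>i\<in>{1..N}. \<forall>j. c i = Site j \<longrightarrow> j \<in> {1..N} \<and> j \<noteq> i \<and> c j = Site i) \<and>
     (\<forall>i\<in>{1..N}. \<forall>j m. c i = Site j \<and> i < m \<and> m < j \<longrightarrow> (\<exists>m'. c m = Site m' \<and> i < m' \<and> m' < j)) \<and>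
     (\<forall>i\<in>{1..N}. \<forall>j\<in>{1..N}. c i = LeftBdry \<and> c j = RightBdry \<longrightarrow> i < j)"

lemma planarD:
  assumes "planar N c" "i \<in> {1..N}" 
  shows "c i = Site j \<Longrightarrow> j \<in> {1..N} \<and> j \<noteq> i \<and> c j = Site i"
    and "c i = Site j \<Longrightarrow> i < m \<Longrightarrow> m < j \<Longrightarrow> \<exists>m'. c m = Site m' \<and> i < m' \<and> m' < j"
    and "c i = LeftBdry \<Longrightarrow> j \<in> {1..N} \<Longrightarrow> c j = RightBdry \<Longrightarrow> i < j"
  using assms unfolding planar_def by blast+

lemma link_of_planar: "planar (length w) (link_of w)"
proof -
  have 2: "\<exists>m'. linked w m m' \<and> i < m' \<and> m' < j" if ij: "linked w i j" "i < m" "m < j" for i j m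
  proof -
    have m: "matched w i j" using ij unfolding linked_def matched_def by auto
    have hi: "height w i \<le> height w n" if "i \<le> n" "n < j" for n using m that unfolding matched_iff_height by auto
    have r: "1 \<le> i" "i < j" "j \<le> length w" "height w j = height w i - 1"
      using m height_pred[of j w] unfolding matched_iff_height by auto
    show ?thesis
    proof (cases "w ! (m - 1)")
      case Opn
      have hm: "height w m = height w (m - 1) + 1" using height_pred[of m w] ij r Opn by simp
      have "height w i \<le> height w (m - 1)" using hi ij by simp
      then obtain m' where m': "matched w m m'" "m' \<le> j"
        using matched_next[of m w j] Opn ij r hm by fastforce
      have "m' \<noteq> j" using m' m ij matched_unique_left by blast
      then show ?thesis using m' ij unfolding linked_def matched_def by (metis le_neq_trans less_trans)
    next
      case Cls
      then obtain m' where "matched w m' m" "i < m'"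
        using matched_prev[of m w i] ij r hi[of m] by fastforce
      then show ?thesis using ij unfolding linked_def matched_def by (metis less_trans)
    qed
  qed
  \<comment> \<open>Suppose the unmatched \<open>Opn\<close> at \<open>j\<close> came before the
    unmatched \<open>Cls\<close> at \<open>i\<close>. The first gives
    \<open>height w j \<le> height w i\<close>, the second
    \<open>height w i < height w (j - 1)\<close>, against the step up at \<open>j\<close>.\<close>
  have 3: "i < j" if "i \<in> {1..length w}" "j \<in> {1..length w}" "link_of w i = LeftBdry" "link_of w j = RightBdry" for i j
  proof (rule ccontr)
    assume "\<not> i < j"
    have ni: "\<nexists>j. linked w i j" "w ! (i - 1) = Cls" and nj: "\<nexists>i. linked w j i" "w ! (j - 1) = Opn"
      using that step.cases by (auto simp: link_of_def split: if_splits)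
    have "i \<noteq> j" using ni nj by auto
    hence ji: "j < i" using \<open>\<not> i < j\<close> by simp
    have "height w j \<le> height w i" using matched_next[of j w i] nj that ji unfolding linked_def by force
    moreover have "height w i < height w (j - 1)"
      using matched_prev[of i w "j - 1"] ni that ji unfolding linked_def by force
    ultimately show False using height_pred[of j w] nj that by simp
  qed
  show ?thesis unfolding planar_def link_of_Site
    using linked_range linked_sym 2 3 by blast
qed

lemma length_pattern_of [simp]: "length (pattern_of N c) = N"
  by (simp add: pattern_of_def)

lemma nth_pattern_of:
  "i \<in> {1..N} \<Longrightarrow> pattern_of N c ! (i - 1) =
     (case c i of Site j \<Rightarrow> if j < i then Cls else Opn | LeftBdry \<Rightarrow> Cls | RightBdry \<Rightarrow> Opn)"
proof -
  assume i: "i \<in> {1..N}"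
  have "[1..<Suc N] ! (i - 1) = i" using nth_upt[of 1 "i - 1" "Suc N"] i by (auto simp del: upt_Suc)
  moreover have "i - 1 < length [1..<Suc N]" using i by auto
  ultimately show ?thesis unfolding pattern_of_def by (simp only: nth_map)
qed

lemma pattern_of_cong: "(\<And>i. i \<in> {1..N} \<Longrightarrow> c i = c' i) \<Longrightarrow> pattern_of N c = pattern_of N c'"
  unfolding pattern_of_def by (rule map_cong) auto

lemma pattern_of_link_of: "pattern_of (length w) (link_of w) = w"
proof (rule nth_equalityI)
  fix n assume "n < length (pattern_of (length w) (link_of w))"
  hence n: "n < length w" by simp
  let ?i = "Suc n"
  show "pattern_of (length w) (link_of w) ! n = w ! n"
  proof (cases "link_of w ?i")
    case (Site j)
    hence "linked w ?i j" by (simp add: link_of_Site)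
    thus ?thesis using nth_pattern_of[of ?i "length w" "link_of w"] n Site
      by (auto simp: linked_def matched_def)
  next
    case LeftBdry
    thus ?thesis using nth_pattern_of[of ?i "length w" "link_of w"] n
      by (auto simp: link_of_def split: if_splits)
  next
    case RightBdry
    hence "w ! n \<noteq> Cls" by (auto simp: link_of_def split: if_splits)
    hence "w ! n = Opn" by (cases "w ! n") auto
    thus ?thesis using nth_pattern_of[of ?i "length w" "link_of w"] n RightBdry by simp
  qed
qed simp

text \<open>The interval from \<open>a\<close> to \<open>b\<close> is closed under taking partners.
  The arc at its left end splits it into two smaller intervals, which planarity shows to be closed
  as well; this is the recursion of \<open>balanced\<close>.\<close>

lemma planar_balanced:
  assumes c: "planar N c" and "1 \<le> a" "b \<le> N"
    and "\<And>m. a \<le> m \<Longrightarrow> m \<le> b \<Longrightarrow> \<exists>m'. c m = Site m' \<and> a \<le> m' \<and> m' \<le> b"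
  shows "balanced (take (b + 1 - a) (drop (a - 1) (pattern_of N c)))"
  using assms(2-)
proof (induction "b + 1 - a" arbitrary: a b rule: less_induct)
  case less
  let ?w = "pattern_of N c"
  show ?case
  proof (cases "a \<le> b")
    case False then show ?thesis by (simp add: balanced.intros)
  next
    case True
    then obtain a' where a': "c a = Site a'" "a \<le> a'" "a' \<le> b" using less.prems(3)[of a] by auto
    have aN: "a \<in> {1..N}" using True less.prems by auto
    have aa: "a < a'" "c a' = Site a" "a' \<in> {1..N}" using planarD(1)[OF c aN a'(1)] a' by auto
    have 1: "balanced (take (a' - a - 1) (drop a ?w))"
    proof -
      have "balanced (take (a' - 1 + 1 - (a + 1)) (drop (a + 1 - 1) ?w))"
      proof (rule less.hyps)
        show "\<exists>m'. c m = Site m' \<and> a + 1 \<le> m' \<and> m' \<le> a' - 1" if "a + 1 \<le> m" "m \<le> a' - 1" for m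
        proof -
          have "a < m" "m < a'" using that aa by auto
          then obtain m' where "c m = Site m'" "a < m'" "m' < a'"
            using planarD(2)[OF c aN a'(1), of m] by blast
          then show ?thesis by auto
        qed
      qed (use less.prems aa a' True in auto)
      thus ?thesis using aa by (simp add: diff_diff_left)
    qed
    have 2: "balanced (take (b - a') (drop a' ?w))"
    proof -
      have "balanced (take (b + 1 - (a' + 1)) (drop (a' + 1 - 1) ?w))"
      proof (rule less.hyps)
        show "\<exists>m'. c m = Site m' \<and> a' + 1 \<le> m' \<and> m' \<le> b" if m: "a' + 1 \<le> m" "m \<le> b" for m
        proof -
          obtain m' where m': "c m = Site m'" "a \<le> m'" "m' \<le> b" using less.prems(3)[of m] m aa by auto
          have mN: "m \<in> {1..N}" using m less.prems aa by auto
          have "c m' = Site m" using planarD(1)[OF c mN m'(1)] by simp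
          moreover have "m' \<noteq> a" "m' \<noteq> a'" using calculation a' aa m by auto
          moreover have "\<not> (a < m' \<and> m' < a')" 
            using planarD(2)[OF c aN a'(1), of m'] calculation(1) m by auto
          ultimately have "a' + 1 \<le> m'" using m' by linarith
          then show ?thesis using m' by blast
        qed
      qed (use less.prems aa a' True in auto)
      thus ?thesis by simp
    qed
    have wa: "?w ! (a - 1) = Opn" "?w ! (a' - 1) = Cls"
      using nth_pattern_of[OF aN] nth_pattern_of[OF aa(3)] a' aa by auto
    have "take (b + 1 - a) (drop (a - 1) ?w) = Opn # take (a' - a - 1) (drop a ?w) @ Cls # take (b - a') (drop a' ?w)"
    proof -
      have e1: "drop (a - 1) ?w = Opn # drop a ?w"
        using Cons_nth_drop_Suc[of "a - 1" ?w] wa aN by auto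
      have e2: "drop a ?w = take (a' - a - 1) (drop a ?w) @ Cls # drop a' ?w"
        using id_take_nth_drop[of "a' - a - 1" "drop a ?w"] wa aa less.prems True a' by auto
      have l: "length (take (a' - a - 1) (drop a ?w)) = a' - a - 1" using aa by auto
      have "take (b + 1 - a) (drop (a - 1) ?w) = Opn # take (b - a) (drop a ?w)"
        using e1 True by (simp add: Suc_diff_le)
      also have "take (b - a) (drop a ?w) = take (a' - a - 1) (drop a ?w) @ take (b - a - (a' - a - 1)) (Cls # drop a' ?w)"
        using aa a' by (subst (1) e2, subst take_append, subst l) (simp add: l)
      also have "b - a - (a' - a - 1) = Suc (b - a')" using aa a' by auto
      finally show ?thesis by simp
    qed
    then show ?thesis using balanced.intros(2)[OF 1 2] by simp
  qed
qed

text \<open>Together with \<open>pattern_of_link_of\<close> this identifies bracket words with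
  planar connectivities. Generators are computed on connectivities, where they are given by a
  formula, and words are compared through their links.\<close>

lemma link_of_pattern_of:
  assumes c: "planar N c" and i: "i \<in> {1..N}"
  shows "link_of (pattern_of N c) i = c i"
proof -
  let ?w = "pattern_of N c"
  have m: "matched ?w i j" if i: "i \<in> {1..N}" and "c i = Site j" "i < j" for i j
  proof -
    have j: "j \<in> {1..N}" "c j = Site i" using planarD(1)[OF c i that(2)] by auto
    have "balanced (take (j - 1 + 1 - (i + 1)) (drop (i + 1 - 1) ?w))"
    proof (rule planar_balanced[OF c])
      show "\<exists>m'. c m = Site m' \<and> i + 1 \<le> m' \<and> m' \<le> j - 1" if "i + 1 \<le> m" "m \<le> j - 1" for m
        using planarD(2)[OF c i \<open>c i = Site j\<close>, of m] that by fastforce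
    qed (use j in auto)
    thus ?thesis unfolding matched_def using nth_pattern_of[OF i] nth_pattern_of[OF j(1)] that j
      by (auto simp: diff_diff_left)
  qed
  have l: "linked ?w i j" if i: "i \<in> {1..N}" and "c i = Site j" for i j
    using m[of i j] m[of j i] planarD(1)[OF c i that(2)] that
    unfolding linked_def by (metis nat_neq_iff)
  show ?thesis
  proof (cases "c i")
    case (Site j)
    thus ?thesis using l[OF i Site] link_of_Site by simp
  next
    case LeftBdry
    have w: "?w ! (i - 1) = Cls" using nth_pattern_of[OF i] LeftBdry by simp
    have "\<not> linked ?w i j" for j
    proof
      assume "linked ?w i j"
      hence mj: "matched ?w j i" using w unfolding linked_def matched_def by auto
      hence jj: "j \<in> {1..N}" "j < i" "?w ! (j - 1) = Opn" using i unfolding matched_def by auto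
      show False
      proof (cases "c j")
        case (Site m)
        hence "linked ?w j m" using l jj by simp
        hence "m = i" using mj linked_unique unfolding linked_def by blast
        thus False using Site planarD(1)[OF c jj(1)] LeftBdry by auto
      next
        case RightBdry thus False using planarD(3)[OF c i LeftBdry jj(1)] jj by auto
      qed (use nth_pattern_of[OF jj(1)] jj in auto)
    qed
    thus ?thesis using w LeftBdry by (simp add: link_of_def)
  next
    case RightBdry
    have w: "?w ! (i - 1) = Opn" using nth_pattern_of[OF i] RightBdry by simp
    have "\<not> linked ?w i j" for j
    proof
      assume "linked ?w i j"
      hence mj: "matched ?w i j" using w unfolding linked_def matched_def by auto
      hence jj: "j \<in> {1..N}" "i < j" "?w ! (j - 1) = Cls" using i unfolding matched_def by auto
      show False
      proof (cases "c j")
        case (Site m)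
        hence "linked ?w j m" using l jj by simp
        hence "m = i" using mj linked_unique unfolding linked_def by blast
        thus False using Site planarD(1)[OF c jj(1)] RightBdry by auto
      next
        case LeftBdry thus False using planarD(3)[OF c jj(1) LeftBdry i] RightBdry jj by auto
      qed (use nth_pattern_of[OF jj(1)] jj in auto)
    qed
    thus ?thesis using w RightBdry by (simp add: link_of_def)
  qed
qed

text \<open>Overwriting an end bracket also unmatches the bracket it was paired with, and that
  partner falls on the same boundary. On connectivities this side effect has to be written
  out.\<close>

definition act :: "nat \<Rightarrow> nat \<Rightarrow> (nat \<Rightarrow> link) \<Rightarrow> nat \<Rightarrow> link" where
  "act N k c =
     (if k = 0 then (\<lambda>j. if j = 1 \<or> c j = Site 1 then LeftBdry else c j)
      else if k = N then (\<lambda>j. if j = N \<or> c j = Site N then RightBdry else c j)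
      else join_sites k c)"

lemma planar_join_sites:
  assumes c: "planar N c" and k: "1 \<le> k" "k < N"
  shows "planar N (join_sites k c)"
proof -
  have kN: "k \<in> {1..N}" "k + 1 \<in> {1..N}" using k by auto
  note p1 = planarD(1)[OF c] and p2 = planarD(2)[OF c] and p3 = planarD(3)[OF c]
  let ?d = "join_sites k c"
  have sym: "j \<in> {1..N} \<and> j \<noteq> i \<and> ?d j = Site i" if i: "i \<in> {1..N}" "?d i = Site j" for i j
  proof -
    consider "i = k" | "i = k + 1" | (a) "i \<noteq> k" "i \<noteq> k + 1" "c i = Site k" | (b) "i \<noteq> k" "i \<noteq> k + 1" "c i = Site (k + 1)"
      | (o) "i \<noteq> k" "i \<noteq> k + 1" "c i \<noteq> Site k" "c i \<noteq> Site (k + 1)" by blast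
    then show ?thesis
    proof cases
      case a
      hence cj: "c (k + 1) = Site j" using i by (simp add: join_sites_def)
      have "c k = Site i" using p1[OF i(1) a(3)] by simp
      thus ?thesis using p1[OF kN(2) cj] a by (auto simp: join_sites_def)
    next
      case b
      hence cj: "c k = Site j" using i by (simp add: join_sites_def)
      have "c (k + 1) = Site i" using p1[OF i(1) b(3)] by simp
      thus ?thesis using p1[OF kN(1) cj] b by (auto simp: join_sites_def)
    next
      case o
      hence ci: "c i = Site j" using i by (simp add: join_sites_def)
      show ?thesis using p1[OF i(1) ci] p1[OF kN(1), of i] p1[OF kN(2), of i] o by (auto simp: join_sites_def)
    qed (use i kN in \<open>auto simp: join_sites_def\<close>)
  qed
  have in2: "\<exists>m'. c m = Site m' \<and> i < m' \<and> m' < j" if "i \<in> {1..N}" "c i = Site j" "i < m" "m < j" for i j m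
    using p2 that by blast
  text \<open>An arc of the new diagram that is not an old one joins the former partners of \<open>k\<close> and
    \<open>k + 1\<close>, and every site below it lies below an old arc.\<close>
  have nest: "\<exists>m'. ?d m = Site m' \<and> i < m' \<and> m' < j"
    if i: "i \<in> {1..N}" "?d i = Site j" "i < m" "m < j" for i j m
  proof -
    have jN: "j \<in> {1..N}" using sym[OF i(1,2)] by auto
    have mN: "m \<in> {1..N}" using i jN by auto
    show ?thesis
    proof (cases "i = k \<or> i = k + 1")
      case True
      then have False using i unfolding join_sites_def by (auto split: if_splits)
      then show ?thesis ..
    next
      case ik: False
      have jk: "j \<noteq> k" "j \<noteq> k + 1" using sym[OF i(1,2)] ik unfolding join_sites_def by (auto split: if_splits)
      consider (old) "c i = Site j" | (a) "c i = Site k" "c (k + 1) = Site j" | (b) "c i = Site (k + 1)" "c k = Site j"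
        using i(2) ik unfolding join_sites_def by (auto split: if_splits)
      then show ?thesis
      proof cases
        case old
        obtain m' where m': "c m = Site m'" "i < m'" "m' < j" using in2[OF i(1) old i(3,4)] by auto
        have cj: "c j = Site i" using p1[OF i(1) old] by auto
        show ?thesis
        proof (cases "m = k \<or> m = k + 1")
          case True
          then have "i < k" "k + 1 < j" using i ik jk by auto
          then show ?thesis using True unfolding join_sites_def by auto
        next
          case mk: False
          show ?thesis
          proof (cases "m' = k \<or> m' = k + 1")
            case False then show ?thesis using m' mk unfolding join_sites_def by auto
          next
            case True
            then have b: "i < k" "k < j" "i < k + 1" "k + 1 < j" using m' ik jk by auto
            obtain u where u: "c k = Site u" "i < u" "u < j" using in2[OF i(1) old b(1,2)] by auto
            obtain v where v: "c (k + 1) = Site v" "i < v" "v < j" using in2[OF i(1) old b(3,4)] by auto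
            show ?thesis using True m' mk u v unfolding join_sites_def by auto
          qed
        qed
      next
        case a
        have ck: "c k = Site i" "i \<noteq> k" using p1[OF i(1) a(1)] by auto
        have cj: "c j = Site (k + 1)" "j \<noteq> k + 1" using p1[OF kN(2) a(2)] by auto
        have "\<not> k < i"
        proof
          assume "k < i"
          then have "k + 1 < i" using ik by auto
          obtain u where "c (k + 1) = Site u" "k < u" "u < i"
            using in2[OF kN(1) ck(1), of "k + 1"] \<open>k + 1 < i\<close> by auto
          then show False using a i by auto
        qed
        then have ik': "i < k" using ck by auto
        have kj: "k + 1 < j"
        proof (rule ccontr)
          assume "\<not> k + 1 < j"
          then have "j < k + 1" using cj by auto
          then have "j < k" using jk by auto
          then obtain u where "c j = Site u" "i < u" "u < k" using in2[OF i(1) a(1), of j] i by auto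
          then show False using cj by auto
        qed
        show ?thesis
        proof (cases "m = k \<or> m = k + 1")
          case True then show ?thesis using ik' kj unfolding join_sites_def by auto
        next
          case mk: False
          obtain m' where m': "c m = Site m'" "i < m' \<and> m' < k \<or> k + 1 < m' \<and> m' < j"
          proof (cases "m < k")
            case True then show ?thesis using in2[OF i(1) a(1) i(3)] that by blast
          next
            case False then have "k + 1 < m" using mk by auto
            then show ?thesis using in2[OF kN(2) a(2) _ i(4)] that by blast
          qed
          then show ?thesis using mk ik' kj unfolding join_sites_def by auto
        qed
      next
        case b
        have ck: "c (k + 1) = Site i" "i \<noteq> k + 1" using p1[OF i(1) b(1)] by auto
        have cj: "c j = Site k" "j \<noteq> k" using p1[OF kN(1) b(2)] by auto
        have ij: "i < j" using i by auto
        have sm: "\<exists>m'. c m = Site m' \<and> i < m' \<and> m' < j"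
        proof (cases "i < k")
          case True
          obtain u where "c k = Site u" "i < u" "u < k + 1" using in2[OF i(1) b(1), of k] True by auto
          then have "j < k" using b cj by auto
          obtain m' where m': "c m = Site m'" "i < m'" "m' < k + 1"
            using in2[OF i(1) b(1) i(3)] i \<open>j < k\<close> by auto
          have bk: "c m' = Site m" "m' \<in> {1..N}" using p1[OF mN m'(1)] by auto
          have "m' \<noteq> j" "m' \<noteq> k" using bk cj b(2) i \<open>j < k\<close> by auto
          moreover have "\<not> (j < m' \<and> m' < k)" using in2[OF jN cj(1), of m'] bk i by auto
          ultimately show ?thesis using m' by auto
        next
          case False
          then have "k + 1 < i" using ik by auto
          obtain m' where m': "c m = Site m'" "k < m'" "m' < j"
            using in2[OF kN(1) b(2), of m] i \<open>k + 1 < i\<close> by auto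
          have bk: "c m' = Site m" "m' \<in> {1..N}" using p1[OF mN m'(1)] by auto
          have "m' \<noteq> i" "m' \<noteq> k + 1" using bk ck b i \<open>k + 1 < i\<close> by auto
          moreover have "\<not> (k + 1 < m' \<and> m' < i)" using in2[OF kN(2) ck(1), of m'] bk i by auto
          ultimately show ?thesis using m' by auto
        qed
        have "m \<noteq> k" "m \<noteq> k + 1"
          using sm b ck i by auto
        moreover obtain m' where m': "c m = Site m'" "i < m'" "m' < j" using sm by auto
        moreover have "c m' = Site m" using p1[OF mN m'(1)] by auto
        hence "m' \<noteq> k" "m' \<noteq> k + 1" using b ck i by auto
        ultimately show ?thesis unfolding join_sites_def by auto
      qed
    qed
  qed
  \<comment> \<open>Traced back to the old diagram, two boundary lines in the wrong order would give
    either two old ones in the wrong order or an old boundary line below an arc.\<close>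
  have bd: "i < j" if "i \<in> {1..N}" "j \<in> {1..N}" "?d i = LeftBdry" "?d j = RightBdry" for i j
  proof -
    have nb: "c m \<noteq> LeftBdry \<and> c m \<noteq> RightBdry" if "i \<in> {1..N}" "c i = Site j" "i < m" "m < j" for i j m
      using in2[OF that] by auto
    have ik: "i \<noteq> k" "i \<noteq> k + 1" "j \<noteq> k" "j \<noteq> k + 1" "i \<noteq> j"
      using that unfolding join_sites_def by (auto split: if_splits)
    have di: "c i = LeftBdry \<or> c i = Site k \<and> c (k + 1) = LeftBdry \<or> c i = Site (k + 1) \<and> c k = LeftBdry"
      and dj: "c j = RightBdry \<or> c j = Site k \<and> c (k + 1) = RightBdry \<or> c j = Site (k + 1) \<and> c k = RightBdry"
      using that ik unfolding join_sites_def by (auto split: if_splits)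
    have si: "c i = Site k \<Longrightarrow> c k = Site i" "c i = Site (k + 1) \<Longrightarrow> c (k + 1) = Site i"
      and sj: "c j = Site k \<Longrightarrow> c k = Site j" "c j = Site (k + 1) \<Longrightarrow> c (k + 1) = Site j"
      using p1 that by blast+
    show "i < j"
    proof (rule ccontr)
      assume "\<not> i < j"
      hence ji: "j < i" using ik by simp
      from di consider (l) "c i = LeftBdry" | (a) "c i = Site k" "c (k + 1) = LeftBdry" | (b) "c i = Site (k + 1)" "c k = LeftBdry" by blast
      thus False
      proof cases
        case l
        with dj consider (r) "c j = RightBdry" | (a) "c j = Site k" "c (k + 1) = RightBdry" | (b) "c j = Site (k + 1)" "c k = RightBdry" by blast
        thus False
        proof cases
          case r thus False using p3[OF that(1) l that(2)] ji by simp
        next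
          case a
          have "i < k + 1" using p3[OF that(1) l kN(2) a(2)] .
          thus False using nb[OF that(2) a(1) ji] ik l by auto
        next
          case b
          have "i < k" using p3[OF that(1) l kN(1) b(2)] .
          thus False using nb[OF that(2) b(1) ji] l by auto
        qed
      next
        case a
        have jr: "c j = RightBdry" using dj a si sj ik by auto
        have "k + 1 < j" using p3[OF kN(2) a(2) that(2) jr] .
        thus False using nb[OF kN(1) si(1)[OF a(1)], of "k + 1"] a ji by auto
      next
        case b
        have jr: "c j = RightBdry" using dj b si sj ik by auto
        have "k < j" using p3[OF kN(1) b(2) that(2) jr] .
        thus False using nb[OF kN(2) si(2)[OF b(1)], of j] jr ji ik by auto
      qed
    qed
  qed
  show ?thesis unfolding planar_def using sym nest bd by blast
qed

lemma planar_act: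
  assumes c: "planar N c" and N: "1 \<le> N" and k: "k \<le> N"
  shows "planar N (act N k c)"
proof -
  note p1 = planarD(1)[OF c] and p2 = planarD(2)[OF c] and p3 = planarD(3)[OF c]
  consider "k = 0" | "k = N" "k \<noteq> 0" | "1 \<le> k" "k < N" using k by linarith
  then show ?thesis
  proof cases
    case 1
    have N1: "1 \<in> {1..N}" using N by auto
    let ?d = "\<lambda>j. if j = 1 \<or> c j = Site 1 then LeftBdry else c j"
    have "planar N ?d"
      unfolding planar_def
    proof (intro conjI ballI allI impI)
      fix i j assume i: "i \<in> {1..N}" "?d i = Site j"
      hence ci: "c i = Site j" "i \<noteq> 1" "j \<noteq> 1" by (auto split: if_splits)
      show "j \<in> {1..N}" "j \<noteq> i" "?d j = Site i" using p1[OF i(1) ci(1)] ci by auto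
    next
      fix i j m assume i: "i \<in> {1..N}" "?d i = Site j \<and> i < m \<and> m < j"
      hence ci: "c i = Site j" "i \<noteq> 1" "j \<noteq> 1" "i < m" "m < j" by (auto split: if_splits)
      obtain m' where m': "c m = Site m'" "i < m'" "m' < j" using p2[OF i(1) ci(1,4,5)] by blast
      thus "\<exists>m'. ?d m = Site m' \<and> i < m' \<and> m' < j" using i ci by auto
    next
      fix i j assume i: "i \<in> {1..N}" "j \<in> {1..N}" "?d i = LeftBdry \<and> ?d j = RightBdry"
      hence cj: "c j = RightBdry" "j \<noteq> 1" by (auto split: if_splits)
      from i consider "i = 1" | "c i = Site 1" | "c i = LeftBdry" by (auto split: if_splits)
      thus "i < j"
      proof cases
        case 1 thus ?thesis using i cj by auto
      next
        case 2
        hence c1: "c 1 = Site i" using p1[OF i(1)] by blast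
        thus ?thesis using p2[OF N1 c1, of j] i cj 2 by (cases "i < j"; cases "i = j"; auto)
      next
        case 3 thus ?thesis using p3 i cj by blast
      qed
    qed
    thus ?thesis using 1 by (simp add: act_def)
  next
    case 2
    have N1: "N \<in> {1..N}" using N by auto
    let ?d = "\<lambda>j. if j = N \<or> c j = Site N then RightBdry else c j"
    have "planar N ?d"
      unfolding planar_def
    proof (intro conjI ballI allI impI)
      fix i j assume i: "i \<in> {1..N}" "?d i = Site j"
      hence ci: "c i = Site j" "i \<noteq> N" "j \<noteq> N" by (auto split: if_splits)
      show "j \<in> {1..N}" "j \<noteq> i" "?d j = Site i" using p1[OF i(1) ci(1)] ci by auto
    next
      fix i j m assume i: "i \<in> {1..N}" "?d i = Site j \<and> i < m \<and> m < j"
      hence ci: "c i = Site j" "i \<noteq> N" "j \<noteq> N" "i < m" "m < j" by (auto split: if_splits)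
      obtain m' where m': "c m = Site m'" "i < m'" "m' < j" using p2[OF i(1) ci(1,4,5)] by blast
      moreover have "j \<in> {1..N}" using p1[OF i(1) ci(1)] by auto
      ultimately show "\<exists>m'. ?d m = Site m' \<and> i < m' \<and> m' < j" using i ci by auto
    next
      fix i j assume i: "i \<in> {1..N}" "j \<in> {1..N}" "?d i = LeftBdry \<and> ?d j = RightBdry"
      hence ci: "c i = LeftBdry" "i \<noteq> N" by (auto split: if_splits)
      from i consider "j = N" | "c j = Site N" | "c j = RightBdry" by (auto split: if_splits)
      thus "i < j"
      proof cases
        case 1 thus ?thesis using i ci by auto
      next
        case 2
        thus ?thesis using p2[OF i(2) 2, of i] i ci 2 by (cases "i < j"; cases "i = j"; auto)
      next
        case 3 thus ?thesis using p3 i ci by blast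
      qed
    qed
    thus ?thesis using 2 by (simp add: act_def)
  next
    case 3 thus ?thesis using planar_join_sites[OF c] by (simp add: act_def)
  qed
qed

lemma act_cong:
  assumes "\<And>i. i \<in> {1..N} \<Longrightarrow> c i = c' i" "1 \<le> N" "k \<le> N" "i \<in> {1..N}"
  shows "act N k c i = act N k c' i"
  using assms(1)[of k] assms(1)[of "k + 1"] assms(1)[of i] assms(2-)
  by (auto simp: act_def join_sites_def)

lemma gen_pattern_of:
  assumes w: "length w = N" and N: "1 \<le> N" and k: "k \<le> N"
  shows "gen N k w = pattern_of N (act N k (link_of w))"
proof -
  have c: "planar N (link_of w)" using link_of_planar[of w] w by simp
  note p1 = planarD(1)[OF c] and p2 = planarD(2)[OF c] and p3 = planarD(3)[OF c]
  have wl: "w ! (i - 1) = (case link_of w i of Site j \<Rightarrow> if j < i then Cls else Opn | LeftBdry \<Rightarrow> Cls | RightBdry \<Rightarrow> Opn)"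
    if "i \<in> {1..N}" for i
    using nth_pattern_of[OF that, of "link_of w"] pattern_of_link_of[of w] w by simp
  consider "k = 0" | "k = N" "k \<noteq> 0" | "1 \<le> k" "k < N" using k by linarith
  then show ?thesis
  proof cases
    case 1
    have "Cls # tl w = pattern_of N (act N 0 (link_of w))"
    proof (rule nth_equalityI)
      fix n assume "n < length (Cls # tl w)"
      hence n: "n < N" using w N by auto
      hence nN: "Suc n \<in> {1..N}" by auto
      show "(Cls # tl w) ! n = pattern_of N (act N 0 (link_of w)) ! n"
        using nth_pattern_of[OF nN, of "act N 0 (link_of w)"] wl[OF nN] w n p1[OF nN]
        by (cases n) (auto simp: act_def nth_tl split: link.splits)
    qed (use w N in auto)
    thus ?thesis using 1 by (simp add: gen_def)
  next
    case 2
    have "butlast w @ [Opn] = pattern_of N (act N N (link_of w))"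
    proof (rule nth_equalityI)
      fix n assume "n < length (butlast w @ [Opn])"
      hence n: "n < N" using w N by auto
      hence nN: "Suc n \<in> {1..N}" by auto
      show "(butlast w @ [Opn]) ! n = pattern_of N (act N N (link_of w)) ! n"
      proof (cases "n < N - 1")
        case True
        thus ?thesis using nth_pattern_of[OF nN, of "act N N (link_of w)"] wl[OF nN] w p1[OF nN] 2
          by (auto simp: act_def nth_append nth_butlast split: link.splits)
      next
        case False
        hence "n = N - 1" using n by simp
        thus ?thesis using nth_pattern_of[of N N "act N N (link_of w)"] w N
          by (auto simp: act_def nth_append)
      qed
    qed (use w N in auto)
    thus ?thesis using 2 by (simp add: gen_def)
  next
    case 3 thus ?thesis by (simp add: gen_def act_def)
  qed
qed

lemma length_gen: "length w = N \<Longrightarrow> 1 \<le> N \<Longrightarrow> k \<le> N \<Longrightarrow> length (gen N k w) = N"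
  by (simp add: gen_pattern_of)

lemma link_of_gen:
  assumes "length w = N" "1 \<le> N" "k \<le> N" "i \<in> {1..N}"
  shows "link_of (gen N k w) i = act N k (link_of w) i"
  using gen_pattern_of[OF assms(1-3)] planar_act[of N "link_of w" k] link_of_planar[of w] assms
  by (simp add: link_of_pattern_of)

lemma link_of_inject:
  assumes "length w = N" "length w' = N" "\<And>i. i \<in> {1..N} \<Longrightarrow> link_of w i = link_of w' i"
  shows "w = w'"
proof -
  have "w = pattern_of N (link_of w)" using pattern_of_link_of[of w] assms(1) by simp
  also have "\<dots> = pattern_of N (link_of w')" using assms(3) by (rule pattern_of_cong)
  also have "\<dots> = w'" using pattern_of_link_of[of w'] assms(2) by simp
  finally show ?thesis .
qed

text \<open>Outside the words of length \<open>N\<close>, where \<^const>\<open>gen\<close> has no meaning, the generators are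
  extended by the identity; this makes the Temperley--Lieb relations unconditional.\<close>

definition tgen :: "nat \<Rightarrow> nat \<Rightarrow> bracket list \<Rightarrow> bracket list" where
  "tgen N k w = (if length w = N then gen N k w else w)"

lemma length_tgen [simp]: "1 \<le> N \<Longrightarrow> k \<le> N \<Longrightarrow> length (tgen N k w) = length w"
  by (simp add: tgen_def length_gen)

lemma tgen_eqI:
  assumes "1 \<le> N"
    and "\<And>w. length w = N \<Longrightarrow> planar N (link_of w) \<Longrightarrow> length (f w) = N \<and> length (g w) = N \<and>
           (\<forall>i\<in>{1..N}. link_of (f w) i = link_of (g w) i)"
    and "\<And>w. length w \<noteq> N \<Longrightarrow> f w = g w"
  shows "f w = g w"
proof (cases "length w = N")
  case True
  then show ?thesis using link_of_inject[of "f w" N "g w"] assms(2)[OF True] link_of_planar[of w] by auto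
qed (rule assms(3))

lemma link_of_tgen1:
  assumes "length w = N" "1 \<le> N" "k \<le> N" "i \<in> {1..N}"
  shows "link_of (tgen N k w) i = act N k (link_of w) i"
  using assms by (simp add: tgen_def link_of_gen)

lemma link_of_tgen2:
  assumes "length w = N" "1 \<le> N" "j \<le> N" "k \<le> N" "i \<in> {1..N}"
  shows "link_of (tgen N j (tgen N k w)) i = act N j (act N k (link_of w)) i"
proof -
  have "link_of (tgen N j (tgen N k w)) i = act N j (link_of (tgen N k w)) i"
    using assms by (simp add: tgen_def length_gen link_of_gen)
  also have "\<dots> = act N j (act N k (link_of w)) i"
    using assms by (intro act_cong) (simp_all add: tgen_def link_of_gen)
  finally show ?thesis .
qed

lemma link_of_tgen3:
  assumes "length w = N" "1 \<le> N" "h \<le> N" "j \<le> N" "k \<le> N" "i \<in> {1..N}"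
  shows "link_of (tgen N h (tgen N j (tgen N k w))) i = act N h (act N j (act N k (link_of w))) i"
proof -
  have "link_of (tgen N h (tgen N j (tgen N k w))) i = act N h (link_of (tgen N j (tgen N k w))) i"
    using assms by (simp add: tgen_def length_gen link_of_gen)
  also have "\<dots> = act N h (act N j (act N k (link_of w))) i"
    using assms by (intro act_cong link_of_tgen2)
  finally show ?thesis .
qed

section \<open>Temperley--Lieb relations with two boundaries\<close>

definition join_pair :: "nat \<Rightarrow> nat \<Rightarrow> (nat \<Rightarrow> link) \<Rightarrow> nat \<Rightarrow> link" where
  "join_pair a b c j =
     (if j = a then Site b else if j = b then Site a
      else if c j = Site a then c b else if c j = Site b then c a else c j)"

lemma join_sites_pair: "join_sites k = join_pair k (k + 1)"
  by (simp add: fun_eq_iff join_sites_def join_pair_def)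

text \<open>Written for arbitrary sites \<open>a\<close>, \<open>b\<close>, \<open>d\<close>, so
  that the two ways in which neighbouring generators absorb each other are instances of one
  computation. Only the links among these sites and \<open>i\<close> enter, through the symmetry of
  the link relation.\<close>

lemma join_pair_absorb:
  assumes "a \<noteq> b" "a \<noteq> d" "b \<noteq> d"
    and "c a \<noteq> Site a" "c b \<noteq> Site b" "c d \<noteq> Site d"
    and "(c a = Site b) = (c b = Site a)" "(c a = Site d) = (c d = Site a)" "(c b = Site d) = (c d = Site b)"
    and "(c a = Site i) = (c i = Site a)" "(c b = Site i) = (c i = Site b)" "(c d = Site i) = (c i = Site d)"
  shows "join_pair a b (join_pair b d (join_pair a b c)) i = join_pair a b c i"
    and "join_pair b d (join_pair a b (join_pair b d c)) i = join_pair b d c i"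
proof -
  show "join_pair a b (join_pair b d (join_pair a b c)) i = join_pair a b c i"
    using assms unfolding join_pair_def by (smt (z3) link.inject)
  show "join_pair b d (join_pair a b (join_pair b d c)) i = join_pair b d c i"
    using assms unfolding join_pair_def by (smt (z3) link.inject)
qed

text \<open>One of four cases of \<open>join_pair_commute\<close>, according to which of the joined
  sites was the partner of \<open>i\<close>. The other three arise by exchanging the sites of a pair
  or the two pairs.\<close>

lemma join_pair_commute_aux:
  assumes "a \<noteq> d" "a \<noteq> e" "b \<noteq> d" "b \<noteq> e" "i \<noteq> a" "i \<noteq> b" "i \<noteq> d" "i \<noteq> e"
    and "c i = Site a" "c e \<noteq> Site a" "c d \<noteq> Site a"
    and "c b = Site d \<Longrightarrow> c e \<noteq> Site b" "c b = Site e \<Longrightarrow> c d \<noteq> Site b"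
  shows "join_pair a b (join_pair d e c) i = join_pair d e (join_pair a b c) i"
proof -
  have "join_pair a b (join_pair d e c) i = join_pair d e c b"
    using assms(1-9) by (simp add: join_pair_def)
  also have "\<dots> = (if c b = Site d then c e else if c b = Site e then c d else c b)"
    using assms(1-9) by (simp add: join_pair_def)
  also have "\<dots> = (if c b = Site d then join_pair a b c e else if c b = Site e then join_pair a b c d else c b)"
    using assms by (simp add: join_pair_def)
  also have "\<dots> = join_pair d e (join_pair a b c) i"
    using assms(1-9) by (simp add: join_pair_def)
  finally show ?thesis .
qed

lemma join_pair_commute:
  assumes d: "a \<noteq> d" "a \<noteq> e" "b \<noteq> d" "b \<noteq> e" "a \<noteq> b" "d \<noteq> e"
    and sym: "\<And>x y. x \<in> {a, b, d, e, i} \<Longrightarrow> y \<in> {a, b, d, e, i} \<Longrightarrow> c x = Site y \<Longrightarrow> c y = Site x"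
  shows "join_pair a b (join_pair d e c) i = join_pair d e (join_pair a b c) i"
proof (cases "i \<in> {a, b, d, e}")
  case True
  then consider "i = a" | "i = b" | "i = d" | "i = e" by blast
  then show ?thesis by cases (use d in \<open>simp_all add: join_pair_def\<close>)
next
  case False
  then have i: "i \<noteq> a" "i \<noteq> b" "i \<noteq> d" "i \<noteq> e" by auto
  have sw: "join_pair a b f = join_pair b a f" "join_pair d e f = join_pair e d f" for f
    using d by (auto simp: join_pair_def fun_eq_iff)
  show ?thesis
  proof (cases "c i \<in> {Site a, Site b, Site d, Site e}")
    case True
    have u: "c x = Site z \<Longrightarrow> c y = Site z \<Longrightarrow> x = y"
      if "x \<in> {a, b, d, e, i}" "y \<in> {a, b, d, e, i}" "z \<in> {a, b, d, e, i}" for x y z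
      using sym[of x z] sym[of y z] that by (metis link.inject)
    have w: "c x = Site y \<Longrightarrow> c z = Site x \<Longrightarrow> y = z"
      if "x \<in> {a, b, d, e, i}" "y \<in> {a, b, d, e, i}" "z \<in> {a, b, d, e, i}" for x y z
      using sym[of z x] that by (metis link.inject)
    from True consider "c i = Site a" | "c i = Site b" | "c i = Site d" | "c i = Site e" by blast
    then show ?thesis
    proof cases
      case 1
      have f: "c e \<noteq> Site a" "c d \<noteq> Site a"
        using u[of i e a] u[of i d a] 1 i by blast+
      have g: "c b = Site d \<Longrightarrow> c e \<noteq> Site b" "c b = Site e \<Longrightarrow> c d \<noteq> Site b"
        using w[of b d e] w[of b e d] d by blast+
      show ?thesis
        by (rule join_pair_commute_aux) (fact | use d i in \<open>simp; fail\<close> | erule g)+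
    next
      case 2
      have f: "c e \<noteq> Site b" "c d \<noteq> Site b"
        using u[of i e b] u[of i d b] 2 i by blast+
      have g: "c a = Site d \<Longrightarrow> c e \<noteq> Site a" "c a = Site e \<Longrightarrow> c d \<noteq> Site a"
        using w[of a d e] w[of a e d] d by blast+
      show ?thesis unfolding sw(1)
        by (rule join_pair_commute_aux) (fact | use d i in \<open>simp; fail\<close> | erule g)+
    next
      case 3
      have f: "c b \<noteq> Site d" "c a \<noteq> Site d"
        using u[of i b d] u[of i a d] 3 i by blast+
      have g: "c e = Site a \<Longrightarrow> c b \<noteq> Site e" "c e = Site b \<Longrightarrow> c a \<noteq> Site e"
        using w[of e a b] w[of e b a] d by blast+
      show ?thesis
        by (rule join_pair_commute_aux[symmetric]) (fact | use d i in \<open>simp; fail\<close> | erule g)+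
    next
      case 4
      have f: "c b \<noteq> Site e" "c a \<noteq> Site e"
        using u[of i b e] u[of i a e] 4 i by blast+
      have g: "c d = Site a \<Longrightarrow> c b \<noteq> Site d" "c d = Site b \<Longrightarrow> c a \<noteq> Site d"
        using w[of d a b] w[of d b a] d by blast+
      show ?thesis unfolding sw(2)
        by (rule join_pair_commute_aux[symmetric]) (fact | use d i in \<open>simp; fail\<close> | erule g)+
    qed
  next
    case False
    then show ?thesis using d i by (simp add: join_pair_def)
  qed
qed

lemma tgen_idem:
  assumes "1 \<le> N" "k \<le> N" shows "tgen N k (tgen N k w) = tgen N k w"
proof (rule tgen_eqI[where N = N and f = "\<lambda>w. tgen N k (tgen N k w)" and g = "tgen N k"])
  fix w assume w: "length w = N" "planar N (link_of w)"
  note p1 = planarD(1)[OF w(2)]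
  let ?c = "link_of w"
  have sw: "(?c a = Site b) = (?c b = Site a)" if "a \<in> {1..N}" "b \<in> {1..N}" for a b
    using p1 that by blast
  have ns: "?c a \<noteq> Site a" if "a \<in> {1..N}" for a
    using p1 that by blast
  have "act N k (act N k ?c) i = act N k ?c i" if i: "i \<in> {1..N}" for i
  proof (cases "1 \<le> k \<and> k < N")
    case True
    hence r: "k \<in> {1..N}" "k + 1 \<in> {1..N}" by auto
    have "join_sites k (join_sites k ?c) i = join_sites k ?c i"
      using sw[OF r(1) i] sw[OF r(2) i] sw[OF r(1) r(2)] ns[OF r(1)] ns[OF r(2)]
      unfolding join_sites_def by (smt (z3) link.inject)
    thus ?thesis using True by (simp add: act_def)
  qed (use assms in \<open>auto simp: act_def\<close>)
  thus "length (tgen N k (tgen N k w)) = N \<and> length (tgen N k w) = N \<and>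
      (\<forall>i\<in>{1..N}. link_of (tgen N k (tgen N k w)) i = link_of (tgen N k w) i)"
    using link_of_tgen2[OF w(1) assms(1,2,2)] link_of_tgen1[OF w(1) assms(1,2)] w assms by simp
qed (use assms in \<open>auto simp: tgen_def\<close>)

text \<open>For a bulk \<open>k\<close> a zigzag is straightened; for \<open>k = 0\<close> or
  \<open>k = N\<close> a path with both ends on one boundary is dropped with weight 1.\<close>

lemma tgen_absorb:
  assumes "1 \<le> j" "j < N" "k \<le> N" "k = Suc j \<or> j = Suc k"
  shows "tgen N j (tgen N k (tgen N j w)) = tgen N j w"
proof (rule tgen_eqI[where N = N and f = "\<lambda>w. tgen N j (tgen N k (tgen N j w))" and g = "tgen N j"])
  fix w assume w: "length w = N" "planar N (link_of w)"
  note p1 = planarD(1)[OF w(2)]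
  let ?c = "link_of w"
  have sw: "(?c a = Site b) = (?c b = Site a)" if "a \<in> {1..N}" "b \<in> {1..N}" for a b
    using p1 that by blast
  have ns: "?c a \<noteq> Site a" if "a \<in> {1..N}" for a
    using p1 that by blast
  have "act N j (act N k (act N j ?c)) i = act N j ?c i" if i: "i \<in> {1..N}" for i
  proof -
    have r: "j \<in> {1..N}" "j + 1 \<in> {1..N}" using assms by auto
    consider "k = 0" "j = 1" | "k = N" "j + 1 = N" | "k = j + 1" "k < N" | "j = k + 1" "1 \<le> k"
      using assms by linarith
    thus ?thesis
    proof cases
      case 1
      have a: "act N k d x = (if x = j \<or> d x = Site j then LeftBdry else d x)" "act N j d = join_sites j d" for d x
        using 1 assms by (auto simp: act_def)
      show ?thesis
        unfolding a join_sites_def using sw[OF r(1) i] sw[OF r(2) i] sw[OF r(1) r(2)] ns[OF r(1)] ns[OF r(2)]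
        by (smt (z3) link.inject link.distinct)
    next
      case 2
      have a: "act N k d x = (if x = j + 1 \<or> d x = Site (j + 1) then RightBdry else d x)" "act N j d = join_sites j d" for d x
        using 2 assms by (auto simp: act_def)
      show ?thesis
        unfolding a join_sites_def using sw[OF r(1) i] sw[OF r(2) i] sw[OF r(1) r(2)] ns[OF r(1)] ns[OF r(2)]
        by (smt (z3) link.inject link.distinct)
    next
      case 3
      hence r3: "j + 1 + 1 \<in> {1..N}" by auto
      have "join_sites j (join_sites (j + 1) (join_sites j ?c)) i = join_sites j ?c i"
        unfolding join_sites_pair
        by (intro join_pair_absorb(1) ns sw r r3 i) simp_all
      thus ?thesis using 3 assms by (simp add: act_def)
    next
      case 4
      hence r3: "k \<in> {1..N}" using assms by auto
      have "join_sites (k + 1) (join_sites k (join_sites (k + 1) ?c)) i = join_sites (k + 1) ?c i"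
        unfolding join_sites_pair \<open>j = k + 1\<close>[symmetric]
        by (intro join_pair_absorb(2) ns sw r r3 i) (use 4 in simp_all)
      thus ?thesis using 4 assms by (simp add: act_def)
    qed
  qed
  thus "length (tgen N j (tgen N k (tgen N j w))) = N \<and> length (tgen N j w) = N \<and>
      (\<forall>i\<in>{1..N}. link_of (tgen N j (tgen N k (tgen N j w))) i = link_of (tgen N j w) i)"
    using link_of_tgen3[OF w(1), of j k j] link_of_tgen1[OF w(1), of j] w assms by simp
qed (use assms in \<open>auto simp: tgen_def\<close>)

lemma tgen_commute:
  assumes "j + 2 \<le> k" "k \<le> N"
  shows "tgen N j (tgen N k w) = tgen N k (tgen N j w)"
proof (rule tgen_eqI[where N = N and f = "\<lambda>w. tgen N j (tgen N k w)" and g = "\<lambda>w. tgen N k (tgen N j w)"])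
  fix w assume w: "length w = N" "planar N (link_of w)"
  note p1 = planarD(1)[OF w(2)]
  let ?c = "link_of w"
  have sw: "(?c a = Site b) = (?c b = Site a)" if "a \<in> {1..N}" "b \<in> {1..N}" for a b
    using p1 that by blast
  have ns: "?c a \<noteq> Site a" if "a \<in> {1..N}" for a
    using p1 that by blast
  have "act N j (act N k ?c) i = act N k (act N j ?c) i" if i: "i \<in> {1..N}" for i
  proof -
    consider "j = 0" "k = N" | "j = 0" "k < N" "k \<ge> 2" | "1 \<le> j" "k = N" | "1 \<le> j" "k < N"
      using assms by linarith
    thus ?thesis
    proof cases
      case 1
      thus ?thesis using assms by (auto simp: act_def)
    next
      case 2
      hence r: "1 \<in> {1..N}" "k \<in> {1..N}" "k + 1 \<in> {1..N}" by auto
      show ?thesis using 2 sw[OF i r(1)] sw[OF i r(2)] sw[OF i r(3)] sw[OF r(1) r(2)] sw[OF r(1) r(3)] ns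
        by (auto simp: act_def join_sites_def i r)
    next
      case 3
      hence r: "j \<in> {1..N}" "j + 1 \<in> {1..N}" "N \<in> {1..N}" using assms by auto
      show ?thesis using 3 assms sw[OF i r(1)] sw[OF i r(2)] sw[OF i r(3)] sw[OF r(1) r(3)] sw[OF r(2) r(3)] ns
        by (auto simp: act_def join_sites_def i r)
    next
      case 4
      hence r: "j \<in> {1..N}" "j + 1 \<in> {1..N}" "k \<in> {1..N}" "k + 1 \<in> {1..N}" using assms by auto
      have "join_sites j (join_sites k ?c) i = join_sites k (join_sites j ?c) i"
        unfolding join_sites_pair
      proof (rule join_pair_commute)
        fix x y assume "x \<in> {j, j + 1, k, k + 1, i}" "y \<in> {j, j + 1, k, k + 1, i}" "?c x = Site y"
        thus "?c y = Site x" using r i sw[of x y] by (metis insertE singletonD)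
      qed (use assms in simp_all)
      thus ?thesis using 4 assms by (simp add: act_def)
    qed
  qed
  thus "length (tgen N j (tgen N k w)) = N \<and> length (tgen N k (tgen N j w)) = N \<and>
      (\<forall>i\<in>{1..N}. link_of (tgen N j (tgen N k w)) i = link_of (tgen N k (tgen N j w)) i)"
    using link_of_tgen2[OF w(1), of j k] link_of_tgen2[OF w(1), of k j] w assms by simp
qed (use assms in \<open>auto simp: tgen_def\<close>)

section \<open>Diagrams as products of generators\<close>

text \<open>The connectivity of \<open>\<alpha>\<close> with two extra sites on its left, linked to each other or both
  connected to the left boundary.\<close>

definition prefixed :: "bool \<Rightarrow> (nat \<Rightarrow> link) \<Rightarrow> nat \<Rightarrow> link" where
  "prefixed l c i =
     (if i \<le> 2 then (if l then Site (3 - i) else LeftBdry)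
      else case c (i - 2) of Site j \<Rightarrow> Site (j + 2) | b \<Rightarrow> b)"

lemma prefixed_shift [simp]:
  "prefixed l c (Suc (Suc i)) = Site (Suc (Suc j)) \<longleftrightarrow> 1 \<le> i \<and> c i = Site j \<or> i = 0 \<and> l \<and> j + 1 = 0"
  "1 \<le> i \<Longrightarrow> prefixed l c (Suc (Suc i)) = LeftBdry \<longleftrightarrow> c i = LeftBdry"
  by (auto simp: prefixed_def split: link.splits)

lemma link_of_prefixed:
  assumes w: "length w = L" and i: "i \<in> {1..L + 2}"
  shows "link_of ((if l then Opn else Cls) # Cls # w) i = prefixed l (link_of w) i"
proof -
  let ?c = "link_of w" and ?v = "(if l then Opn else Cls) # Cls # w"
  have c: "planar L ?c" using link_of_planar[of w] w by simp
  note p1 = planarD(1)[OF c] and p2 = planarD(2)[OF c] and p3 = planarD(3)[OF c]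
  have S: "prefixed l ?c i = Site j \<longleftrightarrow>
      (if i \<le> 2 then l \<and> j = 3 - i else 2 \<le> j \<and> ?c (i - 2) = Site (j - 2))" for i j
    by (auto simp: prefixed_def split: link.splits)
  have B: "prefixed l ?c i = LeftBdry \<longleftrightarrow> (if i \<le> 2 then \<not> l else ?c (i - 2) = LeftBdry)"
    "prefixed l ?c i = RightBdry \<longleftrightarrow> (i > 2 \<and> ?c (i - 2) = RightBdry)" for i
    by (auto simp: prefixed_def split: link.splits)
  have pl: "planar (L + 2) (prefixed l ?c)"
    unfolding planar_def S B
  proof (intro conjI ballI allI impI)
    fix i j assume i: "i \<in> {1..L + 2}" and h: "if i \<le> 2 then l \<and> j = 3 - i else 2 \<le> j \<and> ?c (i - 2) = Site (j - 2)"
    have "i \<le> 2 \<or> i - 2 \<in> {1..L}" using i by auto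
    thus "j \<in> {1..L + 2}" "j \<noteq> i" "if j \<le> 2 then l \<and> i = 3 - j else 2 \<le> i \<and> ?c (j - 2) = Site (i - 2)"
      using h i p1[of "i - 2" "j - 2"] by (auto split: if_splits) presburger?
  next
    fix i j m assume i: "i \<in> {1..L + 2}"
      and h: "(if i \<le> 2 then l \<and> j = 3 - i else 2 \<le> j \<and> ?c (i - 2) = Site (j - 2)) \<and> i < m \<and> m < j"
    have i2: "\<not> i \<le> 2" using h i by auto
    hence "i - 2 \<in> {1..L}" "?c (i - 2) = Site (j - 2)" "i - 2 < m - 2" "m - 2 < j - 2" using h i by auto
    then obtain m' where m': "?c (m - 2) = Site m'" "i - 2 < m'" "m' < j - 2" using p2 by blast
    show "\<exists>m'. (if m \<le> 2 then l \<and> m' = 3 - m else 2 \<le> m' \<and> ?c (m - 2) = Site (m' - 2)) \<and> i < m' \<and> m' < j"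
      using m' h i2 by (intro exI[of _ "m' + 2"]) auto
  next
    fix i j assume i: "i \<in> {1..L + 2}" "j \<in> {1..L + 2}"
      and h: "(if i \<le> 2 then \<not> l else ?c (i - 2) = LeftBdry) \<and> 2 < j \<and> ?c (j - 2) = RightBdry"
    show "i < j"
    proof (cases "i \<le> 2")
      case False
      hence "i - 2 \<in> {1..L}" "j - 2 \<in> {1..L}" using i h by auto
      hence "i - 2 < j - 2" using p3[of "i - 2" "j - 2"] h False by auto
      thus ?thesis by simp
    qed (use h in auto)
  qed
  have "?v = pattern_of (L + 2) (prefixed l ?c)"
  proof (rule nth_equalityI)
    fix n assume "n < length ?v"
    hence n: "n < L + 2" using w by auto
    show "?v ! n = pattern_of (L + 2) (prefixed l ?c) ! n"
    proof (cases "n < 2")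
      case True
      then consider "n = 0" | "n = 1" by linarith
      thus ?thesis
        using nth_pattern_of[of "Suc n" "L + 2" "prefixed l ?c"] n by cases (auto simp: prefixed_def)
    next
      case False
      then obtain k where k: "n = Suc (Suc k)" by (metis less_2_cases_iff not0_implies_Suc One_nat_def)
      have kL: "Suc k \<in> {1..L}" using n k by auto
      have "w ! k = pattern_of L ?c ! k" using pattern_of_link_of[of w] w by simp
      thus ?thesis using nth_pattern_of[of "Suc n" "L + 2" "prefixed l ?c"] nth_pattern_of[OF kL, of ?c] n k
        by (auto simp: prefixed_def split: link.splits)
    qed
  qed (use w in simp)
  thus ?thesis using link_of_pattern_of[OF pl i] by simp
qed

lemma tgen_prefix:
  assumes "1 \<le> L" "1 \<le> k" "k \<le> L"
  shows "tgen (L + 2) (k + 2) (Opn # Cls # w) = Opn # Cls # tgen L k w"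
proof (cases "length w = L")
  case w: True
  have lp: "link_of (Opn # Cls # v) i = prefixed True (link_of v) i" if "length v = L" "i \<in> {1..L + 2}" for v i
    using link_of_prefixed[OF that, of True] by simp
  show ?thesis
  proof (rule link_of_inject)
    fix i assume i: "i \<in> {1..L + 2}"
    have "link_of (tgen (L + 2) (k + 2) (Opn # Cls # w)) i = act (L + 2) (k + 2) (link_of (Opn # Cls # w)) i"
      using w i assms by (intro link_of_tgen1) auto
    also have "\<dots> = act (L + 2) (k + 2) (prefixed True (link_of w)) i"
      using w i assms lp by (intro act_cong) auto
    also have "\<dots> = prefixed True (act L k (link_of w)) i"
    proof (cases "i \<le> 2")
      case True
      thus ?thesis using assms i by (auto simp: act_def join_sites_def prefixed_def)
    next
      case False
      hence "i = (i - 2) + 2" "i - 2 \<ge> 1" by auto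
      then obtain m where m: "i = m + 2" "m \<ge> 1" by blast
      show ?thesis
        using assms m by (auto simp: act_def join_sites_def prefixed_def split: link.splits)
    qed
    also have "\<dots> = prefixed True (link_of (tgen L k w)) i"
    proof (cases "i \<le> 2")
      case False
      hence "i - 2 \<in> {1..L}" using i by auto
      hence "link_of (tgen L k w) (i - 2) = act L k (link_of w) (i - 2)"
        using w assms by (intro link_of_tgen1) auto
      thus ?thesis by (simp add: prefixed_def)
    qed (simp add: prefixed_def)
    also have "\<dots> = link_of (Opn # Cls # tgen L k w) i"
      using w i assms by (intro lp[symmetric]) auto
    finally show "link_of (tgen (L + 2) (k + 2) (Opn # Cls # w)) i = link_of (Opn # Cls # tgen L k w) i" .
  qed (use w assms in auto)
qed (simp add: tgen_def)

section \<open>Cap and cup on the two auxiliary sites\<close>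

definition contract :: "nat \<Rightarrow> bracket list \<Rightarrow> bracket list" where
  "contract L w = drop 2 (tgen (L + 2) 1 w)"

text \<open>The generator with index 1 is a cap followed by a cup on the sites 1 and 2;
  \<open>contract\<close> keeps the cap.\<close>

lemma tgen_1_contract:
  assumes "length w = L + 2"
  shows "tgen (L + 2) 1 w = Opn # Cls # contract L w"
proof -
  have "tgen (L + 2) 1 w = pattern_of (L + 2) (join_sites 1 (link_of w))"
    using assms gen_pattern_of[of w "L + 2" 1] by (simp add: tgen_def act_def)
  hence "tgen (L + 2) 1 w ! 0 = Opn" "tgen (L + 2) 1 w ! 1 = Cls"
    using nth_pattern_of[of 1 "L + 2" "join_sites 1 (link_of w)"] nth_pattern_of[of 2 "L + 2" "join_sites 1 (link_of w)"]
    by (auto simp: join_sites_def)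
  moreover have "length (tgen (L + 2) 1 w) = L + 2" using assms by simp
  ultimately show ?thesis unfolding contract_def
    by (cases "tgen (L + 2) 1 w"; cases "tl (tgen (L + 2) 1 w)") auto
qed

lemma tgen_1_prefix [simp]: "tgen (L + 2) 1 (Opn # Cls # w) = Opn # Cls # w"
proof (cases "length w = L")
  case w: True
  have lp: "link_of (Opn # Cls # w) i = prefixed True (link_of w) i" if "i \<in> {1..L + 2}" for i
    using link_of_prefixed[OF w that, of True] by simp
  show ?thesis
  proof (rule link_of_inject)
    fix i assume i: "i \<in> {1..L + 2}"
    have "link_of (tgen (L + 2) 1 (Opn # Cls # w)) i = act (L + 2) 1 (link_of (Opn # Cls # w)) i"
      using w i by (intro link_of_tgen1) auto
    also have "\<dots> = act (L + 2) 1 (prefixed True (link_of w)) i"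
      using i lp by (intro act_cong) auto
    also have "\<dots> = prefixed True (link_of w) i"
      using i by (auto simp: act_def join_sites_def prefixed_def split: link.splits)
    finally show "link_of (tgen (L + 2) 1 (Opn # Cls # w)) i = link_of (Opn # Cls # w) i" using lp[OF i] by simp
  qed (use w in auto)
qed (simp add: tgen_def)

lemma tgen_0_prefix:
  assumes "length w = L" shows "tgen (L + 2) 0 (Opn # Cls # w) = Cls # Cls # w"
  using assms by (simp add: tgen_def gen_def)

text \<open>Generator 0 cuts the cup and leaves both auxiliary sites on the left boundary. Generator
  2 sends the former partner of the first physical site there, and generator 1 restores the cup
  while passing the remaining boundary line on to that site. In this way the boundary generator of
  the physical sites is recovered.\<close>

lemma tgen_prefix_0:
  assumes "1 \<le> L"
  shows "tgen (L + 2) 1 (tgen (L + 2) 2 (tgen (L + 2) 0 (Opn # Cls # w))) = Opn # Cls # tgen L 0 w"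
proof (cases "length w = L")
  case w: True
  have lp: "link_of (Opn # Cls # v) i = prefixed True (link_of v) i" if "length v = L" "i \<in> {1..L + 2}" for v i
    using link_of_prefixed[OF that, of True] by simp
  have lp': "link_of (Cls # Cls # w) i = prefixed False (link_of w) i" if "i \<in> {1..L + 2}" for i
    using link_of_prefixed[OF w that, of False] by simp
  have "planar L (link_of w)" using link_of_planar[of w] w by simp
  note p1 = planarD(1)[OF this]
  show ?thesis unfolding tgen_0_prefix[OF w]
  proof (rule link_of_inject)
    fix i assume i: "i \<in> {1..L + 2}"
    let ?c = "link_of w"
    have "link_of (tgen (L + 2) 1 (tgen (L + 2) 2 (Cls # Cls # w))) i = act (L + 2) 1 (act (L + 2) 2 (link_of (Cls # Cls # w))) i"
      using w i assms by (intro link_of_tgen2) auto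
    also have "\<dots> = act (L + 2) 1 (act (L + 2) 2 (prefixed False ?c)) i"
      using i lp' assms by (intro act_cong) auto
    also have "\<dots> = prefixed True (act L 0 ?c) i"
    proof (cases "i \<le> 3")
      case True
      then consider "i = 1" | "i = 2" | "i = 3" using i by fastforce
      thus ?thesis using assms i p1[of 1]
        by cases (auto simp: act_def join_sites_def prefixed_def split: link.splits)
    next
      case False
      hence "i = (i - 2) + 2" "i - 2 \<ge> 2" by auto
      then obtain m where m: "i = m + 2" "m \<ge> 2" by blast
      hence mL: "m \<in> {1..L}" using i by auto
      have s: "act (L + 2) 1 d = join_sites 1 d" "act (L + 2) 2 d = join_sites 2 d" for d
        using assms by (simp_all add: act_def)
      show ?thesis
      proof (cases "?c m")
        case (Site j)
        hence "1 \<le> j" using p1[OF mL] by auto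
        have 2: "join_sites 2 (prefixed False ?c) (m + 2) = (if j = 1 then LeftBdry else Site (j + 2))"
          using m \<open>1 \<le> j\<close> by (auto simp add: join_sites_def prefixed_def Site)
        show ?thesis unfolding s m(1) using m \<open>1 \<le> j\<close>
          by (subst join_sites_def) (simp add: 2[simplified] act_def prefixed_def Site)
      next
        case LeftBdry
        have 2: "join_sites 2 (prefixed False ?c) (m + 2) = LeftBdry"
          using m by (simp add: join_sites_def prefixed_def LeftBdry)
        show ?thesis unfolding s m(1) using m
          by (subst join_sites_def) (simp add: 2[simplified] act_def prefixed_def LeftBdry)
      next
        case RightBdry
        have 2: "join_sites 2 (prefixed False ?c) (m + 2) = RightBdry"
          using m by (simp add: join_sites_def prefixed_def RightBdry)
        show ?thesis unfolding s m(1) using m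
          by (subst join_sites_def) (simp add: 2[simplified] act_def prefixed_def RightBdry)
      qed
    qed
    also have "\<dots> = prefixed True (link_of (tgen L 0 w)) i"
    proof (cases "i \<le> 2")
      case False
      hence "i - 2 \<in> {1..L}" using i by auto
      hence "link_of (tgen L 0 w) (i - 2) = act L 0 (link_of w) (i - 2)"
        using w assms by (intro link_of_tgen1) auto
      thus ?thesis by (simp add: prefixed_def)
    qed (simp add: prefixed_def)
    also have "\<dots> = link_of (Opn # Cls # tgen L 0 w) i"
      using w i assms by (intro lp[symmetric]) auto
    finally show "link_of (tgen (L + 2) 1 (tgen (L + 2) 2 (Cls # Cls # w))) i = link_of (Opn # Cls # tgen L 0 w) i" .
  qed (use w assms in auto)
qed (use assms in \<open>simp add: tgen_def\<close>)

lemma contract_prefix [simp]: "contract L (Opn # Cls # w) = w"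
  unfolding contract_def tgen_1_prefix by simp

lemma contract_tgen:
  assumes "1 \<le> L" "1 \<le> k" "k \<le> L"
  shows "contract L (tgen (L + 2) (k + 2) w) = tgen L k (contract L w)"
proof (cases "length w = L + 2")
  case True
  have "tgen (L + 2) 1 (tgen (L + 2) (k + 2) w) = tgen (L + 2) (k + 2) (tgen (L + 2) 1 w)"
    using assms by (intro tgen_commute) auto
  also have "\<dots> = Opn # Cls # tgen L k (contract L w)"
    unfolding tgen_1_contract[OF True] by (rule tgen_prefix[OF assms])
  finally show ?thesis by (simp add: contract_def)
next
  case False
  moreover from False assms have "length (drop 2 w) \<noteq> L" by auto
  ultimately show ?thesis by (simp add: contract_def tgen_def)
qed

lemma contract_tgen_prefix:
  assumes "1 \<le> L"
  shows "contract L (tgen (L + 2) 0 (Opn # Cls # w)) = w" "contract L (tgen (L + 2) 2 (Opn # Cls # w)) = w"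
proof -
  have "tgen (L + 2) 1 (tgen (L + 2) k (tgen (L + 2) 1 (Opn # Cls # w))) = Opn # Cls # w" if "k = 0 \<or> k = 2" for k
    using tgen_absorb[of 1 "L + 2" k "Opn # Cls # w"] that assms unfolding tgen_1_prefix by auto
  from this[of 0] this[of 2]
  show "contract L (tgen (L + 2) 0 (Opn # Cls # w)) = w" "contract L (tgen (L + 2) 2 (Opn # Cls # w)) = w"
    unfolding contract_def tgen_1_prefix by simp_all
qed

lemma tgen_2_0_prefix:
  assumes "1 \<le> L"
  shows "tgen (L + 2) 2 (tgen (L + 2) 0 (Opn # Cls # w)) = tgen (L + 2) 2 (Opn # Cls # tgen L 0 w)"
  unfolding tgen_prefix_0[OF assms, symmetric]
  by (rule tgen_absorb[symmetric]) (use assms in auto)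

text \<open>The counterpart of \<open>tgen_2_0_prefix\<close> on the side of the cap:
  \<open>tgen_prefix_0\<close> is applied to the contracted word, and the surplus generators are
  removed by commutation and absorption.\<close>

lemma contract_tgen_2_0:
  assumes "1 \<le> L"
  shows "contract L (tgen (L + 2) 2 (tgen (L + 2) 0 w)) = tgen L 0 (contract L (tgen (L + 2) 2 w))"
proof (cases "length w = L + 2")
  case True
  let ?e = "tgen (L + 2)"
  have l: "length (?e 2 w) = L + 2" using True by simp
  have "Opn # Cls # tgen L 0 (contract L (?e 2 w)) = ?e 1 (?e 2 (?e 0 (?e 1 (?e 2 w))))"
    unfolding tgen_1_contract[OF l] tgen_prefix_0[OF assms] ..
  also have "?e 2 (?e 0 (?e 1 (?e 2 w))) = ?e 0 (?e 2 (?e 1 (?e 2 w)))"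
    by (rule tgen_commute[symmetric]) (use assms in auto)
  also have "?e 2 (?e 1 (?e 2 w)) = ?e 2 w"
    by (rule tgen_absorb) (use assms in auto)
  also have "?e 0 (?e 2 w) = ?e 2 (?e 0 w)"
    by (rule tgen_commute) (use assms in auto)
  finally have "Opn # Cls # tgen L 0 (contract L (?e 2 w)) = ?e 1 (?e 2 (?e 0 w))" .
  thus ?thesis unfolding contract_def[of L "?e 2 (?e 0 w)"] by (metis drop0 drop_Suc_Cons numeral_2_eq_2)
next
  case False
  moreover from False assms have "length (drop 2 w) \<noteq> L" by auto
  ultimately show ?thesis by (simp add: contract_def tgen_def)
qed

section \<open>Connected components of a growing graph\<close>

definition conn :: "('v \<times> 'v) set \<Rightarrow> 'v \<Rightarrow> 'v \<Rightarrow> bool" where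
  "conn E x y \<longleftrightarrow> (x, y) \<in> (E \<union> E\<inverse>)\<^sup>*"

lemma conn_refl [simp, intro]: "conn E x x"
  by (simp add: conn_def)

lemma conn_sym: "conn E x y \<longleftrightarrow> conn E y x"
proof -
  have "sym ((E \<union> E\<inverse>)\<^sup>*)" by (intro sym_rtrancl symI) auto
  thus ?thesis unfolding conn_def by (meson symD)
qed

lemma conn_trans: "conn E x y \<Longrightarrow> conn E y z \<Longrightarrow> conn E x z"
  unfolding conn_def by (rule rtrancl_trans)

lemma conn_mono: "conn E x y \<Longrightarrow> E \<subseteq> E' \<Longrightarrow> conn E' x y"
  unfolding conn_def using rtrancl_mono[of "E \<union> E\<inverse>" "E' \<union> E'\<inverse>"] by blast

text \<open>A new edge merges at most two components. With this rule connectivity is followed arc by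
  arc while a diagram is drawn, without describing any path.\<close>

lemma conn_insert:
  "conn (insert (a, b) E) x y \<longleftrightarrow> conn E x y \<or> conn E x a \<and> conn E b y \<or> conn E x b \<and> conn E a y" (is "?l = ?r")
proof
  assume ?l
  then have "(x, y) \<in> (insert (a, b) E \<union> (insert (a, b) E)\<inverse>)\<^sup>*" by (simp add: conn_def)
  then show ?r
  proof (induction rule: rtrancl_induct)
    case (step y z)
    from step(2) consider "(y, z) \<in> E \<union> E\<inverse>" | "y = a" "z = b" | "y = b" "z = a" by auto
    then show ?case
    proof cases
      case 1
      then have "conn E y z" unfolding conn_def by auto
      then show ?thesis using step(3) conn_trans by metis
    next
      case 2 then show ?thesis using step(3) conn_refl conn_trans conn_sym by metis
    next
      case 3 then show ?thesis using step(3) conn_refl conn_trans conn_sym by metis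
    qed
  qed simp
next
  have ab: "conn (insert (a, b) E) a b" unfolding conn_def by auto
  assume ?r
  then show ?l using ab conn_mono[of E _ _ "insert (a, b) E"] conn_trans conn_sym by (metis subset_insertI)
qed

lemma conn_flip: "conn (insert (a, b) E) = conn (insert (b, a) E)"
  by (auto simp: conn_insert fun_eq_iff)

lemma conn_fresh: "p \<notin> Field E \<Longrightarrow> conn E x p \<longleftrightarrow> x = p" "p \<notin> Field E \<Longrightarrow> conn E p x \<longleftrightarrow> x = p"
proof -
  show "conn E x p \<longleftrightarrow> x = p" if "p \<notin> Field E"
    using that unfolding conn_def by (auto simp: Field_def elim: rtranclE)
  thus "conn E p x \<longleftrightarrow> x = p" if "p \<notin> Field E" using that conn_sym by metis
qed

text \<open>No vertex has two neighbours, so a path can only go back and forth along one edge. This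
  covers the initial diagram, before any tile is drawn.\<close>

lemma conn_matching:
  assumes "\<And>x y z. (x, y) \<in> E \<union> E\<inverse> \<Longrightarrow> (y, z) \<in> E \<union> E\<inverse> \<Longrightarrow> x = z"
  shows "conn E x y \<longleftrightarrow> x = y \<or> (x, y) \<in> E \<union> E\<inverse>"
proof
  assume "conn E x y"
  then have "(x, y) \<in> (E \<union> E\<inverse>)\<^sup>*" by (simp add: conn_def)
  then show "x = y \<or> (x, y) \<in> E \<union> E\<inverse>"
    by (induction rule: rtrancl_induct) (use assms in blast)+
qed (auto simp: conn_def)

lemma conn_map_Some: "conn (map_prod Some Some ` E) (Some x) (Some y) \<longleftrightarrow> conn E x y"
proof
  assume "conn (map_prod Some Some ` E) (Some x) (Some y)"
  then have "(Some x, Some y) \<in> (map_prod Some Some ` E \<union> (map_prod Some Some ` E)\<inverse>)\<^sup>*" by (simp add: conn_def)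
  moreover have "(Some x, z) \<in> (map_prod Some Some ` E \<union> (map_prod Some Some ` E)\<inverse>)\<^sup>* \<Longrightarrow> \<exists>y. z = Some y \<and> (x, y) \<in> (E \<union> E\<inverse>)\<^sup>*" for z
    by (induction rule: rtrancl_induct) (auto intro: rtrancl_into_rtrancl)
  ultimately show "conn E x y" by (auto simp: conn_def)
next
  assume "conn E x y"
  then have "(x, y) \<in> (E \<union> E\<inverse>)\<^sup>*" by (simp add: conn_def)
  then show "conn (map_prod Some Some ` E) (Some x) (Some y)"
  proof (induction rule: rtrancl_induct)
    case (step y z)
    have "(Some y, Some z) \<in> map_prod Some Some ` E \<union> (map_prod Some Some ` E)\<inverse>"
      using step(2) by force
    thus ?case using step(3) unfolding conn_def by (rule rtrancl_into_rtrancl[rotated])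
  qed simp
qed

text \<open>The frontier \<open>fs\<close> of a partially drawn diagram with arcs \<open>E\<close>, drawn on vertices in \<open>W\<close>, reads
  the word \<open>w\<close>; \<open>M\<close> are the vertices on the left boundary.\<close>

definition reads :: "'v set \<Rightarrow> ('v \<times> 'v) set \<Rightarrow> 'v set \<Rightarrow> nat \<Rightarrow> (nat \<Rightarrow> 'v) \<Rightarrow> bracket list \<Rightarrow> bool" where
  "reads W E M N fs w \<longleftrightarrow>
     Field E \<subseteq> W \<and> M \<subseteq> W \<and> fs ` {1..N} \<subseteq> W \<and> inj_on fs {1..N} \<and> length w = N \<and>
     (\<forall>i\<in>{1..N}. (\<forall>j\<in>{1..N}. i \<noteq> j \<longrightarrow> conn E (fs i) (fs j) = (link_of w i = Site j)) \<and>
        (\<exists>x\<in>M. conn E (fs i) x) = (link_of w i = LeftBdry))"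

text \<open>A tile that lets a strand pass only prolongs it: the end of strand \<open>k\<close>
  moves along a fresh edge to \<open>p\<close>. As \<open>p\<close> has no other edge, the
  components of the other frontier vertices are unaffected.\<close>

lemma reads_rename:
  assumes r: "reads W E M N fs w" and k: "k \<in> {1..N}" and p: "p \<notin> W"
  shows "reads (insert p W) (insert (fs k, p) E) M N (fs(k := p)) w"
proof -
  have W: "fs i \<in> W" if "i \<in> {1..N}" for i using r that by (auto simp: reads_def)
  have pE: "p \<notin> Field E" using r p by (auto simp: reads_def)
  have np: "fs i \<noteq> p" if "i \<in> {1..N}" for i using W[OF that] p by auto
  have 1: "conn (insert (fs k, p) E) (if i = k then p else fs i) (if j = k then p else fs j) = conn E (fs i) (fs j)"
    if "i \<in> {1..N}" "j \<in> {1..N}" "i \<noteq> j" for i j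
    using that k np np[symmetric] by (auto simp: conn_insert conn_fresh[OF pE])
  have 2: "conn (insert (fs k, p) E) (if i = k then p else fs i) x = conn E (fs i) x" if "i \<in> {1..N}" "x \<in> M" for i x
  proof -
    have "x \<noteq> p" "p \<noteq> x" using that r p by (auto simp: reads_def)
    thus ?thesis using that k np np[symmetric] by (auto simp: conn_insert conn_fresh[OF pE])
  qed
  have 3: "inj_on (fs(k := p)) {1..N}"
  proof (rule inj_on_fun_updI)
    show "p \<notin> fs ` {1..N}" using W p by blast
  qed (use r in \<open>simp add: reads_def\<close>)
  have 4: "Field (insert (fs k, p) E) \<subseteq> insert p W" "M \<subseteq> insert p W" "(fs(k := p)) ` {1..N} \<subseteq> insert p W"
    using r W k unfolding reads_def by (auto simp: Field_insert)
  show ?thesis unfolding reads_def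
  proof (intro conjI ballI impI)
    fix i assume i: "i \<in> {1..N}"
    show "conn (insert (fs k, p) E) ((fs(k := p)) i) ((fs(k := p)) j) = (link_of w i = Site j)"
      if "j \<in> {1..N}" "i \<noteq> j" for j
      using 1[OF i that] r i that by (simp add: reads_def fun_upd_def)
    have "(\<exists>x\<in>M. conn (insert (fs k, p) E) ((fs(k := p)) i) x) = (\<exists>x\<in>M. conn E (fs i) x)"
      using 2[OF i] by (simp add: fun_upd_def)
    thus "(\<exists>x\<in>M. conn (insert (fs k, p) E) ((fs(k := p)) i) x) = (link_of w i = LeftBdry)"
      using r i by (simp add: reads_def)
  qed (use 3 4 r in \<open>simp_all add: reads_def\<close>)
qed

lemma reads_flip: "reads W (insert (a, b) E) M N fs w = reads W (insert (b, a) E) M N fs w"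
  unfolding reads_def conn_flip[of a b] by (auto simp: Field_insert)

text \<open>The picture of a generator: the ends of the strands \<open>k\<close> and
  \<open>k + 1\<close> are connected, and a new arc with fresh ends \<open>p\<close>,
  \<open>p'\<close> takes their places. Freshness makes this arc a component of its own.\<close>

lemma reads_join:
  assumes r: "reads W E M N fs w" and k: "1 \<le> k" "k < N" and p: "p \<notin> W" "p' \<notin> W" "p \<noteq> p'"
  shows "reads (insert p (insert p' W)) (insert (fs k, fs (k + 1)) (insert (p, p') E)) M N
           (fs(k := p, k + 1 := p')) (tgen N k w)"
proof -
  have kN: "k \<in> {1..N}" "k + 1 \<in> {1..N}" using k by auto
  have W: "fs i \<in> W" if "i \<in> {1..N}" for i using r that by (auto simp: reads_def)
  have np: "fs i \<noteq> p" "fs i \<noteq> p'" "p \<noteq> fs i" "p' \<noteq> fs i" if "i \<in> {1..N}" for i using W[OF that] p by auto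
  have nM: "x \<noteq> p" "x \<noteq> p'" if "x \<in> M" for x using that r p by (auto simp: reads_def)
  define E1 where "E1 = insert (fs k, fs (k + 1)) E"
  define E2 where "E2 = insert (fs k, fs (k + 1)) (insert (p, p') E)"
  have E: "E2 = insert (p, p') E1" by (auto simp: E1_def E2_def)
  have pE: "p \<notin> Field E1" "p' \<notin> Field E1" using r p W kN by (auto simp: E1_def reads_def Field_insert)
  let ?c = "link_of w" and ?d = "link_of (tgen N k w)"
  have w: "length w = N" using r by (simp add: reads_def)
  have d: "?d i = join_sites k ?c i" if "i \<in> {1..N}" for i
    using link_of_tgen1[OF w _ _ that, of k] k by (simp add: act_def)
  have cs: "conn E (fs i) (fs j) = (?c i = Site j)" if "i \<in> {1..N}" "j \<in> {1..N}" "i \<noteq> j" for i j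
    using r that by (simp add: reads_def)
  have cl: "(\<exists>x\<in>M. conn E (fs i) x) = (?c i = LeftBdry)" if "i \<in> {1..N}" for i
    using r that by (simp add: reads_def)
  let ?g = "fs(k := p, k + 1 := p')"
  have old: "conn E2 (fs i) y = conn E1 (fs i) y" if "i \<in> {1..N}" "y \<noteq> p" "y \<noteq> p'" for i y
    unfolding E using that np[OF that(1)] by (simp add: conn_insert[of p p'] conn_fresh[OF pE(1)] conn_fresh[OF pE(2)])
  have new: "conn E2 p y = (y = p \<or> y = p')" "conn E2 p' y = (y = p \<or> y = p')" for y
    unfolding E using p by (auto simp: conn_insert[of p p'] conn_fresh[OF pE(1)] conn_fresh[OF pE(2)])
  have S: "conn E2 (?g i) (?g j) = (?d i = Site j)" if ij: "i \<in> {1..N}" "j \<in> {1..N}" "i \<noteq> j" for i j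
  proof -
    consider "i = k" | "i = k + 1" | "i \<noteq> k" "i \<noteq> k + 1" "j = k \<or> j = k + 1" | "i \<noteq> k" "i \<noteq> k + 1" "j \<noteq> k" "j \<noteq> k + 1"
      by blast
    thus ?thesis
    proof cases
      case 1 thus ?thesis using ij np[OF ij(2)] d[OF ij(1)] p by (auto simp: new join_sites_def)
    next
      case 2 thus ?thesis using ij np[OF ij(2)] d[OF ij(1)] p by (auto simp: new join_sites_def)
    next
      case 3
      have "link_of (tgen N k w) k = Site (k + 1)" "link_of (tgen N k w) (k + 1) = Site k"
        using d kN by (simp_all add: join_sites_def)
      hence "?d i \<noteq> Site j" using 3 linked_unique linked_sym by (metis link_of_Site)
      moreover have "\<not> conn E2 (?g i) (?g j)"
        using 3 new[of "fs i"] np[OF ij(1)] conn_sym[of E2 "fs i"] by auto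
      ultimately show ?thesis by simp
    next
      case 4
      have "conn E2 (?g i) (?g j) = conn E1 (fs i) (fs j)" using 4 old[OF ij(1), of "fs j"] np[OF ij(2)] by simp
      also have "\<dots> = (?c i = Site j \<or> ?c i = Site k \<and> ?c (k + 1) = Site j \<or> ?c i = Site (k + 1) \<and> ?c k = Site j)"
        unfolding E1_def conn_insert using 4 cs ij kN by simp
      also have "\<dots> = (?d i = Site j)" using 4 d[OF ij(1)] by (auto simp: join_sites_def)
      finally show ?thesis .
    qed
  qed
  have Lf: "(\<exists>x\<in>M. conn E2 (?g i) x) = (?d i = LeftBdry)" if i: "i \<in> {1..N}" for i
  proof (cases "i = k \<or> i = k + 1")
    case True thus ?thesis using d[OF i] nM by (auto simp: new join_sites_def)
  next
    case False
    have "(\<exists>x\<in>M. conn E2 (?g i) x) = (\<exists>x\<in>M. conn E1 (fs i) x)" using False old[OF i] nM by simp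
    also have "\<dots> = (?c i = LeftBdry \<or> ?c i = Site k \<and> ?c (k + 1) = LeftBdry \<or> ?c i = Site (k + 1) \<and> ?c k = LeftBdry)"
      unfolding E1_def conn_insert using False cs[OF i kN(1)] cs[OF i kN(2)] cl[OF i] cl[OF kN(1)] cl[OF kN(2)] by blast
    also have "\<dots> = (?d i = LeftBdry)" using False d[OF i] by (auto simp: join_sites_def)
    finally show ?thesis .
  qed
  have "p \<notin> fs ` {1..N}" using W p by blast
  hence "inj_on (fs(k := p)) {1..N}" using r unfolding reads_def by (blast intro: inj_on_fun_updI)
  moreover have "p' \<notin> fs ` {1..N}" using W p by blast
  hence "p' \<notin> (fs(k := p)) ` {1..N}" using p by (auto simp: fun_upd_def)
  ultimately have "inj_on ?g {1..N}" by (rule inj_on_fun_updI)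
  moreover have "Field E2 \<subseteq> insert p (insert p' W)" using r W kN by (auto simp: reads_def Field_insert E2_def)
  moreover have "M \<subseteq> insert p (insert p' W)" "?g ` {1..N} \<subseteq> insert p (insert p' W)"
    using r W unfolding reads_def by auto
  moreover have "length (tgen N k w) = N" using w k by simp
  ultimately show ?thesis using S Lf unfolding reads_def E2_def by blast
qed

text \<open>Only the left boundary is marked by vertices; a site counts as connected to the right
  one if it is connected to nothing else. So an open right end amounts to abandoning the last
  frontier vertex and putting an isolated one in its place.\<close>

lemma reads_cut:
  assumes r: "reads W E M N fs w" and N: "1 \<le> N" and p: "p \<notin> W"
  shows "reads (insert p W) E M N (fs(N := p)) (tgen N N w)"
proof -
  have NN: "N \<in> {1..N}" using N by auto
  have W: "fs i \<in> W" if "i \<in> {1..N}" for i using r that by (auto simp: reads_def)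
  have np: "fs i \<noteq> p" "p \<noteq> fs i" if "i \<in> {1..N}" for i using W[OF that] p by auto
  have pE: "p \<notin> Field E" using r p by (auto simp: reads_def)
  have w: "length w = N" using r by (simp add: reads_def)
  have d: "link_of (tgen N N w) i = (if i = N \<or> link_of w i = Site N then RightBdry else link_of w i)" if "i \<in> {1..N}" for i
    using link_of_tgen1[OF w N _ that, of N] N by (simp add: act_def)
  have S: "conn E ((fs(N := p)) i) ((fs(N := p)) j) = (link_of (tgen N N w) i = Site j)"
    if ij: "i \<in> {1..N}" "j \<in> {1..N}" "i \<noteq> j" for i j
    using ij r d[OF ij(1)] np[OF ij(1)] np[OF ij(2)] by (auto simp: conn_fresh[OF pE] reads_def)
  have Lf: "(\<exists>x\<in>M. conn E ((fs(N := p)) i) x) = (link_of (tgen N N w) i = LeftBdry)" if i: "i \<in> {1..N}" for i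
  proof -
    have nM: "x \<noteq> p" if "x \<in> M" for x using that r p by (auto simp: reads_def)
    have cl: "(\<exists>x\<in>M. conn E (fs i) x) = (link_of w i = LeftBdry)" using r i by (simp add: reads_def)
    show ?thesis
    proof (cases "i = N")
      case True thus ?thesis using d[OF i] nM by (auto simp: conn_fresh[OF pE])
    next
      case False thus ?thesis using d[OF i] cl by auto
    qed
  qed
  have "p \<notin> fs ` {1..N}" using W p by blast
  hence "inj_on (fs(N := p)) {1..N}" using r unfolding reads_def by (blast intro: inj_on_fun_updI)
  moreover have "Field E \<subseteq> insert p W" "M \<subseteq> insert p W" "(fs(N := p)) ` {1..N} \<subseteq> insert p W"
    using r W unfolding reads_def by auto
  moreover have "length (tgen N N w) = N" using w N by simp
  ultimately show ?thesis using S Lf unfolding reads_def by blast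
qed

text \<open>The auxiliary strand enters column \<open>j\<close> at site \<open>j + 1\<close> and the
  column itself sits at site \<open>j + 2\<close>, whence the generator \<open>j + 1\<close>. A
  lower face acts if it is of type II, an upper face if it is of type I. The upper row is traversed
  from right to left, so its last column acts first.\<close>

fun lower_row :: "nat \<Rightarrow> nat set \<Rightarrow> nat \<Rightarrow> bracket list \<Rightarrow> bracket list" where
  "lower_row N A 0 w = w"
| "lower_row N A (Suc n) w = (if Suc n \<in> A then lower_row N A n w else tgen N (n + 2) (lower_row N A n w))"

fun upper_row :: "nat \<Rightarrow> nat set \<Rightarrow> nat \<Rightarrow> bracket list \<Rightarrow> bracket list" where
  "upper_row N B 0 w = w"
| "upper_row N B (Suc n) w = upper_row N B n (if Suc n \<in> B then tgen N (n + 2) w else w)"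

abbreviation lift_arcs :: "(point \<times> point) set \<Rightarrow> (point option \<times> point option) set" where
  "lift_arcs E \<equiv> map_prod Some Some ` E"

text \<open>The frontiers while the lower row is drawn from left to right and the upper row from right to
  left. The vertex \<^const>\<open>None\<close> is a copy of \<open>Upper 0\<close> that is present from the start.\<close>

definition lower_front :: "nat \<Rightarrow> nat \<Rightarrow> point option" where
  "lower_front n m =
     (if m \<le> 1 then None else if m \<le> n + 1 then Some (Middle (m - 1))
      else if m = n + 2 then Some (Lower n) else Some (Bottom (m - 2)))"

definition upper_front :: "nat \<Rightarrow> nat \<Rightarrow> point option" where
  "upper_front n m =
     (if m \<le> 1 then None else if m \<le> n + 1 then Some (Middle (m - 1))
      else if m = n + 2 then Some (Upper n) else Some (Top (m - 2)))"

definition lower_vertices :: "nat \<Rightarrow> nat \<Rightarrow> point option set" where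
  "lower_vertices L n = insert None (Some ` (Bottom ` {1..L} \<union> Lower ` {..n} \<union> Middle ` {1..n}))"

definition upper_vertices :: "nat \<Rightarrow> nat \<Rightarrow> point option set" where
  "upper_vertices L n = lower_vertices L L \<union> Some ` (Upper ` {n..L} \<union> Top ` {n<..L})"

lemma lower_front_Suc:
  "(lower_front n)(n + 2 := Some (Middle (Suc n)), n + 2 + 1 := Some (Lower (Suc n))) = lower_front (Suc n)"
  by (auto simp: lower_front_def fun_eq_iff)

lemma upper_front_Suc:
  "(upper_front (Suc n))(n + 2 := Some (Upper n), n + 2 + 1 := Some (Top (Suc n))) = upper_front n"
  by (auto simp: upper_front_def fun_eq_iff)

lemma lower_vertices_Suc:
  "insert (Some (Middle (Suc n))) (insert (Some (Lower (Suc n))) (lower_vertices L n)) = lower_vertices L (Suc n)"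
  by (auto simp: lower_vertices_def atMost_Suc atLeastAtMostSuc_conv)

lemma upper_vertices_Suc:
  assumes "Suc n \<le> L"
  shows "insert (Some (Upper n)) (insert (Some (Top (Suc n))) (upper_vertices L (Suc n))) = upper_vertices L n"
proof -
  have "{n..L} = insert n {Suc n..L}" "{n<..L} = insert (Suc n) {Suc n<..L}" using assms by auto
  thus ?thesis by (auto simp: upper_vertices_def)
qed

lemma reads_lower_row:
  assumes "reads (lower_vertices L 0) E M (L + 2) (lower_front 0) w" "n \<le> L"
  shows "reads (lower_vertices L n) (E \<union> lift_arcs (\<Union>i\<in>{1..n}. lower_arcs A i)) M (L + 2) (lower_front n)
           (lower_row (L + 2) A n w)"
  using assms(2)
proof (induction n)
  case 0 then show ?case using assms(1) by simp
next
  case (Suc n)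
  let ?E = "E \<union> lift_arcs (\<Union>i\<in>{1..n}. lower_arcs A i)"
  have r: "reads (lower_vertices L n) ?E M (L + 2) (lower_front n) (lower_row (L + 2) A n w)" using Suc by simp
  have fs: "lower_front n (n + 2) = Some (Lower n)" "lower_front n (n + 2 + 1) = Some (Bottom (Suc n))"
    by (simp_all add: lower_front_def)
  have new: "Some (Middle (Suc n)) \<notin> lower_vertices L n" "Some (Lower (Suc n)) \<notin> lower_vertices L n"
    by (auto simp: lower_vertices_def)
  have U: "(\<Union>i\<in>{1..Suc n}. lower_arcs A i) = lower_arcs A (Suc n) \<union> (\<Union>i\<in>{1..n}. lower_arcs A i)"
    by (auto simp: atLeastAtMostSuc_conv)
  show ?case
  proof (cases "Suc n \<in> A")
    case True
    have "reads (insert (Some (Middle (Suc n))) (lower_vertices L n))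
        (insert (lower_front n (n + 2), Some (Middle (Suc n))) ?E) M (L + 2)
        ((lower_front n)(n + 2 := Some (Middle (Suc n)))) (lower_row (L + 2) A n w)"
      using r new Suc.prems by (intro reads_rename) auto
    from reads_rename[OF this, of "n + 2 + 1" "Some (Lower (Suc n))"]
    have "reads (insert (Some (Lower (Suc n))) (insert (Some (Middle (Suc n))) (lower_vertices L n)))
        (insert (Some (Bottom (Suc n)), Some (Lower (Suc n))) (insert (Some (Lower n), Some (Middle (Suc n))) ?E)) M (L + 2)
        ((lower_front n)(n + 2 := Some (Middle (Suc n)), n + 2 + 1 := Some (Lower (Suc n)))) (lower_row (L + 2) A n w)"
      using new Suc.prems fs by simp
    moreover have "insert (Some (Bottom (Suc n)), Some (Lower (Suc n))) (insert (Some (Lower n), Some (Middle (Suc n))) ?E)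
        = E \<union> lift_arcs (\<Union>i\<in>{1..Suc n}. lower_arcs A i)"
    proof -
      have a: "lift_arcs (lower_arcs A (Suc n)) = {(Some (Lower n), Some (Middle (Suc n))), (Some (Bottom (Suc n)), Some (Lower (Suc n)))}"
        using True by (simp add: lower_arcs_def)
      show ?thesis unfolding U image_Un a by blast
    qed
    ultimately show ?thesis using True
      unfolding lower_front_Suc insert_commute[of "Some (Lower (Suc n))"] lower_vertices_Suc by simp
  next
    case False
    have "reads (insert (Some (Middle (Suc n))) (insert (Some (Lower (Suc n))) (lower_vertices L n)))
        (insert (lower_front n (n + 2), lower_front n (n + 2 + 1)) (insert (Some (Middle (Suc n)), Some (Lower (Suc n))) ?E)) M (L + 2)
        ((lower_front n)(n + 2 := Some (Middle (Suc n)), n + 2 + 1 := Some (Lower (Suc n))))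
        (tgen (L + 2) (n + 2) (lower_row (L + 2) A n w))"
      using r new Suc.prems by (intro reads_join) auto
    moreover have "insert (Some (Lower n), Some (Bottom (Suc n))) (insert (Some (Middle (Suc n)), Some (Lower (Suc n))) ?E)
        = E \<union> lift_arcs (\<Union>i\<in>{1..Suc n}. lower_arcs A i)"
    proof -
      have a: "lift_arcs (lower_arcs A (Suc n)) = {(Some (Lower n), Some (Bottom (Suc n))), (Some (Middle (Suc n)), Some (Lower (Suc n)))}"
        using False by (simp add: lower_arcs_def)
      show ?thesis unfolding U image_Un a by blast
    qed
    ultimately show ?thesis using False unfolding lower_front_Suc lower_vertices_Suc fs by simp
  qed
qed

lemma reads_upper_row:
  assumes "reads (upper_vertices L n) E M (L + 2) (upper_front n) w" "n \<le> L"
  shows "reads (upper_vertices L 0) (E \<union> lift_arcs (\<Union>i\<in>{1..n}. upper_arcs B i)) M (L + 2) (upper_front 0)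
           (upper_row (L + 2) B n w)"
  using assms
proof (induction n arbitrary: E w)
  case 0 then show ?case by simp
next
  case (Suc n)
  note r = Suc.prems(1)
  have fs: "upper_front (Suc n) (n + 2) = Some (Middle (Suc n))" "upper_front (Suc n) (n + 2 + 1) = Some (Upper (Suc n))"
    by (simp_all add: upper_front_def)
  have new: "Some (Upper n) \<notin> upper_vertices L (Suc n)" "Some (Top (Suc n)) \<notin> upper_vertices L (Suc n)"
    by (auto simp: upper_vertices_def lower_vertices_def)
  have U: "E \<union> lift_arcs (\<Union>i\<in>{1..Suc n}. upper_arcs B i)
      = (E \<union> lift_arcs (upper_arcs B (Suc n))) \<union> lift_arcs (\<Union>i\<in>{1..n}. upper_arcs B i)"
    by (auto simp: atLeastAtMostSuc_conv)
  have "reads (upper_vertices L n) (E \<union> lift_arcs (upper_arcs B (Suc n))) M (L + 2) (upper_front n)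
      (if Suc n \<in> B then tgen (L + 2) (n + 2) w else w)"
  proof (cases "Suc n \<in> B")
    case False
    have "reads (insert (Some (Upper n)) (upper_vertices L (Suc n)))
        (insert (Some (Middle (Suc n)), Some (Upper n)) E) M (L + 2)
        ((upper_front (Suc n))(n + 2 := Some (Upper n))) w"
      using reads_rename[OF r, of "n + 2" "Some (Upper n)"] new Suc.prems fs by simp
    hence "reads (insert (Some (Upper n)) (upper_vertices L (Suc n)))
        (insert (Some (Upper n), Some (Middle (Suc n))) E) M (L + 2)
        ((upper_front (Suc n))(n + 2 := Some (Upper n))) w"
      by (simp only: reads_flip[where a = "Some (Middle (Suc n))"])
    from reads_rename[OF this, of "n + 2 + 1" "Some (Top (Suc n))"]
    have "reads (insert (Some (Top (Suc n))) (insert (Some (Upper n)) (upper_vertices L (Suc n))))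
        (insert (Some (Upper (Suc n)), Some (Top (Suc n))) (insert (Some (Upper n), Some (Middle (Suc n))) E)) M (L + 2)
        ((upper_front (Suc n))(n + 2 := Some (Upper n), n + 2 + 1 := Some (Top (Suc n)))) w"
      using new Suc.prems fs by simp
    hence "reads (insert (Some (Top (Suc n))) (insert (Some (Upper n)) (upper_vertices L (Suc n))))
        (insert (Some (Top (Suc n)), Some (Upper (Suc n))) (insert (Some (Upper n), Some (Middle (Suc n))) E)) M (L + 2)
        (upper_front n) w"
      unfolding upper_front_Suc by (simp only: reads_flip[where a = "Some (Upper (Suc n))"])
    moreover have "insert (Some (Top (Suc n)), Some (Upper (Suc n))) (insert (Some (Upper n), Some (Middle (Suc n))) E)
        = E \<union> lift_arcs (upper_arcs B (Suc n))"
    proof -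
      have a: "lift_arcs (upper_arcs B (Suc n)) = {(Some (Upper n), Some (Middle (Suc n))), (Some (Top (Suc n)), Some (Upper (Suc n)))}"
        using False by (simp add: upper_arcs_def)
      show ?thesis unfolding a by blast
    qed
    ultimately show ?thesis using False Suc.prems(2)
      unfolding insert_commute[of "Some (Top (Suc n))"] upper_vertices_Suc[OF Suc.prems(2)] by simp
  next
    case True
    have "reads (insert (Some (Upper n)) (insert (Some (Top (Suc n))) (upper_vertices L (Suc n))))
        (insert (upper_front (Suc n) (n + 2), upper_front (Suc n) (n + 2 + 1)) (insert (Some (Upper n), Some (Top (Suc n))) E)) M (L + 2)
        ((upper_front (Suc n))(n + 2 := Some (Upper n), n + 2 + 1 := Some (Top (Suc n))))
        (tgen (L + 2) (n + 2) w)"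
      using r new Suc.prems by (intro reads_join) auto
    moreover have "insert (Some (Middle (Suc n)), Some (Upper (Suc n))) (insert (Some (Upper n), Some (Top (Suc n))) E)
        = E \<union> lift_arcs (upper_arcs B (Suc n))"
    proof -
      have a: "lift_arcs (upper_arcs B (Suc n)) = {(Some (Upper n), Some (Top (Suc n))), (Some (Middle (Suc n)), Some (Upper (Suc n)))}"
        using True by (simp add: upper_arcs_def)
      show ?thesis unfolding a by blast
    qed
    ultimately show ?thesis using True unfolding upper_front_Suc upper_vertices_Suc[OF Suc.prems(2)] fs by simp
  qed
  thus ?case unfolding U upper_row.simps(2) by (rule Suc.IH) (use Suc.prems(2) in simp)
qed

definition start_arcs :: "bool \<Rightarrow> bracket list \<Rightarrow> (point option \<times> point option) set" where
  "start_arcs l w = {(Some (Bottom i), Some (Bottom j)) | i j. linked w i j} \<union> (if l then {(None, Some (Lower 0))} else {})"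

definition start_left :: "bool \<Rightarrow> bracket list \<Rightarrow> point option set" where
  "start_left l w = {Some (Bottom i) | i. i \<in> {1..length w} \<and> link_of w i = LeftBdry} \<union> (if l then {} else {None, Some (Lower 0)})"

lemma reads_start:
  assumes "length w = L"
  shows "reads (lower_vertices L 0) (start_arcs l w) (start_left l w) (L + 2) (lower_front 0)
           ((if l then Opn else Cls) # Cls # w)"
proof -
  let ?E = "start_arcs l w" and ?v = "(if l then Opn else Cls) # Cls # w"
  have c: "conn ?E x y \<longleftrightarrow> x = y \<or> (x, y) \<in> ?E \<union> ?E\<inverse>" for x y
  proof (rule conn_matching)
    fix x y z assume "(x, y) \<in> ?E \<union> ?E\<inverse>" "(y, z) \<in> ?E \<union> ?E\<inverse>"
    thus "x = z" using linked_unique[of w] linked_sym[of w] unfolding start_arcs_def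
      by (auto split: if_splits) blast+
  qed
  have s: "(x, y) \<in> ?E \<union> ?E\<inverse> \<longleftrightarrow> (\<exists>i j. x = Some (Bottom i) \<and> y = Some (Bottom j) \<and> linked w i j)
      \<or> l \<and> (x = None \<and> y = Some (Lower 0) \<or> x = Some (Lower 0) \<and> y = None)" for x y
    using linked_sym[of w] unfolding start_arcs_def by auto
  have F: "lower_front 0 m = (if m \<le> 1 then None else if m = 2 then Some (Lower 0) else Some (Bottom (m - 2)))" for m
    by (simp add: lower_front_def)
  show ?thesis unfolding reads_def
  proof (intro conjI ballI impI)
    show "Field ?E \<subseteq> lower_vertices L 0"
    proof -
      have lr: "Some (Bottom i) \<in> lower_vertices L 0" "Some (Bottom j) \<in> lower_vertices L 0" if "linked w i j" for i j
        using linked_range[OF that] assms by (simp_all add: lower_vertices_def)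
      have "None \<in> lower_vertices L 0" "Some (Lower 0) \<in> lower_vertices L 0" by (simp_all add: lower_vertices_def)
      thus ?thesis using lr unfolding start_arcs_def Field_def by (auto split: if_splits)
    qed
    show "start_left l w \<subseteq> lower_vertices L 0"
      using assms unfolding start_left_def lower_vertices_def by (auto split: if_splits)
    show "lower_front 0 ` {1..L + 2} \<subseteq> lower_vertices L 0"
    proof -
      have "lower_front 0 m \<in> lower_vertices L 0" if "m \<in> {1..L + 2}" for m
      proof -
        have "m \<le> 1 \<or> m = 2 \<or> m - 2 \<in> {1..L}" using that by auto
        moreover have "Some (Bottom b) \<in> lower_vertices L 0" if "b \<in> {1..L}" for b
          using that unfolding lower_vertices_def by blast
        moreover have "None \<in> lower_vertices L 0" "Some (Lower 0) \<in> lower_vertices L 0" by (simp_all add: lower_vertices_def)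
        ultimately show ?thesis unfolding F by (simp del: atLeastAtMost_iff split: if_split) blast
      qed
      thus ?thesis by blast
    qed
    show "inj_on (lower_front 0) {1..L + 2}"
      unfolding inj_on_def F by auto
    fix i assume i: "i \<in> {1..L + 2}"
    have lp: "link_of ?v i = prefixed l (link_of w) i" using link_of_prefixed[OF assms i] .
    have S: "prefixed l (link_of w) i = Site j \<longleftrightarrow>
        (if i \<le> 2 then l \<and> j = 3 - i else 2 \<le> j \<and> linked w (i - 2) (j - 2))" for j
      by (auto simp: prefixed_def link_of_Site[symmetric] split: link.splits)
    show "conn ?E (lower_front 0 i) (lower_front 0 j) = (link_of ?v i = Site j)" if j: "j \<in> {1..L + 2}" "i \<noteq> j" for j
    proof -
      have l0: "\<not> linked w a 0" for a using linked_range[of w a 0] by auto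
      consider "i = 1" | "i = 2" | "i \<ge> 3" using i by fastforce
      thus ?thesis using i j l0 unfolding c s lp S F by cases (auto split: if_splits)
    qed
    show "(\<exists>x\<in>start_left l w. conn ?E (lower_front 0 i) x) = (link_of ?v i = LeftBdry)"
    proof (cases "i \<le> 2")
      case True
      hence "lower_front 0 i = None \<or> lower_front 0 i = Some (Lower 0)" by (auto simp: F)
      thus ?thesis using True unfolding c s lp by (auto simp: prefixed_def start_left_def)
    next
      case False
      hence f: "lower_front 0 i = Some (Bottom (i - 2))" by (simp add: F)
      have nb: "\<not> (linked w (i - 2) j \<and> link_of w j = LeftBdry)" for j
      proof
        assume a: "linked w (i - 2) j \<and> link_of w j = LeftBdry"
        hence "link_of w j = Site (i - 2)" using linked_sym link_of_Site by blast
        thus False using a by simp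
      qed
      have "i - 2 \<in> {1..length w}" using i False assms by auto
      thus ?thesis using False nb unfolding f c s lp by (auto simp: prefixed_def start_left_def split: link.splits)
    qed
  qed (use assms in simp)
qed

lemma readsD:
  assumes "reads W E M N fs w" "i \<in> {1..N}"
  shows "j \<in> {1..N} \<Longrightarrow> i \<noteq> j \<Longrightarrow> conn E (fs i) (fs j) = (link_of w i = Site j)"
    and "(\<exists>x\<in>M. conn E (fs i) x) = (link_of w i = LeftBdry)"
  using assms unfolding reads_def by blast+

text \<open>The diagram is drawn in the order start, lower row, right end, upper row. The arc from
  \<open>None\<close> to \<open>Upper 0\<close>, added last, closes the auxiliary strand, and
  \<open>contract\<close> reads off the result.\<close>

theorem out_pattern_factor:
  assumes w: "length w = L" and L: "1 \<le> L"
  shows "out_pattern L (A, B, l, r) w =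
    contract L (upper_row (L + 2) B L
      ((if r then id else tgen (L + 2) (L + 2)) (lower_row (L + 2) A L ((if l then Opn else Cls) # Cls # w))))"
proof -
  let ?N = "L + 2" and ?M = "start_left l w"
  define low where "low = (\<Union>i\<in>{1..L}. lower_arcs A i)"
  define upp where "upp = (\<Union>i\<in>{1..L}. upper_arcs B i)"
  define right where "right = (if r then {(Lower L, Upper L)} else {})"
  define v where "v = upper_row ?N B L ((if r then id else tgen ?N ?N) (lower_row ?N A L ((if l then Opn else Cls) # Cls # w)))"
  have front: "(lower_front L)(?N := Some (Upper L)) = (\<lambda>m. if m \<le> ?N then upper_front L m else lower_front L m)"
    by (auto simp: lower_front_def upper_front_def fun_eq_iff)
  have cong: "reads W E M N f u \<longleftrightarrow> reads W E M N g u" if "\<And>m. m \<le> N \<Longrightarrow> f m = g m" for W :: "point option set" and E M N f g u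
  proof -
    have "f ` {1..N} = g ` {1..N}" "inj_on f {1..N} = inj_on g {1..N}" using that by (auto intro!: image_cong inj_on_cong)
    thus ?thesis using that unfolding reads_def by auto
  qed
  have shift: "reads W E M ?N (upper_front L) u"
    if "reads W E M ?N ((lower_front L)(?N := Some (Upper L))) u" for W E M u
    using that cong[of ?N "(lower_front L)(?N := Some (Upper L))" "upper_front L" W E M u] unfolding front by simp
  have 1: "reads (lower_vertices L L) (start_arcs l w \<union> lift_arcs low) ?M ?N (lower_front L)
      (lower_row ?N A L ((if l then Opn else Cls) # Cls # w))"
    unfolding low_def by (rule reads_lower_row[OF reads_start[OF w] order_refl])
  have new: "Some (Upper L) \<notin> lower_vertices L L" by (auto simp: lower_vertices_def)
  have uv: "insert (Some (Upper L)) (lower_vertices L L) = upper_vertices L L" by (simp add: upper_vertices_def)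
  have 2: "reads (upper_vertices L L) (start_arcs l w \<union> lift_arcs (low \<union> right)) ?M ?N (upper_front L)
      ((if r then id else tgen ?N ?N) (lower_row ?N A L ((if l then Opn else Cls) # Cls # w)))"
  proof (cases r)
    case True
    have "lower_front L ?N = Some (Lower L)" by (simp add: lower_front_def)
    with reads_rename[OF 1 _ new, of ?N] have "reads (upper_vertices L L)
        (insert (Some (Lower L), Some (Upper L)) (start_arcs l w \<union> lift_arcs low)) ?M ?N
        ((lower_front L)(?N := Some (Upper L))) (lower_row ?N A L ((if l then Opn else Cls) # Cls # w))"
      unfolding uv by simp
    moreover have "start_arcs l w \<union> lift_arcs (low \<union> right) = insert (Some (Lower L), Some (Upper L)) (start_arcs l w \<union> lift_arcs low)"
      using True by (auto simp: right_def)
    ultimately show ?thesis using True by (simp only: shift if_True id_apply)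
  next
    case False
    have "reads (upper_vertices L L) (start_arcs l w \<union> lift_arcs low) ?M ?N (upper_front L)
        (tgen ?N ?N (lower_row ?N A L ((if l then Opn else Cls) # Cls # w)))"
      using reads_cut[OF 1 _ new] unfolding uv by (intro shift) simp
    moreover have "start_arcs l w \<union> lift_arcs (low \<union> right) = start_arcs l w \<union> lift_arcs low"
      using False by (auto simp: right_def)
    ultimately show ?thesis using False by (simp only: if_False)
  qed
  define G where "G = {(Bottom i, Bottom j) | i j. linked w i j} \<union> low \<union> right \<union> upp"
  define E where "E = start_arcs l w \<union> lift_arcs (low \<union> right) \<union> lift_arcs upp"
  have 3: "reads (upper_vertices L 0) E ?M ?N (upper_front 0) v"
    unfolding v_def E_def upp_def by (rule reads_upper_row[OF 2 order_refl])
  have E: "E = (if l then insert (None, Some (Lower 0)) (lift_arcs G) else lift_arcs G)"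
  proof -
    have "lift_arcs {(Bottom i, Bottom j) | i j. linked w i j} = {(Some (Bottom i), Some (Bottom j)) | i j. linked w i j}"
      by auto
    thus ?thesis unfolding E_def G_def start_arcs_def by (auto simp: image_Un)
  qed
  \<comment> \<open>The final \<open>reads_join\<close> asks for two fresh vertices; no column has
    index 0, so these occur nowhere else. The arc between them is the cup that
    \<open>contract\<close> removes.\<close>
  let ?p = "Some (Bottom 0)" and ?p' = "Some (Middle 0)"
  define E' where "E' = insert (None, Some (Upper 0)) E"
  have fr: "upper_front 0 1 = None" "upper_front 0 (1 + 1) = Some (Upper 0)"
    by (simp_all add: upper_front_def)
  have np: "?p \<notin> upper_vertices L 0" "?p' \<notin> upper_vertices L 0"
    by (auto simp: upper_vertices_def lower_vertices_def)
  have 4: "reads (insert ?p (insert ?p' (upper_vertices L 0))) (insert (None, Some (Upper 0)) (insert (?p, ?p') E)) ?M ?N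
      ((upper_front 0)(1 := ?p, 1 + 1 := ?p')) (tgen ?N 1 v)"
  proof -
    have "reads (insert ?p (insert ?p' (upper_vertices L 0)))
        (insert (upper_front 0 1, upper_front 0 (1 + 1)) (insert (?p, ?p') E)) ?M ?N
        ((upper_front 0)(1 := ?p, 1 + 1 := ?p')) (tgen ?N 1 v)"
      by (rule reads_join[OF 3]) (use np in simp_all)
    thus ?thesis unfolding fr .
  qed
  have lv: "length v = L + 2" using 3 by (simp add: reads_def)
  have pF: "?p \<notin> Field E'" "?p' \<notin> Field E'"
    using 3 np unfolding reads_def E'_def by (auto simp: Field_insert upper_vertices_def)
  have drop: "conn (insert (None, Some (Upper 0)) (insert (?p, ?p') E)) x y = conn E' x y"
    if "x \<noteq> ?p" "x \<noteq> ?p'" "y \<noteq> ?p" "y \<noteq> ?p'" for x y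
    unfolding insert_commute[of "(None, Some (Upper 0))"] E'_def[symmetric]
    using that by (simp add: conn_insert[of ?p ?p'] conn_fresh[OF pF(1)] conn_fresh[OF pF(2)])
  have N: "None \<notin> Field (lift_arcs G)" by (auto simp: Field_def)
  have some: "conn (lift_arcs G) (Some x) (Some y) = conn G x y" for x y by (rule conn_map_Some)
  have arcs: "arcs L (A, B, l, r) w = (if l then insert (Lower 0, Upper 0) G else G)"
    unfolding G_def low_def upp_def right_def by auto
  have conn: "conn E' (Some x) (Some y) = conn (arcs L (A, B, l, r) w) x y" for x y
  proof (cases l)
    case True
    show ?thesis unfolding E'_def E arcs using True
      by (auto simp: conn_insert conn_fresh[OF N] some)
  next
    case False
    show ?thesis unfolding E'_def E arcs using False
      by (auto simp: conn_insert conn_fresh[OF N] some)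
  qed
  \<comment> \<open>With an open left end both \<open>None\<close> and \<open>Upper 0\<close> lie on
    the left boundary, but only \<open>None\<close> is marked from the start; the last arc
    identifies the two.\<close>
  have left: "(\<exists>x\<in>?M. conn E' (Some t) x) = (\<exists>x\<in>left_ends L (A, B, l, r) w. conn (arcs L (A, B, l, r) w) t x)" for t
  proof -
    define H where "H = arcs L (A, B, l, r) w"
    define S where "S = {Bottom i | i. i \<in> {1..L} \<and> link_of w i = LeftBdry}"
    have le: "left_ends L (A, B, l, r) w = S \<union> (if l then {} else {Lower 0, Upper 0})"
      by (simp add: S_def)
    have sl: "?M = Some ` S \<union> (if l then {} else {None, Some (Lower 0)})"
      using w unfolding start_left_def S_def by blast
    have "conn E' (Some t) None = conn E' (Some t) (Some (Upper 0))" if "\<not> l"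
      unfolding E'_def E using that by (auto simp: conn_insert conn_fresh[OF N])
    thus ?thesis unfolding le sl using conn[folded H_def] unfolding H_def[symmetric] by (cases l) auto
  qed
  have top: "top_link L (A, B, l, r) w i = link_of (contract L v) i" if i: "i \<in> {1..L}" for i
  proof -
    let ?u = "contract L v"
    have lu: "length ?u = L" using lv unfolding contract_def by simp
    have fi: "((upper_front 0)(1 := ?p, 1 + 1 := ?p')) (i + 2) = Some (Top i)" if "i \<in> {1..L}" for i
      using that by (auto simp: upper_front_def)
    have lk: "link_of (tgen ?N 1 v) (i + 2) = prefixed True (link_of ?u) (i + 2)" if "i \<in> {1..L}" for i
      unfolding tgen_1_contract[OF lv] using link_of_prefixed[OF lu, of "i + 2" True] that by simp
    have S: "conn (arcs L (A, B, l, r) w) (Top i) (Top j) = (link_of ?u i = Site j)" if ij: "i \<in> {1..L}" "j \<in> {1..L}" "i \<noteq> j" for i j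
    proof -
      have "conn E' (Some (Top i)) (Some (Top j)) = (link_of (tgen ?N 1 v) (i + 2) = Site (j + 2))"
      proof -
        have "i + 2 \<in> {1..?N}" "j + 2 \<in> {1..?N}" "i + 2 \<noteq> j + 2" using ij by auto
        from readsD(1)[OF 4 this] show ?thesis
          unfolding fi[OF ij(1)] fi[OF ij(2)] by (subst (asm) drop) simp_all
      qed
      thus ?thesis unfolding conn lk[OF ij(1)] using ij by simp
    qed
    have Lf: "(\<exists>x\<in>left_ends L (A, B, l, r) w. conn (arcs L (A, B, l, r) w) (Top i) x) = (link_of ?u i = LeftBdry)"
    proof -
      have M: "x \<noteq> ?p" "x \<noteq> ?p'" if "x \<in> ?M" for x using that by (auto simp: start_left_def split: if_splits)
      have "(\<exists>x\<in>?M. conn E' (Some (Top i)) x) = (\<exists>x\<in>?M. conn (insert (None, Some (Upper 0)) (insert (?p, ?p') E)) (Some (Top i)) x)"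
        using drop[of "Some (Top i)"] M by simp
      also have "\<dots> = (link_of (tgen ?N 1 v) (i + 2) = LeftBdry)"
      proof -
        have "i + 2 \<in> {1..?N}" using i by auto
        from readsD(2)[OF 4 this] show ?thesis unfolding fi[OF i] .
      qed
      finally show ?thesis unfolding left lk[OF i] using i by simp
    qed
    have P: "((a, b) \<in> paths L (A, B, l, r) w) = conn (arcs L (A, B, l, r) w) a b" for a b
      by (simp add: paths_def conn_def)
    show ?thesis
    proof (cases "link_of ?u i")
      case (Site j)
      hence j: "j \<in> {1..L}" "j \<noteq> i" using link_of_Site linked_range lu by metis+
      have "(THE j. j \<in> {1..L} \<and> j \<noteq> i \<and> conn (arcs L (A, B, l, r) w) (Top i) (Top j)) = j"
        using j S[OF i] Site by (intro the_equality) auto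
      moreover have "\<exists>j\<in>{1..L}. j \<noteq> i \<and> conn (arcs L (A, B, l, r) w) (Top i) (Top j)" using j S[OF i] Site by auto
      ultimately show ?thesis unfolding top_link_def P using Site by simp
    next
      case LeftBdry
      hence "\<not> (\<exists>j\<in>{1..L}. j \<noteq> i \<and> conn (arcs L (A, B, l, r) w) (Top i) (Top j))" using S[OF i] by auto
      thus ?thesis unfolding top_link_def P Lf using LeftBdry by simp
    next
      case RightBdry
      hence "\<not> (\<exists>j\<in>{1..L}. j \<noteq> i \<and> conn (arcs L (A, B, l, r) w) (Top i) (Top j))" using S[OF i] by auto
      thus ?thesis unfolding top_link_def P Lf using RightBdry by simp
    qed
  qed
  have "length (contract L v) = L" using lv unfolding contract_def by simp
  hence "contract L v = pattern_of L (link_of (contract L v))" using pattern_of_link_of by metis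
  also have "\<dots> = out_pattern L (A, B, l, r) w" unfolding out_pattern_def by (rule pattern_of_cong[OF top[symmetric]])
  finally show ?thesis unfolding v_def by simp
qed

section \<open>Exchange relations of the transfer matrix\<close>

lemma q_cubic: "q\<^sup>2 + q + 1 = 0"
proof -
  have "q = cis (2 * pi / 3)" by (simp add: q_def cis_conv_exp mult.commute)
  also have "\<dots> = Complex (-1/2) (sqrt 3 / 2)"
    using cos_120 sin_120 by (simp add: complex_eq_iff cos_of_real)
  finally have q: "q = Complex (-1/2) (sqrt 3 / 2)" .
  show ?thesis unfolding q by (simp add: complex_eq_iff power2_eq_square)
qed

lemma q_nz [simp]: "q \<noteq> 0"
  by (simp add: q_def)

lemma inverse_q: "inverse q = q\<^sup>2"
proof -
  have "q * q\<^sup>2 = 1" using q_cubic by Groebner_Basis.algebra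
  thus ?thesis by (metis inverse_unique)
qed

lemma br_inverse: "br (inverse x) = - br x"
  by (simp add: br_def)

lemma br_minus: "br (- x) = - br x"
  by (simp add: br_def)

section \<open>The transposed transfer matrix as a product of R and K operators\<close>

definition Rd :: "nat \<Rightarrow> nat \<Rightarrow> complex \<Rightarrow> Defs.vec \<Rightarrow> Defs.vec" where
  "Rd N k x \<psi> = (\<lambda>v. (br (q / x) * \<psi> v - br x * \<psi> (tgen N k v)) / br (q * x))"

definition Kd :: "nat \<Rightarrow> nat \<Rightarrow> complex \<Rightarrow> complex \<Rightarrow> Defs.vec \<Rightarrow> Defs.vec" where
  "Kd N k x \<zeta> \<psi> = (\<lambda>v. (kfun x \<zeta> * \<psi> v + br (inverse q) * br (x\<^sup>2) * \<psi> (tgen N k v)) / kfun (1 / x) \<zeta>)"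

definition Td :: "nat \<Rightarrow> complex \<Rightarrow> (nat \<Rightarrow> complex) \<Rightarrow> complex \<Rightarrow> complex \<Rightarrow> Defs.vec \<Rightarrow> Defs.vec" where
  "Td L w z \<zeta>0 \<zeta>L \<phi> v = (\<Sum>C\<in>configs L. weight L w z \<zeta>0 \<zeta>L C * \<phi> (out_pattern L C v))"

text \<open>These operators are the transposes of \<^const>\<open>R_op\<close>, \<^const>\<open>K_op\<close> and \<^const>\<open>T_op\<close>: they act on
  functionals, which are given by their values on link patterns, and so need no summation over preimages.\<close>

fun lowers :: "nat \<Rightarrow> complex \<Rightarrow> (nat \<Rightarrow> complex) \<Rightarrow> nat \<Rightarrow> Defs.vec \<Rightarrow> Defs.vec" where
  "lowers N w z 0 \<psi> = \<psi>"
| "lowers N w z (Suc n) \<psi> = lowers N w z n (Rd N (n + 2) (w / z (Suc n)) \<psi>)"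

fun uppers :: "nat \<Rightarrow> complex \<Rightarrow> (nat \<Rightarrow> complex) \<Rightarrow> nat \<Rightarrow> Defs.vec \<Rightarrow> Defs.vec" where
  "uppers N w z 0 \<psi> = \<psi>"
| "uppers N w z (Suc n) \<psi> = Rd N (n + 2) (z (Suc n) * w) (uppers N w z n \<psi>)"

lemma sum_Pow_insert:
  assumes "finite S" "a \<notin> S"
  shows "(\<Sum>A\<in>Pow (insert a S). f A) = (\<Sum>A\<in>Pow S. f A + f (insert a A))"
proof -
  have "(\<Sum>A\<in>Pow (insert a S). f A) = (\<Sum>A\<in>Pow S. f A) + (\<Sum>A\<in>insert a ` Pow S. f A)"
    unfolding Pow_insert using assms by (intro sum.union_disjoint) auto
  also have "(\<Sum>A\<in>insert a ` Pow S. f A) = (\<Sum>A\<in>Pow S. f (insert a A))"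
    using assms by (intro sum.reindex_cong[of "insert a"]) (auto simp: inj_on_def)
  finally show ?thesis by (simp add: sum.distrib)
qed

lemma lower_row_cong: "A \<inter> {1..n} = B \<inter> {1..n} \<Longrightarrow> lower_row N A n v = lower_row N B n v"
proof (induction n)
  case (Suc n)
  have "A \<inter> {1..n} = A \<inter> {1..Suc n} \<inter> {1..n}" "B \<inter> {1..n} = B \<inter> {1..Suc n} \<inter> {1..n}" by auto
  hence "A \<inter> {1..n} = B \<inter> {1..n}" using Suc.prems by simp
  moreover have "Suc n \<in> A \<inter> {1..Suc n} \<longleftrightarrow> Suc n \<in> B \<inter> {1..Suc n}" using Suc.prems by simp
  hence "Suc n \<in> A \<longleftrightarrow> Suc n \<in> B" by simp
  ultimately show ?case using Suc.IH by simp
qed simp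

lemma upper_row_cong: "A \<inter> {1..n} = B \<inter> {1..n} \<Longrightarrow> upper_row N A n v = upper_row N B n v"
proof (induction n arbitrary: v)
  case (Suc n)
  have "A \<inter> {1..n} = A \<inter> {1..Suc n} \<inter> {1..n}" "B \<inter> {1..n} = B \<inter> {1..Suc n} \<inter> {1..n}" by auto
  hence "A \<inter> {1..n} = B \<inter> {1..n}" using Suc.prems by simp
  moreover have "Suc n \<in> A \<inter> {1..Suc n} \<longleftrightarrow> Suc n \<in> B \<inter> {1..Suc n}" using Suc.prems by simp
  hence "Suc n \<in> A \<longleftrightarrow> Suc n \<in> B" by simp
  ultimately show ?case using Suc.IH by simp
qed simp

lemma sum_lower_row:
  "(\<Sum>A\<in>Pow {1..n}. (\<Prod>i\<in>{1..n}. (if i \<in> A then br (q * z i / w) else br (z i / w)) / br (q * w / z i))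
      * \<psi> (lower_row N A n v)) = lowers N w z n \<psi> v"
proof (induction n arbitrary: \<psi>)
  case (Suc n)
  let ?W = "\<lambda>A i. (if i \<in> A then br (q * z i / w) else br (z i / w)) / br (q * w / z i)"
  have "(\<Sum>A\<in>Pow {1..Suc n}. (\<Prod>i\<in>{1..Suc n}. ?W A i) * \<psi> (lower_row N A (Suc n) v)) =
     (\<Sum>A\<in>Pow {1..n}. (\<Prod>i\<in>{1..Suc n}. ?W A i) * \<psi> (lower_row N A (Suc n) v)
        + (\<Prod>i\<in>{1..Suc n}. ?W (insert (Suc n) A) i) * \<psi> (lower_row N (insert (Suc n) A) (Suc n) v))"
  proof -
    have P: "Pow {1..Suc n} = Pow (insert (Suc n) {1..n})" by (simp add: atLeastAtMostSuc_conv)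
    show ?thesis unfolding P by (rule sum_Pow_insert) auto
  qed
  also have "\<dots> = (\<Sum>A\<in>Pow {1..n}. (\<Prod>i\<in>{1..n}. ?W A i) * Rd N (n + 2) (w / z (Suc n)) \<psi> (lower_row N A n v))"
  proof (rule sum.cong[OF refl])
    fix A assume A: "A \<in> Pow {1..n}"
    hence nA: "Suc n \<notin> A" by auto
    have 1: "lower_row N (insert (Suc n) A) n v = lower_row N A n v" by (rule lower_row_cong) auto
    define P where "P = (\<Prod>i\<in>{1..n}. ?W A i)"
    have "(\<Prod>i\<in>{1..n}. ?W (insert (Suc n) A) i) = P" unfolding P_def by (rule prod.cong) auto
    hence 2: "(\<Prod>i\<in>{1..Suc n}. ?W (insert (Suc n) A) i) = P * ?W (insert (Suc n) A) (Suc n)"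
      "(\<Prod>i\<in>{1..Suc n}. ?W A i) = P * ?W A (Suc n)"
      unfolding P_def prod.cl_ivl_Suc by simp_all
    have 3: "br (w / z (Suc n)) = - br (z (Suc n) / w)" using br_inverse[of "z (Suc n) / w"] by simp
    show "(\<Prod>i\<in>{1..Suc n}. ?W A i) * \<psi> (lower_row N A (Suc n) v)
        + (\<Prod>i\<in>{1..Suc n}. ?W (insert (Suc n) A) i) * \<psi> (lower_row N (insert (Suc n) A) (Suc n) v)
        = (\<Prod>i\<in>{1..n}. ?W A i) * Rd N (n + 2) (w / z (Suc n)) \<psi> (lower_row N A n v)"
      using nA unfolding 2 P_def[symmetric] Rd_def 3 by (simp add: 1 diff_divide_distrib add_divide_distrib distrib_left mult_ac)
  qed
  also have "\<dots> = lowers N w z (Suc n) \<psi> v" using Suc.IH by simp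
  finally show ?case .
qed simp

lemma sum_upper_row:
  "(\<Sum>B\<in>Pow {1..n}. (\<Prod>i\<in>{1..n}. (if i \<in> B then - br (z i * w) else br (q / (z i * w))) / br (q * z i * w))
      * \<psi> (upper_row N B n v)) = uppers N w z n \<psi> v"
proof (induction n arbitrary: v)
  case (Suc n)
  let ?W = "\<lambda>B i. (if i \<in> B then - br (z i * w) else br (q / (z i * w))) / br (q * z i * w)"
  have "(\<Sum>B\<in>Pow {1..Suc n}. (\<Prod>i\<in>{1..Suc n}. ?W B i) * \<psi> (upper_row N B (Suc n) v)) =
     (\<Sum>B\<in>Pow {1..n}. (\<Prod>i\<in>{1..Suc n}. ?W B i) * \<psi> (upper_row N B (Suc n) v)
        + (\<Prod>i\<in>{1..Suc n}. ?W (insert (Suc n) B) i) * \<psi> (upper_row N (insert (Suc n) B) (Suc n) v))"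
  proof -
    have P: "Pow {1..Suc n} = Pow (insert (Suc n) {1..n})" by (simp add: atLeastAtMostSuc_conv)
    show ?thesis unfolding P by (rule sum_Pow_insert) auto
  qed
  also have "\<dots> = (\<Sum>B\<in>Pow {1..n}. br (q / (z (Suc n) * w)) / br (q * z (Suc n) * w) * ((\<Prod>i\<in>{1..n}. ?W B i) * \<psi> (upper_row N B n v))
       + - br (z (Suc n) * w) / br (q * z (Suc n) * w) * ((\<Prod>i\<in>{1..n}. ?W B i) * \<psi> (upper_row N B n (tgen N (n + 2) v))))"
  proof (rule sum.cong[OF refl])
    fix B assume B: "B \<in> Pow {1..n}"
    hence nB: "Suc n \<notin> B" by auto
    have 1: "upper_row N (insert (Suc n) B) n u = upper_row N B n u" for u by (rule upper_row_cong) auto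
    define P where "P = (\<Prod>i\<in>{1..n}. ?W B i)"
    have "(\<Prod>i\<in>{1..n}. ?W (insert (Suc n) B) i) = P" unfolding P_def by (rule prod.cong) auto
    hence 2: "(\<Prod>i\<in>{1..Suc n}. ?W (insert (Suc n) B) i) = P * ?W (insert (Suc n) B) (Suc n)"
      "(\<Prod>i\<in>{1..Suc n}. ?W B i) = P * ?W B (Suc n)"
      unfolding P_def prod.cl_ivl_Suc by simp_all
    show "(\<Prod>i\<in>{1..Suc n}. ?W B i) * \<psi> (upper_row N B (Suc n) v)
        + (\<Prod>i\<in>{1..Suc n}. ?W (insert (Suc n) B) i) * \<psi> (upper_row N (insert (Suc n) B) (Suc n) v)
        = br (q / (z (Suc n) * w)) / br (q * z (Suc n) * w) * ((\<Prod>i\<in>{1..n}. ?W B i) * \<psi> (upper_row N B n v))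
       + - br (z (Suc n) * w) / br (q * z (Suc n) * w) * ((\<Prod>i\<in>{1..n}. ?W B i) * \<psi> (upper_row N B n (tgen N (n + 2) v)))"
      using nB unfolding 2 P_def[symmetric] by (simp add: 1 mult_ac)
  qed
  also have "\<dots> = uppers N w z (Suc n) \<psi> v"
    unfolding sum.distrib sum_distrib_left[symmetric] Suc.IH by (simp add: Rd_def diff_divide_distrib mult.assoc)
  finally show ?case .
qed simp

text \<open>Every tile contributes a choice between two terms, so the sum over configurations
  factors into the operators \<open>Rd\<close> and \<open>Kd\<close>; the left end is the K operator
  at \<open>q / w\<close>. Since the operators are transposed, the tile drawn first stands
  outermost.\<close>

theorem Td_factor:
  assumes v: "length v = L" and L: "1 \<le> L"
  shows "Td L w z \<zeta>0 \<zeta>L \<phi> v =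
    Kd (L + 2) 0 (q / w) \<zeta>0 (lowers (L + 2) w z L (Kd (L + 2) (L + 2) w \<zeta>L
      (uppers (L + 2) w z L (\<phi> \<circ> contract L)))) (Opn # Cls # v)"
proof -
  let ?N = "L + 2"
  define WA where "WA A = (\<Prod>i\<in>{1..L}. (if i \<in> A then br (q * z i / w) else br (z i / w)) / br (q * w / z i))" for A
  define WB where "WB B = (\<Prod>i\<in>{1..L}. (if i \<in> B then - br (z i * w) else br (q / (z i * w))) / br (q * z i * w))" for B
  define Wl where "Wl l = (if l then kfun (q / w) \<zeta>0 else br (inverse q) * br (q\<^sup>2 / w\<^sup>2)) / kfun (w / q) \<zeta>0" for l
  define Wr where "Wr r = (if r then kfun w \<zeta>L else br (inverse q) * br (w\<^sup>2)) / kfun (1 / w) \<zeta>L" for r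
  define U where "U = uppers ?N w z L (\<phi> \<circ> contract L)"
  define D where "D = lowers ?N w z L (Kd ?N ?N w \<zeta>L U)"
  let ?s = "\<lambda>l. (if l then Opn else Cls) # Cls # v"
  have "Td L w z \<zeta>0 \<zeta>L \<phi> v = (\<Sum>(A, B, l, r)\<in>configs L. WA A * WB B * Wl l * Wr r *
      \<phi> (contract L (upper_row ?N B L ((if r then id else tgen ?N ?N) (lower_row ?N A L (?s l))))))"
    unfolding Td_def by (rule sum.cong) (auto simp: out_pattern_factor[OF v L] WA_def WB_def Wl_def Wr_def)
  also have "\<dots> = (\<Sum>A\<in>Pow {1..L}. \<Sum>B\<in>Pow {1..L}. \<Sum>l\<in>UNIV. \<Sum>r\<in>UNIV. WA A * WB B * Wl l * Wr r *
      \<phi> (contract L (upper_row ?N B L ((if r then id else tgen ?N ?N) (lower_row ?N A L (?s l))))))"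
    unfolding configs_def sum.cartesian_product by (simp add: case_prod_unfold)
  also have "\<dots> = (\<Sum>A\<in>Pow {1..L}. \<Sum>l\<in>UNIV. \<Sum>r\<in>UNIV. \<Sum>B\<in>Pow {1..L}. WA A * WB B * Wl l * Wr r *
      \<phi> (contract L (upper_row ?N B L ((if r then id else tgen ?N ?N) (lower_row ?N A L (?s l))))))"
    by (rule sum.cong[OF refl], subst sum.swap, rule sum.cong[OF refl], subst sum.swap) (rule refl)
  also have "\<dots> = (\<Sum>A\<in>Pow {1..L}. \<Sum>l\<in>UNIV. \<Sum>r\<in>UNIV. WA A * Wl l * Wr r *
      U ((if r then id else tgen ?N ?N) (lower_row ?N A L (?s l))))"
  proof (intro sum.cong refl)
    fix A :: "nat set" and l r :: bool
    let ?u = "(if r then id else tgen ?N ?N) (lower_row ?N A L (?s l))"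
    have "(\<Sum>B\<in>Pow {1..L}. WA A * WB B * Wl l * Wr r * \<phi> (contract L (upper_row ?N B L ?u)))
      = WA A * Wl l * Wr r * (\<Sum>B\<in>Pow {1..L}. WB B * (\<phi> \<circ> contract L) (upper_row ?N B L ?u))"
      by (simp add: sum_distrib_left mult_ac)
    thus "(\<Sum>B\<in>Pow {1..L}. WA A * WB B * Wl l * Wr r * \<phi> (contract L (upper_row ?N B L ?u)))
      = WA A * Wl l * Wr r * U ?u" unfolding U_def sum_upper_row[symmetric] WB_def .
  qed
  also have "\<dots> = (\<Sum>A\<in>Pow {1..L}. \<Sum>l\<in>UNIV. Wl l * (WA A * Kd ?N ?N w \<zeta>L U (lower_row ?N A L (?s l))))"
  proof (intro sum.cong refl)
    fix A :: "nat set" and l :: bool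
    let ?u = "lower_row ?N A L (?s l)"
    have "Kd ?N ?N w \<zeta>L U ?u = Wr True * U ?u + Wr False * U (tgen ?N ?N ?u)"
      by (simp add: Kd_def Wr_def add_divide_distrib)
    thus "(\<Sum>r\<in>UNIV. WA A * Wl l * Wr r * U ((if r then id else tgen ?N ?N) ?u)) = Wl l * (WA A * Kd ?N ?N w \<zeta>L U ?u)"
      by (simp add: UNIV_bool algebra_simps)
  qed
  also have "\<dots> = (\<Sum>l\<in>UNIV. Wl l * D (?s l))"
    unfolding D_def sum_lower_row[symmetric] WA_def by (subst sum.swap) (simp add: sum_distrib_left)
  also have "\<dots> = Kd ?N 0 (q / w) \<zeta>0 D (Opn # Cls # v)"
    using tgen_0_prefix[OF v] by (simp add: UNIV_bool Wl_def Kd_def add_divide_distrib power_divide)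
  finally show ?thesis unfolding D_def U_def .
qed

text \<open>Comparing coefficients in the Yang--Baxter equation, only those at the words obtained
  from \<open>v\<close> by a single generator are not equal at sight, and both amount to this
  identity. It rests on \<open>q\<^sup>2 + q + 1 = 0\<close>, which expresses loop weight 1.\<close>

lemma yang_baxter_scalar:
  assumes "x \<noteq> 0" "y \<noteq> 0"
  shows "br (q / x) * br (x * y) * br (q / y) =
    br x * br (q / (x * y)) * br (q / y) + br (q / x) * br (q / (x * y)) * br y
    - br x * br (q / (x * y)) * br y + br x * br (x * y) * br y"
proof -
  obtain X Y where XY: "x * X = 1" "y * Y = 1" using assms by (metis right_inverse)
  have i: "inverse x = X" "inverse y = Y" "inverse X = x" "inverse Y = y"
    using XY by (simp_all add: inverse_unique mult.commute)
  have "br (q / x) = q * X - q\<^sup>2 * x" "br (q / y) = q * Y - q\<^sup>2 * y"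
    "br (q / (x * y)) = q * X * Y - q\<^sup>2 * x * y" "br (x * y) = x * y - X * Y" "br x = x - X" "br y = y - Y"
    by (simp_all add: br_def divide_inverse i inverse_q)
  thus ?thesis using XY q_cubic by Groebner_Basis.algebra
qed

lemma yang_baxter:
  assumes "x \<noteq> 0" "y \<noteq> 0" "1 \<le> j" "j + 1 < N"
  shows "Rd N j x (Rd N (j + 1) (x * y) (Rd N j y \<psi>)) = Rd N (j + 1) y (Rd N j (x * y) (Rd N (j + 1) x \<psi>))"
proof
  fix v
  let ?e = "tgen N j" and ?f = "tgen N (j + 1)"
  have r: "?e (?e u) = ?e u" "?f (?f u) = ?f u" "?e (?f (?e u)) = ?e u" "?f (?e (?f u)) = ?f u" for u
    using assms by (simp_all add: tgen_idem tgen_absorb)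
  define d where "d = br (q * x) * br (q * y) * br (q * (x * y))"
  define A where "A = br (q / (x * y))" define B where "B = br (x * y)"
  define a where "a = br (q / x)" define b where "b = br x"
  define a' where "a' = br (q / y)" define b' where "b' = br y"
  define p0 where "p0 = \<psi> v" define p1 where "p1 = \<psi> (?e v)" define p2 where "p2 = \<psi> (?f v)"
  define p3 where "p3 = \<psi> (?f (?e v))" define p4 where "p4 = \<psi> (?e (?f v))"
  have 1: "Rd N j x (Rd N (j + 1) (x * y) (Rd N j y \<psi>)) v =
     (a * (A * (a' * p0 - b' * p1) - B * (a' * p2 - b' * p4)) - b * (A * (a' * p1 - b' * p1) - B * (a' * p3 - b' * p1))) / d"
    unfolding Rd_def r d_def A_def B_def a_def b_def a'_def b'_def p0_def p1_def p2_def p3_def p4_def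
    by (simp add: diff_divide_distrib[symmetric] times_divide_eq_right mult_ac)
  have 2: "Rd N (j + 1) y (Rd N j (x * y) (Rd N (j + 1) x \<psi>)) v =
     (a' * (A * (a * p0 - b * p2) - B * (a * p1 - b * p3)) - b' * (A * (a * p2 - b * p2) - B * (a * p4 - b * p2))) / d"
    unfolding Rd_def r d_def A_def B_def a_def b_def a'_def b'_def p0_def p1_def p2_def p3_def p4_def
    by (simp add: diff_divide_distrib[symmetric] times_divide_eq_right mult_ac)
  have s: "a * B * a' = b * A * a' + a * A * b' - b * A * b' + b * B * b'"
    using yang_baxter_scalar[OF assms(1,2)] unfolding a_def b_def a'_def b'_def A_def B_def .
  show "Rd N j x (Rd N (j + 1) (x * y) (Rd N j y \<psi>)) v = Rd N (j + 1) y (Rd N j (x * y) (Rd N (j + 1) x \<psi>)) v"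
    unfolding 1 2 using s by (intro arg_cong[of _ _ "\<lambda>n. n / d"]) Groebner_Basis.algebra
qed

text \<open>The parameter \<open>\<zeta>\<close> enters only through
  \<open>\<zeta>\<^sup>2 + (inverse \<zeta>)\<^sup>2\<close>, so the scalar identities below treat
  this quantity as one free constant \<open>c\<close>.\<close>

lemma kfun_expand:
  assumes "x \<noteq> 0" "\<zeta> \<noteq> 0"
  shows "kfun x \<zeta> = q * x\<^sup>2 + q\<^sup>2 * (inverse x)\<^sup>2 - (\<zeta>\<^sup>2 + (inverse \<zeta>)\<^sup>2)"
proof -
  obtain X Z where XZ: "x * X = 1" "\<zeta> * Z = 1" using assms by (metis right_inverse)
  have i: "inverse x = X" "inverse \<zeta> = Z" "inverse X = x" "inverse Z = \<zeta>"
    using XZ by (simp_all add: inverse_unique mult.commute)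
  have "kfun x \<zeta> = (q\<^sup>2 * x * Z - q * \<zeta> * X) * (q\<^sup>2 * x * \<zeta> - q * X * Z)"
    by (simp add: kfun_def br_def divide_inverse i inverse_q[symmetric] mult_ac)
  thus ?thesis unfolding i using XZ q_cubic by Groebner_Basis.algebra
qed

lemma kfun_inverse_zeta: "kfun x (inverse \<zeta>) = kfun x \<zeta>"
  by (simp add: kfun_def divide_inverse mult_ac)

text \<open>In \<open>reflection\<close> all coefficients agree at once except those at the two
  words obtained by applying the bulk and the boundary generator once each, in either order; both
  lead to this identity.\<close>

lemma reflection_scalar:
  assumes "x \<noteq> 0" "y \<noteq> 0" "\<zeta> \<noteq> 0"
  defines "A \<equiv> br (q / (x * y))" and "B \<equiv> br (x * y)" and "C \<equiv> br (q / (y / x))" and "D \<equiv> br (y / x)"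
    and "l \<equiv> \<lambda>x. br (inverse q) * br (x\<^sup>2)"
  shows "l x * (kfun y \<zeta> * (B * D - B * C - A * D) + l y * B * D) = kfun x \<zeta> * l y * (A * D - B * C) + l x * l y * A * D"
proof -
  obtain X Y where XY: "x * X = 1" "y * Y = 1" using assms by (metis right_inverse)
  have i: "inverse x = X" "inverse y = Y" "inverse X = x" "inverse Y = y"
    using XY by (simp_all add: inverse_unique mult.commute)
  define c where "c = \<zeta>\<^sup>2 + (inverse \<zeta>)\<^sup>2"
  have e: "A = q * X * Y - q\<^sup>2 * x * y" "B = x * y - X * Y" "C = q * x * Y - q\<^sup>2 * X * y" "D = y * X - x * Y"
    "l x = (q\<^sup>2 - q) * (x\<^sup>2 - X\<^sup>2)" "l y = (q\<^sup>2 - q) * (y\<^sup>2 - Y\<^sup>2)"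
    unfolding A_def B_def C_def D_def l_def
    by (simp_all add: br_def divide_inverse i inverse_q[symmetric] power_inverse[symmetric] mult_ac)
  have k: "kfun x \<zeta> = q * x\<^sup>2 + q\<^sup>2 * X\<^sup>2 - c" "kfun y \<zeta> = q * y\<^sup>2 + q\<^sup>2 * Y\<^sup>2 - c"
    using kfun_expand assms(1-3) i c_def by simp_all
  show ?thesis unfolding e k using XY q_cubic by Groebner_Basis.algebra
qed

section \<open>Exchange of neighbouring parameters\<close>

definition lin :: "complex \<Rightarrow> complex \<Rightarrow> (bracket list \<Rightarrow> bracket list) \<Rightarrow> Defs.vec \<Rightarrow> Defs.vec" where
  "lin a b t \<psi> = (\<lambda>v. a * \<psi> v + b * \<psi> (t v))"

lemma Rd_lin: "Rd N k x = lin (br (q / x) / br (q * x)) (- br x / br (q * x)) (tgen N k)"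
  by (simp add: Rd_def lin_def fun_eq_iff diff_divide_distrib)

lemma Kd_lin: "Kd N k x \<zeta> = lin (kfun x \<zeta> / kfun (1 / x) \<zeta>) (br (inverse q) * br (x\<^sup>2) / kfun (1 / x) \<zeta>) (tgen N k)"
  by (simp add: Kd_def lin_def fun_eq_iff add_divide_distrib)

lemma lin_commute:
  assumes "\<And>u. s (t u) = t (s u)"
  shows "lin a b s (lin c d t \<psi>) = lin c d t (lin a b s \<psi>)"
  by (simp add: lin_def fun_eq_iff assms algebra_simps)

lemma lin_comp:
  assumes "\<And>u. J (s' u) = s (J u)"
  shows "lin a b s \<psi> \<circ> J = lin a b s' (\<psi> \<circ> J)"
  by (simp add: lin_def fun_eq_iff assms)

lemma lin_tgen_commute:
  assumes "j + 2 \<le> k" "k \<le> N"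
  shows "lin a b (tgen N j) (lin c d (tgen N k) \<psi>) = lin c d (tgen N k) (lin a b (tgen N j) \<psi>)"
  by (rule lin_commute) (rule tgen_commute[OF assms])

lemma uppers_cong: "(\<And>i. 1 \<le> i \<Longrightarrow> i \<le> n \<Longrightarrow> z i = z' i) \<Longrightarrow> uppers N w z n \<psi> = uppers N w z' n \<psi>"
  by (induction n) auto

lemma lowers_cong: "(\<And>i. 1 \<le> i \<Longrightarrow> i \<le> n \<Longrightarrow> z i = z' i) \<Longrightarrow> lowers N w z n \<psi> = lowers N w z' n \<psi>"
  by (induction n arbitrary: \<psi>) auto

lemma uppers_lin:
  assumes "n + 3 \<le> k" "k \<le> N"
  shows "uppers N w z n (lin a b (tgen N k) \<psi>) = lin a b (tgen N k) (uppers N w z n \<psi>)"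
  using assms(1)
proof (induction n)
  case (Suc n)
  then show ?case using assms(2) by (simp add: Rd_lin lin_tgen_commute[of "n + 2" k N, simplified])
qed simp

lemma lowers_lin:
  assumes "n + 3 \<le> k" "k \<le> N"
  shows "lowers N w z n (lin a b (tgen N k) \<psi>) = lin a b (tgen N k) (lowers N w z n \<psi>)"
  using assms(1)
proof (induction n arbitrary: \<psi>)
  case (Suc n)
  then show ?case using assms(2) by (simp add: Rd_lin lin_tgen_commute[of "n + 2" k N, simplified])
qed simp

text \<open>The operator is carried through the row by the Yang--Baxter equation at the columns
  \<open>m + 1\<close> and \<open>m + 2\<close> and commutes with the others. In passing it shifts
  by one site, from \<open>m + 3\<close> to \<open>m + 2\<close>; the lower row shifts it
  back.\<close>

lemma uppers_swap:
  assumes "w \<noteq> 0" "z (Suc m) \<noteq> 0" "z (Suc (Suc m)) \<noteq> 0" "Suc (Suc m) \<le> n" "n + 2 \<le> N"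
  defines "x \<equiv> z (Suc m) / z (Suc (Suc m))"
    and "z' \<equiv> z(Suc m := z (Suc (Suc m)), Suc (Suc m) := z (Suc m))"
  shows "uppers N w z n (Rd N (m + 3) x \<psi>) = Rd N (m + 2) x (uppers N w z' n \<psi>)"
  using assms(4,5)
proof (induction n rule: dec_induct)
  case base
  have c: "uppers N w z m \<psi> = uppers N w z' m \<psi>" by (rule uppers_cong) (simp add: z'_def)
  have xy: "x * (z (Suc (Suc m)) * w) = z (Suc m) * w" using assms by (simp add: x_def)
  have "uppers N w z (Suc (Suc m)) (Rd N (m + 3) x \<psi>) =
      Rd N (m + 2 + 1) (z (Suc (Suc m)) * w) (Rd N (m + 2) (x * (z (Suc (Suc m)) * w)) (Rd N (m + 2 + 1) x (uppers N w z m \<psi>)))"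
    unfolding xy using base uppers_lin[of m "m + 3" N] by (simp add: Rd_lin eval_nat_numeral)
  also have "\<dots> = Rd N (m + 2) x (Rd N (m + 2 + 1) (x * (z (Suc (Suc m)) * w)) (Rd N (m + 2) (z (Suc (Suc m)) * w) (uppers N w z m \<psi>)))"
    by (rule yang_baxter[symmetric]) (use assms base in \<open>auto simp: x_def\<close>)
  also have "\<dots> = Rd N (m + 2) x (uppers N w z' (Suc (Suc m)) \<psi>)"
    unfolding xy c by (simp add: z'_def)
  finally show ?case .
next
  case (step n)
  have "uppers N w z (Suc n) (Rd N (m + 3) x \<psi>) = Rd N (n + 2) (z (Suc n) * w) (Rd N (m + 2) x (uppers N w z' n \<psi>))"
    using step by simp
  also have "\<dots> = Rd N (m + 2) x (Rd N (n + 2) (z (Suc n) * w) (uppers N w z' n \<psi>))"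
    unfolding Rd_lin by (rule lin_tgen_commute[symmetric]) (use step in auto)
  also have "\<dots> = Rd N (m + 2) x (uppers N w z' (Suc n) \<psi>)" using step(1) by (simp add: z'_def)
  finally show ?case .
qed

lemma lowers_swap:
  assumes "w \<noteq> 0" "z (Suc m) \<noteq> 0" "z (Suc (Suc m)) \<noteq> 0" "Suc (Suc m) \<le> n" "n + 2 \<le> N"
  defines "x \<equiv> z (Suc m) / z (Suc (Suc m))"
    and "z' \<equiv> z(Suc m := z (Suc (Suc m)), Suc (Suc m) := z (Suc m))"
  shows "lowers N w z n (Rd N (m + 2) x \<psi>) = Rd N (m + 3) x (lowers N w z' n \<psi>)"
  using assms(4,5)
proof (induction n arbitrary: \<psi> rule: dec_induct)
  case base
  have c: "lowers N w z m \<chi> = lowers N w z' m \<chi>" for \<chi> by (rule lowers_cong) (simp add: z'_def)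
  have xy: "w / z (Suc m) * x = w / z (Suc (Suc m))" using assms by (simp add: x_def)
  have "lowers N w z (Suc (Suc m)) (Rd N (m + 2) x \<psi>) =
      lowers N w z m (Rd N (m + 2) (w / z (Suc m)) (Rd N (m + 2 + 1) (w / z (Suc m) * x) (Rd N (m + 2) x \<psi>)))"
    unfolding xy by (simp add: eval_nat_numeral)
  also have "\<dots> = lowers N w z m (Rd N (m + 2 + 1) x (Rd N (m + 2) (w / z (Suc m) * x) (Rd N (m + 2 + 1) (w / z (Suc m)) \<psi>)))"
    by (subst yang_baxter) (use assms base in \<open>auto simp: x_def\<close>)
  also have "\<dots> = Rd N (m + 3) x (lowers N w z m (Rd N (m + 2) (w / z (Suc m) * x) (Rd N (m + 2 + 1) (w / z (Suc m)) \<psi>)))"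
    using base lowers_lin[of m "m + 3" N] by (simp add: Rd_lin eval_nat_numeral)
  also have "\<dots> = Rd N (m + 3) x (lowers N w z' (Suc (Suc m)) \<psi>)"
    unfolding xy c by (simp add: z'_def eval_nat_numeral)
  finally show ?case .
next
  case (step n)
  have "lowers N w z (Suc n) (Rd N (m + 2) x \<psi>) = lowers N w z n (Rd N (n + 2) (w / z (Suc n)) (Rd N (m + 2) x \<psi>))"
    by simp
  also have "\<dots> = lowers N w z n (Rd N (m + 2) x (Rd N (n + 2) (w / z (Suc n)) \<psi>))"
    unfolding Rd_lin by (subst lin_tgen_commute) (use step in auto)
  also have "\<dots> = Rd N (m + 3) x (lowers N w z' n (Rd N (n + 2) (w / z (Suc n)) \<psi>))" using step by simp
  also have "\<dots> = Rd N (m + 3) x (lowers N w z' (Suc n) \<psi>)" using step(1) by (simp add: z'_def)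
  finally show ?case .
qed

text \<open>Through \<open>contract\<close> the operator at \<open>i\<close> becomes one at
  \<open>i + 2\<close>. The upper row moves it to \<open>i + 1\<close>, where it commutes with the
  right end, the lower row moves it back to \<open>i + 2\<close>, where it commutes with the left
  end, and the cup returns it to \<open>i\<close>.\<close>

theorem Td_swap:
  assumes v: "length v = L" and i: "1 \<le> i" "i < L" and nz: "w \<noteq> 0" "z i \<noteq> 0" "z (i + 1) \<noteq> 0"
  shows "Td L w z \<zeta>0 \<zeta>L (Rd L i (z i / z (i + 1)) \<phi>) v =
    Rd L i (z i / z (i + 1)) (Td L w (z(i := z (i + 1), i + 1 := z i)) \<zeta>0 \<zeta>L \<phi>) v"
proof -
  obtain m where m: "i = Suc m" using i by (cases i) auto
  let ?N = "L + 2" and ?x = "z i / z (i + 1)" and ?z = "z(i := z (i + 1), i + 1 := z i)"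
  have L: "1 \<le> L" using i by simp
  define U where "U = uppers ?N w ?z L (\<phi> \<circ> contract L)"
  define D where "D = lowers ?N w ?z L (Kd ?N ?N w \<zeta>L U)"
  have T: "Td L w ?z \<zeta>0 \<zeta>L \<phi> u = Kd ?N 0 (q / w) \<zeta>0 D (Opn # Cls # u)" if "length u = L" for u
    unfolding D_def U_def by (rule Td_factor[OF that L])
  have J: "Rd L i ?x \<phi> \<circ> contract L = Rd ?N (i + 2) ?x (\<phi> \<circ> contract L)"
    unfolding Rd_lin by (rule lin_comp) (rule contract_tgen; use i in simp)
  have "uppers ?N w z L (Rd L i ?x \<phi> \<circ> contract L) = Rd ?N (i + 1) ?x U"
    unfolding J U_def using uppers_swap[of w z m L ?N] nz i by (simp add: m eval_nat_numeral)
  moreover have "Kd ?N ?N w \<zeta>L (Rd ?N (i + 1) ?x U) = Rd ?N (i + 1) ?x (Kd ?N ?N w \<zeta>L U)"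
    unfolding Kd_lin Rd_lin by (rule lin_tgen_commute[symmetric]) (use i in auto)
  moreover have "lowers ?N w z L (Rd ?N (i + 1) ?x (Kd ?N ?N w \<zeta>L U)) = Rd ?N (i + 2) ?x D"
    unfolding D_def using lowers_swap[of w z m L ?N] nz i by (simp add: m eval_nat_numeral)
  moreover have "Kd ?N 0 (q / w) \<zeta>0 (Rd ?N (i + 2) ?x D) = Rd ?N (i + 2) ?x (Kd ?N 0 (q / w) \<zeta>0 D)"
    unfolding Kd_lin Rd_lin by (rule lin_tgen_commute) (use i in auto)
  ultimately have "Td L w z \<zeta>0 \<zeta>L (Rd L i ?x \<phi>) v = Rd ?N (i + 2) ?x (Kd ?N 0 (q / w) \<zeta>0 D) (Opn # Cls # v)"
    unfolding Td_factor[OF v L] by simp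
  also have "\<dots> = Rd L i ?x (Td L w ?z \<zeta>0 \<zeta>L \<phi>) v"
  proof -
    have "tgen ?N (i + 2) (Opn # Cls # v) = Opn # Cls # tgen L i v" by (rule tgen_prefix) (use i in auto)
    thus ?thesis using T[OF v] T[of "tgen L i v"] v i unfolding Rd_def by simp
  qed
  finally show ?thesis .
qed

section \<open>Exchange relations at the two ends\<close>

lemma reflection:
  assumes nz: "x \<noteq> 0" "y \<noteq> 0" "\<zeta> \<noteq> 0" and j: "1 \<le> j"
  defines "N \<equiv> j + 1"
  shows "Kd N N x \<zeta> (Rd N j (x * y) (Kd N N y \<zeta> (Rd N j (y / x) \<psi>))) =
     Rd N j (y / x) (Kd N N y \<zeta> (Rd N j (x * y) (Kd N N x \<zeta> \<psi>)))"
proof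
  fix v
  let ?e = "tgen N j" and ?b = "tgen N N"
  have r: "?e (?e u) = ?e u" "?b (?b u) = ?b u" "?e (?b (?e u)) = ?e u" for u
    using j by (simp_all add: tgen_idem tgen_absorb N_def)
  define A where "A = br (q / (x * y))" define B where "B = br (x * y)"
  define C where "C = br (q / (y / x))" define D where "D = br (y / x)"
  define k where "k = kfun x \<zeta>" define k' where "k' = kfun y \<zeta>"
  define l where "l = br (inverse q) * br (x\<^sup>2)" define l' where "l' = br (inverse q) * br (y\<^sup>2)"
  define d where "d = kfun (1 / x) \<zeta>" define d' where "d' = kfun (1 / y) \<zeta>"
  define r1 where "r1 = br (q * (x * y))" define r2 where "r2 = br (q * (y / x))"
  define p0 where "p0 = \<psi> v" define p1 where "p1 = \<psi> (?e v)" define p2 where "p2 = \<psi> (?b v)"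
  define p3 where "p3 = \<psi> (?e (?b v))" define p4 where "p4 = \<psi> (?b (?e v))" define p5 where "p5 = \<psi> (?b (?e (?b v)))"
  have s: "l * (k' * (B * D - B * C - A * D) + l' * B * D) = k * l' * (A * D - B * C) + l * l' * A * D"
    using reflection_scalar[OF nz] unfolding A_def B_def C_def D_def k_def k'_def l_def l'_def .
  have 1: "Kd N N x \<zeta> (Rd N j (x * y) (Kd N N y \<zeta> (Rd N j (y / x) \<psi>))) v =
     (k * (A * (k' * (C * p0 - D * p1) + l' * (C * p2 - D * p3)) - B * (k' * (C * p1 - D * p1) + l' * (C * p4 - D * p1)))
      + l * (A * (k' * (C * p2 - D * p3) + l' * (C * p2 - D * p3)) - B * (k' * (C * p3 - D * p3) + l' * (C * p5 - D * p3)))) / (d * r1 * d' * r2)"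
    unfolding Kd_def Rd_def r A_def B_def C_def D_def k_def k'_def l_def l'_def d_def d'_def r1_def r2_def
      p0_def p1_def p2_def p3_def p4_def p5_def
    by (simp add: diff_divide_distrib[symmetric] add_divide_distrib[symmetric] times_divide_eq_right mult_ac)
  have 2: "Rd N j (y / x) (Kd N N y \<zeta> (Rd N j (x * y) (Kd N N x \<zeta> \<psi>))) v =
     (C * (k' * (A * (k * p0 + l * p2) - B * (k * p1 + l * p4)) + l' * (A * (k * p2 + l * p2) - B * (k * p3 + l * p5)))
      - D * (k' * (A * (k * p1 + l * p4) - B * (k * p1 + l * p4)) + l' * (A * (k * p4 + l * p4) - B * (k * p1 + l * p4)))) / (d * r1 * d' * r2)"
    unfolding Kd_def Rd_def r A_def B_def C_def D_def k_def k'_def l_def l'_def d_def d'_def r1_def r2_def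
      p0_def p1_def p2_def p3_def p4_def p5_def
    by (simp add: diff_divide_distrib[symmetric] add_divide_distrib[symmetric] times_divide_eq_right mult_ac)
  show "Kd N N x \<zeta> (Rd N j (x * y) (Kd N N y \<zeta> (Rd N j (y / x) \<psi>))) v =
     Rd N j (y / x) (Kd N N y \<zeta> (Rd N j (x * y) (Kd N N x \<zeta> \<psi>))) v"
    unfolding 1 2 using s by (intro arg_cong[of _ _ "\<lambda>n. n / (d * r1 * d' * r2)"]) Groebner_Basis.algebra
qed

text \<open>An operator at the right edge commutes with all columns but the last. There it passes
  the two R operators and the right end by the reflection equation with \<open>x = z L\<close> and
  \<open>y = w\<close>; the exchange of the arguments \<open>z L * w\<close> and
  \<open>w / z L\<close> amounts to inverting \<open>z L\<close>.\<close>

theorem Td_right: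
  assumes v: "length v = L" and L: "1 \<le> L" and nz: "w \<noteq> 0" "z L \<noteq> 0" "\<zeta>L \<noteq> 0"
  shows "Td L w z \<zeta>0 \<zeta>L (Kd L L (z L) \<zeta>L \<phi>) v = Kd L L (z L) \<zeta>L (Td L w (z(L := 1 / z L)) \<zeta>0 \<zeta>L \<phi>) v"
proof -
  obtain m where m: "L = Suc m" using L by (cases L) auto
  let ?N = "L + 2" and ?x = "z L" and ?z = "z(L := 1 / z L)"
  have T: "Td L w ?z \<zeta>0 \<zeta>L \<phi> u = Kd ?N 0 (q / w) \<zeta>0 (lowers ?N w ?z L (Kd ?N ?N w \<zeta>L
      (uppers ?N w ?z L (\<phi> \<circ> contract L)))) (Opn # Cls # u)" if "length u = L" for u
    by (rule Td_factor[OF that L])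
  have J: "Kd L L ?x \<zeta>L \<phi> \<circ> contract L = Kd ?N ?N ?x \<zeta>L (\<phi> \<circ> contract L)"
    unfolding Kd_lin by (rule lin_comp) (rule contract_tgen; use L in simp)
  define U where "U = uppers ?N w z m (\<phi> \<circ> contract L)"
  have U': "uppers ?N w ?z m (\<phi> \<circ> contract L) = U" unfolding U_def by (rule uppers_cong) (simp add: m)
  have Dc: "lowers ?N w ?z m \<chi> = lowers ?N w z m \<chi>" for \<chi> by (rule lowers_cong) (simp add: m)
  have "uppers ?N w z L (Kd L L ?x \<zeta>L \<phi> \<circ> contract L) = Rd ?N (m + 2) (?x * w) (Kd ?N ?N ?x \<zeta>L U)"
    unfolding J U_def using uppers_lin[of m ?N ?N] by (simp add: m Kd_lin)
  hence "lowers ?N w z L (Kd ?N ?N w \<zeta>L (uppers ?N w z L (Kd L L ?x \<zeta>L \<phi> \<circ> contract L))) =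
     lowers ?N w z m (Rd ?N (m + 2) (w / ?x) (Kd ?N ?N w \<zeta>L (Rd ?N (m + 2) (?x * w) (Kd ?N ?N ?x \<zeta>L U))))"
    by (simp add: m)
  also have "\<dots> = lowers ?N w z m (Kd ?N ?N ?x \<zeta>L (Rd ?N (m + 2) (?x * w) (Kd ?N ?N w \<zeta>L (Rd ?N (m + 2) (w / ?x) U))))"
    using reflection[OF nz(2,1,3), of "m + 2" U] by (simp add: m)
  also have "\<dots> = Kd ?N ?N ?x \<zeta>L (lowers ?N w z m (Rd ?N (m + 2) (?x * w) (Kd ?N ?N w \<zeta>L (Rd ?N (m + 2) (w / ?x) U))))"
    unfolding Kd_lin by (rule lowers_lin) (simp_all add: m)
  also have "\<dots> = Kd ?N ?N ?x \<zeta>L (lowers ?N w ?z L (Kd ?N ?N w \<zeta>L (uppers ?N w ?z L (\<phi> \<circ> contract L))))"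
    using U' Dc by (simp add: m mult.commute)
  finally have E: "lowers ?N w z L (Kd ?N ?N w \<zeta>L (uppers ?N w z L (Kd L L ?x \<zeta>L \<phi> \<circ> contract L))) =
     Kd ?N ?N ?x \<zeta>L (lowers ?N w ?z L (Kd ?N ?N w \<zeta>L (uppers ?N w ?z L (\<phi> \<circ> contract L))))" .
  have C: "Kd ?N 0 (q / w) \<zeta>0 (Kd ?N ?N ?x \<zeta>L D) = Kd ?N ?N ?x \<zeta>L (Kd ?N 0 (q / w) \<zeta>0 D)" for D
    unfolding Kd_lin by (rule lin_tgen_commute) auto
  have "tgen ?N ?N (Opn # Cls # v) = Opn # Cls # tgen L L v" by (rule tgen_prefix) (use L in auto)
  thus ?thesis unfolding Td_factor[OF v L] E C
    using T[OF v] T[of "tgen L L v"] v L unfolding Kd_def[of ?N ?N] Kd_def[of L L] by simp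
qed

abbreviation cup :: "bracket list \<Rightarrow> bracket list" where
  "cup v \<equiv> Opn # Cls # v"

text \<open>Satisfied by what the columns from the second on and the right end contribute: these
  operators avoid the sites 1 and 2, so they commute with generator 0 and descend through cap and
  cup to an operator \<open>Y'\<close> on \<open>L\<close> sites.\<close>

definition lifts :: "nat \<Rightarrow> (Defs.vec \<Rightarrow> Defs.vec) \<Rightarrow> (Defs.vec \<Rightarrow> Defs.vec) \<Rightarrow> bool" where
  "lifts L Y Y' \<longleftrightarrow>
     (\<forall>a b \<psi> \<chi>. Y (\<lambda>v. a * \<psi> v + b * \<chi> v) = (\<lambda>v. a * Y \<psi> v + b * Y \<chi> v)) \<and>
     (\<forall>\<psi>. Y (\<psi> \<circ> tgen (L + 2) 0) = Y \<psi> \<circ> tgen (L + 2) 0) \<and>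
     (\<forall>\<phi>. Y (\<phi> \<circ> contract L) = Y' \<phi> \<circ> contract L) \<and>
     (\<forall>\<psi>. Y \<psi> \<circ> cup = Y' (\<psi> \<circ> cup))"

lemma lifts_id: "lifts L (\<lambda>\<psi>. \<psi>) (\<lambda>\<psi>. \<psi>)"
  by (simp add: lifts_def)

lemma lifts_comp: "lifts L Y Y' \<Longrightarrow> lifts L Z Z' \<Longrightarrow> lifts L (\<lambda>\<psi>. Y (Z \<psi>)) (\<lambda>\<psi>. Y' (Z' \<psi>))"
  by (simp add: lifts_def)

lemma lifts_lin:
  assumes "1 \<le> k" "k \<le> L"
  shows "lifts L (lin a b (tgen (L + 2) (k + 2))) (lin a b (tgen L k))"
proof -
  have 1: "tgen (L + 2) (k + 2) (tgen (L + 2) 0 u) = tgen (L + 2) 0 (tgen (L + 2) (k + 2) u)" for u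
    by (rule tgen_commute[symmetric]) (use assms in auto)
  have 2: "contract L (tgen (L + 2) (k + 2) u) = tgen L k (contract L u)" for u
    by (rule contract_tgen) (use assms in auto)
  have 3: "tgen (L + 2) (k + 2) (cup u) = cup (tgen L k u)" for u
    by (rule tgen_prefix) (use assms in auto)
  show ?thesis unfolding lifts_def lin_def comp_def 1 2 3 by (simp add: algebra_simps)
qed

text \<open>All dependence on \<open>z 1\<close> sits in one R operator. The order of the
  quantifiers lets the same \<open>Y\<close> serve a point and the one with \<open>z 1\<close>
  inverted.\<close>

lemma lowers_first:
  assumes "1 \<le> n" "n \<le> L"
  shows "\<exists>Y Y'. lifts L Y Y' \<and> (\<forall>z' \<psi>. (\<forall>i\<ge>2. z' i = z i) \<longrightarrow> lowers (L + 2) w z' n \<psi> = Rd (L + 2) 2 (w / z' 1) (Y \<psi>))"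
  using assms
proof (induction n rule: dec_induct)
  case base
  show ?case by (intro exI[of _ "\<lambda>\<psi>. \<psi>"] conjI lifts_id) (simp add: numeral_2_eq_2)
next
  case (step n)
  then obtain Y Y' where Y: "lifts L Y Y'"
    "\<And>z' \<psi>. (\<forall>i\<ge>2. z' i = z i) \<Longrightarrow> lowers (L + 2) w z' n \<psi> = Rd (L + 2) 2 (w / z' 1) (Y \<psi>)" by auto
  show ?case
  proof (intro exI conjI allI impI)
    show "lifts L (\<lambda>\<psi>. Y (Rd (L + 2) (n + 2) (w / z (Suc n)) \<psi>)) (\<lambda>\<psi>. Y' (Rd L n (w / z (Suc n)) \<psi>))"
      unfolding Rd_lin by (rule lifts_comp[OF Y(1) lifts_lin]) (use step in auto)
    fix z' \<psi> assume z: "\<forall>i\<ge>2. z' i = z i"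
    hence "z' (Suc n) = z (Suc n)" using step by simp
    thus "lowers (L + 2) w z' (Suc n) \<psi> = Rd (L + 2) 2 (w / z' 1) (Y (Rd (L + 2) (n + 2) (w / z (Suc n)) \<psi>))"
      using Y(2)[OF z] by simp
  qed
qed

lemma uppers_first:
  assumes "1 \<le> n" "n \<le> L"
  shows "\<exists>Y Y'. lifts L Y Y' \<and> (\<forall>z' \<psi>. (\<forall>i\<ge>2. z' i = z i) \<longrightarrow> uppers (L + 2) w z' n \<psi> = Y (Rd (L + 2) 2 (z' 1 * w) \<psi>))"
  using assms
proof (induction n rule: dec_induct)
  case base
  show ?case by (intro exI[of _ "\<lambda>\<psi>. \<psi>"] conjI lifts_id) (simp add: numeral_2_eq_2)
next
  case (step n)
  then obtain Y Y' where Y: "lifts L Y Y'"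
    "\<And>z' \<psi>. (\<forall>i\<ge>2. z' i = z i) \<Longrightarrow> uppers (L + 2) w z' n \<psi> = Y (Rd (L + 2) 2 (z' 1 * w) \<psi>)" by auto
  show ?case
  proof (intro exI conjI allI impI)
    show "lifts L (\<lambda>\<psi>. Rd (L + 2) (n + 2) (z (Suc n) * w) (Y \<psi>)) (\<lambda>\<psi>. Rd L n (z (Suc n) * w) (Y' \<psi>))"
      unfolding Rd_lin by (rule lifts_comp[OF lifts_lin Y(1)]) (use step in auto)
    fix z' \<psi> assume z: "\<forall>i\<ge>2. z' i = z i"
    hence "z' (Suc n) = z (Suc n)" using step by simp
    thus "uppers (L + 2) w z' (Suc n) \<psi> = Rd (L + 2) (n + 2) (z (Suc n) * w) (Y (Rd (L + 2) 2 (z' 1 * w) \<psi>))"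
      using Y(2)[OF z] by simp
  qed
qed

text \<open>The dependence of \<^const>\<open>Td\<close> on \<open>z\<^sub>1\<close>. Here \<open>F\<close> is the diagram without its first column and
  \<open>H\<close> closes the first line up to the boundary.\<close>

lemma Td_first_column:
  assumes L: "1 \<le> L"
  obtains F H :: "Defs.vec \<Rightarrow> Defs.vec" where
    "\<And>a b. \<And>\<phi> \<chi> :: Defs.vec. F (\<lambda>v. a * \<phi> v + b * \<chi> v) = (\<lambda>v. a * F \<phi> v + b * F \<chi> v)"
    "\<And>a b. \<And>\<phi> \<chi> :: Defs.vec. H (\<lambda>v. a * \<phi> v + b * \<chi> v) = (\<lambda>v. a * H \<phi> v + b * H \<chi> v)"
    "\<And>\<phi> v. H (\<phi> \<circ> tgen L 0) v = H \<phi> (tgen L 0 v)"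
    "\<And>z'. \<And>\<phi> :: Defs.vec. \<And>v :: bracket list. (\<forall>i\<ge>2. z' i = z i) \<Longrightarrow> length v = L \<Longrightarrow>
       Td L w z' \<zeta>0 \<zeta>L \<phi> v =
         (let a0 = br (q / (z' 1 * w)); a1 = - br (z' 1 * w); b0 = br (q / (w / z' 1)); b1 = - br (w / z' 1);
              k0 = kfun (q / w) \<zeta>0; k1 = br (inverse q) * br ((q / w)\<^sup>2) in
          ((a0 * (k0 * b0 + k0 * b1 + k1 * b0) + a1 * k0 * b0) * F \<phi> v + a0 * b1 * k1 * F \<phi> (tgen L 0 v)
           + a1 * b0 * k1 * F (\<phi> \<circ> tgen L 0) v + a1 * b1 * (k0 * H \<phi> v + k1 * H \<phi> (tgen L 0 v)))
          / (kfun (1 / (q / w)) \<zeta>0 * br (q * (w / z' 1)) * br (q * (z' 1 * w))))"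
proof -
  let ?N = "L + 2" and ?J = "contract L"
  let ?e0 = "tgen ?N 0" and ?e2 = "tgen ?N 2" and ?E = "tgen L 0"
  obtain Y1 Y1' where Y1: "lifts L Y1 Y1'"
    "\<And>z' \<psi>. (\<forall>i\<ge>2. z' i = z i) \<Longrightarrow> lowers ?N w z' L \<psi> = Rd ?N 2 (w / z' 1) (Y1 \<psi>)"
    using lowers_first[OF L order_refl, of z w] by blast
  obtain Y2 Y2' where Y2: "lifts L Y2 Y2'"
    "\<And>z' \<psi>. (\<forall>i\<ge>2. z' i = z i) \<Longrightarrow> uppers ?N w z' L \<psi> = Y2 (Rd ?N 2 (z' 1 * w) \<psi>)"
    using uppers_first[OF L order_refl, of z w] by blast
  define Y where "Y \<psi> = Y1 (Kd ?N ?N w \<zeta>L (Y2 \<psi>))" for \<psi>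
  define F where "F \<phi> = Y1' (Kd L L w \<zeta>L (Y2' \<phi>))" for \<phi>
  have Y: "lifts L Y F" unfolding Y_def F_def Kd_lin
    by (rule lifts_comp[OF Y1(1) lifts_comp[OF lifts_lin Y2(1)]]) (use L in auto)
  have lin: "Y (\<lambda>v. a * \<psi> v + b * \<chi> v) = (\<lambda>v. a * Y \<psi> v + b * Y \<chi> v)" for a b \<psi> \<chi> using Y by (simp add: lifts_def)
  have c0: "Y (\<lambda>u. \<psi> (?e0 u)) v = Y \<psi> (?e0 v)" for \<psi> v using Y by (simp add: lifts_def comp_def fun_eq_iff)
  have cJ: "Y (\<lambda>u. \<phi> (?J u)) v = F \<phi> (?J v)" for \<phi> v using Y by (simp add: lifts_def comp_def fun_eq_iff)
  have cC: "Y \<psi> (cup v) = F (\<lambda>u. \<psi> (cup u)) v" for \<psi> v using Y by (simp add: lifts_def comp_def fun_eq_iff)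
  have J: "?J (?e0 (cup v)) = v" "?J (?e2 (cup v)) = v" "?J (cup v) = v" for v
    using contract_tgen_prefix[OF L] by simp_all
  have e20: "?e2 (?e0 (cup v)) = ?e2 (cup (?E v))" for v by (rule tgen_2_0_prefix[OF L])
  have J20: "?J (?e2 (?e0 v)) = ?E (?J (?e2 v))" for v by (rule contract_tgen_2_0[OF L])
  have c02: "?e0 (?e2 v) = ?e2 (?e0 v)" for v by (rule tgen_commute) auto
  define H where "H \<phi> v = Y (\<lambda>u. \<phi> (?J (?e2 u))) (?e2 (cup v))" for \<phi> v
  have F_Y: "F \<phi> v = Y (\<lambda>u. \<phi> (?J u)) (cup v)" for \<phi> v using cJ J(3) by simp
  show ?thesis
  proof (rule that[of F H])
    show "F (\<lambda>v. a * \<phi> v + b * \<chi> v) = (\<lambda>v. a * F \<phi> v + b * F \<chi> v)" for a b and \<phi> \<chi> :: Defs.vec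
      unfolding F_Y by (simp add: fun_eq_iff F_Y lin)
    show "H (\<lambda>v. a * \<phi> v + b * \<chi> v) = (\<lambda>v. a * H \<phi> v + b * H \<chi> v)" for a b and \<phi> \<chi> :: Defs.vec
      by (simp add: fun_eq_iff H_def lin)
    show "H (\<phi> \<circ> ?E) v = H \<phi> (?E v)" for \<phi> v
      unfolding H_def comp_def J20[symmetric] using c0[of "\<lambda>u. \<phi> (?J (?e2 u))"] by (simp only: c02 e20)
    fix z' and \<phi> :: Defs.vec and v :: "bracket list" assume z': "\<forall>i\<ge>2. z' i = z i" and v: "length v = L"
    define a0 where "a0 = br (q / (z' 1 * w))" define a1 where "a1 = - br (z' 1 * w)"
    define b0 where "b0 = br (q / (w / z' 1))" define b1 where "b1 = - br (w / z' 1)"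
    define k0 where "k0 = kfun (q / w) \<zeta>0" define k1 where "k1 = br (inverse q) * br ((q / w)\<^sup>2)"
    define da where "da = br (q * (z' 1 * w))" define db where "db = br (q * (w / z' 1))"
    define dk where "dk = kfun (1 / (q / w)) \<zeta>0"
    define G where "G = Y (\<lambda>u. \<phi> (?J (?e2 u)))"
    define Z where "Z = Y (Rd ?N 2 (z' 1 * w) (\<phi> \<circ> ?J))"
    have Z: "Z u = a0 / da * F \<phi> (?J u) + a1 / da * G u" for u
    proof -
      have "Z = Y (\<lambda>u. a0 / da * \<phi> (?J u) + a1 / da * \<phi> (?J (?e2 u)))"
        unfolding Z_def Rd_def a0_def a1_def da_def by (simp add: diff_divide_distrib)
      thus ?thesis unfolding lin cJ G_def by simp
    qed
    have G: "G (cup u) = F \<phi> u" "G (?e0 (cup u)) = F (\<lambda>v. \<phi> (?E v)) u" "G (?e2 (cup u)) = H \<phi> u" for u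
    proof -
      show "G (cup u) = F \<phi> u" unfolding G_def cC J ..
      show "G (?e0 (cup u)) = F (\<lambda>v. \<phi> (?E v)) u" unfolding G_def c0[symmetric] J20 cC J ..
      show "G (?e2 (cup u)) = H \<phi> u" unfolding G_def H_def ..
    qed
    have "Td L w z' \<zeta>0 \<zeta>L \<phi> v = Kd ?N 0 (q / w) \<zeta>0 (Rd ?N 2 (w / z' 1) Z) (cup v)"
      unfolding Td_factor[OF v L] Y1(2)[OF z'] Y2(2)[OF z'] Z_def Y_def ..
    also have "\<dots> = (k0 * ((b0 * Z (cup v) + b1 * Z (?e2 (cup v))) / db)
        + k1 * ((b0 * Z (?e0 (cup v)) + b1 * Z (?e2 (?e0 (cup v)))) / db)) / dk"
      unfolding Kd_def Rd_def k0_def k1_def b0_def b1_def db_def dk_def by simp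
    also have "\<dots> = ((a0 * (k0 * b0 + k0 * b1 + k1 * b0) + a1 * k0 * b0) * F \<phi> v + a0 * b1 * k1 * F \<phi> (?E v)
           + a1 * b0 * k1 * F (\<phi> \<circ> ?E) v + a1 * b1 * (k0 * H \<phi> v + k1 * H \<phi> (?E v))) / (dk * db * da)"
      unfolding e20 Z J G comp_def by (simp add: add_divide_distrib algebra_simps)
    finally show "Td L w z' \<zeta>0 \<zeta>L \<phi> v =
         (let a0 = br (q / (z' 1 * w)); a1 = - br (z' 1 * w); b0 = br (q / (w / z' 1)); b1 = - br (w / z' 1);
              k0 = kfun (q / w) \<zeta>0; k1 = br (inverse q) * br ((q / w)\<^sup>2) in
          ((a0 * (k0 * b0 + k0 * b1 + k1 * b0) + a1 * k0 * b0) * F \<phi> v + a0 * b1 * k1 * F \<phi> (tgen L 0 v)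
           + a1 * b0 * k1 * F (\<phi> \<circ> tgen L 0) v + a1 * b1 * (k0 * H \<phi> v + k1 * H \<phi> (tgen L 0 v)))
          / (kfun (1 / (q / w)) \<zeta>0 * br (q * (w / z' 1)) * br (q * (z' 1 * w))))"
      unfolding Let_def a0_def a1_def b0_def b1_def k0_def k1_def da_def db_def dk_def .
  qed
qed

text \<open>When both sides of \<open>Td_left\<close> are expanded, the terms with
  \<open>F \<phi> (?E v)\<close> and with \<open>F (\<phi> \<circ> ?E) v\<close> each require this
  identity; all other coefficients agree at sight.\<close>

lemma left_reflection_scalar:
  assumes "w \<noteq> 0" "z \<noteq> 0" "\<zeta> \<noteq> 0"
  defines "a0 \<equiv> br (q / (z * w))" and "a1 \<equiv> - br (z * w)" and "b0 \<equiv> br (q / (w / z))" and "b1 \<equiv> - br (w / z)"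
    and "k0 \<equiv> kfun (q / w) \<zeta>" and "k1 \<equiv> br (inverse q) * br ((q / w)\<^sup>2)"
    and "m0 \<equiv> kfun (1 / z) \<zeta>" and "m1 \<equiv> br (inverse q) * br ((1 / z)\<^sup>2)"
  shows "m0 * (a1 * b0 * k1) + m1 * (a0 * (k0 * b0 + k0 * b1 + k1 * b0) + a1 * k0 * b0 + a1 * b0 * k1) = m0 * (a0 * b1 * k1)"
proof -
  obtain W Z where WZ: "w * W = 1" "z * Z = 1" using assms by (metis right_inverse)
  have i: "inverse w = W" "inverse z = Z" "inverse W = w" "inverse Z = z"
    using WZ by (simp_all add: inverse_unique mult.commute)
  have nz: "W \<noteq> 0" "Z \<noteq> 0" using WZ by auto
  define c where "c = \<zeta>\<^sup>2 + (inverse \<zeta>)\<^sup>2"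
  have qw: "(q / w)\<^sup>2 = (q * W)\<^sup>2" "inverse ((q / w)\<^sup>2) = (q\<^sup>2 * w)\<^sup>2" "br (inverse q) = q\<^sup>2 - q"
  proof -
    show "(q / w)\<^sup>2 = (q * W)\<^sup>2" by (simp add: divide_inverse i)
    have "inverse ((q / w)\<^sup>2) = (inverse q * w)\<^sup>2" by (simp add: power_divide power_mult_distrib divide_inverse power_inverse mult.commute)
    thus "inverse ((q / w)\<^sup>2) = (q\<^sup>2 * w)\<^sup>2" unfolding inverse_q .
    have "br (inverse q) = inverse q - q" by (simp add: br_def)
    thus "br (inverse q) = q\<^sup>2 - q" unfolding inverse_q .
  qed
  have k1: "k1 = (q\<^sup>2 - q) * ((q * W)\<^sup>2 - (q\<^sup>2 * w)\<^sup>2)"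
    unfolding k1_def qw(3) br_def[of "(q / w)\<^sup>2"] qw(2) unfolding qw(1) ..
  have e: "a0 = q * Z * W - q\<^sup>2 * z * w" "a1 = Z * W - z * w" "b0 = q * z * W - q\<^sup>2 * Z * w" "b1 = z * W - w * Z"
    "m1 = (q\<^sup>2 - q) * (Z\<^sup>2 - z\<^sup>2)"
    unfolding a0_def a1_def b0_def b1_def m1_def
    by (simp_all add: br_def divide_inverse i inverse_q[symmetric] power_inverse[symmetric] power_mult_distrib mult_ac)
  have k: "m0 = q * Z\<^sup>2 + q\<^sup>2 * z\<^sup>2 - c" "k0 = q * (q * W)\<^sup>2 + q\<^sup>2 * (q\<^sup>2 * w)\<^sup>2 - c"
    unfolding m0_def k0_def using kfun_expand[of "1 / z" \<zeta>] kfun_expand[of "q / w" \<zeta>] assms(1-3) nz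
    by (simp_all add: divide_inverse i inverse_q[symmetric] c_def)
  show ?thesis unfolding e k k1 using WZ q_cubic by Groebner_Basis.algebra
qed

text \<open>The boundary generator of the physical sites is not among the generators on
  \<open>L + 2\<close> sites; it arises only through cap and cup, as in
  \<open>tgen_prefix_0\<close>. Hence no reflection equation applies directly, and both sides are
  expanded in the first column instead.\<close>

theorem Td_left:
  assumes v: "length v = L" and L: "1 \<le> L" and nz: "w \<noteq> 0" "z 1 \<noteq> 0" "\<zeta>0 \<noteq> 0"
  shows "Td L w z \<zeta>0 \<zeta>L (Kd L 0 (1 / z 1) \<zeta>0 \<phi>) v = Kd L 0 (1 / z 1) \<zeta>0 (Td L w (z(1 := 1 / z 1)) \<zeta>0 \<zeta>L \<phi>) v"
proof -
  let ?E = "tgen L 0" and ?z = "z(1 := 1 / z 1)"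
  obtain F H :: "Defs.vec \<Rightarrow> Defs.vec" where
    F: "\<And>a b. \<And>\<phi> \<chi> :: Defs.vec. F (\<lambda>v. a * \<phi> v + b * \<chi> v) = (\<lambda>v. a * F \<phi> v + b * F \<chi> v)"
    and H: "\<And>a b. \<And>\<phi> \<chi> :: Defs.vec. H (\<lambda>v. a * \<phi> v + b * \<chi> v) = (\<lambda>v. a * H \<phi> v + b * H \<chi> v)"
    and HE: "\<And>\<phi> v. H (\<phi> \<circ> ?E) v = H \<phi> (?E v)"
    and T: "\<And>z'. \<And>\<phi> :: Defs.vec. \<And>v :: bracket list. (\<forall>i\<ge>2. z' i = z i) \<Longrightarrow> length v = L \<Longrightarrow>
       Td L w z' \<zeta>0 \<zeta>L \<phi> v =
         (let a0 = br (q / (z' 1 * w)); a1 = - br (z' 1 * w); b0 = br (q / (w / z' 1)); b1 = - br (w / z' 1);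
              k0 = kfun (q / w) \<zeta>0; k1 = br (inverse q) * br ((q / w)\<^sup>2) in
          ((a0 * (k0 * b0 + k0 * b1 + k1 * b0) + a1 * k0 * b0) * F \<phi> v + a0 * b1 * k1 * F \<phi> (?E v)
           + a1 * b0 * k1 * F (\<phi> \<circ> ?E) v + a1 * b1 * (k0 * H \<phi> v + k1 * H \<phi> (?E v)))
          / (kfun (1 / (q / w)) \<zeta>0 * br (q * (w / z' 1)) * br (q * (z' 1 * w))))"
    using Td_first_column[OF L, of z w \<zeta>0 \<zeta>L] by blast
  define a0 where "a0 = br (q / (z 1 * w))" define a1 where "a1 = - br (z 1 * w)"
  define b0 where "b0 = br (q / (w / z 1))" define b1 where "b1 = - br (w / z 1)"
  define k0 where "k0 = kfun (q / w) \<zeta>0" define k1 where "k1 = br (inverse q) * br ((q / w)\<^sup>2)"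
  define m0 where "m0 = kfun (1 / z 1) \<zeta>0" define m1 where "m1 = br (inverse q) * br ((1 / z 1)\<^sup>2)"
  define d where "d = kfun (1 / (q / w)) \<zeta>0 * br (q * (w / z 1)) * br (q * (z 1 * w))"
  define n where "n = kfun (1 / (1 / z 1)) \<zeta>0"
  have s: "m0 * (a1 * b0 * k1) + m1 * (a0 * (k0 * b0 + k0 * b1 + k1 * b0) + a1 * k0 * b0 + a1 * b0 * k1) = m0 * (a0 * b1 * k1)"
    using left_reflection_scalar[OF nz] unfolding a0_def a1_def b0_def b1_def k0_def k1_def m0_def m1_def .
  have K: "Kd L 0 (1 / z 1) \<zeta>0 \<chi> = (\<lambda>u. m0 / n * \<chi> u + m1 / n * \<chi> (?E u))" for \<chi>
    unfolding Kd_def m0_def m1_def n_def by (simp add: add_divide_distrib)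
  have E: "?E (?E u) = ?E u" for u using L by (simp add: tgen_idem)
  have T1: "Td L w z \<zeta>0 \<zeta>L \<chi> v =
      ((a0 * (k0 * b0 + k0 * b1 + k1 * b0) + a1 * k0 * b0) * F \<chi> v + a0 * b1 * k1 * F \<chi> (?E v)
           + a1 * b0 * k1 * F (\<chi> \<circ> ?E) v + a1 * b1 * (k0 * H \<chi> v + k1 * H \<chi> (?E v))) / d" for \<chi>
    using T[of z v \<chi>] v unfolding Let_def a0_def a1_def b0_def b1_def k0_def k1_def d_def by simp
  have sw: "br (q / (1 / z 1 * w)) = b0" "- br (1 / z 1 * w) = b1" "br (q / (w / (1 / z 1))) = a0" "- br (w / (1 / z 1)) = a1"
    "kfun (1 / (q / w)) \<zeta>0 * br (q * (w / (1 / z 1))) * br (q * (1 / z 1 * w)) = d"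
    unfolding a0_def a1_def b0_def b1_def d_def by (simp_all add: mult_ac)
  have T2: "Td L w ?z \<zeta>0 \<zeta>L \<phi> u =
      ((b0 * (k0 * a0 + k0 * a1 + k1 * a0) + b1 * k0 * a0) * F \<phi> u + b0 * a1 * k1 * F \<phi> (?E u)
           + b1 * a0 * k1 * F (\<phi> \<circ> ?E) u + b1 * a1 * (k0 * H \<phi> u + k1 * H \<phi> (?E u))) / d" if "length u = L" for u
    using T[of ?z u \<phi>] that unfolding Let_def fun_upd_same sw k0_def[symmetric] k1_def[symmetric] by simp
  have l: "length (?E v) = L" using v L by simp
  define f0 where "f0 = F \<phi> v" define f1 where "f1 = F \<phi> (?E v)"
  define f2 where "f2 = F (\<phi> \<circ> ?E) v" define f3 where "f3 = F (\<phi> \<circ> ?E) (?E v)"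
  define h0 where "h0 = H \<phi> v" define h1 where "h1 = H \<phi> (?E v)"
  have FE: "F (\<lambda>u. m0 / n * \<phi> u + m1 / n * \<phi> (?E u)) u = m0 / n * F \<phi> u + m1 / n * F (\<phi> \<circ> ?E) u" for u
    unfolding F comp_def ..
  have FE2: "F ((\<lambda>u. m0 / n * \<phi> u + m1 / n * \<phi> (?E u)) \<circ> ?E) u = (m0 / n + m1 / n) * F (\<phi> \<circ> ?E) u" for u
    using F[of "m0 / n" "\<phi> \<circ> ?E" "m1 / n" "\<phi> \<circ> ?E"] by (simp add: comp_def E algebra_simps)
  have HH: "H (\<lambda>u. m0 / n * \<phi> u + m1 / n * \<phi> (?E u)) u = m0 / n * H \<phi> u + m1 / n * H \<phi> (?E u)" for u
    using H[of "m0 / n" \<phi> "m1 / n" "\<phi> \<circ> ?E"] HE[of \<phi> u] by (simp add: comp_def)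
  define M0 where "M0 = m0 / n" define M1 where "M1 = m1 / n"
  have s': "M0 * (a1 * b0 * k1) + M1 * (a0 * (k0 * b0 + k0 * b1 + k1 * b0) + a1 * k0 * b0 + a1 * b0 * k1) = M0 * (a0 * b1 * k1)"
    using arg_cong[OF s, of "\<lambda>t. t / n"] unfolding M0_def M1_def by (simp add: add_divide_distrib)
  have "Td L w z \<zeta>0 \<zeta>L (Kd L 0 (1 / z 1) \<zeta>0 \<phi>) v =
      ((a0 * (k0 * b0 + k0 * b1 + k1 * b0) + a1 * k0 * b0) * (M0 * f0 + M1 * f2) + a0 * b1 * k1 * (M0 * f1 + M1 * f3)
        + a1 * b0 * k1 * ((M0 + M1) * f2) + a1 * b1 * (k0 * (M0 * h0 + M1 * h1) + k1 * (M0 * h1 + M1 * h1))) / d"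
    unfolding T1 K FE FE2 HH E f0_def f1_def f2_def f3_def h0_def h1_def M0_def M1_def ..
  also have "\<dots> = (M0 * ((b0 * (k0 * a0 + k0 * a1 + k1 * a0) + b1 * k0 * a0) * f0 + b0 * a1 * k1 * f1
           + b1 * a0 * k1 * f2 + b1 * a1 * (k0 * h0 + k1 * h1))
       + M1 * ((b0 * (k0 * a0 + k0 * a1 + k1 * a0) + b1 * k0 * a0) * f1 + b0 * a1 * k1 * f1
           + b1 * a0 * k1 * f3 + b1 * a1 * (k0 * h1 + k1 * h1))) / d"
    using s' by (intro arg_cong[of _ _ "\<lambda>t. t / d"]) Groebner_Basis.algebra
  also have "\<dots> = Kd L 0 (1 / z 1) \<zeta>0 (Td L w ?z \<zeta>0 \<zeta>L \<phi>) v"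
  proof -
    have D: "(M0 * X + M1 * Y) / d = M0 * (X / d) + M1 * (Y / d)" for X Y by (simp add: add_divide_distrib)
    show ?thesis
      unfolding D unfolding K T2[OF v] T2[OF l] E f0_def f1_def f2_def f3_def h0_def h1_def M0_def M1_def ..
  qed
  finally show ?thesis .
qed

section \<open>From functionals to fixed vectors\<close>

lemma finite_LP [simp]: "finite (LP L)"
proof -
  have "LP L = {xs. set xs \<subseteq> {Opn, Cls} \<and> length xs = L}"
    using step.cases by (auto simp: LP_def)
  thus ?thesis using finite_lists_length_eq[of "{Opn, Cls}" L] by simp
qed

lemma finite_configs [simp]: "finite (configs L)"
  by (simp add: configs_def)

lemma sum_T_op: "(\<Sum>\<beta>\<in>LP L. \<phi> \<beta> * T_op L w z \<zeta>0 \<zeta>L v \<beta>) = (\<Sum>\<alpha>\<in>LP L. v \<alpha> * Td L w z \<zeta>0 \<zeta>L \<phi> \<alpha>)"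
proof -
  let ?g = "\<lambda>(\<alpha>, C). out_pattern L C \<alpha>" and ?f = "\<lambda>(\<alpha>, C). \<phi> (out_pattern L C \<alpha>) * (weight L w z \<zeta>0 \<zeta>L C * v \<alpha>)"
  have "(\<Sum>\<beta>\<in>LP L. \<phi> \<beta> * T_op L w z \<zeta>0 \<zeta>L v \<beta>) = (\<Sum>\<beta>\<in>LP L. sum ?f {x \<in> LP L \<times> configs L. ?g x = \<beta>})"
  proof (rule sum.cong[OF refl])
    fix \<beta>
    have "{(\<alpha>, C). \<alpha> \<in> LP L \<and> C \<in> configs L \<and> out_pattern L C \<alpha> = \<beta>} = {x \<in> LP L \<times> configs L. ?g x = \<beta>}" by auto
    thus "\<phi> \<beta> * T_op L w z \<zeta>0 \<zeta>L v \<beta> = sum ?f {x \<in> LP L \<times> configs L. ?g x = \<beta>}"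
      unfolding T_op_def sum_distrib_left by (auto intro!: sum.cong)
  qed
  also have "\<dots> = sum ?f (LP L \<times> configs L)"
    by (rule sum.group, simp, simp) (auto simp: LP_def out_pattern_def)
  also have "\<dots> = (\<Sum>\<alpha>\<in>LP L. v \<alpha> * Td L w z \<zeta>0 \<zeta>L \<phi> \<alpha>)"
    unfolding sum.cartesian_product[symmetric] Td_def sum_distrib_left by (simp add: mult_ac)
  finally show ?thesis .
qed

lemma sum_gen_op:
  assumes "1 \<le> L" "k \<le> L"
  shows "(\<Sum>\<beta>\<in>LP L. \<phi> \<beta> * gen_op L k v \<beta>) = (\<Sum>\<alpha>\<in>LP L. v \<alpha> * \<phi> (tgen L k \<alpha>))"
proof -
  have "(\<Sum>\<beta>\<in>LP L. \<phi> \<beta> * gen_op L k v \<beta>) = (\<Sum>\<beta>\<in>LP L. \<Sum>\<alpha>\<in>{\<alpha> \<in> LP L. gen L k \<alpha> = \<beta>}. v \<alpha> * \<phi> (gen L k \<alpha>))"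
    unfolding gen_op_def sum_distrib_left by (intro sum.cong refl) (auto simp: mult.commute)
  also have "\<dots> = (\<Sum>\<alpha>\<in>LP L. v \<alpha> * \<phi> (gen L k \<alpha>))"
    by (rule sum.group, simp, simp) (use assms length_gen in \<open>auto simp: LP_def\<close>)
  also have "\<dots> = (\<Sum>\<alpha>\<in>LP L. v \<alpha> * \<phi> (tgen L k \<alpha>))"
    by (intro sum.cong refl) (simp add: tgen_def LP_def)
  finally show ?thesis .
qed

lemma vec_eqI_functional:
  assumes "\<And>\<phi>. (\<Sum>\<beta>\<in>LP L. \<phi> \<beta> * u \<beta>) = (\<Sum>\<beta>\<in>LP L. \<phi> \<beta> * v \<beta>)"
  shows "vec_eq L u v"
  unfolding vec_eq_def
proof
  fix \<beta> assume "\<beta> \<in> LP L"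
  have "(\<Sum>\<gamma>\<in>LP L. (if \<gamma> = \<beta> then 1 else 0) * x \<gamma>) = x \<beta>" for x :: Defs.vec
    using \<open>\<beta> \<in> LP L\<close> by (subst sum.remove[of _ \<beta>]) auto
  thus "u \<beta> = v \<beta>" using assms[of "\<lambda>\<gamma>. if \<gamma> = \<beta> then 1 else 0"] by simp
qed

lemma fixed_vec_functional:
  "fixed_vec L z \<zeta>0 \<zeta>L v \<longleftrightarrow> (\<forall>w \<phi>. T_regular L w z \<zeta>0 \<zeta>L \<longrightarrow>
     (\<Sum>\<alpha>\<in>LP L. v \<alpha> * Td L w z \<zeta>0 \<zeta>L \<phi> \<alpha>) = (\<Sum>\<alpha>\<in>LP L. v \<alpha> * \<phi> \<alpha>))"
proof
  assume f: "fixed_vec L z \<zeta>0 \<zeta>L v"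
  show "\<forall>w \<phi>. T_regular L w z \<zeta>0 \<zeta>L \<longrightarrow>
     (\<Sum>\<alpha>\<in>LP L. v \<alpha> * Td L w z \<zeta>0 \<zeta>L \<phi> \<alpha>) = (\<Sum>\<alpha>\<in>LP L. v \<alpha> * \<phi> \<alpha>)"
  proof (intro allI impI)
    fix w \<phi> assume "T_regular L w z \<zeta>0 \<zeta>L"
    hence "T_op L w z \<zeta>0 \<zeta>L v \<beta> = v \<beta>" if "\<beta> \<in> LP L" for \<beta> using f that by (simp add: fixed_vec_def vec_eq_def)
    thus "(\<Sum>\<alpha>\<in>LP L. v \<alpha> * Td L w z \<zeta>0 \<zeta>L \<phi> \<alpha>) = (\<Sum>\<alpha>\<in>LP L. v \<alpha> * \<phi> \<alpha>)"
      unfolding sum_T_op[symmetric] by (simp add: mult.commute)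
  qed
next
  assume a: "\<forall>w \<phi>. T_regular L w z \<zeta>0 \<zeta>L \<longrightarrow>
     (\<Sum>\<alpha>\<in>LP L. v \<alpha> * Td L w z \<zeta>0 \<zeta>L \<phi> \<alpha>) = (\<Sum>\<alpha>\<in>LP L. v \<alpha> * \<phi> \<alpha>)"
  show "fixed_vec L z \<zeta>0 \<zeta>L v" unfolding fixed_vec_def
    by (intro allI impI vec_eqI_functional) (use a in \<open>simp add: sum_T_op mult.commute\<close>)
qed

text \<open>Pairing with an arbitrary functional moves the operator from the functional to the
  vector, which transposes the relation \<open>tw\<close>. Regularity is pulled back from
  \<open>z'\<close> to \<open>z\<close> because \<open>v\<close> is known to be fixed only at
  regular \<open>w\<close>.\<close>

lemma fixed_vec_intertwine:
  assumes L: "1 \<le> L" "k \<le> L" and f: "fixed_vec L z \<zeta>0 \<zeta>L v"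
    and reg: "\<And>w. T_regular L w z' \<zeta>0 \<zeta>L \<Longrightarrow> T_regular L w z \<zeta>0 \<zeta>L"
    and tw: "\<And>w \<phi> \<alpha>. T_regular L w z' \<zeta>0 \<zeta>L \<Longrightarrow> \<alpha> \<in> LP L \<Longrightarrow>
      Td L w z \<zeta>0 \<zeta>L (lin a b (tgen L k) \<phi>) \<alpha> = lin a b (tgen L k) (Td L w z' \<zeta>0 \<zeta>L \<phi>) \<alpha>"
  shows "fixed_vec L z' \<zeta>0 \<zeta>L (\<lambda>\<beta>. a * v \<beta> + b * gen_op L k v \<beta>)"
  unfolding fixed_vec_functional
proof (intro allI impI)
  fix w \<phi> assume r: "T_regular L w z' \<zeta>0 \<zeta>L"
  have p: "(\<Sum>\<beta>\<in>LP L. (a * v \<beta> + b * gen_op L k v \<beta>) * \<chi> \<beta>) = (\<Sum>\<alpha>\<in>LP L. v \<alpha> * lin a b (tgen L k) \<chi> \<alpha>)" for \<chi>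
  proof -
    have "(\<Sum>\<beta>\<in>LP L. (a * v \<beta> + b * gen_op L k v \<beta>) * \<chi> \<beta>) =
        (\<Sum>\<beta>\<in>LP L. a * (v \<beta> * \<chi> \<beta>)) + b * (\<Sum>\<beta>\<in>LP L. \<chi> \<beta> * gen_op L k v \<beta>)"
      unfolding sum_distrib_left sum.distrib[symmetric] by (intro sum.cong refl) (simp add: algebra_simps)
    also have "\<dots> = (\<Sum>\<alpha>\<in>LP L. v \<alpha> * lin a b (tgen L k) \<chi> \<alpha>)"
      unfolding sum_gen_op[OF L] unfolding sum_distrib_left sum.distrib[symmetric]
      by (intro sum.cong refl) (simp add: lin_def algebra_simps)
    finally show ?thesis .
  qed
  have "(\<Sum>\<alpha>\<in>LP L. v \<alpha> * lin a b (tgen L k) (Td L w z' \<zeta>0 \<zeta>L \<phi>) \<alpha>)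
      = (\<Sum>\<alpha>\<in>LP L. v \<alpha> * Td L w z \<zeta>0 \<zeta>L (lin a b (tgen L k) \<phi>) \<alpha>)"
    using tw[OF r] by simp
  also have "\<dots> = (\<Sum>\<alpha>\<in>LP L. v \<alpha> * lin a b (tgen L k) \<phi> \<alpha>)"
    using f reg[OF r] unfolding fixed_vec_functional by blast
  finally show "(\<Sum>\<alpha>\<in>LP L. (a * v \<alpha> + b * gen_op L k v \<alpha>) * Td L w z' \<zeta>0 \<zeta>L \<phi> \<alpha>)
      = (\<Sum>\<alpha>\<in>LP L. (a * v \<alpha> + b * gen_op L k v \<alpha>) * \<phi> \<alpha>)"
    unfolding p .
qed

lemma T_regular_nz: "T_regular L w z \<zeta>0 \<zeta>L \<Longrightarrow> w \<noteq> 0"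
  by (simp add: T_regular_def)

lemma fixed_vec_R:
  assumes i: "1 \<le> i" "i < L" and nz: "z i \<noteq> 0" "z (i + 1) \<noteq> 0" and f: "fixed_vec L z \<zeta>0 \<zeta>L v"
  shows "fixed_vec L (z(i := z (i + 1), i + 1 := z i)) \<zeta>0 \<zeta>L (R_op L i (z i / z (i + 1)) v)"
proof -
  let ?x = "z i / z (i + 1)"
  have R: "R_op L i ?x v = (\<lambda>\<beta>. br (q / ?x) / br (q * ?x) * v \<beta> + - br ?x / br (q * ?x) * gen_op L i v \<beta>)"
    by (simp add: R_op_def fun_eq_iff diff_divide_distrib)
  show ?thesis unfolding R
  proof (rule fixed_vec_intertwine[OF _ _ f])
    fix w \<phi> \<alpha> assume "T_regular L w (z(i := z (i + 1), i + 1 := z i)) \<zeta>0 \<zeta>L" "\<alpha> \<in> LP L"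
    thus "Td L w z \<zeta>0 \<zeta>L (lin (br (q / ?x) / br (q * ?x)) (- br ?x / br (q * ?x)) (tgen L i) \<phi>) \<alpha> =
       lin (br (q / ?x) / br (q * ?x)) (- br ?x / br (q * ?x)) (tgen L i) (Td L w (z(i := z (i + 1), i + 1 := z i)) \<zeta>0 \<zeta>L \<phi>) \<alpha>"
      using Td_swap[of \<alpha> L i w z] i nz T_regular_nz unfolding Rd_lin by (simp add: LP_def)
  next
    fix w assume r: "T_regular L w (z(i := z (i + 1), i + 1 := z i)) \<zeta>0 \<zeta>L"
    have "\<exists>j'\<in>{1..L}. (z(i := z (i + 1), i + 1 := z i)) j' = z j" if "j \<in> {1..L}" for j
      using that i by (cases "j = i"; cases "j = i + 1") (auto intro: bexI[of _ "i + 1"] bexI[of _ i] bexI[of _ j])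
    hence "br (q * w / z j) \<noteq> 0 \<and> br (q * z j * w) \<noteq> 0" if "j \<in> {1..L}" for j
      using r that unfolding T_regular_def by force
    thus "T_regular L w z \<zeta>0 \<zeta>L" using r unfolding T_regular_def by blast
  qed (use i in auto)
qed

lemma fixed_vec_K0:
  assumes L: "1 \<le> L" and nz: "z 1 \<noteq> 0" "\<zeta>0 \<noteq> 0" and f: "fixed_vec L z \<zeta>0 \<zeta>L v"
  shows "fixed_vec L (z(1 := 1 / z 1)) \<zeta>0 \<zeta>L (K_op L 0 (1 / z 1) \<zeta>0 v)"
proof -
  let ?x = "1 / z 1"
  have K: "K_op L 0 ?x \<zeta>0 v = (\<lambda>\<beta>. kfun ?x \<zeta>0 / kfun (1 / ?x) \<zeta>0 * v \<beta> + br (inverse q) * br (?x\<^sup>2) / kfun (1 / ?x) \<zeta>0 * gen_op L 0 v \<beta>)"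
    by (simp add: K_op_def fun_eq_iff add_divide_distrib)
  show ?thesis unfolding K
  proof (rule fixed_vec_intertwine[OF _ _ f])
    fix w \<phi> \<alpha> assume "T_regular L w (z(1 := 1 / z 1)) \<zeta>0 \<zeta>L" "\<alpha> \<in> LP L"
    thus "Td L w z \<zeta>0 \<zeta>L (lin (kfun ?x \<zeta>0 / kfun (1 / ?x) \<zeta>0) (br (inverse q) * br (?x\<^sup>2) / kfun (1 / ?x) \<zeta>0) (tgen L 0) \<phi>) \<alpha> =
       lin (kfun ?x \<zeta>0 / kfun (1 / ?x) \<zeta>0) (br (inverse q) * br (?x\<^sup>2) / kfun (1 / ?x) \<zeta>0) (tgen L 0) (Td L w (z(1 := 1 / z 1)) \<zeta>0 \<zeta>L \<phi>) \<alpha>"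
      using Td_left[of \<alpha> L w z \<zeta>0] L nz T_regular_nz unfolding Kd_lin by (simp add: LP_def)
  next
    fix w assume r: "T_regular L w (z(1 := 1 / z 1)) \<zeta>0 \<zeta>L"
    show "T_regular L w z \<zeta>0 \<zeta>L" unfolding T_regular_def
    proof (intro conjI ballI)
      fix j assume j: "j \<in> {1..L}"
      show "br (q * w / z j) \<noteq> 0" "br (q * z j * w) \<noteq> 0"
        using r j L unfolding T_regular_def by (cases "j = 1"; force simp: mult_ac)+
    qed (use r in \<open>simp_all add: T_regular_def\<close>)
  qed (use L in auto)
qed

lemma fixed_vec_KL:
  assumes L: "1 \<le> L" and nz: "z L \<noteq> 0" "\<zeta>L \<noteq> 0" and f: "fixed_vec L z \<zeta>0 \<zeta>L v"
  shows "fixed_vec L (z(L := 1 / z L)) \<zeta>0 \<zeta>L (K_op L L (z L) \<zeta>L v)"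
proof -
  let ?x = "z L"
  have K: "K_op L L ?x \<zeta>L v = (\<lambda>\<beta>. kfun ?x \<zeta>L / kfun (1 / ?x) \<zeta>L * v \<beta> + br (inverse q) * br (?x\<^sup>2) / kfun (1 / ?x) \<zeta>L * gen_op L L v \<beta>)"
    by (simp add: K_op_def fun_eq_iff add_divide_distrib)
  show ?thesis unfolding K
  proof (rule fixed_vec_intertwine[OF _ _ f])
    fix w \<phi> \<alpha> assume "T_regular L w (z(L := 1 / z L)) \<zeta>0 \<zeta>L" "\<alpha> \<in> LP L"
    thus "Td L w z \<zeta>0 \<zeta>L (lin (kfun ?x \<zeta>L / kfun (1 / ?x) \<zeta>L) (br (inverse q) * br (?x\<^sup>2) / kfun (1 / ?x) \<zeta>L) (tgen L L) \<phi>) \<alpha> =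
       lin (kfun ?x \<zeta>L / kfun (1 / ?x) \<zeta>L) (br (inverse q) * br (?x\<^sup>2) / kfun (1 / ?x) \<zeta>L) (tgen L L) (Td L w (z(L := 1 / z L)) \<zeta>0 \<zeta>L \<phi>) \<alpha>"
      using Td_right[of \<alpha> L w z \<zeta>L] L nz T_regular_nz unfolding Kd_lin by (simp add: LP_def)
  next
    fix w assume r: "T_regular L w (z(L := 1 / z L)) \<zeta>0 \<zeta>L"
    show "T_regular L w z \<zeta>0 \<zeta>L" unfolding T_regular_def
    proof (intro conjI ballI)
      fix j assume j: "j \<in> {1..L}"
      show "br (q * w / z j) \<noteq> 0" "br (q * z j * w) \<noteq> 0"
        using r j L unfolding T_regular_def by (cases "j = L"; force simp: mult_ac)+
    qed (use r in \<open>simp_all add: T_regular_def\<close>)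
  qed (use L in auto)
qed

text \<open>Each factor of a weight that involves \<open>z i\<close> is, up to sign, a quotient of
  two values of the odd function \<open>br\<close>, and both change sign. The parity of the ground
  state in each variable comes from here.\<close>

lemma fixed_vec_uminus:
  assumes f: "fixed_vec L z \<zeta>0 \<zeta>L v"
  shows "fixed_vec L (z(i := - z i)) \<zeta>0 \<zeta>L v"
proof -
  let ?z = "z(i := - z i)"
  have W: "weight L w ?z \<zeta>0 \<zeta>L C = weight L w z \<zeta>0 \<zeta>L C" for w C
  proof -
    obtain A B l r where C: "C = (A, B, l, r)" by (cases C) auto
    have "(\<Prod>j\<in>{1..L}. (if j \<in> A then br (q * ?z j / w) else br (?z j / w)) / br (q * w / ?z j)) =
       (\<Prod>j\<in>{1..L}. (if j \<in> A then br (q * z j / w) else br (z j / w)) / br (q * w / z j))"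
      by (rule prod.cong) (auto simp: br_minus)
    moreover have "(\<Prod>j\<in>{1..L}. (if j \<in> B then - br (?z j * w) else br (q / (?z j * w))) / br (q * ?z j * w)) =
       (\<Prod>j\<in>{1..L}. (if j \<in> B then - br (z j * w) else br (q / (z j * w))) / br (q * z j * w))"
      by (rule prod.cong) (auto simp: br_minus)
    ultimately show ?thesis by (simp only: C weight.simps)
  qed
  have "T_op L w ?z \<zeta>0 \<zeta>L v = T_op L w z \<zeta>0 \<zeta>L v" for w
    unfolding T_op_def[abs_def] W ..
  moreover have "T_regular L w ?z \<zeta>0 \<zeta>L \<longleftrightarrow> T_regular L w z \<zeta>0 \<zeta>L" for w
    unfolding T_regular_def by (auto simp: br_minus split: if_splits)
  ultimately show ?thesis using f by (simp add: fixed_vec_def)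
qed

section \<open>The special point\<close>

text \<open>The diagram whose first \<open>i\<close> columns consist of faces of type I and the others of faces of type
  II, with both ends open: it moves the first sites to the right by two and the last ones to the left by
  two, so its iterates forget the pattern they are applied to.\<close>

definition open_diagram :: "nat \<Rightarrow> nat \<Rightarrow> bracket list \<Rightarrow> bracket list" where
  "open_diagram L i = out_pattern L ({1..i}, {1..i}, False, False)"

lemma join_sites_away:
  "j \<noteq> k \<Longrightarrow> j \<noteq> k + 1 \<Longrightarrow> c j = LeftBdry \<Longrightarrow> join_sites k c j = LeftBdry"
  "j \<noteq> k \<Longrightarrow> j \<noteq> k + 1 \<Longrightarrow> c j = RightBdry \<Longrightarrow> join_sites k c j = RightBdry"
  by (simp_all add: join_sites_def)

lemma link_of_tgen_bulk:
  assumes "length w = N" "1 \<le> k" "k < N" "j \<in> {1..N}"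
  shows "link_of (tgen N k w) j = join_sites k (link_of w) j"
  using link_of_tgen1[of w N k j] assms by (simp add: act_def)

text \<open>While the columns beyond \<open>i\<close> are drawn, the auxiliary strand always ends in
  a fresh arc between the sites \<open>n + 1\<close> and \<open>n + 2\<close>. Lines to the right
  boundary are shifted by two sites to the left as the drawing passes them: behind the current
  column the condition is \<open>L - b < j\<close>, ahead of it still \<open>L + 2 - b < j\<close>.
  The two sites of the open left end extend the \<open>a\<close> left lines to
  \<open>a + 2\<close>.\<close>

lemma lower_row_open:
  assumes iL: "i \<le> n" "n \<le> L" and a: "a \<le> i" and b: "b \<le> L - i" and l: "length w = L"
    and left: "\<And>j. 1 \<le> j \<Longrightarrow> j \<le> a \<Longrightarrow> link_of w j = LeftBdry"
    and right: "\<And>j. L - b < j \<Longrightarrow> j \<le> L \<Longrightarrow> link_of w j = RightBdry"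
  defines "u \<equiv> \<lambda>n. lower_row (L + 2) {1..i} n (Cls # Cls # w)"
  shows "length (u n) = L + 2 \<and>
    (\<forall>j. 1 \<le> j \<and> j \<le> a + 2 \<and> j \<le> i + 1 \<longrightarrow> link_of (u n) j = LeftBdry) \<and>
    (i < n \<longrightarrow> link_of (u n) (n + 1) = Site (n + 2)) \<and>
    (\<forall>j. i + 2 \<le> j \<and> j < n + 1 \<and> L - b < j \<longrightarrow> link_of (u n) j = RightBdry) \<and>
    (\<forall>j. n + 2 < j \<and> j \<le> L + 2 \<and> L + 2 - b < j \<longrightarrow> link_of (u n) j = RightBdry)"
  using iL
proof (induction n rule: dec_induct)
  case base
  have id: "lower_row (L + 2) {1..i} m v = v" if "m \<le> i" for m v
    using that by (induction m) auto
  have lp: "link_of (Cls # Cls # w) j = prefixed False (link_of w) j" if "j \<in> {1..L + 2}" for j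
    using link_of_prefixed[OF l that, of False] by simp
  have P: "prefixed False (link_of w) j = LeftBdry" if "1 \<le> j" "j \<le> a + 2" for j
    using left[of "j - 2"] that by (simp add: prefixed_def)
  have Q: "prefixed False (link_of w) j = RightBdry" if "i + 2 < j" "L + 2 - b < j" "j \<le> L + 2" for j
    using right[of "j - 2"] that by (simp add: prefixed_def)
  have "i \<le> L" using base by simp
  thus ?case unfolding u_def id[OF order_refl] using lp P Q l a by auto
next
  case (step n)
  let ?N = "L + 2" and ?w = "u n"
  from step have l: "length ?w = ?N" by auto
  have u: "u (Suc n) = tgen ?N (n + 2) ?w" using step by (simp add: u_def)
  have j: "link_of (u (Suc n)) j = join_sites (n + 2) (link_of ?w) j" if "1 \<le> j" "j \<le> ?N" for j
    unfolding u by (rule link_of_tgen_bulk) (use l step that in auto)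
  from step have IH: "\<And>j. 1 \<le> j \<Longrightarrow> j \<le> a + 2 \<Longrightarrow> j \<le> i + 1 \<Longrightarrow> link_of ?w j = LeftBdry"
    "i < n \<Longrightarrow> link_of ?w (n + 1) = Site (n + 2)"
    "\<And>j. i + 2 \<le> j \<Longrightarrow> j < n + 1 \<Longrightarrow> L - b < j \<Longrightarrow> link_of ?w j = RightBdry"
    "\<And>j. n + 2 < j \<Longrightarrow> j \<le> ?N \<Longrightarrow> L + 2 - b < j \<Longrightarrow> link_of ?w j = RightBdry" by auto
  show ?case
  proof (intro conjI allI impI)
    show "length (u (Suc n)) = ?N" unfolding u using l step by simp
    show "link_of (u (Suc n)) (Suc n + 1) = Site (Suc n + 2)" using j[of "n + 2"] step by (simp add: join_sites_def)
  next
    fix m assume m: "1 \<le> m \<and> m \<le> a + 2 \<and> m \<le> i + 1"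
    show "link_of (u (Suc n)) m = LeftBdry"
      using j[of m] join_sites_away(1)[of m "n + 2" "link_of ?w"] IH(1)[of m] m step by simp
  next
    fix m assume m: "i + 2 \<le> m \<and> m < Suc n + 1 \<and> L - b < m"
    show "link_of (u (Suc n)) m = RightBdry"
    proof (cases "m = n + 1")
      case True
      have "i < n" using m True by linarith
      hence "link_of ?w m = Site (n + 2)" using IH(2) True by simp
      moreover have "n + 3 \<le> ?N" "?N - b < n + 3" using m True step(3) step.prems by linarith+
      hence "link_of ?w (n + 3) = RightBdry" by (intro IH(4)) auto
      ultimately show ?thesis using j[of m] m step True by (simp add: join_sites_def eval_nat_numeral)
    next
      case False
      thus ?thesis using j[of m] join_sites_away(2)[of m "n + 2" "link_of ?w"] IH(3)[of m] m step by simp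
    qed
  next
    fix m assume m: "Suc n + 2 < m \<and> m \<le> ?N \<and> ?N - b < m"
    show "link_of (u (Suc n)) m = RightBdry"
      using j[of m] join_sites_away(2)[of m "n + 2" "link_of ?w"] IH(4)[of m] m step by simp
  qed
qed

text \<open>Invariant of the upper row, drawn from right to left: the sites \<open>m\<close> and
  \<open>m + 1\<close> carry the arc created last, sites before \<open>m\<close> are as the lower
  row left them, and from \<open>m + 2\<close> on the left lines have moved by two sites to the
  right. At the start \<open>m = i + 2\<close> there is no such arc yet.\<close>

definition upper_state :: "nat \<Rightarrow> nat \<Rightarrow> nat \<Rightarrow> nat \<Rightarrow> nat \<Rightarrow> bracket list \<Rightarrow> bool" where
  "upper_state N i a r m u \<longleftrightarrow> length u = N \<and>
     (m \<le> i + 1 \<longrightarrow> link_of u (m + 1) = Site m) \<and>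
     (\<forall>j. 1 \<le> j \<and> j < m \<and> j \<le> a \<longrightarrow> link_of u j = LeftBdry) \<and>
     (\<forall>j. m + 2 \<le> j \<and> j \<le> i + 2 \<and> j \<le> a + 2 \<longrightarrow> link_of u j = LeftBdry) \<and>
     (\<forall>j. i + 2 < j \<and> r < j \<and> j \<le> N \<longrightarrow> link_of u j = RightBdry)"

lemma upper_state_step:
  assumes s: "upper_state N i a r (Suc m) u" and m: "1 \<le> m" "m \<le> i + 1" "i + 2 \<le> N"
  shows "upper_state N i a r m (tgen N m u)"
proof -
  have l: "length u = N" using s by (simp add: upper_state_def)
  have j: "link_of (tgen N m u) j = join_sites m (link_of u) j" if "1 \<le> j" "j \<le> N" for j
    by (rule link_of_tgen_bulk) (use l m that in auto)
  show ?thesis unfolding upper_state_def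
  proof (intro conjI allI impI)
    show "length (tgen N m u) = N" using l m by simp
    show "link_of (tgen N m u) (m + 1) = Site m" using j[of "m + 1"] m by (simp add: join_sites_def)
  next
    fix k assume k: "1 \<le> k \<and> k < m \<and> k \<le> a"
    hence "link_of u k = LeftBdry" using s unfolding upper_state_def by auto
    thus "link_of (tgen N m u) k = LeftBdry" using j[of k] join_sites_away(1)[of k m] k m by simp
  next
    fix k assume k: "m + 2 \<le> k \<and> k \<le> i + 2 \<and> k \<le> a + 2"
    show "link_of (tgen N m u) k = LeftBdry"
    proof (cases "k = m + 2")
      case True
      have "link_of u (m + 2) = Site (m + 1)" using s k True unfolding upper_state_def by auto
      moreover have "link_of u m = LeftBdry" using s k m True unfolding upper_state_def by auto
      ultimately show ?thesis using j[of k] True k m by (simp add: join_sites_def)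
    next
      case False
      hence "link_of u k = LeftBdry" using s k unfolding upper_state_def by auto
      thus ?thesis using j[of k] join_sites_away(1)[of k m] k m False by simp
    qed
  next
    fix k assume k: "i + 2 < k \<and> r < k \<and> k \<le> N"
    hence "link_of u k = RightBdry" using s unfolding upper_state_def by auto
    thus "link_of (tgen N m u) k = RightBdry" using j[of k] join_sites_away(2)[of k m] k m by simp
  qed
qed

lemma upper_row_open:
  assumes "upper_state N i a r (n + 2) u" "n \<le> i" "i + 2 \<le> N"
  shows "upper_state N i a r 1 (tgen N 1 (upper_row N {1..i} n u))"
  using assms
proof (induction n arbitrary: u)
  case 0
  then show ?case using upper_state_step[of N i a r 1 u] by simp
next
  case (Suc n)
  have "upper_state N i a r (n + 2) (tgen N (n + 2) u)"
    using upper_state_step[of N i a r "n + 2" u] Suc.prems by simp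
  from Suc.IH[OF this] Suc.prems show ?case by simp
qed

text \<open>Site \<open>j\<close> of the outcome is site \<open>j + 2\<close> before contraction.
  The open ends add two lines on either side, so among the first \<open>i\<close> sites the left
  lines grow from \<open>a\<close> to \<open>a + 2\<close>, and among the others the right lines
  from \<open>b\<close> to \<open>b + 2\<close>.\<close>

lemma open_diagram_step:
  assumes L: "1 \<le> L" and i: "i \<le> L" and a: "a \<le> i" and b: "b \<le> L - i" and l: "length w = L"
    and left: "\<And>j. 1 \<le> j \<Longrightarrow> j \<le> a \<Longrightarrow> link_of w j = LeftBdry"
    and right: "\<And>j. L - b < j \<Longrightarrow> j \<le> L \<Longrightarrow> link_of w j = RightBdry"
  shows "length (open_diagram L i w) = L"
    and "1 \<le> j \<Longrightarrow> j \<le> i \<Longrightarrow> j \<le> a + 2 \<Longrightarrow> link_of (open_diagram L i w) j = LeftBdry"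
    and "i < j \<Longrightarrow> L - (b + 2) < j \<Longrightarrow> j \<le> L \<Longrightarrow> link_of (open_diagram L i w) j = RightBdry"
proof -
  let ?N = "L + 2"
  define u where "u = lower_row ?N {1..i} L (Cls # Cls # w)"
  define v where "v = tgen ?N ?N u"
  have U: "length u = ?N" "\<And>j. 1 \<le> j \<Longrightarrow> j \<le> a + 2 \<Longrightarrow> j \<le> i + 1 \<Longrightarrow> link_of u j = LeftBdry"
    "i < L \<Longrightarrow> link_of u (L + 1) = Site (L + 2)"
    "\<And>j. i + 2 \<le> j \<Longrightarrow> j < L + 1 \<Longrightarrow> L - b < j \<Longrightarrow> link_of u j = RightBdry"
    using lower_row_open[OF i order_refl a b l left right] unfolding u_def by auto
  have V: "link_of v j = (if j = ?N \<or> link_of u j = Site ?N then RightBdry else link_of u j)" if "1 \<le> j" "j \<le> ?N" for j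
    unfolding v_def using link_of_tgen1[OF U(1), of ?N j] that by (simp add: act_def)
  have skip: "upper_row ?N {1..i} n x = upper_row ?N {1..i} i x" if "i \<le> n" for n x
    using that by (induction n rule: dec_induct) auto
  have "upper_state ?N i (min (a + 2) (i + 1)) (L - b) (i + 2) v"
    unfolding upper_state_def
  proof (intro conjI allI impI)
    show "length v = ?N" unfolding v_def using U(1) by simp
  next
    fix j assume j: "1 \<le> j \<and> j < i + 2 \<and> j \<le> min (a + 2) (i + 1)"
    hence "1 \<le> j" "j \<le> a + 2" "j \<le> i + 1" by auto
    hence "link_of u j = LeftBdry" by (rule U(2))
    thus "link_of v j = LeftBdry" using V[of j] j i by auto
  next
    fix j assume j: "i + 2 < j \<and> L - b < j \<and> j \<le> ?N"
    show "link_of v j = RightBdry"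
    proof (cases "j < L + 1")
      case True thus ?thesis using V[of j] U(4)[of j] j by auto
    next
      case False
      hence "j = L + 1 \<or> j = ?N" using j by auto
      thus ?thesis using V[of j] U(3) j by auto
    qed
  qed auto
  hence S: "upper_state ?N i (min (a + 2) (i + 1)) (L - b) 1 (tgen ?N 1 (upper_row ?N {1..i} i v))"
    using upper_row_open[of ?N i "min (a + 2) (i + 1)" "L - b" i v] i by simp
  define x where "x = upper_row ?N {1..i} i v"
  have o: "open_diagram L i w = contract L x"
    unfolding open_diagram_def x_def v_def u_def out_pattern_factor[OF l L] using skip[OF i] by simp
  have "length (tgen ?N 1 x) = ?N" using S unfolding x_def[symmetric] upper_state_def by simp
  hence lx: "length x = ?N" by simp
  show lo: "length (open_diagram L i w) = L" unfolding o contract_def using lx by simp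
  have lk: "link_of (tgen ?N 1 x) (j + 2) = prefixed True (link_of (contract L x)) (j + 2)" if "1 \<le> j" "j \<le> L" for j
    unfolding tgen_1_contract[OF lx] using link_of_prefixed[OF lo[unfolded o], of "j + 2" True] that by simp
  show "link_of (open_diagram L i w) j = LeftBdry" if "1 \<le> j" "j \<le> i" "j \<le> a + 2"
  proof -
    have "link_of (tgen ?N 1 x) (j + 2) = LeftBdry" using S that unfolding x_def[symmetric] upper_state_def by auto
    hence "prefixed True (link_of (contract L x)) (j + 2) = LeftBdry" using lk[of j] that i by simp
    thus ?thesis using that unfolding o by (auto simp: prefixed_def split: link.splits)
  qed
  show "link_of (open_diagram L i w) j = RightBdry" if "i < j" "L - (b + 2) < j" "j \<le> L"
  proof -
    have "link_of (tgen ?N 1 x) (j + 2) = RightBdry" using S that unfolding x_def[symmetric] upper_state_def by auto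
    hence "prefixed True (link_of (contract L x)) (j + 2) = RightBdry" using lk[of j] that i by simp
    thus ?thesis using that unfolding o by (auto simp: prefixed_def split: link.splits)
  qed
qed

lemma open_diagram_iterate:
  assumes L: "1 \<le> L" and i: "i \<le> L" and l: "length w = L"
  shows "length ((open_diagram L i ^^ n) w) = L \<and>
    (\<forall>j. 1 \<le> j \<and> j \<le> i \<and> j \<le> 2 * n \<longrightarrow> link_of ((open_diagram L i ^^ n) w) j = LeftBdry) \<and>
    (\<forall>j. i < j \<and> L - 2 * n < j \<and> j \<le> L \<longrightarrow> link_of ((open_diagram L i ^^ n) w) j = RightBdry)"
proof (induction n)
  case 0 then show ?case using l by auto
next
  case (Suc n)
  let ?x = "(open_diagram L i ^^ n) w"
  define a where "a = min i (2 * n)" define b where "b = min (L - i) (2 * n)"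
  have ab: "a \<le> i" "a \<le> 2 * n" "b \<le> L - i" "b \<le> 2 * n" by (auto simp: a_def b_def)
  have x: "length ?x = L" using Suc by simp
  have left: "link_of ?x j = LeftBdry" if "1 \<le> j" "j \<le> a" for j
  proof -
    have "j \<le> i" "j \<le> 2 * n" using ab that by linarith+
    thus ?thesis using Suc that by blast
  qed
  have right: "link_of ?x j = RightBdry" if "L - b < j" "j \<le> L" for j
  proof -
    have "i < j" "L - 2 * n < j" using ab that i by linarith+
    thus ?thesis using Suc that by blast
  qed
  note s = open_diagram_step[OF L i ab(1,3) x left right]
  show ?case
  proof (intro conjI allI impI)
    show "length ((open_diagram L i ^^ Suc n) w) = L" using s(1) by simp
    fix j
    assume j: "1 \<le> j \<and> j \<le> i \<and> j \<le> 2 * Suc n"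
    hence "j \<le> a + 2" unfolding a_def by (auto simp: min_def)
    thus "link_of ((open_diagram L i ^^ Suc n) w) j = LeftBdry" using s(2)[of j] j by simp
  next
    fix j
    assume j: "i < j \<and> L - 2 * Suc n < j \<and> j \<le> L"
    hence "L - (b + 2) < j" unfolding b_def by (auto simp: min_def)
    thus "link_of ((open_diagram L i ^^ Suc n) w) j = RightBdry" using s(3)[of j] j by simp
  qed
qed

text \<open>Each application claims two more sites from either side, until the first
  \<open>i\<close> are on the left boundary and the others on the right one; \<open>L\<close>
  applications are enough from any start.\<close>

lemma open_diagram_const:
  assumes "1 \<le> L" "i \<le> L" "\<alpha> \<in> LP L" "\<beta> \<in> LP L"
  shows "(open_diagram L i ^^ L) \<alpha> = (open_diagram L i ^^ L) \<beta>"
proof (rule link_of_inject)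
  have l: "length \<alpha> = L" "length \<beta> = L" using assms by (simp_all add: LP_def)
  note A = open_diagram_iterate[OF assms(1,2) l(1), of L] and B = open_diagram_iterate[OF assms(1,2) l(2), of L]
  show "length ((open_diagram L i ^^ L) \<alpha>) = L" "length ((open_diagram L i ^^ L) \<beta>) = L" using A B by auto
  fix j assume "j \<in> {1..L}"
  thus "link_of ((open_diagram L i ^^ L) \<alpha>) j = link_of ((open_diagram L i ^^ L) \<beta>) j"
    using A B by (cases "j \<le> i") auto
qed

section \<open>The transfer matrix at the special point\<close>

lemma prod_indicator:
  assumes "finite S" "A \<subseteq> S" "A0 \<subseteq> S"
    and "\<And>j. j \<in> S \<Longrightarrow> f j = (if j \<in> A \<longleftrightarrow> j \<in> A0 then 1 else (0 :: complex))"
  shows "prod f S = (if A = A0 then 1 else 0)"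
proof (cases "A = A0")
  case True thus ?thesis using assms(4) by simp
next
  case False
  then obtain j where "j \<in> S" "(j \<in> A) \<noteq> (j \<in> A0)" using assms by blast
  hence "f j = 0" using assms(4) by auto
  thus ?thesis using False \<open>j \<in> S\<close> assms(1) by (auto simp: prod_zero_iff)
qed

lemma br_q_nz [simp]: "br q \<noteq> 0"
proof
  assume "br q = 0"
  hence "q\<^sup>2 = q" using inverse_q by (simp add: br_def)
  hence "q = 1" using q_nz by (simp add: power2_eq_square)
  thus False using q_cubic by simp
qed

lemma br_q2: "br (q\<^sup>2) = - br q"
  using br_inverse[of q] unfolding inverse_q .

text \<open>At \<open>z_j = w\<close> the numerators of type II are \<open>br 1\<close> in the lower
  row and \<open>br (q / w\<^sup>2) = br (- 1)\<close> in the upper one; at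
  \<open>z_j = w / q\<close> those of type I are \<open>br 1\<close> and, up to sign,
  \<open>br (w\<^sup>2 / q) = br (- 1)\<close>. All of them vanish, and
  \<open>w\<^sup>2 = - q\<close> is what makes both rows degenerate together. The values of
  \<open>\<zeta>0\<close> and \<open>\<zeta>L\<close> make the weights of the closed ends
  vanish.\<close>

lemma T_special:
  assumes L: "1 \<le> L" and i: "i \<le> L" and w: "w\<^sup>2 = - q"
    and zA: "\<And>j. 1 \<le> j \<Longrightarrow> j \<le> i \<Longrightarrow> z j = w" and zB: "\<And>j. i < j \<Longrightarrow> j \<le> L \<Longrightarrow> z j = w / q"
    and z0: "\<zeta>0 = w \<or> \<zeta>0 = inverse w" and zL: "\<zeta>L = w / q \<or> \<zeta>L = q / w"
  shows "T_regular L w z \<zeta>0 \<zeta>L" and "C \<in> configs L \<Longrightarrow> weight L w z \<zeta>0 \<zeta>L C = (if C = ({1..i}, {1..i}, False, False) then 1 else 0)"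
proof -
  have nz: "w \<noteq> 0" using w by auto
  have one: "br 1 = 0" "br (- 1) = 0" by (simp_all add: br_def)
  have ww: "w * w = - q" using w by (simp add: power2_eq_square)
  have A: "br (q * w / w) = br q" "br (w / w) = 0" "br (w * w) = - br q" "br (q / (w * w)) = 0" "br (q * w * w) = br q"
    using nz one by (simp_all add: ww br_minus mult.assoc br_q2[unfolded power2_eq_square])
  have B: "br (q * (w / q) / w) = 0" "br (w / q / w) = - br q" "br (q * w / (w / q)) = - br q"
      "br (w / q * w) = 0" "br (q / (w / q * w)) = - br q" "br (q * (w / q) * w) = - br q"
    using nz one by (simp_all add: ww br_minus br_q2[unfolded power2_eq_square] br_inverse[of q, unfolded inverse_eq_divide])
  have k0: "kfun (q / w) \<zeta>0 = 0" "kfun (w / q) \<zeta>0 = br (inverse q) * br (q\<^sup>2 / w\<^sup>2)" "kfun (w / q) \<zeta>0 \<noteq> 0"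
  proof -
    have s: "kfun x \<zeta>0 = kfun x (inverse w)" for x using z0 kfun_inverse_zeta[of x w] by auto
    show "kfun (q / w) \<zeta>0 = 0" unfolding s using nz one by (simp add: kfun_def)
    have "kfun (w / q) (inverse w) = br (w / q / (q * inverse w)) * br (w / q * inverse w / q)" by (simp add: kfun_def)
    also have "w / q / (q * inverse w) = w * w / (q * q)" using nz by (simp add: field_simps)
    also have "w / q * inverse w / q = inverse q * inverse q" using nz by (simp add: field_simps)
    also have "br (w * w / (q * q)) = br q" unfolding ww using br_inverse[of q] by (simp add: br_minus inverse_eq_divide)
    also have "br (inverse q * inverse q) = br q"
      using br_inverse[of "q\<^sup>2"] br_q2 by (simp add: power2_eq_square)
    finally have e: "kfun (w / q) \<zeta>0 = br q * br q" unfolding s .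
    thus "kfun (w / q) \<zeta>0 \<noteq> 0" by simp
    have "br (q\<^sup>2 / w\<^sup>2) = - br q" unfolding w by (simp add: br_minus power2_eq_square)
    thus "kfun (w / q) \<zeta>0 = br (inverse q) * br (q\<^sup>2 / w\<^sup>2)" unfolding e br_inverse by simp
  qed
  have kL: "kfun w \<zeta>L = 0" "kfun (1 / w) \<zeta>L = br (inverse q) * br (w\<^sup>2)" "kfun (1 / w) \<zeta>L \<noteq> 0"
  proof -
    have s: "kfun x \<zeta>L = kfun x (w / q)" for x using zL kfun_inverse_zeta[of x "w / q"] by auto
    show "kfun w \<zeta>L = 0" unfolding s using nz one by (simp add: kfun_def)
    have "kfun (1 / w) (w / q) = br (1 / w / (q * (w / q))) * br (1 / w * (w / q) / q)" by (simp add: kfun_def)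
    also have "1 / w / (q * (w / q)) = inverse (w * w)" using nz by (simp add: field_simps)
    also have "1 / w * (w / q) / q = inverse q * inverse q" using nz by (simp add: field_simps)
    also have "br (inverse (w * w)) = br q" unfolding br_inverse A by simp
    also have "br (inverse q * inverse q) = br q"
      using br_inverse[of "q\<^sup>2"] br_q2 by (simp add: power2_eq_square)
    finally have e: "kfun (1 / w) \<zeta>L = br q * br q" unfolding s .
    thus "kfun (1 / w) \<zeta>L \<noteq> 0" by simp
    show "kfun (1 / w) \<zeta>L = br (inverse q) * br (w\<^sup>2)" unfolding e br_inverse power2_eq_square A by simp
  qed
  show "T_regular L w z \<zeta>0 \<zeta>L" unfolding T_regular_def
  proof (intro conjI ballI)
    fix j assume "j \<in> {1..L}"
    hence "z j = w \<or> z j = w / q" using zA zB by (metis atLeastAtMost_iff linorder_not_le)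
    thus "br (q * w / z j) \<noteq> 0" "br (q * z j * w) \<noteq> 0" using A B by (metis br_q_nz neg_equal_0_iff_equal)+
  qed (use nz k0 kL in auto)
  assume "C \<in> configs L"
  then obtain A' B' l r where C: "C = (A', B', l, r)" "A' \<subseteq> {1..L}" "B' \<subseteq> {1..L}" by (auto simp: configs_def)
  have 1: "(\<Prod>j\<in>{1..L}. (if j \<in> A' then br (q * z j / w) else br (z j / w)) / br (q * w / z j)) = (if A' = {1..i} then 1 else 0)"
  proof (rule prod_indicator)
    fix j assume j: "j \<in> {1..L}"
    show "(if j \<in> A' then br (q * z j / w) else br (z j / w)) / br (q * w / z j) = (if j \<in> A' \<longleftrightarrow> j \<in> {1..i} then 1 else 0)"
    proof (cases "j \<le> i")
      case True
      hence "z j = w" "j \<in> {1..i}" using zA j by auto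
      thus ?thesis by (simp only: A) simp
    next
      case False
      hence "z j = w / q" "j \<notin> {1..i}" using zB j by auto
      thus ?thesis by (simp only: B) simp
    qed
  qed (use C i in auto)
  have 2: "(\<Prod>j\<in>{1..L}. (if j \<in> B' then - br (z j * w) else br (q / (z j * w))) / br (q * z j * w)) = (if B' = {1..i} then 1 else 0)"
  proof (rule prod_indicator)
    fix j assume j: "j \<in> {1..L}"
    show "(if j \<in> B' then - br (z j * w) else br (q / (z j * w))) / br (q * z j * w) = (if j \<in> B' \<longleftrightarrow> j \<in> {1..i} then 1 else 0)"
    proof (cases "j \<le> i")
      case True
      hence "z j = w" "j \<in> {1..i}" using zA j by auto
      thus ?thesis by (simp only: A) simp
    next
      case False
      hence "z j = w / q" "j \<notin> {1..i}" using zB j by auto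
      thus ?thesis by (simp only: B) simp
    qed
  qed (use C i in auto)
  have 3: "(if l then kfun (q / w) \<zeta>0 else br (inverse q) * br (q\<^sup>2 / w\<^sup>2)) / kfun (w / q) \<zeta>0 = (if l then 0 else 1)"
    using k0 by simp
  have 4: "(if r then kfun w \<zeta>L else br (inverse q) * br (w\<^sup>2)) / kfun (1 / w) \<zeta>L = (if r then 0 else 1)"
    using kL by simp
  show "weight L w z \<zeta>0 \<zeta>L C = (if C = ({1..i}, {1..i}, False, False) then 1 else 0)"
    unfolding C(1) weight.simps 1 2 3 4 by simp
qed

text \<open>Stated for a single \<open>w\<close>, so that it is a condition on one finite matrix; a
  ground state is fixed at every regular \<open>w\<close>, hence at this one.\<close>

definition zero_sum_free :: "nat \<Rightarrow> complex \<Rightarrow> (nat \<Rightarrow> complex) \<Rightarrow> complex \<Rightarrow> complex \<Rightarrow> bool" where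
  "zero_sum_free L w z \<zeta>0 \<zeta>L \<longleftrightarrow> (\<forall>v. vec_eq L (T_op L w z \<zeta>0 \<zeta>L v) v \<longrightarrow> sum v (LP L) = 0 \<longrightarrow> (\<forall>\<alpha>\<in>LP L. v \<alpha> = 0))"

text \<open>Only one configuration survives, so a fixed vector is unchanged under the
  \<open>L\<close>-th iterate of a map of link patterns. That iterate is constant, so the vector is
  its coefficient sum times one basis vector.\<close>

lemma zero_sum_free_special:
  assumes L: "1 \<le> L" and i: "i \<le> L" and w: "w\<^sup>2 = - q"
    and zA: "\<And>j. 1 \<le> j \<Longrightarrow> j \<le> i \<Longrightarrow> z j = w" and zB: "\<And>j. i < j \<Longrightarrow> j \<le> L \<Longrightarrow> z j = w / q"
    and z0: "\<zeta>0 = w \<or> \<zeta>0 = inverse w" and zL: "\<zeta>L = w / q \<or> \<zeta>L = q / w"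
  shows "(\<Sum>\<alpha>\<in>LP L. v \<alpha> * Td L w z \<zeta>0 \<zeta>L \<phi> \<alpha>) = (\<Sum>\<alpha>\<in>LP L. v \<alpha> * \<phi> (open_diagram L i \<alpha>))"
    and "zero_sum_free L w z \<zeta>0 \<zeta>L"
proof -
  have c0: "({1..i}, {1..i}, False, False) \<in> configs L" using i by (auto simp: configs_def)
  have T: "Td L w z \<zeta>0 \<zeta>L \<phi> \<alpha> = \<phi> (open_diagram L i \<alpha>)" for \<phi> \<alpha>
  proof -
    have "Td L w z \<zeta>0 \<zeta>L \<phi> \<alpha> = (\<Sum>C\<in>configs L. if C = ({1..i}, {1..i}, False, False) then \<phi> (out_pattern L C \<alpha>) else 0)"
      unfolding Td_def using T_special(2)[OF L i w zA zB z0 zL] by (intro sum.cong) auto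
    also have "\<dots> = \<phi> (open_diagram L i \<alpha>)" using c0 by (simp add: open_diagram_def)
    finally show ?thesis .
  qed
  thus "(\<Sum>\<alpha>\<in>LP L. v \<alpha> * Td L w z \<zeta>0 \<zeta>L \<phi> \<alpha>) = (\<Sum>\<alpha>\<in>LP L. v \<alpha> * \<phi> (open_diagram L i \<alpha>))" for v \<phi> by simp
  show "zero_sum_free L w z \<zeta>0 \<zeta>L" unfolding zero_sum_free_def
  proof (intro allI impI ballI)
    fix v :: vec and \<beta> assume v: "vec_eq L (T_op L w z \<zeta>0 \<zeta>L v) v" "sum v (LP L) = 0" and \<beta>: "\<beta> \<in> LP L"
    have s: "(\<Sum>\<alpha>\<in>LP L. v \<alpha> * \<phi> (open_diagram L i \<alpha>)) = (\<Sum>\<alpha>\<in>LP L. v \<alpha> * \<phi> \<alpha>)" for \<phi>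
    proof -
      have "(\<Sum>\<alpha>\<in>LP L. v \<alpha> * \<phi> (open_diagram L i \<alpha>)) = (\<Sum>\<alpha>\<in>LP L. \<phi> \<alpha> * T_op L w z \<zeta>0 \<zeta>L v \<alpha>)"
        unfolding sum_T_op T ..
      also have "\<dots> = (\<Sum>\<alpha>\<in>LP L. v \<alpha> * \<phi> \<alpha>)" using v by (intro sum.cong) (auto simp: vec_eq_def)
      finally show ?thesis .
    qed
    have it: "(\<Sum>\<alpha>\<in>LP L. v \<alpha> * \<phi> ((open_diagram L i ^^ n) \<alpha>)) = (\<Sum>\<alpha>\<in>LP L. v \<alpha> * \<phi> \<alpha>)" for \<phi> n
    proof (induction n)
      case (Suc n)
      show ?case using s[of "\<lambda>\<alpha>. \<phi> ((open_diagram L i ^^ n) \<alpha>)"] Suc by (simp only: funpow_Suc_right comp_def)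
    qed simp
    let ?\<phi> = "\<lambda>\<gamma>. if \<gamma> = \<beta> then 1 else (0 :: complex)"
    have "v \<beta> = (\<Sum>\<alpha>\<in>LP L. v \<alpha> * ?\<phi> \<alpha>)" using \<beta> by (subst sum.remove[of _ \<beta>]) auto
    also have "\<dots> = (\<Sum>\<alpha>\<in>LP L. v \<alpha> * ?\<phi> ((open_diagram L i ^^ L) \<alpha>))" using it[of ?\<phi> L] by simp
    also have "\<dots> = (\<Sum>\<alpha>\<in>LP L. v \<alpha> * ?\<phi> ((open_diagram L i ^^ L) \<beta>))"
      using open_diagram_const[OF L i _ \<beta>] by (intro sum.cong) auto
    also have "\<dots> = 0" unfolding sum_distrib_right[symmetric] using v by simp
    finally show "v \<beta> = 0" .
  qed
qed

section \<open>Unique factorisation of Laurent polynomials\<close>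

text \<open>Rings are sets inside one type because the induction on the number of variables runs
  through \<open>pol_in V\<close> for growing \<open>V\<close> and must compare each of these rings
  with polynomials over the previous one.\<close>

definition subring_set :: "'a::idom set \<Rightarrow> bool" where
  "subring_set R \<longleftrightarrow> 0 \<in> R \<and> 1 \<in> R \<and> (\<forall>a\<in>R. \<forall>b\<in>R. a + b \<in> R \<and> a * b \<in> R) \<and> (\<forall>a\<in>R. - a \<in> R)"

definition dvd_in :: "'a::idom set \<Rightarrow> 'a \<Rightarrow> 'a \<Rightarrow> bool" where
  "dvd_in R a b \<longleftrightarrow> (\<exists>c\<in>R. b = a * c)"

definition prime_in :: "'a::idom set \<Rightarrow> 'a \<Rightarrow> bool" where
  "prime_in R p \<longleftrightarrow> p \<in> R \<and> p \<noteq> 0 \<and> \<not> dvd_in R p 1 \<and>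
     (\<forall>a\<in>R. \<forall>b\<in>R. dvd_in R p (a * b) \<longrightarrow> dvd_in R p a \<or> dvd_in R p b)"

text \<open>A domain is factorial as soon as every nonzero element is a unit times a product of
  primes. The number \<open>n\<close> of prime factors, counted with multiplicity, is the induction
  measure in \<open>primitive_part\<close>.\<close>

inductive prime_product :: "'a::idom set \<Rightarrow> nat \<Rightarrow> 'a \<Rightarrow> bool" for R where
  unit: "u \<in> R \<Longrightarrow> dvd_in R u 1 \<Longrightarrow> prime_product R 0 u"
| prime: "prime_in R p \<Longrightarrow> prime_product R n x \<Longrightarrow> prime_product R (Suc n) (p * x)"

definition ufd_set :: "'a::idom set \<Rightarrow> bool" where
  "ufd_set R \<longleftrightarrow> subring_set R \<and> (\<forall>x\<in>R. x \<noteq> 0 \<longrightarrow> (\<exists>n. prime_product R n x))"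

lemma subring_setD:
  assumes "subring_set R"
  shows "0 \<in> R" "1 \<in> R" "a \<in> R \<Longrightarrow> b \<in> R \<Longrightarrow> a + b \<in> R" "a \<in> R \<Longrightarrow> b \<in> R \<Longrightarrow> a * b \<in> R"
    "a \<in> R \<Longrightarrow> - a \<in> R" "a \<in> R \<Longrightarrow> b \<in> R \<Longrightarrow> a - b \<in> R"
proof -
  show 1: "0 \<in> R" "1 \<in> R" "\<And>a b. a \<in> R \<Longrightarrow> b \<in> R \<Longrightarrow> a + b \<in> R" "a \<in> R \<Longrightarrow> b \<in> R \<Longrightarrow> a * b \<in> R"
    "\<And>a. a \<in> R \<Longrightarrow> - a \<in> R" using assms by (auto simp: subring_set_def)
  show "a \<in> R \<Longrightarrow> b \<in> R \<Longrightarrow> a - b \<in> R" using 1(3)[of a "- b"] 1(5)[of b] by simp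
qed

lemma subring_set_sum: "subring_set R \<Longrightarrow> (\<And>i. i \<in> S \<Longrightarrow> f i \<in> R) \<Longrightarrow> sum f S \<in> R"
  by (induction S rule: infinite_finite_induct) (auto simp: subring_set_def)

lemma dvd_in_refl: "subring_set R \<Longrightarrow> dvd_in R a a"
  unfolding dvd_in_def using subring_setD(2)[of R] by (intro bexI[of _ 1]) auto

lemma dvd_in_mult: "subring_set R \<Longrightarrow> dvd_in R a b \<Longrightarrow> c \<in> R \<Longrightarrow> dvd_in R a (b * c)"
  unfolding dvd_in_def using subring_setD(4)[of R] by (metis mult.assoc)

lemma dvd_in_trans: "subring_set R \<Longrightarrow> dvd_in R a b \<Longrightarrow> dvd_in R b c \<Longrightarrow> dvd_in R a c"
  unfolding dvd_in_def using subring_setD(4)[of R] by (metis mult.assoc)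

lemma dvd_in_add: "subring_set R \<Longrightarrow> dvd_in R a b \<Longrightarrow> dvd_in R a c \<Longrightarrow> dvd_in R a (b + c)"
  unfolding dvd_in_def using subring_setD(3)[of R] by (metis distrib_left)

lemma dvd_in_diff: "subring_set R \<Longrightarrow> dvd_in R a b \<Longrightarrow> dvd_in R a c \<Longrightarrow> dvd_in R a (b - c)"
  unfolding dvd_in_def using subring_setD(6)[of R] by (metis right_diff_distrib)

lemma dvd_in_sum: "subring_set R \<Longrightarrow> (\<And>i. i \<in> S \<Longrightarrow> dvd_in R a (f i)) \<Longrightarrow> dvd_in R a (sum f S)"
proof (induction S rule: infinite_finite_induct)
  case (insert x F)
  then show ?case using dvd_in_add[of R a "f x" "sum f F"] by simp
qed (auto simp: dvd_in_def intro!: bexI[of _ 0] subring_setD)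

lemma prime_product_in:
  assumes "subring_set R" "prime_product R n x" shows "x \<in> R \<and> x \<noteq> 0"
  using assms(2,1)
proof (induction rule: prime_product.induct)
  case (unit u)
  then show ?case by (auto simp: dvd_in_def)
next
  case (prime p n x)
  then show ?case by (auto simp: prime_in_def subring_setD)
qed

lemma prime_product_unit_mult:
  assumes "subring_set R" "prime_product R n x" "u \<in> R" "dvd_in R u 1"
  shows "prime_product R n (u * x)"
  using assms(2,1,3,4)
proof (induction arbitrary: u rule: prime_product.induct)
  case (unit v)
  from unit obtain a b where "a \<in> R" "1 = v * a" "b \<in> R" "1 = u * b" by (auto simp: dvd_in_def)
  hence "1 = u * v * (b * a)" by (metis mult.assoc mult.commute mult_1_right)
  hence "dvd_in R (u * v) 1" using \<open>a \<in> R\<close> \<open>b \<in> R\<close> unit subring_setD(4)[of R] by (auto simp: dvd_in_def)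
  thus ?case using unit by (intro prime_product.unit) (auto simp: subring_setD)
next
  case (prime p n x)
  thus ?case using prime_product.prime[of R p n "u * x"] by (simp add: mult.left_commute)
qed

lemma prime_product_mult:
  assumes "subring_set R" "prime_product R n x" "prime_product R m y"
  shows "prime_product R (n + m) (x * y)"
  using assms(2,1,3)
proof (induction rule: prime_product.induct)
  case (unit u)
  then show ?case using prime_product_unit_mult by simp
next
  case (prime p n x)
  then show ?case using prime_product.prime[of R p "n + m" "x * y"] by (simp add: mult.assoc)
qed

text \<open>The prime \<open>p\<close> divides a factor of \<open>z\<close>; if that factor is
  itself prime, the two are associated. So dividing by a prime shortens the factorisation, which
  makes the splitting off of constants terminate.\<close>

lemma prime_product_cancel:
  assumes R: "subring_set R"
  shows "prime_product R n z \<Longrightarrow> z = p * y \<Longrightarrow> prime_in R p \<Longrightarrow> y \<in> R \<Longrightarrow> \<exists>m<n. prime_product R m y"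
proof (induction arbitrary: y rule: prime_product.induct)
  case (unit u)
  then obtain a where "a \<in> R" "1 = u * a" by (auto simp: dvd_in_def)
  hence "1 = p * (y * a)" using unit by (simp add: mult.assoc)
  hence "dvd_in R p 1" using unit \<open>a \<in> R\<close> subring_setD(4)[OF R] by (auto simp: dvd_in_def)
  thus ?case using unit by (simp add: prime_in_def)
next
  case (prime p1 n x)
  have x: "x \<in> R" using prime_product_in[OF R] prime by blast
  have p0: "p \<noteq> 0" "p \<in> R" "p1 \<noteq> 0" "p1 \<in> R" using prime by (auto simp: prime_in_def)
  have "dvd_in R p (p1 * x)" using prime by (auto simp: dvd_in_def)
  then consider "dvd_in R p x" | "dvd_in R p p1" using prime.prems(2) p0 x by (auto simp: prime_in_def)
  then show ?case
  proof cases
    case 1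
    then obtain y' where y': "y' \<in> R" "x = p * y'" by (auto simp: dvd_in_def)
    then obtain m where m: "m < n" "prime_product R m y'" using prime.IH prime.prems by blast
    have "p * y = p * (p1 * y')"
      using prime.prems(1)[symmetric] unfolding y'(2) by (simp only: mult.left_commute[of p1 p])
    hence "y = p1 * y'" using p0(1) by simp
    hence "prime_product R (Suc m) y" using prime_product.prime[OF prime.hyps(1) m(2)] by simp
    thus ?thesis using m by auto
  next
    case 2
    then obtain e where e: "e \<in> R" "p1 = p * e" by (auto simp: dvd_in_def)
    have "dvd_in R p1 (p * e)" using e dvd_in_refl[OF R] by simp
    then consider "dvd_in R p1 p" | "dvd_in R p1 e" using prime.hyps(1) p0 e by (auto simp: prime_in_def)
    then have "dvd_in R e 1"
    proof cases
      case 1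
      then obtain f where f: "f \<in> R" "p = p1 * f" by (auto simp: dvd_in_def)
      hence "p * 1 = p * (e * f)" using e by (simp add: mult_ac)
      hence "1 = e * f" using p0 by (metis mult_left_cancel)
      thus ?thesis using f by (auto simp: dvd_in_def)
    next
      case 2
      then obtain f where f: "f \<in> R" "e = p1 * f" by (auto simp: dvd_in_def)
      have "p1 = p * e" by (rule e(2))
      also have "\<dots> = p1 * (p * f)" unfolding f(2) by (simp only: mult.left_commute)
      finally have "p1 * 1 = p1 * (p * f)" by simp
      hence "1 = p * f" using p0 by (metis mult_left_cancel)
      hence "dvd_in R p 1" using f by (auto simp: dvd_in_def)
      thus ?thesis using prime.prems(2) by (simp add: prime_in_def)
    qed
    moreover have "p * y = p * (e * x)" using prime.prems(1)[symmetric] unfolding e(2) by (simp only: mult.assoc)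
    hence "y = e * x" using p0(1) by simp
    ultimately have "prime_product R n y" using prime_product_unit_mult[OF R prime.hyps(2) e(1)] by simp
    thus ?thesis by auto
  qed
qed

section \<open>Gauss's lemma for polynomials over a factorial ring\<close>

definition polys :: "'a::idom set \<Rightarrow> 'a poly set" where
  "polys R = {P. \<forall>k. coeff P k \<in> R}"

lemma subring_polys: "subring_set R \<Longrightarrow> subring_set (polys R)"
  unfolding subring_set_def[of "polys R"] unfolding polys_def
  by (auto simp: subring_setD coeff_mult intro!: subring_set_sum)

lemma const_polys: "subring_set R \<Longrightarrow> c \<in> R \<Longrightarrow> [:c:] \<in> polys R"
  by (auto simp: polys_def coeff_pCons subring_setD split: nat.split)

lemma monom_polys: "subring_set R \<Longrightarrow> c \<in> R \<Longrightarrow> monom c n \<in> polys R"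
  by (auto simp: polys_def subring_setD)

lemma const_dvd_polys:
  assumes "subring_set R"
  shows "dvd_in (polys R) [:c:] P \<longleftrightarrow> (\<forall>k. dvd_in R c (coeff P k))"
proof
  assume "dvd_in (polys R) [:c:] P"
  thus "\<forall>k. dvd_in R c (coeff P k)" by (auto simp: dvd_in_def polys_def)
next
  assume "\<forall>k. dvd_in R c (coeff P k)"
  then obtain f where f: "\<And>k. f k \<in> R" "\<And>k. coeff P k = c * f k" unfolding dvd_in_def by metis
  define Q where "Q = (\<Sum>k\<le>degree P. monom (f k) k)"
  have cQ: "coeff Q k = (if k \<le> degree P then f k else 0)" for k
    by (simp add: Q_def coeff_sum)
  have "P = [:c:] * Q"
  proof (rule poly_eqI)
    fix k show "coeff P k = coeff ([:c:] * Q) k"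
      by (cases "k \<le> degree P") (simp_all add: cQ f(2)[of k, symmetric] coeff_eq_0)
  qed
  moreover have "Q \<in> polys R" using f(1) assms by (auto simp: polys_def cQ subring_setD)
  ultimately show "dvd_in (polys R) [:c:] P" by (auto simp: dvd_in_def)
qed

text \<open>If \<open>p\<close> divides neither polynomial, take the first coefficients, of index
  \<open>i\<close> and \<open>j\<close>, that it does not divide: in the coefficient of index
  \<open>i + j\<close> of the product all other summands are divisible by \<open>p\<close>.\<close>

lemma prime_in_const_poly:
  assumes R: "subring_set R" and p: "prime_in R p"
  shows "prime_in (polys R) [:p:]"
proof -
  have "\<not> dvd_in (polys R) [:p:] 1"
    unfolding const_dvd_polys[OF R] using p by (auto simp: prime_in_def coeff_1 dest!: spec[of _ 0])
  moreover have "dvd_in (polys R) [:p:] P \<or> dvd_in (polys R) [:p:] Q"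
    if PQ: "P \<in> polys R" "Q \<in> polys R" "dvd_in (polys R) [:p:] (P * Q)" for P Q
  proof (rule ccontr)
    assume "\<not> ?thesis"
    hence ex: "\<exists>i. \<not> dvd_in R p (coeff P i)" "\<exists>j. \<not> dvd_in R p (coeff Q j)"
      unfolding const_dvd_polys[OF R] by auto
    define i where "i = (LEAST i. \<not> dvd_in R p (coeff P i))"
    define j where "j = (LEAST j. \<not> dvd_in R p (coeff Q j))"
    have i: "\<not> dvd_in R p (coeff P i)" "\<And>k. k < i \<Longrightarrow> dvd_in R p (coeff P k)"
      using LeastI_ex[OF ex(1)] not_less_Least unfolding i_def by auto
    have j: "\<not> dvd_in R p (coeff Q j)" "\<And>k. k < j \<Longrightarrow> dvd_in R p (coeff Q k)"
      using LeastI_ex[OF ex(2)] not_less_Least unfolding j_def by auto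
    have in_R: "coeff P k \<in> R" "coeff Q k \<in> R" for k using PQ by (auto simp: polys_def)
    have d: "dvd_in R p (coeff (P * Q) (i + j))" using PQ(3) unfolding const_dvd_polys[OF R] by blast
    have eq: "coeff (P * Q) (i + j) = coeff P i * coeff Q j + (\<Sum>k\<in>{..i + j} - {i}. coeff P k * coeff Q (i + j - k))"
      unfolding coeff_mult by (subst sum.remove[of _ i]) auto
    have ds: "dvd_in R p (\<Sum>k\<in>{..i + j} - {i}. coeff P k * coeff Q (i + j - k))"
    proof (rule dvd_in_sum[OF R])
      fix k assume k: "k \<in> {..i + j} - {i}"
      show "dvd_in R p (coeff P k * coeff Q (i + j - k))"
      proof (cases "k < i")
        case True
        thus ?thesis by (intro dvd_in_mult[OF R] i in_R)
      next
        case False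
        hence "i + j - k < j" using k by auto
        hence "dvd_in R p (coeff Q (i + j - k) * coeff P k)" by (intro dvd_in_mult[OF R] j in_R)
        thus ?thesis by (simp add: mult.commute)
      qed
    qed
    have "dvd_in R p (coeff P i * coeff Q j)"
      using dvd_in_diff[OF R d ds] unfolding eq by simp
    hence "dvd_in R p (coeff P i) \<or> dvd_in R p (coeff Q j)" using p in_R unfolding prime_in_def by blast
    thus False using i(1) j(1) by blast
  qed
  ultimately show ?thesis using p const_polys[OF R] by (auto simp: prime_in_def)
qed

lemma prime_product_const_poly:
  assumes R: "subring_set R" shows "prime_product R n c \<Longrightarrow> prime_product (polys R) n [:c:]"
proof (induction rule: prime_product.induct)
  case (unit u)
  then obtain a where "a \<in> R" "1 = u * a" by (auto simp: dvd_in_def)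
  hence "dvd_in (polys R) [:u:] 1" using const_polys[OF R] unfolding dvd_in_def
    by (intro bexI[of _ "[:a:]"]) (auto simp: one_pCons mult.commute)
  thus ?case using unit const_polys[OF R] by (intro prime_product.unit)
next
  case (prime p n x)
  then show ?case using prime_product.prime[OF prime_in_const_poly[OF R prime.hyps(1)], of n "[:x:]"] by (simp add: mult.commute)
qed

definition primitive :: "'a::idom set \<Rightarrow> 'a poly \<Rightarrow> bool" where
  "primitive R P \<longleftrightarrow> P \<in> polys R \<and> P \<noteq> 0 \<and> (\<forall>p. prime_in R p \<longrightarrow> \<not> dvd_in (polys R) [:p:] P)"

text \<open>Prime constants are split off one at a time; each lowers the number of prime factors of
  the leading coefficient.\<close>

lemma primitive_part:
  assumes R: "ufd_set R" and P: "P \<in> polys R" "P \<noteq> 0"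
  obtains c P0 where "c \<in> R" "c \<noteq> 0" "primitive R P0" "P = [:c:] * P0"
proof -
  have S: "subring_set R" using R by (simp add: ufd_set_def)
  have "\<exists>c P0. c \<in> R \<and> c \<noteq> 0 \<and> primitive R P0 \<and> P = [:c:] * P0"
    if "prime_product R n (lead_coeff P)" "P \<in> polys R" "P \<noteq> 0" for n
    using that
  proof (induction n arbitrary: P rule: less_induct)
    case (less n)
    show ?case
    proof (cases "primitive R P")
      case True
      thus ?thesis using subring_setD(2)[OF S] by (intro exI[of _ 1] exI[of _ P]) auto
    next
      case False
      then obtain p Q where p: "prime_in R p" "Q \<in> polys R" "P = [:p:] * Q"
        using less.prems by (auto simp: primitive_def dvd_in_def)
      have Q0: "Q \<noteq> 0" using p less.prems by auto
      have pR: "p \<in> R" "p \<noteq> 0" using p by (auto simp: prime_in_def)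
      have lc: "lead_coeff P = p * lead_coeff Q" using p pR by simp
      obtain m where m: "m < n" "prime_product R m (lead_coeff Q)"
        using prime_product_cancel[OF S less.prems(1) lc p(1)] p(2) by (auto simp: polys_def)
      obtain c P0 where c: "c \<in> R" "c \<noteq> 0" "primitive R P0" "Q = [:c:] * P0"
        using less.IH[OF m p(2) Q0] by blast
      have "P = [:p * c:] * P0" unfolding p(3) c(4) by (simp add: mult_ac)
      thus ?thesis using c pR subring_setD(4)[OF S] by (intro exI[of _ "p * c"] exI[of _ P0]) auto
    qed
  qed
  moreover have "lead_coeff P \<in> R" "lead_coeff P \<noteq> 0" using P by (auto simp: polys_def)
  then obtain n where "prime_product R n (lead_coeff P)"
    using R unfolding ufd_set_def by blast
  ultimately show ?thesis using P that by blast
qed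

text \<open>The primes of the constant \<open>c\<close> are cancelled one by one: each divides
  \<open>m * u\<close> but not the primitive \<open>m\<close>, hence it divides
  \<open>u\<close>.\<close>

lemma primitive_dvd:
  assumes R: "subring_set R" and m: "primitive R m"
  shows "prime_product R n c \<Longrightarrow> f \<in> polys R \<Longrightarrow> u \<in> polys R \<Longrightarrow> [:c:] * f = m * u \<Longrightarrow> dvd_in (polys R) m f"
proof (induction arbitrary: u rule: prime_product.induct)
  note D = subring_polys[OF R]
  case (unit c)
  then obtain d where d: "d \<in> R" "1 = c * d" by (auto simp: dvd_in_def)
  have cd: "d * c = 1" "c * d = 1" using d by (simp_all add: mult.commute)
  hence "f = [:d:] * ([:c:] * f)" by simp
  also have "\<dots> = m * ([:d:] * u)" unfolding unit.prems(3) by (simp add: mult_ac)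
  finally show ?case using subring_setD(4)[OF D const_polys[OF R d(1)] unit.prems(2)] unfolding dvd_in_def by blast
next
  note D = subring_polys[OF R]
  case (prime p n x)
  have x: "x \<in> R" using prime_product_in[OF R prime.hyps(2)] by simp
  have "m * u = [:p:] * ([:x:] * f)" using prime.prems(3)[symmetric] by (simp add: mult_ac)
  moreover have "[:x:] * f \<in> polys R" by (intro subring_setD(4)[OF D] const_polys[OF R] x prime.prems)
  ultimately have "dvd_in (polys R) [:p:] (m * u)" unfolding dvd_in_def by blast
  moreover have "m \<in> polys R" "\<not> dvd_in (polys R) [:p:] m" using m prime.hyps(1) by (auto simp: primitive_def)
  ultimately have "dvd_in (polys R) [:p:] u"
    using prime_in_const_poly[OF R prime.hyps(1)] prime.prems(2) by (auto simp: prime_in_def)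
  then obtain u' where u': "u' \<in> polys R" "u = [:p:] * u'" by (auto simp: dvd_in_def)
  have p0: "[:p:] \<noteq> 0" using prime.hyps(1) by (simp add: prime_in_def)
  have "[:p:] * ([:x:] * f) = [:p:] * (m * u')" using \<open>m * u = [:p:] * ([:x:] * f)\<close> u' by (simp add: mult_ac)
  hence "[:x:] * f = m * u'" using p0 mult_left_cancel by blast
  thus ?case using prime.IH prime.prems u' by blast
qed

text \<open>Euclid's lemma: an element of least degree of the ideal generated by \<open>f\<close> and \<open>g\<close> divides both
  up to constants, by pseudo-division.\<close>

lemma irreducible_primitive_prime:
  assumes R: "ufd_set R" and f: "primitive R f" "\<not> dvd_in (polys R) f 1"
    and irr: "\<And>g h. g \<in> polys R \<Longrightarrow> h \<in> polys R \<Longrightarrow> f = g * h \<Longrightarrow> dvd_in (polys R) g 1 \<or> dvd_in (polys R) h 1"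
  shows "prime_in (polys R) f"
proof -
  have S: "subring_set R" using R by (simp add: ufd_set_def)
  note D = subring_polys[OF S]
  have fR: "f \<in> polys R" "f \<noteq> 0" using f by (auto simp: primitive_def)
  have pp: "\<exists>n. prime_product R n c" if "c \<in> R" "c \<noteq> 0" for c using R that by (simp add: ufd_set_def)
  have "dvd_in (polys R) f h" if g: "g \<in> polys R" and h: "h \<in> polys R" and fgh: "dvd_in (polys R) f (g * h)"
    and nd: "\<not> dvd_in (polys R) f g" for g h
  proof -
    define I where "I = {a * f + b * g | a b. a \<in> polys R \<and> b \<in> polys R}"
    have I1: "a * x \<in> I" if "a \<in> polys R" "x \<in> I" for a x
    proof -
      from that obtain b c where "b \<in> polys R" "c \<in> polys R" "x = b * f + c * g" by (auto simp: I_def)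
      hence "a * x = (a * b) * f + (a * c) * g" "a * b \<in> polys R" "a * c \<in> polys R"
        using that subring_setD(4)[OF D] by (auto simp: algebra_simps)
      thus ?thesis unfolding I_def by blast
    qed
    have I2: "x - y \<in> I" if "x \<in> I" "y \<in> I" for x y
    proof -
      from that obtain b c b' c' where "b \<in> polys R" "c \<in> polys R" "x = b * f + c * g"
        "b' \<in> polys R" "c' \<in> polys R" "y = b' * f + c' * g" by (auto simp: I_def)
      hence "x - y = (b - b') * f + (c - c') * g" "b - b' \<in> polys R" "c - c' \<in> polys R"
        using subring_setD(6)[OF D] by (auto simp: algebra_simps)
      thus ?thesis unfolding I_def by blast
    qed
    have fI: "f \<in> I" unfolding I_def using subring_setD(1,2)[OF D] by (intro CollectI exI[of _ 1] exI[of _ 0]) auto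
    have gI: "g \<in> I" unfolding I_def using subring_setD(1,2)[OF D] by (intro CollectI exI[of _ 0] exI[of _ 1]) auto
    have IR: "x \<in> polys R" if "x \<in> I" for x
      using that subring_setD(3,4)[OF D] fR(1) g unfolding I_def by auto
    define k where "k = (LEAST k. \<exists>x\<in>I. x \<noteq> 0 \<and> degree x = k)"
    have ex: "\<exists>k. \<exists>x\<in>I. x \<noteq> 0 \<and> degree x = k" using fI fR by blast
    obtain m0 where m0: "m0 \<in> I" "m0 \<noteq> 0" "degree m0 = k" using LeastI_ex[OF ex] unfolding k_def by blast
    have min: "k \<le> degree x" if "x \<in> I" "x \<noteq> 0" for x unfolding k_def using that by (intro Least_le) blast
    obtain c m where c: "c \<in> R" "c \<noteq> 0" "primitive R m" "m0 = [:c:] * m"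
      using primitive_part[OF R IR[OF m0(1)] m0(2)] by blast
    have mR: "m \<in> polys R" using c by (simp add: primitive_def)
    have div: "\<exists>d u. d \<in> R \<and> d \<noteq> 0 \<and> u \<in> polys R \<and> [:d:] * x = m0 * u" if "x \<in> I" for x
      using that
    proof (induction "degree x" arbitrary: x rule: less_induct)
      case less
      show ?case
      proof (cases "x = 0")
        case True
        thus ?thesis using subring_setD(1,2)[OF S] subring_setD(1)[OF D] by (intro exI[of _ 1] exI[of _ 0]) auto
      next
        case False
        define t where "t = monom (lead_coeff x) (degree x - degree m0)"
        define y where "y = [:lead_coeff m0:] * x - t * m0"
        have deg: "degree m0 \<le> degree x" using min[OF less.prems False] m0 by simp
        have l0: "lead_coeff m0 \<in> R" "lead_coeff m0 \<noteq> 0" "lead_coeff x \<in> R"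
          using IR[OF m0(1)] IR[OF less.prems] m0 by (auto simp: polys_def)
        have tR: "t \<in> polys R" unfolding t_def by (rule monom_polys[OF S l0(3)])
        have yI: "y \<in> I" unfolding y_def by (intro I1 I2 const_polys[OF S] l0 tR less.prems m0)
        have tm: "degree (t * m0) = degree x"
        proof -
          have lx: "lead_coeff x \<noteq> 0" using False by simp
          have "degree t = degree x - degree m0" unfolding t_def by (rule degree_monom_eq[OF lx])
          moreover have "t \<noteq> 0" using lx unfolding t_def monom_eq_0_iff .
          ultimately show ?thesis using m0(2) deg by (simp add: degree_mult_eq)
        qed
        have "degree y \<le> degree x" unfolding y_def
          by (rule order.trans[OF degree_diff_le_max]) (use tm l0 in auto)
        moreover have "coeff y (degree x) = 0"
        proof -
          have "coeff (t * m0) (degree x) = lead_coeff t * lead_coeff m0"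
            using tm lead_coeff_mult[of t m0] by simp
          also have "lead_coeff t = lead_coeff x" unfolding t_def by (rule lead_coeff_monom)
          finally show ?thesis by (simp add: y_def mult.commute)
        qed
        ultimately have y: "y = 0 \<or> degree y < degree x"
          by (metis eq_zero_or_degree_less)
        have "\<exists>d u. d \<in> R \<and> d \<noteq> 0 \<and> u \<in> polys R \<and> [:d:] * y = m0 * u"
        proof (cases "y = 0")
          case True
          thus ?thesis using subring_setD(1,2)[OF S] subring_setD(1)[OF D] by (intro exI[of _ 1] exI[of _ 0]) auto
        next
          case False thus ?thesis using less.hyps[OF _ yI] y by blast
        qed
        then obtain d u where d: "d \<in> R" "d \<noteq> 0" "u \<in> polys R" "[:d:] * y = m0 * u" by blast
        have "[:d * lead_coeff m0:] * x = [:d:] * ([:lead_coeff m0:] * x)" by (simp add: mult_ac)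
        also have "\<dots> = [:d:] * y + [:d:] * (t * m0)" unfolding y_def by (simp add: right_diff_distrib smult_diff_right)
        also have "\<dots> = m0 * (u + [:d:] * t)" unfolding d(4) by (simp add: algebra_simps)
        finally have e: "[:d * lead_coeff m0:] * x = m0 * (u + [:d:] * t)" .
        moreover have "d * lead_coeff m0 \<in> R" "d * lead_coeff m0 \<noteq> 0" using d l0 subring_setD(4)[OF S] by auto
        moreover have "u + [:d:] * t \<in> polys R"
          by (intro subring_setD(3,4)[OF D] const_polys[OF S] d tR)
        ultimately show ?thesis by blast
      qed
    qed
    have mdvd: "dvd_in (polys R) m x" if x: "x \<in> I" for x
    proof -
      obtain d u where d: "d \<in> R" "d \<noteq> 0" "u \<in> polys R" "[:d:] * x = m0 * u" using div[OF x] by blast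
      obtain n where "prime_product R n d" using pp d by blast
      moreover have "[:d:] * x = m * ([:c:] * u)" unfolding d(4) c(4) by (simp add: mult_ac)
      moreover have "[:c:] * u \<in> polys R" by (intro subring_setD(4)[OF D] const_polys[OF S] c d)
      ultimately show ?thesis using primitive_dvd[OF S c(3)] IR[OF x] by blast
    qed
    obtain t where t: "t \<in> polys R" "f = m * t" using mdvd[OF fI] by (auto simp: dvd_in_def)
    \<comment> \<open>If the cofactor \<open>t\<close> of \<open>m\<close> in \<open>f\<close> were
      a unit, \<open>f\<close> would divide \<open>m\<close> and hence \<open>g\<close>. So
      irreducibility makes \<open>m\<close> a unit, and the ideal contains the nonzero constant
      \<open>c\<close>; multiplying its representation by \<open>h\<close> shows that
      \<open>f\<close> divides a constant multiple of \<open>h\<close>.\<close>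
    have "\<not> dvd_in (polys R) t 1"
    proof
      assume "dvd_in (polys R) t 1"
      then obtain t' where t': "t' \<in> polys R" "1 = t * t'" by (auto simp: dvd_in_def)
      hence "m = f * t'" using t by (simp add: mult.assoc flip: t'(2))
      hence "dvd_in (polys R) f m" using t' by (auto simp: dvd_in_def)
      thus False using nd dvd_in_trans[OF D] mdvd[OF gI] by blast
    qed
    hence "dvd_in (polys R) m 1" using irr[OF mR t] by blast
    then obtain m' where m': "m' \<in> polys R" "1 = m * m'" by (auto simp: dvd_in_def)
    have "m' * m0 = [:c:] * (m * m')" unfolding c(4) by (simp only: mult_ac)
    also have "\<dots> = [:c:]" unfolding m'(2)[symmetric] by simp
    finally have "[:c:] = m' * m0" by simp
    hence "[:c:] \<in> I" using I1[OF m'(1) m0(1)] by simp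
    then obtain a b where ab: "a \<in> polys R" "b \<in> polys R" "[:c:] = a * f + b * g" by (auto simp: I_def)
    obtain k where k: "k \<in> polys R" "g * h = f * k" using fgh by (auto simp: dvd_in_def)
    have "[:c:] * h = a * f * h + b * (g * h)" unfolding ab(3) by (simp add: algebra_simps)
    also have "\<dots> = f * (a * h + b * k)" unfolding k(2) by (simp add: algebra_simps)
    finally have "[:c:] * h = f * (a * h + b * k)" .
    moreover have "a * h + b * k \<in> polys R" by (intro subring_setD(3,4)[OF D] ab k h)
    moreover obtain n where "prime_product R n c" using pp c by blast
    ultimately show ?thesis using primitive_dvd[OF S f(1)] h by blast
  qed
  thus ?thesis using fR f(2) unfolding prime_in_def by blast
qed

text \<open>Constants factor in \<open>R\<close>. A primitive constant has no prime factor and is a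
  unit, so a primitive polynomial that splits into two nonunits splits into factors of smaller
  degree; one that does not split is prime by Euclid's lemma.\<close>

theorem ufd_polys:
  assumes R: "ufd_set R"
  shows "ufd_set (polys R)"
proof -
  have S: "subring_set R" using R by (simp add: ufd_set_def)
  note D = subring_polys[OF S]
  have prim: "\<exists>n. prime_product (polys R) n P" if "primitive R P" for P
    using that
  proof (induction "degree P" arbitrary: P rule: less_induct)
    case less
    have P: "P \<in> polys R" "P \<noteq> 0" using less.prems by (auto simp: primitive_def)
    show ?case
    proof (cases "dvd_in (polys R) P 1")
      case True
      thus ?thesis using prime_product.unit P by blast
    next
      case nu: False
      show ?thesis
      proof (cases "\<forall>g\<in>polys R. \<forall>h\<in>polys R. P = g * h \<longrightarrow> dvd_in (polys R) g 1 \<or> dvd_in (polys R) h 1")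
        case True
        hence "prime_in (polys R) P" using irreducible_primitive_prime[OF R less.prems nu] by blast
        moreover have "prime_product (polys R) 0 1" using subring_setD(2)[OF D] dvd_in_refl[OF D] by (intro prime_product.unit)
        ultimately have "prime_product (polys R) (Suc 0) (P * 1)" by (rule prime_product.prime)
        thus ?thesis by auto
      next
        case False
        then obtain g h where gh: "g \<in> polys R" "h \<in> polys R" "P = g * h" "\<not> dvd_in (polys R) g 1" "\<not> dvd_in (polys R) h 1" by blast
        have gh0: "g \<noteq> 0" "h \<noteq> 0" using P gh by auto
        have pg: "primitive R g" "primitive R h"
          using less.prems gh gh0 dvd_in_mult[OF D] unfolding primitive_def gh(3) by (auto, metis mult.commute)
        have deg: "0 < degree x" if x: "primitive R x" "\<not> dvd_in (polys R) x 1" for x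
        proof (rule ccontr)
          assume "\<not> 0 < degree x"
          then obtain r where r: "x = [:r:]" using degree_eq_zeroE[of x] by auto
          have rR: "r \<in> R" "r \<noteq> 0" using x r by (auto simp: primitive_def polys_def dest!: spec[of _ 0])
          obtain n where "prime_product R n r" using R rR by (auto simp: ufd_set_def)
          thus False
          proof cases
            case unit
            then obtain a where "a \<in> R" "1 = r * a" by (auto simp: dvd_in_def)
            hence "dvd_in (polys R) x 1" using const_polys[OF S] unfolding dvd_in_def r
              by (intro bexI[of _ "[:a:]"]) (auto simp: one_pCons mult.commute)
            thus False using x by simp
          next
            case (prime p m y)
            have "y \<in> R" using prime_product_in[OF S prime(4)] by simp
            hence "dvd_in (polys R) [:p:] x" unfolding r prime(2) dvd_in_def
              by (intro bexI[of _ "[:y:]"]) (auto simp: const_polys[OF S] mult.commute)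
            thus False using x prime by (auto simp: primitive_def)
          qed
        qed
        have "degree P = degree g + degree h" using gh gh0 by (simp add: degree_mult_eq)
        hence "degree g < degree P" "degree h < degree P" using deg pg gh by (metis less_add_same_cancel1 less_add_same_cancel2)+
        then obtain m n where "prime_product (polys R) m g" "prime_product (polys R) n h" using less.hyps pg by blast
        thus ?thesis using prime_product_mult[OF D] gh(3) by blast
      qed
    qed
  qed
  have "\<exists>n. prime_product (polys R) n P" if P: "P \<in> polys R" "P \<noteq> 0" for P
  proof -
    obtain c P0 where c: "c \<in> R" "c \<noteq> 0" "primitive R P0" "P = [:c:] * P0" using primitive_part[OF R P] by blast
    obtain n where "prime_product R n c" using R c by (auto simp: ufd_set_def)
    hence "prime_product (polys R) n [:c:]" by (rule prime_product_const_poly[OF S])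
    moreover obtain m where "prime_product (polys R) m P0" using prim c by blast
    ultimately show ?thesis using prime_product_mult[OF D] c(4) by blast
  qed
  thus ?thesis using D by (auto simp: ufd_set_def)
qed

lemma ufd_image:
  assumes R: "ufd_set R" and inj: "inj_on \<phi> R"
    and hom: "\<And>a b. a \<in> R \<Longrightarrow> b \<in> R \<Longrightarrow> \<phi> (a + b) = \<phi> a + \<phi> b" "\<And>a b. a \<in> R \<Longrightarrow> b \<in> R \<Longrightarrow> \<phi> (a * b) = \<phi> a * \<phi> b"
      "\<phi> 1 = 1"
  shows "ufd_set (\<phi> ` R)"
proof -
  have S: "subring_set R" using R by (simp add: ufd_set_def)
  note C = subring_setD[OF S]
  have "\<phi> 0 + \<phi> 0 = \<phi> 0" using hom(1)[of 0 0] C by simp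
  hence z: "\<phi> 0 = 0" using add_left_cancel[of "\<phi> 0" "\<phi> 0" 0] by simp
  have neg: "\<phi> (- a) = - \<phi> a" if "a \<in> R" for a
    using hom(1)[of a "- a"] C(5) that z by (simp add: eq_neg_iff_add_eq_0 add.commute)
  have S': "subring_set (\<phi> ` R)" unfolding subring_set_def
  proof (intro conjI ballI)
    show "0 \<in> \<phi> ` R" using C(1) z by (metis imageI)
    show "1 \<in> \<phi> ` R" using C(2) hom(3) by (metis imageI)
    fix a b assume "a \<in> \<phi> ` R" "b \<in> \<phi> ` R"
    thus "a + b \<in> \<phi> ` R" "a * b \<in> \<phi> ` R" using hom(1,2)[symmetric] C(3,4) by auto
  next
    fix a assume "a \<in> \<phi> ` R" thus "- a \<in> \<phi> ` R" using neg[symmetric] C(5) by auto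
  qed
  have d: "dvd_in (\<phi> ` R) (\<phi> a) (\<phi> b) \<longleftrightarrow> dvd_in R a b" if "a \<in> R" "b \<in> R" for a b
  proof -
    have "\<phi> b = \<phi> a * \<phi> c \<longleftrightarrow> b = a * c" if "c \<in> R" for c
      using hom(2)[OF \<open>a \<in> R\<close> that] inj_onD[OF inj, of b "a * c"] C(4)[OF \<open>a \<in> R\<close> that] \<open>b \<in> R\<close> by auto
    thus ?thesis by (auto simp: dvd_in_def)
  qed
  have p: "prime_in (\<phi> ` R) (\<phi> p)" if "prime_in R p" for p
  proof -
    have pR: "p \<in> R" "p \<noteq> 0" using that by (auto simp: prime_in_def)
    have "\<phi> p \<noteq> 0" using inj_onD[OF inj, of p 0] z pR C(1) by auto
    moreover have "\<not> dvd_in (\<phi> ` R) (\<phi> p) 1" using d[of p 1] C(2) pR that hom(3) by (simp add: prime_in_def)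
    moreover have "dvd_in (\<phi> ` R) (\<phi> p) (\<phi> a) \<or> dvd_in (\<phi> ` R) (\<phi> p) (\<phi> b)"
      if "a \<in> R" "b \<in> R" "dvd_in (\<phi> ` R) (\<phi> p) (\<phi> a * \<phi> b)" for a b
      using that d[OF pR(1)] C(4)[of a b] hom(2)[of a b, symmetric] \<open>prime_in R p\<close> by (auto simp: prime_in_def)
    ultimately show ?thesis using pR by (auto simp: prime_in_def)
  qed
  have "prime_product R n x \<Longrightarrow> prime_product (\<phi> ` R) n (\<phi> x)" for n x
  proof (induction rule: prime_product.induct)
    case (unit u)
    thus ?case using d[of u 1] C(2) hom(3) by (intro prime_product.unit) auto
  next
    case (prime r n x)
    have "x \<in> R" "r \<in> R" using prime_product_in[OF S] prime by (auto simp: prime_in_def)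
    thus ?case using prime_product.prime[OF p[OF prime.hyps(1)] prime.IH] hom(2) by simp
  qed
  moreover have "\<exists>n. prime_product R n x" if "x \<in> R" "\<phi> x \<noteq> 0" for x
    using R that z unfolding ufd_set_def by metis
  ultimately have "\<forall>y\<in>\<phi> ` R. y \<noteq> 0 \<longrightarrow> (\<exists>n. prime_product (\<phi> ` R) n y)" by fast
  thus ?thesis using S' unfolding ufd_set_def by simp
qed

section \<open>Evaluation on the complex torus\<close>

abbreviation lookup where "lookup \<equiv> Poly_Mapping.lookup"
abbreviation keys where "keys \<equiv> Poly_Mapping.keys"
abbreviation single where "single \<equiv> Poly_Mapping.single"

text \<open>All coordinates are nonzero, including those outside the variables in use. Only there is
  evaluation multiplicative: at 0 the product of the powers with exponents 1 and -1 would be 0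
  instead of 1.\<close>

definition torus :: "(nat \<Rightarrow> complex) set" where
  "torus = {z. \<forall>i. z i \<noteq> 0}"

definition meval :: "(nat \<Rightarrow>\<^sub>0 int) \<Rightarrow> (nat \<Rightarrow> complex) \<Rightarrow> complex" where
  "meval m z = (\<Prod>i\<in>keys m. z i powi lookup m i)"

lemma meval_superset: "finite S \<Longrightarrow> keys m \<subseteq> S \<Longrightarrow> meval m z = (\<Prod>i\<in>S. z i powi lookup m i)"
  unfolding meval_def by (intro prod.mono_neutral_left) (auto simp: in_keys_iff)

lemma meval_0 [simp]: "meval 0 z = 1"
  by (simp add: meval_def)

lemma meval_add:
  assumes "z \<in> torus" shows "meval (m + n) z = meval m z * meval n z"
proof -
  let ?S = "keys m \<union> keys n"
  have "meval (m + n) z = (\<Prod>i\<in>?S. z i powi lookup (m + n) i)"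
    by (rule meval_superset) (simp_all add: Poly_Mapping.keys_add)
  also have "\<dots> = (\<Prod>i\<in>?S. z i powi lookup m i) * (\<Prod>i\<in>?S. z i powi lookup n i)"
    unfolding prod.distrib[symmetric] using assms by (intro prod.cong) (auto simp: lookup_add power_int_add torus_def)
  also have "\<dots> = meval m z * meval n z" by (subst (1 2) meval_superset[of ?S]) auto
  finally show ?thesis .
qed

lemma meval_nz: "z \<in> torus \<Longrightarrow> meval m z \<noteq> 0"
  by (simp add: meval_def torus_def)

lemma meval_mult: "meval m (\<lambda>i. a i * z i) = meval m a * meval m z"
  by (simp add: meval_def power_int_mult_distrib prod.distrib)

lemma meval_single: "meval (single i k) z = z i powi k"
  by (cases "k = 0") (auto simp: meval_def)

lemma leval_meval: "leval p z = (\<Sum>m\<in>keys p. lookup p m * meval m z)"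
  by (simp add: leval_def meval_def)

lemma leval_superset: "finite S \<Longrightarrow> keys p \<subseteq> S \<Longrightarrow> leval p z = (\<Sum>m\<in>S. lookup p m * meval m z)"
  unfolding leval_meval by (intro sum.mono_neutral_left) (auto simp: in_keys_iff)

lemma leval_0 [simp]: "leval 0 z = 0"
  by (simp add: leval_meval)

lemma leval_add: "leval (p + r) z = leval p z + leval r z"
proof -
  let ?S = "keys p \<union> keys r"
  have "leval (p + r) z = (\<Sum>m\<in>?S. lookup (p + r) m * meval m z)"
    by (rule leval_superset) (simp_all add: Poly_Mapping.keys_add)
  also have "\<dots> = (\<Sum>m\<in>?S. lookup p m * meval m z) + (\<Sum>m\<in>?S. lookup r m * meval m z)"
    unfolding sum.distrib[symmetric] by (simp add: lookup_add distrib_right)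
  also have "\<dots> = leval p z + leval r z" by (subst (1 2) leval_superset[of ?S]) auto
  finally show ?thesis .
qed

lemma leval_sum: "leval (sum f S) z = (\<Sum>i\<in>S. leval (f i) z)"
  by (induction S rule: infinite_finite_induct) (auto simp: leval_add)

lemma leval_single: "leval (single m c) z = c * meval m z"
  by (cases "c = 0") (auto simp: leval_meval)

lemma leval_1 [simp]: "leval 1 z = 1"
  using leval_single[of 0 1 z] by simp

lemma sum_single: "p = (\<Sum>m\<in>keys p. single m (lookup p m))"
  by (rule poly_mapping_eqI) (auto simp: lookup_sum lookup_single when_def sum.delta in_keys_iff)

lemma mult_sum_single:
  fixes p r :: laurent
  shows "p * r = (\<Sum>m\<in>keys p. \<Sum>n\<in>keys r. single (m + n) (lookup p m * lookup r n))"
proof -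
  have "p * r = (\<Sum>m\<in>keys p. single m (lookup p m)) * (\<Sum>n\<in>keys r. single n (lookup r n))"
    using sum_single[of p] sum_single[of r] by simp
  also have "\<dots> = (\<Sum>m\<in>keys p. \<Sum>n\<in>keys r. single (m + n) (lookup p m * lookup r n))"
    unfolding sum_product mult_single ..
  finally show ?thesis .
qed

lemma leval_mult: "z \<in> torus \<Longrightarrow> leval (p * r) z = leval p z * leval r z"
  unfolding mult_sum_single leval_sum leval_single
  by (simp add: leval_meval sum_product meval_add mult_ac)

lemma leval_uminus: "leval (- p) z = - leval p z"
  using leval_add[of p "- p" z] by (simp add: eq_neg_iff_add_eq_0 add.commute)

lemma leval_diff: "leval (p - r) z = leval p z - leval r z"
  using leval_add[of p "- r" z] by (simp add: leval_uminus)

lemma powi_2_inject: "(2 :: complex) powi a = 2 powi b \<Longrightarrow> a = b"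
proof -
  assume "(2 :: complex) powi a = 2 powi b"
  hence "norm ((2 :: complex) powi a) = norm ((2 :: complex) powi b)" by simp
  hence e: "(2 :: real) powi a = 2 powi b" by (simp add: norm_power_int)
  have "(2 :: real) powi x < 2 powi y" if "x < y" for x y :: int
    using that by (intro power_int_strict_increasing) auto
  thus "a = b" using e by (metis linorder_neqE order_less_irrefl)
qed

lemma monomials_separated:
  assumes "m \<noteq> n"
  obtains a where "a \<in> torus" "meval m a \<noteq> meval n a"
proof -
  obtain i where i: "lookup m i \<noteq> lookup n i" using assms by (metis poly_mapping_eqI)
  define a where "a j = (if j = i then 2 else (1 :: complex))" for j
  have "meval m a = 2 powi lookup m i" for m
  proof -
    have "meval m a = (\<Prod>j\<in>insert i (keys m). a j powi lookup m j)" by (rule meval_superset) auto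
    also have "\<dots> = 2 powi lookup m i"
      by (subst prod.remove[of _ i]) (auto simp: a_def intro!: prod.neutral)
    finally show ?thesis .
  qed
  hence "meval m a \<noteq> meval n a" using i powi_2_inject by auto
  moreover have "a \<in> torus" by (simp add: torus_def a_def)
  ultimately show ?thesis using that by blast
qed

text \<open>By linear independence of characters.\<close>

lemma leval_eq_0:
  assumes "\<And>z. z \<in> torus \<Longrightarrow> leval p z = 0"
  shows "p = 0"
  using assms
proof (induction "card (keys p)" arbitrary: p rule: less_induct)
  case less
  show ?case
  proof (cases "\<exists>m\<in>keys p. \<exists>n\<in>keys p. m \<noteq> n")
    case True
    then obtain m n where mn: "m \<in> keys p" "n \<in> keys p" "m \<noteq> n" by blast
    obtain a where a: "a \<in> torus" "meval m a \<noteq> meval n a" using monomials_separated mn(3) by blast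
    define r where "r = (\<Sum>k\<in>keys p. single k (lookup p k * (meval k a - meval m a)))"
    have lr: "lookup r k = lookup p k * (meval k a - meval m a)" for k
      by (auto simp: r_def lookup_sum lookup_single when_def sum.delta in_keys_iff)
    have "leval r z = 0" if z: "z \<in> torus" for z
    proof -
      have az: "(\<lambda>i. a i * z i) \<in> torus" using a z by (simp add: torus_def)
      have "leval r z = leval p (\<lambda>i. a i * z i) - meval m a * leval p z"
        unfolding r_def leval_sum leval_single
        by (simp add: leval_meval meval_mult sum_distrib_left sum_subtractf[symmetric] algebra_simps)
      thus ?thesis using less.prems az z by simp
    qed
    moreover have "keys r \<subseteq> keys p - {m}" by (auto simp: in_keys_iff lr)
    hence "card (keys r) < card (keys p)" using mn(1) by (meson card_Diff1_less card_mono finite_Diff finite_keys le_less_trans)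
    ultimately have "r = 0" using less.hyps by blast
    hence "lookup r n = 0" by simp
    thus ?thesis using lr[of n] a mn by (simp add: in_keys_iff)
  next
    case False
    show ?thesis
    proof (rule ccontr)
      assume "p \<noteq> 0"
      then obtain m where m: "m \<in> keys p" by (metis all_not_in_conv keys_eq_empty)
      hence "keys p = {m}" using False by blast
      hence "leval p (\<lambda>_. 1) = lookup p m * meval m (\<lambda>_. 1)" by (simp add: leval_meval)
      moreover have "(\<lambda>_. 1) \<in> torus" by (simp add: torus_def)
      ultimately show False using less.prems m meval_nz[of "\<lambda>_. 1" m] by (simp add: in_keys_iff)
    qed
  qed
qed

lemma leval_eqI: "(\<And>z. z \<in> torus \<Longrightarrow> leval p z = leval r z) \<Longrightarrow> p = r"
  using leval_eq_0[of "p - r"] by (simp add: leval_diff)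

lemma laurent_in_subring: "subring_set (laurent_in V)"
proof -
  have "keys k \<subseteq> V" if "k \<in> keys (p + r)" "p \<in> laurent_in V" "r \<in> laurent_in V" for k and p r :: laurent
    using that Poly_Mapping.keys_add[of p r] by (auto simp: laurent_in_def)
  moreover have "keys k \<subseteq> V" if k: "k \<in> keys (p * r)" and p: "p \<in> laurent_in V" "r \<in> laurent_in V" for k and p r :: laurent
  proof -
    obtain a b where "a \<in> keys p" "b \<in> keys r" "k = a + b" using Poly_Mapping.keys_mult[of p r] k by blast
    thus ?thesis using p Poly_Mapping.keys_add[of a b] unfolding laurent_in_def by blast
  qed
  ultimately show ?thesis unfolding subring_set_def laurent_in_def by (auto simp: keys_one)
qed

lemmas laurent_in_closed = subring_setD[OF laurent_in_subring]

lemma laurent_in_single: "keys m \<subseteq> V \<Longrightarrow> single m c \<in> laurent_in V"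
  by (auto simp: laurent_in_def)

lemma leval_cong: "p \<in> laurent_in V \<Longrightarrow> (\<And>i. i \<in> V \<Longrightarrow> z i = z' i) \<Longrightarrow> leval p z = leval p z'"
proof -
  assume p: "p \<in> laurent_in V" and z: "\<And>i. i \<in> V \<Longrightarrow> z i = z' i"
  have "z i = z' i" if "m \<in> keys p" "i \<in> keys m" for m i using p z that unfolding laurent_in_def by blast
  thus ?thesis unfolding leval_meval meval_def by (intro sum.cong refl arg_cong2[of _ _ _ _ times] prod.cong) auto
qed

text \<open>These functions agree on the torus with Laurent polynomials, see
  \<open>lfun_leval\<close>. The closure rules make membership a matter of syntax, in particular for
  determinants and after substitutions.\<close>

inductive_set lfun :: "nat set \<Rightarrow> ((nat \<Rightarrow> complex) \<Rightarrow> complex) set" for V where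
  const: "(\<lambda>z. c) \<in> lfun V"
| var: "i \<in> V \<Longrightarrow> (\<lambda>z. z i) \<in> lfun V"
| inv: "i \<in> V \<Longrightarrow> (\<lambda>z. inverse (z i)) \<in> lfun V"
| add: "f \<in> lfun V \<Longrightarrow> g \<in> lfun V \<Longrightarrow> (\<lambda>z. f z + g z) \<in> lfun V"
| mult: "f \<in> lfun V \<Longrightarrow> g \<in> lfun V \<Longrightarrow> (\<lambda>z. f z * g z) \<in> lfun V"

lemma lfun_minus: "f \<in> lfun V \<Longrightarrow> (\<lambda>z. - f z) \<in> lfun V"
  using lfun.mult[OF lfun.const[of "-1"], of f V] by simp

lemma lfun_diff: "f \<in> lfun V \<Longrightarrow> g \<in> lfun V \<Longrightarrow> (\<lambda>z. f z - g z) \<in> lfun V"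
  using lfun.add[OF _ lfun_minus[of g V], of f] by simp

lemma lfun_power: "f \<in> lfun V \<Longrightarrow> (\<lambda>z. f z ^ n) \<in> lfun V"
  by (induction n) (auto intro: lfun.intros)

lemma lfun_sum: "(\<And>i. i \<in> S \<Longrightarrow> f i \<in> lfun V) \<Longrightarrow> (\<lambda>z. \<Sum>i\<in>S. f i z) \<in> lfun V"
  by (induction S rule: infinite_finite_induct) (auto intro: lfun.intros)

lemma lfun_prod: "(\<And>i. i \<in> S \<Longrightarrow> f i \<in> lfun V) \<Longrightarrow> (\<lambda>z. \<Prod>i\<in>S. f i z) \<in> lfun V"
  by (induction S rule: infinite_finite_induct) (auto intro: lfun.intros)

lemma lfun_powi: "i \<in> V \<Longrightarrow> (\<lambda>z. z i powi k) \<in> lfun V"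
  unfolding power_int_def by (cases "k \<ge> 0") (auto intro: lfun_power lfun.intros)

lemma leval_lfun: "p \<in> laurent_in V \<Longrightarrow> leval p \<in> lfun V"
  unfolding leval_def[abs_def] laurent_in_def
  by (intro lfun_sum lfun.mult lfun.const lfun_prod lfun_powi) auto

lemma lfun_leval:
  assumes "f \<in> lfun V"
  shows "\<exists>p\<in>laurent_in V. \<forall>z\<in>torus. leval p z = f z"
  using assms
proof induction
  case (const c)
  show ?case by (intro bexI[of _ "single 0 c"]) (auto simp: leval_single laurent_in_single)
next
  case (var i)
  thus ?case by (intro bexI[of _ "single (single i 1) 1"]) (auto simp: leval_single meval_single intro!: laurent_in_single)
next
  case (inv i)
  thus ?case by (intro bexI[of _ "single (single i (- 1)) 1"])
    (auto simp: leval_single meval_single power_int_minus intro!: laurent_in_single)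
next
  case (add f g)
  then obtain p r where "p \<in> laurent_in V" "r \<in> laurent_in V" "\<forall>z\<in>torus. leval p z = f z" "\<forall>z\<in>torus. leval r z = g z" by blast
  thus ?case by (intro bexI[of _ "p + r"]) (auto simp: leval_add laurent_in_closed)
next
  case (mult f g)
  then obtain p r where "p \<in> laurent_in V" "r \<in> laurent_in V" "\<forall>z\<in>torus. leval p z = f z" "\<forall>z\<in>torus. leval r z = g z" by blast
  thus ?case by (intro bexI[of _ "p * r"]) (auto simp: leval_mult laurent_in_closed)
qed

lemma lfun_comp:
  assumes "f \<in> lfun V" "\<And>i. i \<in> V \<Longrightarrow> (\<lambda>z. \<sigma> z i) \<in> lfun W" "\<And>i. i \<in> V \<Longrightarrow> (\<lambda>z. inverse (\<sigma> z i)) \<in> lfun W"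
  shows "(\<lambda>z. f (\<sigma> z)) \<in> lfun W"
  using assms(1) by induction (auto intro: lfun.intros assms)

text \<open>Laurent polynomials form an integral domain, so two of them that are not identically
  zero have a common point of nonvanishing. The genericity arguments rest on this.\<close>

lemma lfun_mult_nonzero:
  assumes "f \<in> lfun V" "g \<in> lfun V" "z1 \<in> torus" "f z1 \<noteq> 0" "z2 \<in> torus" "g z2 \<noteq> 0"
  obtains z where "z \<in> torus" "f z \<noteq> 0" "g z \<noteq> 0"
proof -
  obtain p r where p: "\<forall>z\<in>torus. leval p z = f z" "\<forall>z\<in>torus. leval r z = g z" using lfun_leval assms(1,2) by metis
  have "p \<noteq> 0" "r \<noteq> 0" using p assms by auto
  hence "p * r \<noteq> 0" by simp
  then obtain z where "z \<in> torus" "leval (p * r) z \<noteq> 0" using leval_eq_0 by blast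
  thus ?thesis using that p by (auto simp: leval_mult)
qed

text \<open>The factor theorem with a variable root \<open>\<mu>\<close>: the quotient exists for
  constants, variables and inverses of variables and passes to sums and products by the Leibniz
  rule.\<close>

lemma lfun_factor:
  assumes f: "f \<in> lfun V" and \<mu>: "\<mu> \<in> lfun V" "(\<lambda>z. inverse (\<mu> z)) \<in> lfun V"
  shows "\<exists>G\<in>lfun V. \<forall>z\<in>torus. \<mu> z \<noteq> 0 \<longrightarrow> f z - f (z(i := \<mu> z)) = (z i - \<mu> z) * G z"
  using f
proof induction
  case (const c)
  show ?case by (intro bexI[of _ "\<lambda>z. 0"]) (auto intro: lfun.const)
next
  case (var j)
  show ?case by (intro bexI[of _ "\<lambda>z. if j = i then 1 else 0"]) (auto intro: lfun.const)
next
  case (inv j)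
  show ?case
  proof (cases "j = i")
    case True
    have "inverse (z i) - inverse (\<mu> z) = (z i - \<mu> z) * (- (inverse (z i) * inverse (\<mu> z)))"
      if "z i \<noteq> 0" "\<mu> z \<noteq> 0" for z using that by (simp add: field_simps)
    moreover have "(\<lambda>z. - (inverse (z i) * inverse (\<mu> z))) \<in> lfun V"
      using inv True by (intro lfun_minus lfun.mult lfun.inv \<mu>(2)) simp
    ultimately show ?thesis using True
      by (intro bexI[of _ "\<lambda>z. - (inverse (z i) * inverse (\<mu> z))"]) (auto simp: torus_def)
  next
    case False
    thus ?thesis by (intro bexI[of _ "\<lambda>z. 0"]) (auto intro: lfun.const)
  qed
next
  case (add f g)
  then obtain F G where "F \<in> lfun V" "G \<in> lfun V"
    "\<forall>z\<in>torus. \<mu> z \<noteq> 0 \<longrightarrow> f z - f (z(i := \<mu> z)) = (z i - \<mu> z) * F z"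
    "\<forall>z\<in>torus. \<mu> z \<noteq> 0 \<longrightarrow> g z - g (z(i := \<mu> z)) = (z i - \<mu> z) * G z" by blast
  thus ?case by (intro bexI[of _ "\<lambda>z. F z + G z"]) (auto simp: add_diff_add distrib_left fun_upd_def intro: lfun.add)
next
  case (mult f g)
  then obtain F G where FG: "F \<in> lfun V" "G \<in> lfun V"
    "\<forall>z\<in>torus. \<mu> z \<noteq> 0 \<longrightarrow> f z - f (z(i := \<mu> z)) = (z i - \<mu> z) * F z"
    "\<forall>z\<in>torus. \<mu> z \<noteq> 0 \<longrightarrow> g z - g (z(i := \<mu> z)) = (z i - \<mu> z) * G z" by blast
  have f': "(\<lambda>z. f (z(i := \<mu> z))) \<in> lfun V"
  proof (rule lfun_comp[OF mult.hyps(1)])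
    fix j assume "j \<in> V"
    thus "(\<lambda>z. (z(i := \<mu> z)) j) \<in> lfun V" "(\<lambda>z. inverse ((z(i := \<mu> z)) j)) \<in> lfun V"
      using \<mu> by (cases "j = i"; auto intro: lfun.intros)+
  qed
  have eq: "f z * g z - f (z(i := \<mu> z)) * g (z(i := \<mu> z)) = (z i - \<mu> z) * (F z * g z + f (z(i := \<mu> z)) * G z)"
    if "z \<in> torus" "\<mu> z \<noteq> 0" for z
  proof -
    have "f z * g z - f (z(i := \<mu> z)) * g (z(i := \<mu> z)) = (f z - f (z(i := \<mu> z))) * g z + f (z(i := \<mu> z)) * (g z - g (z(i := \<mu> z)))"
      by (simp add: algebra_simps)
    thus ?thesis using FG that by (simp add: algebra_simps)
  qed
  have H: "(\<lambda>z. F z * g z + f (z(i := \<mu> z)) * G z) \<in> lfun V"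
    by (intro lfun.add lfun.mult FG(1,2) f' mult.hyps)
  show ?case
    by (rule bexI[OF _ H]) (intro ballI impI eq)
qed

text \<open>The sum of two extreme exponents arises in no other way if one of them is strictly
  extreme. Used with the order of exponent vectors to find the units and with degree functions to
  compare exponents.\<close>

lemma lookup_mult_extreme:
  fixes p r :: laurent and wt :: "(nat \<Rightarrow>\<^sub>0 int) \<Rightarrow> 'o::linordered_ab_group_add"
  assumes add: "\<And>m n. wt (m + n) = wt m + wt n"
    and p: "a \<in> keys p" "\<And>m. m \<in> keys p \<Longrightarrow> m \<noteq> a \<Longrightarrow> wt m < wt a"
    and r: "b \<in> keys r" "\<And>n. n \<in> keys r \<Longrightarrow> wt n \<le> wt b"
  shows "lookup (p * r) (a + b) = lookup p a * lookup r b"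
proof -
  have "lookup (p * r) (a + b) = (\<Sum>m\<in>keys p. \<Sum>n\<in>keys r. lookup p m * lookup r n when m + n = a + b)"
    unfolding mult_sum_single by (simp add: lookup_sum lookup_single)
  also have "\<dots> = (\<Sum>m\<in>keys p. if m = a then lookup p a * lookup r b else 0)"
  proof (rule sum.cong[OF refl])
    fix m assume m: "m \<in> keys p"
    show "(\<Sum>n\<in>keys r. lookup p m * lookup r n when m + n = a + b) = (if m = a then lookup p a * lookup r b else 0)"
    proof (cases "m = a")
      case True
      thus ?thesis using r(1) by (simp add: when_def sum.delta)
    next
      case False
      have "m + n \<noteq> a + b" if "n \<in> keys r" for n
      proof
        assume "m + n = a + b"
        hence "wt m + wt n = wt a + wt b" using add by metis
        thus False using add_less_le_mono[OF p(2)[OF m False] r(2)[OF that]] by simp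
      qed
      thus ?thesis using False by (simp add: when_def)
    qed
  qed
  also have "\<dots> = lookup p a * lookup r b" using p(1) by simp
  finally show ?thesis .
qed

text \<open>Exponent vectors form a linearly ordered group, so the largest and the smallest exponent
  of a product are the sums of those of the factors. The product 1 has a single exponent, hence so
  has each factor.\<close>

lemma laurent_unit_monomial:
  fixes p r :: laurent
  assumes "p * r = 1"
  obtains m c where "p = single m c" "r = single (- m) (inverse c)" "c \<noteq> 0"
proof -
  have nz: "p \<noteq> 0" "r \<noteq> 0" using assms by auto
  hence ne: "keys p \<noteq> {}" "keys r \<noteq> {}" by auto
  have k1: "keys (p * r) = {0}" using assms by simp
  have max: "Max (keys p) + Max (keys r) = 0"
  proof -
    have "lookup (p * r) (Max (keys p) + Max (keys r)) = lookup p (Max (keys p)) * lookup r (Max (keys r))"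
      using ne by (intro lookup_mult_extreme[where wt = "\<lambda>m. m"]) (auto simp: order.strict_iff_order)
    also have "\<dots> \<noteq> 0" using Max_in[OF finite_keys ne(1)] Max_in[OF finite_keys ne(2)] by (simp add: in_keys_iff)
    finally show ?thesis using k1 by (simp add: in_keys_iff[symmetric])
  qed
  have min: "Min (keys p) + Min (keys r) = 0"
  proof -
    have ext: "lookup (p * r) (a + b) = lookup p a * lookup r b"
      if "a \<in> keys p" "b \<in> keys r" "\<And>m. m \<in> keys p \<Longrightarrow> a \<le> m" "\<And>m. m \<in> keys r \<Longrightarrow> b \<le> m" for a b
      using that by (intro lookup_mult_extreme[where wt = "\<lambda>m. - m"]) (auto simp: order.strict_iff_order)
    have "lookup (p * r) (Min (keys p) + Min (keys r)) = lookup p (Min (keys p)) * lookup r (Min (keys r))"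
      using ne by (intro ext) auto
    also have "\<dots> \<noteq> 0" using Min_in[OF finite_keys ne(1)] Min_in[OF finite_keys ne(2)] by (simp add: in_keys_iff)
    finally show ?thesis using k1 by (simp add: in_keys_iff[symmetric])
  qed
  have "Min (keys p) \<le> Max (keys p)" "Min (keys r) \<le> Max (keys r)" using ne by simp_all
  hence e: "Min (keys p) = Max (keys p)" "Min (keys r) = Max (keys r)"
    using max min by (metis add_le_cancel_left add_mono dual_order.antisym add_le_cancel_right)+
  have one: "\<exists>c. s = single (Max (keys s)) c" if "Min (keys s) = Max (keys s)" "keys s \<noteq> {}" for s :: laurent
  proof -
    have "k = Max (keys s)" if "k \<in> keys s" for k
      using that \<open>Min (keys s) = Max (keys s)\<close> Min_le[OF finite_keys that] Max_ge[OF finite_keys that] by simp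
    then obtain k where k: "keys s = {k}" using \<open>keys s \<noteq> {}\<close> by blast
    hence "s = single k (lookup s k)" using sum_single[of s] by simp
    thus ?thesis using k by auto
  qed
  obtain c d where c: "p = single (Max (keys p)) c" "r = single (Max (keys r)) d" using one e ne by blast
  define m where "m = Max (keys p)"
  have rm: "Max (keys r) = - m" using max by (simp add: m_def eq_neg_iff_add_eq_0 add.commute)
  have p: "p = single m c" using c(1) m_def by simp
  have r: "r = single (- m) d" using c(2) rm by simp
  have "single (0 :: nat \<Rightarrow>\<^sub>0 int) (c * d) = single 0 1" using assms unfolding p r mult_single by simp
  hence "c * d = 1" by (metis lookup_single_eq)
  thus ?thesis using that[OF p] r by (metis inverse_unique mult_zero_left zero_neq_one)
qed

section \<open>Factoriality and coprime families\<close>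

definition pol_in :: "nat set \<Rightarrow> laurent set" where
  "pol_in V = {p\<in>laurent_in V. \<forall>m\<in>keys p. \<forall>i. 0 \<le> lookup m i}"

lemma pol_in_single: "keys m \<subseteq> V \<Longrightarrow> (\<And>i. 0 \<le> lookup m i) \<Longrightarrow> single m c \<in> pol_in V"
  by (auto simp: pol_in_def laurent_in_def)

lemma pol_in_subring: "subring_set (pol_in V)"
proof -
  have "0 \<le> lookup k i" if "k \<in> keys (p + r)" "p \<in> pol_in V" "r \<in> pol_in V" for k i and p r :: laurent
    using that Poly_Mapping.keys_add[of p r] by (auto simp: pol_in_def)
  moreover have "0 \<le> lookup k i" if k: "k \<in> keys (p * r)" and p: "p \<in> pol_in V" "r \<in> pol_in V" for k i and p r :: laurent
  proof -
    obtain a b where "a \<in> keys p" "b \<in> keys r" "k = a + b" using Poly_Mapping.keys_mult[of p r] k by blast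
    thus ?thesis using p by (auto simp: pol_in_def lookup_add)
  qed
  ultimately show ?thesis using laurent_in_closed[where V = V] unfolding subring_set_def
    by (simp add: pol_in_def keys_one)
qed

text \<open>The variable \<open>v\<close> is new, so the exponent
  \<open>m + single v (int k)\<close> can only come from the coefficient of index \<open>k\<close>.
  This gives injectivity of the substitution in \<open>ufd_pol_in\<close>.\<close>

lemma poly_var_lookup:
  fixes P :: "laurent poly"
  assumes v: "v \<notin> V" and P: "P \<in> polys (pol_in V)" and m: "lookup m v = 0"
  shows "lookup (poly P (single (single v 1) 1)) (m + single v (int k)) = lookup (coeff P k) m"
proof -
  have pw: "single (single v 1) 1 ^ j = (single (single v (int j)) 1 :: laurent)" for j
    by (induction j) (simp_all add: mult_single single_add[symmetric] add.commute)
  have "lookup (coeff P j * single (single v (int j)) 1) (m + single v (int k)) = (if j = k then lookup (coeff P k) m else 0)" for j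
  proof -
    have "coeff P j * single (single v (int j)) 1 = (\<Sum>n\<in>keys (coeff P j). single (n + single v (int j)) (lookup (coeff P j) n))"
      using mult_sum_single[of "coeff P j" "single (single v (int j)) 1"] by simp
    hence "lookup (coeff P j * single (single v (int j)) 1) (m + single v (int k)) =
        (\<Sum>n\<in>keys (coeff P j). lookup (coeff P j) n when n + single v (int j) = m + single v (int k))"
      by (simp add: lookup_sum lookup_single)
    also have "\<dots> = (\<Sum>n\<in>keys (coeff P j). if n = m then (if j = k then lookup (coeff P k) m else 0) else 0)"
    proof (rule sum.cong[OF refl])
      fix n assume n: "n \<in> keys (coeff P j)"
      have "coeff P j \<in> laurent_in V" using P by (auto simp: polys_def pol_in_def)
      hence "v \<notin> keys n" using n v unfolding laurent_in_def by blast
      hence "lookup n v = 0" by (simp add: in_keys_iff)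
      have "n + single v (int j) = m + single v (int k) \<longleftrightarrow> n = m \<and> j = k"
      proof
        assume e: "n + single v (int j) = m + single v (int k)"
        hence "lookup (n + single v (int j)) v = lookup (m + single v (int k)) v" by simp
        hence "j = k" using \<open>lookup n v = 0\<close> m by (simp add: lookup_add)
        thus "n = m \<and> j = k" using e by simp
      qed simp
      thus "(lookup (coeff P j) n when n + single v (int j) = m + single v (int k)) =
          (if n = m then (if j = k then lookup (coeff P k) m else 0) else 0)" by (auto simp: when_def)
    qed
    also have "\<dots> = (if j = k then lookup (coeff P k) m else 0)" by (auto simp: in_keys_iff)
    finally show ?thesis .
  qed
  hence "lookup (poly P (single (single v 1) 1)) (m + single v (int k)) = (\<Sum>j\<le>degree P. if j = k then lookup (coeff P k) m else 0)"
    by (simp add: poly_altdef pw lookup_sum)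
  thus ?thesis using coeff_eq_0[of P k] by (auto simp: not_le)
qed

text \<open>Variables are adjoined one at a time: substituting the monomial of \<open>v\<close>
  identifies polynomials over \<open>pol_in V\<close> with
  \<open>pol_in (insert v V)\<close>.\<close>

lemma ufd_pol_in: "finite V \<Longrightarrow> ufd_set (pol_in V)"
proof (induction V rule: finite_induct)
  case empty
  have k: "keys p \<subseteq> {0}" if "p \<in> pol_in {}" for p using that by (auto simp: pol_in_def laurent_in_def)
  have "prime_product (pol_in {}) 0 p" if p: "p \<in> pol_in {}" "p \<noteq> 0" for p
  proof (rule prime_product.unit[OF p(1)])
    have "keys p = {0}" using k[OF p(1)] p(2) by (metis keys_eq_empty subset_singletonD)
    hence "p = single 0 (lookup p 0)" "lookup p 0 \<noteq> 0" using sum_single[of p] by (auto simp: in_keys_iff[symmetric])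
    hence "1 = p * single 0 (inverse (lookup p 0))" by (metis mult_single add.right_neutral right_inverse single_one)
    moreover have "single 0 (inverse (lookup p 0)) \<in> pol_in {}" by (rule pol_in_single) auto
    ultimately show "dvd_in (pol_in {}) p 1" by (auto simp: dvd_in_def)
  qed
  thus ?case using pol_in_subring by (auto simp: ufd_set_def)
next
  case (insert v V)
  let ?X = "single (single v 1) 1 :: laurent"
  define \<phi> where "\<phi> P = poly P ?X" for P
  note S = pol_in_subring[of "insert v V"]
  have sub: "pol_in V \<subseteq> pol_in (insert v V)" by (auto simp: pol_in_def laurent_in_def)
  have X: "?X \<in> pol_in (insert v V)" by (rule pol_in_single) (auto simp: lookup_single when_def)
  have "ufd_set (\<phi> ` polys (pol_in V))"
  proof (rule ufd_image[OF ufd_polys[OF insert.IH]])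
    show "inj_on \<phi> (polys (pol_in V))"
    proof (rule inj_onI)
      fix P Q assume PQ: "P \<in> polys (pol_in V)" "Q \<in> polys (pol_in V)" "\<phi> P = \<phi> Q"
      show "P = Q"
      proof (rule poly_eqI, rule poly_mapping_eqI)
        fix k m
        have z: "lookup (coeff R k) m = 0" if "R \<in> polys (pol_in V)" "lookup m v \<noteq> 0" for R
        proof -
          have "coeff R k \<in> laurent_in V" using that by (auto simp: polys_def pol_in_def)
          moreover have "v \<in> keys m" using that(2) by (simp add: in_keys_iff)
          ultimately have "m \<notin> keys (coeff R k)" using insert.hyps(2) unfolding laurent_in_def by blast
          thus ?thesis by (simp add: in_keys_iff)
        qed
        show "lookup (coeff P k) m = lookup (coeff Q k) m"
        proof (cases "lookup m v = 0")
          case True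
          have "lookup (coeff R k) m = lookup (\<phi> R) (m + single v (int k))" if "R \<in> polys (pol_in V)" for R
            unfolding \<phi>_def by (rule poly_var_lookup[OF insert.hyps(2) that True, symmetric])
          thus ?thesis using PQ by simp
        qed (simp add: z PQ)
      qed
    qed
  qed (simp_all add: \<phi>_def)
  moreover have "\<phi> ` polys (pol_in V) = pol_in (insert v V)"
  proof
    have pw: "?X ^ j \<in> pol_in (insert v V)" for j
      by (induction j) (auto simp: subring_setD[OF S] X)
    show "\<phi> ` polys (pol_in V) \<subseteq> pol_in (insert v V)"
      unfolding \<phi>_def poly_altdef
      using sub by (auto simp: polys_def intro!: subring_set_sum[OF S] subring_setD(4)[OF S] pw)
    have D: "subring_set (polys (pol_in V))" by (rule subring_polys[OF pol_in_subring])
    show "pol_in (insert v V) \<subseteq> \<phi> ` polys (pol_in V)"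
    proof
      fix p assume p: "p \<in> pol_in (insert v V)"
      have "\<exists>P\<in>polys (pol_in V). \<phi> P = single m c" if m: "m \<in> keys p" for m c
      proof -
        have km: "keys m \<subseteq> insert v V" "\<And>i. 0 \<le> lookup m i" using p m by (auto simp: pol_in_def laurent_in_def)
        define n where "n = m - single v (lookup m v)"
        have n: "lookup n i = (if i = v then 0 else lookup m i)" for i
          by (simp add: n_def lookup_minus lookup_single when_def)
        have "single n c \<in> pol_in V"
          by (rule pol_in_single) (use km n in \<open>auto simp: in_keys_iff split: if_splits\<close>)
        hence "monom (single n c) (nat (lookup m v)) \<in> polys (pol_in V)" by (rule monom_polys[OF pol_in_subring])
        moreover have "\<phi> (monom (single n c) (nat (lookup m v))) = single m c"
        proof -
          have "?X ^ j = single (single v (int j)) 1" for j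
            by (induction j) (simp_all add: mult_single single_add[symmetric] add.commute)
          thus ?thesis using km(2)[of v] by (simp add: \<phi>_def poly_monom mult_single n_def)
        qed
        ultimately show ?thesis by blast
      qed
      hence "\<forall>m. \<exists>P. m \<in> keys p \<longrightarrow> P \<in> polys (pol_in V) \<and> \<phi> P = single m (lookup p m)" by blast
      from choice[OF this] obtain f where f: "\<And>m. m \<in> keys p \<Longrightarrow> f m \<in> polys (pol_in V)"
        "\<And>m. m \<in> keys p \<Longrightarrow> \<phi> (f m) = single m (lookup p m)" by blast
      have "p = \<phi> (\<Sum>m\<in>keys p. f m)" using f(2) sum_single[of p] by (simp add: \<phi>_def poly_sum)
      moreover have "(\<Sum>m\<in>keys p. f m) \<in> polys (pol_in V)" by (intro subring_set_sum[OF D] f)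
      ultimately show "p \<in> \<phi> ` polys (pol_in V)" by blast
    qed
  qed
  ultimately show ?case by simp
qed

lemma clear_denominators:
  assumes "finite V" "finite F" "F \<subseteq> laurent_in V"
  obtains m where "keys m \<subseteq> V" "single m 1 \<in> pol_in V" "\<And>p. p \<in> F \<Longrightarrow> single m 1 * p \<in> pol_in V"
proof -
  define B where "B = (\<Union>p\<in>F. \<Union>m\<in>keys p. (\<lambda>i. \<bar>lookup m i\<bar>) ` V)"
  have fB: "finite B" unfolding B_def using assms by auto
  define k where "k = (\<Sum>b\<in>B. \<bar>b\<bar>)"
  have kb: "b \<le> k" if "b \<in> B" for b
    using member_le_sum[of b B abs] fB that by (auto simp: k_def B_def)
  define m where "m = (\<Sum>i\<in>V. single i k)"
  have lm: "lookup m i = (if i \<in> V then k else 0)" for i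
    using assms(1) by (simp add: m_def lookup_sum lookup_single when_def sum.delta')
  have km: "keys m \<subseteq> V" by (auto simp: in_keys_iff lm split: if_splits)
  have "single m 1 * p \<in> pol_in V" if p: "p \<in> F" for p
  proof -
    have "single m 1 * p \<in> laurent_in V" using assms(3) p km by (intro laurent_in_closed laurent_in_single) auto
    moreover have "0 \<le> lookup n i" if n: "n \<in> keys (single m 1 * p)" for n i
    proof -
      obtain a where a: "a \<in> keys p" "n = m + a" using Poly_Mapping.keys_mult[of "single m 1" p] n by auto
      show ?thesis
      proof (cases "i \<in> V")
        case True
        hence "\<bar>lookup a i\<bar> \<le> k" using a(1) p by (intro kb) (auto simp: B_def)
        thus ?thesis using True by (simp add: a(2) lookup_add lm)
      next
        case False
        hence "i \<notin> keys a" using assms(3) p a(1) unfolding laurent_in_def by blast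
        hence "lookup a i = 0" by (simp add: in_keys_iff)
        thus ?thesis using False by (simp add: a(2) lookup_add lm)
      qed
    qed
    ultimately show ?thesis by (simp add: pol_in_def)
  qed
  moreover have "0 \<le> k" unfolding k_def by (rule sum_nonneg) simp
  hence "single m 1 \<in> pol_in V" using km by (intro pol_in_single) (auto simp: lm)
  ultimately show ?thesis using that km by blast
qed

lemma monomial_inverse: "single m (1 :: complex) * single (- m) 1 = (1 :: laurent)"
  by (simp add: mult_single)

text \<open>A prime factor \<open>p\<close> of \<open>A\<close> that is not a unit fails to divide
  some \<open>X j\<close> by coprimality, so it divides \<open>B\<close> and can be cancelled;
  induction on the number of factors does the rest. Primes are those of the polynomial ring
  \<open>pol_in V\<close>, hence the monomials that clear denominators.\<close>

theorem coprime_dvd: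
  fixes N X :: "'i \<Rightarrow> laurent"
  assumes V: "finite V" and I: "finite I"
    and in_V: "A \<in> laurent_in V" "B \<in> laurent_in V" "\<And>i. i \<in> I \<Longrightarrow> N i \<in> laurent_in V" "\<And>i. i \<in> I \<Longrightarrow> X i \<in> laurent_in V"
    and A: "A \<noteq> 0" and eq: "\<And>i. i \<in> I \<Longrightarrow> A * N i = B * X i"
    and cop: "\<And>g. g \<in> laurent_in V \<Longrightarrow> (\<And>i. i \<in> I \<Longrightarrow> g dvd X i) \<Longrightarrow> g dvd 1"
  obtains u where "u \<in> laurent_in V" "B = A * u"
proof -
  note C = laurent_in_closed[where V = V]
  have pl: "x \<in> laurent_in V" if "x \<in> pol_in V" for x using that by (simp add: pol_in_def)
  have unit: "\<exists>r\<in>laurent_in V. p * r = 1" if p: "p \<in> laurent_in V" "p dvd 1" for p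
  proof -
    obtain r where "p * r = 1" using p(2) by (metis dvd_def)
    then obtain m c where m: "p = single m c" "r = single (- m) (inverse c)" "c \<noteq> 0" by (rule laurent_unit_monomial)
    have "keys m \<subseteq> V" using p(1) m by (auto simp: laurent_in_def)
    hence "keys (- m) \<subseteq> V" by simp
    hence "r \<in> laurent_in V" unfolding m(2) by (rule laurent_in_single)
    thus ?thesis using \<open>p * r = 1\<close> by blast
  qed
  have main: "\<exists>u\<in>laurent_in V. B = A * u"
    if "prime_product (pol_in V) n A" "B \<in> laurent_in V" "\<And>i. i \<in> I \<Longrightarrow> N i \<in> laurent_in V"
      "\<And>i. i \<in> I \<Longrightarrow> A * N i = B * X i" for n A B and N :: "'i \<Rightarrow> laurent"
    using that
  proof (induction arbitrary: B N rule: prime_product.induct)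
    case (unit a)
    then obtain b where b: "b \<in> pol_in V" "1 = a * b" by (auto simp: dvd_in_def)
    hence "B = a * (b * B)" by (metis mult.assoc mult_1)
    thus ?case using C(4)[OF pl[OF b(1)] unit.prems(1)] by blast
  next
    case (prime p n A)
    have pA: "p \<in> laurent_in V" "p \<noteq> 0" "A \<in> laurent_in V"
      using prime.hyps(1) prime_product_in[OF pol_in_subring prime.hyps(2)] pl by (auto simp: prime_in_def)
    show ?case
    \<comment> \<open>A prime of the polynomial ring may become invertible among Laurent
      polynomials, namely a variable up to a constant. Such a factor is moved to the other
      side.\<close>
    proof (cases "p dvd 1")
      case True
      then obtain r where r: "r \<in> laurent_in V" "p * r = 1" using unit pA by blast
      have "A * N i = r * B * X i" if "i \<in> I" for i
      proof -
        have "r * B * X i = r * (p * A * N i)" using prime.prems(3)[OF that] by (simp add: mult.assoc)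
        also have "\<dots> = (p * r) * (A * N i)" by (simp only: mult_ac)
        finally show ?thesis using r by simp
      qed
      then obtain u where u: "u \<in> laurent_in V" "r * B = A * u"
        using prime.IH[of "r * B" N] C(4)[OF r(1) prime.prems(1)] prime.prems(2) by blast
      have "B = p * (r * B)" using r(2) by (metis mult.assoc mult_1)
      thus ?thesis using u by (auto simp: mult.assoc)
    next
      case False
      then obtain j where j: "j \<in> I" "\<not> p dvd X j" using cop pA by blast
      \<comment> \<open>Clears the denominators of the elements in play, so that primality of
        \<open>p\<close>, which is known in the polynomial ring only, can be applied.\<close>
      obtain m where m: "keys m \<subseteq> V" "single m 1 \<in> pol_in V" "\<And>x. x \<in> {B, X j, N j} \<Longrightarrow> single m 1 * x \<in> pol_in V"
        using clear_denominators[OF V, of "{B, X j, N j}"] prime.prems(1,2) j(1) in_V(4) by auto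
      define \<mu> where "\<mu> = (single m 1 :: laurent)"
      define \<nu> where "\<nu> = (single (- m) 1 :: laurent)"
      have \<mu>\<nu>: "\<nu> * \<mu> = 1" unfolding \<mu>_def \<nu>_def using monomial_inverse by (simp add: mult.commute)
      have \<nu>V: "\<nu> \<in> laurent_in V" unfolding \<nu>_def using m(1) by (intro laurent_in_single) simp
      have \<mu>V: "\<mu> \<in> pol_in V" "\<mu> * B \<in> pol_in V" "\<mu> * X j \<in> pol_in V" "\<mu> * N j \<in> pol_in V"
        unfolding \<mu>_def using m by auto
      have "\<mu> * B * (\<mu> * X j) = \<mu> * \<mu> * (B * X j)" by (simp only: mult_ac)
      also have "\<dots> = p * (A * (\<mu> * (\<mu> * N j)))" unfolding prime.prems(3)[OF j(1), symmetric] by (simp only: mult_ac)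
      finally have e: "\<mu> * B * (\<mu> * X j) = p * (A * (\<mu> * (\<mu> * N j)))" .
      have "A * (\<mu> * (\<mu> * N j)) \<in> pol_in V"
        using prime_product_in[OF pol_in_subring prime.hyps(2)]
          subring_setD(4)[OF pol_in_subring _ subring_setD(4)[OF pol_in_subring \<mu>V(1) \<mu>V(4)]] by blast
      hence "dvd_in (pol_in V) p (\<mu> * B * (\<mu> * X j))" using e unfolding dvd_in_def by blast
      then consider "dvd_in (pol_in V) p (\<mu> * B)" | "dvd_in (pol_in V) p (\<mu> * X j)"
        using prime.hyps(1) \<mu>V by (auto simp: prime_in_def)
      then show ?thesis
      proof cases
        case 1
        then obtain b where b: "b \<in> pol_in V" "\<mu> * B = p * b" by (auto simp: dvd_in_def)
        have "B = \<nu> * \<mu> * B" using \<mu>\<nu> by simp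
        also have "\<dots> = p * (\<nu> * b)" using b(2) by (simp only: mult.assoc mult.left_commute[of \<nu> p])
        finally have B: "B = p * (\<nu> * b)" .
        have bV: "\<nu> * b \<in> laurent_in V" by (intro C \<nu>V pl b)
        have "A * N i = \<nu> * b * X i" if "i \<in> I" for i
        proof -
          have "p * (A * N i) = p * (\<nu> * b * X i)" using prime.prems(3)[OF that] B by (simp only: mult.assoc)
          thus ?thesis using pA(2) by simp
        qed
        then obtain u where u: "u \<in> laurent_in V" "\<nu> * b = A * u" using prime.IH[of "\<nu> * b" N] bV prime.prems(2) by blast
        have "B = p * A * u" unfolding mult.assoc u(2)[symmetric] by (rule B)
        thus ?thesis using u(1) by blast
      next
        case 2
        then obtain t where t: "\<mu> * X j = p * t" by (auto simp: dvd_in_def)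
        have "X j = \<nu> * \<mu> * X j" using \<mu>\<nu> by simp
        also have "\<dots> = p * (\<nu> * t)" using t by (simp only: mult.assoc mult.left_commute[of \<nu> p])
        finally show ?thesis using j(2) by (metis dvd_triv_left)
      qed
    qed
  qed
  obtain m where m: "keys m \<subseteq> V" "single m 1 * A \<in> pol_in V"
    using clear_denominators[OF V, of "{A}"] in_V(1) by auto
  define \<mu> where "\<mu> = (single m 1 :: laurent)"
  have \<mu>: "\<mu> \<noteq> 0" "\<mu> \<in> laurent_in V" unfolding \<mu>_def
    using m(1) by (auto intro: laurent_in_single simp flip: keys_eq_empty)
  have "\<mu> * A \<noteq> 0" using \<mu> A by simp
  then obtain n where "prime_product (pol_in V) n (\<mu> * A)"
    using ufd_pol_in[OF V] m(2) unfolding \<mu>_def ufd_set_def by blast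
  moreover have "\<mu> * A * N i = \<mu> * B * X i" if "i \<in> I" for i using eq[OF that] by (simp add: mult.assoc)
  ultimately obtain u where "u \<in> laurent_in V" "\<mu> * B = \<mu> * A * u"
    using main[of n "\<mu> * A" "\<mu> * B" N] C(4)[OF \<mu>(2) in_V(2)] in_V(3) by blast
  thus ?thesis using that \<mu>(1) by (simp add: mult.assoc)
qed

section \<open>Vectors with vanishing sum\<close>

text \<open>A trivial kernel means a nonzero determinant, and the expansion over permutations keeps
  the determinant within \<open>lfun\<close>.\<close>

lemma lfun_kernel:
  assumes I: "finite I" and A: "\<And>i j. i \<in> I \<Longrightarrow> j \<in> I \<Longrightarrow> (\<lambda>\<theta>. A \<theta> i j) \<in> lfun V"
  shows "\<exists>d\<in>lfun V. \<forall>\<theta>. d \<theta> \<noteq> 0 \<longleftrightarrow> (\<forall>v. (\<forall>i\<in>I. (\<Sum>j\<in>I. A \<theta> i j * v j) = 0) \<longrightarrow> (\<forall>i\<in>I. v i = 0))"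
proof -
  define n where "n = card I"
  obtain e where e: "bij_betw e {0..<n} I" using ex_bij_betw_nat_finite[OF I] unfolding n_def by blast
  have eI: "e a \<in> I" if "a < n" for a using e that by (auto simp: bij_betw_def)
  define M where "M \<theta> = mat n n (\<lambda>(a, b). A \<theta> (e a) (e b))" for \<theta>
  have M: "M \<theta> \<in> carrier_mat n n" for \<theta> by (simp add: M_def)
  have "(\<lambda>\<theta>. \<Sum>p | p permutes {0..<n}. signof p * (\<Prod>i = 0..<n. M \<theta> $$ (i, p i))) \<in> lfun V"
  proof (intro lfun_sum lfun.mult lfun.const lfun_prod)
    fix p i assume p: "p \<in> {p. p permutes {0..<n}}" and i: "i \<in> {0..<n}"
    hence "p i < n" by (metis atLeastLessThan_iff mem_Collect_eq permutes_in_image)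
    thus "(\<lambda>\<theta>. M \<theta> $$ (i, p i)) \<in> lfun V" using i A eI by (simp add: M_def)
  qed
  moreover have "(\<lambda>\<theta>. det (M \<theta>)) = (\<lambda>\<theta>. \<Sum>p | p permutes {0..<n}. signof p * (\<Prod>i = 0..<n. M \<theta> $$ (i, p i)))"
    by (simp add: det_def M_def)
  ultimately have "(\<lambda>\<theta>. det (M \<theta>)) \<in> lfun V" by simp
  moreover have "det (M \<theta>) \<noteq> 0 \<longleftrightarrow> (\<forall>v. (\<forall>i\<in>I. (\<Sum>j\<in>I. A \<theta> i j * v j) = 0) \<longrightarrow> (\<forall>i\<in>I. v i = 0))" for \<theta>
  proof -
    have prod: "(M \<theta> *\<^sub>v vec n (\<lambda>a. v (e a))) $ a = (\<Sum>j\<in>I. A \<theta> (e a) j * v j)" if "a < n" for v a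
    proof -
      have "(M \<theta> *\<^sub>v vec n (\<lambda>a. v (e a))) $ a = (\<Sum>b\<in>{0..<n}. A \<theta> (e a) (e b) * v (e b))"
        using that by (simp add: M_def scalar_prod_def)
      thus ?thesis by (simp add: sum.reindex_bij_betw[OF e, of "\<lambda>j. A \<theta> (e a) j * v j"])
    qed
    have surj: "\<exists>a<n. i = e a" if "i \<in> I" for i using e that by (auto simp: bij_betw_def)
    have "det (M \<theta>) = 0 \<longleftrightarrow> (\<exists>v. (\<forall>i\<in>I. (\<Sum>j\<in>I. A \<theta> i j * v j) = 0) \<and> (\<exists>i\<in>I. v i \<noteq> 0))"
    proof
      assume "det (M \<theta>) = 0"
      then obtain x where x: "x \<in> carrier_vec n" "x \<noteq> 0\<^sub>v n" "M \<theta> *\<^sub>v x = 0\<^sub>v n"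
        using det_0_iff_vec_prod_zero[OF M] by blast
      define v where "v i = x $ (the_inv_into {0..<n} e i)" for i
      have ve: "v (e a) = x $ a" if "a < n" for a
        using that e the_inv_into_f_f[of e "{0..<n}" a] by (simp add: v_def bij_betw_def)
      have xv: "x = vec n (\<lambda>a. v (e a))" using x(1) ve by auto
      have "(\<Sum>j\<in>I. A \<theta> i j * v j) = 0" if "i \<in> I" for i
      proof -
        obtain a where a: "a < n" "i = e a" using surj[OF \<open>i \<in> I\<close>] by blast
        have "(M \<theta> *\<^sub>v x) $ a = 0" using x(3) a by simp
        thus ?thesis using prod[OF a(1), of v] xv a by simp
      qed
      moreover obtain a where "a < n" "x $ a \<noteq> 0"
        using x(1,2) by (metis carrier_vecD eq_vecI index_zero_vec(1) index_zero_vec(2))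
      hence "\<exists>i\<in>I. v i \<noteq> 0" using ve eI by metis
      ultimately show "\<exists>v. (\<forall>i\<in>I. (\<Sum>j\<in>I. A \<theta> i j * v j) = 0) \<and> (\<exists>i\<in>I. v i \<noteq> 0)" by blast
    next
      assume "\<exists>v. (\<forall>i\<in>I. (\<Sum>j\<in>I. A \<theta> i j * v j) = 0) \<and> (\<exists>i\<in>I. v i \<noteq> 0)"
      then obtain v i where v: "\<And>i. i \<in> I \<Longrightarrow> (\<Sum>j\<in>I. A \<theta> i j * v j) = 0" "i \<in> I" "v i \<noteq> 0" by blast
      let ?x = "vec n (\<lambda>a. v (e a))"
      obtain a where a: "a < n" "i = e a" using surj[OF v(2)] by blast
      have "?x $ a \<noteq> 0\<^sub>v n $ a" using a v(3) by simp
      hence "?x \<noteq> 0\<^sub>v n" by metis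
      moreover have "M \<theta> *\<^sub>v ?x = 0\<^sub>v n"
      proof (rule eq_vecI)
        fix a assume "a < dim_vec (0\<^sub>v n)"
        hence a: "a < n" by simp
        show "(M \<theta> *\<^sub>v ?x) $ a = 0\<^sub>v n $ a" using prod[OF a] v(1)[OF eI[OF a]] a by simp
      qed (use M in auto)
      ultimately show "det (M \<theta>) = 0"
        using det_0_iff_vec_prod_zero[OF M] vec_carrier[of n] by metis
    qed
    thus ?thesis by blast
  qed
  ultimately show ?thesis by (intro bexI[of _ "\<lambda>\<theta>. det (M \<theta>)"] allI)
qed

text \<open>Multiplication by this common denominator turns the entries of the transfer matrix into
  Laurent functions of the parameters.\<close>

definition tden :: "nat \<Rightarrow> complex \<Rightarrow> (nat \<Rightarrow> complex) \<Rightarrow> complex \<Rightarrow> complex \<Rightarrow> complex" where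
  "tden L w z \<zeta>0 \<zeta>L = (\<Prod>i\<in>{1..L}. br (q * w / z i)) * (\<Prod>i\<in>{1..L}. br (q * z i * w)) * kfun (w / q) \<zeta>0 * kfun (1 / w) \<zeta>L"

fun wnum :: "nat \<Rightarrow> complex \<Rightarrow> (nat \<Rightarrow> complex) \<Rightarrow> complex \<Rightarrow> complex \<Rightarrow> config \<Rightarrow> complex" where
  "wnum L w z \<zeta>0 \<zeta>L (A, B, l, r) =
     (\<Prod>i\<in>{1..L}. if i \<in> A then br (q * z i / w) else br (z i / w)) *
     (\<Prod>i\<in>{1..L}. if i \<in> B then - br (z i * w) else br (q / (z i * w))) *
     (if l then kfun (q / w) \<zeta>0 else br (inverse q) * br (q\<^sup>2 / w\<^sup>2)) *
     (if r then kfun w \<zeta>L else br (inverse q) * br (w\<^sup>2))"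

lemma T_regular_tden: "T_regular L w z \<zeta>0 \<zeta>L \<longleftrightarrow> w \<noteq> 0 \<and> tden L w z \<zeta>0 \<zeta>L \<noteq> 0"
  by (auto simp: T_regular_def tden_def)

lemma weight_wnum: "tden L w z \<zeta>0 \<zeta>L \<noteq> 0 \<Longrightarrow> tden L w z \<zeta>0 \<zeta>L * weight L w z \<zeta>0 \<zeta>L C = wnum L w z \<zeta>0 \<zeta>L C"
  by (cases C) (simp add: tden_def prod_dividef)

lemma T_op_sum:
  assumes "\<beta> \<in> LP L"
  shows "T_op L w z \<zeta>0 \<zeta>L v \<beta> = (\<Sum>\<alpha>\<in>LP L. v \<alpha> * (\<Sum>C\<in>configs L. weight L w z \<zeta>0 \<zeta>L C * (if out_pattern L C \<alpha> = \<beta> then 1 else 0)))"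
proof -
  have "T_op L w z \<zeta>0 \<zeta>L v \<beta> = (\<Sum>\<gamma>\<in>LP L. (if \<gamma> = \<beta> then 1 else 0) * T_op L w z \<zeta>0 \<zeta>L v \<gamma>)"
    using assms by (simp add: if_distrib[of "\<lambda>x. x * _"] cong: if_cong)
  thus ?thesis unfolding sum_T_op Td_def .
qed

lemma lfun_if: "(c \<Longrightarrow> f \<in> lfun V) \<Longrightarrow> (\<not> c \<Longrightarrow> g \<in> lfun V) \<Longrightarrow> (\<lambda>z. if c then f z else g z) \<in> lfun V"
  by (cases c) simp_all

lemma lfun_br:
  assumes "f \<in> lfun V" "(\<lambda>z. inverse (f z)) \<in> lfun V"
  shows "(\<lambda>z. br (f z)) \<in> lfun V"
  unfolding br_def by (intro lfun_diff assms)

text \<open>The constant 0 also belongs to this set, as \<open>inverse 0 = 0\<close>.\<close>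

definition lunit :: "nat set \<Rightarrow> ((nat \<Rightarrow> complex) \<Rightarrow> complex) set" where
  "lunit V = {f. f \<in> lfun V \<and> (\<lambda>z. inverse (f z)) \<in> lfun V}"

lemma lunit_const: "(\<lambda>z. c) \<in> lunit V"
  by (simp add: lunit_def lfun.const)

lemma lunit_var: "i \<in> V \<Longrightarrow> (\<lambda>z. z i) \<in> lunit V"
  by (simp add: lunit_def lfun.intros)

lemma lunit_mult: "f \<in> lunit V \<Longrightarrow> g \<in> lunit V \<Longrightarrow> (\<lambda>z. f z * g z) \<in> lunit V"
  by (simp add: lunit_def lfun.mult)

lemma lunit_inverse: "f \<in> lunit V \<Longrightarrow> (\<lambda>z. inverse (f z)) \<in> lunit V"
  by (simp add: lunit_def)

lemma lunit_divide: "f \<in> lunit V \<Longrightarrow> g \<in> lunit V \<Longrightarrow> (\<lambda>z. f z / g z) \<in> lunit V"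
  unfolding divide_inverse by (intro lunit_mult lunit_inverse)

lemma lfun_br': "f \<in> lunit V \<Longrightarrow> (\<lambda>z. br (f z)) \<in> lfun V"
  by (simp add: lunit_def lfun_br)

lemma lfun_kfun: "f \<in> lunit V \<Longrightarrow> g \<in> lunit V \<Longrightarrow> (\<lambda>z. kfun (f z) (g z)) \<in> lfun V"
  unfolding kfun_def by (intro lfun.mult lfun_br' lunit_divide lunit_mult lunit_const)

text \<open>Up to denominators \<open>d\<close> is the determinant of the identity minus
  \<open>T\<close> plus the rank one map that sends \<open>v\<close> to \<open>sum v (LP L)\<close>
  times a basis vector. Fixed vectors of sum zero lie in its kernel; conversely, where
  \<open>T\<close> preserves sums, adding up all components shows that a kernel vector has sum zero
  and is fixed.\<close>

lemma zero_sum_free_det: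
  assumes L: "1 \<le> L" and w: "w \<noteq> 0" and Z: "\<And>i. i \<in> {1..L} \<Longrightarrow> (\<lambda>\<theta>. Z \<theta> i) \<in> lunit V"
    and Z0: "Z0 \<in> lunit V" and ZL: "ZL \<in> lunit V"
  obtains d where "d \<in> lfun V"
    "\<And>\<theta>. d \<theta> \<noteq> 0 \<Longrightarrow> T_regular L w (Z \<theta>) (Z0 \<theta>) (ZL \<theta>) \<and> zero_sum_free L w (Z \<theta>) (Z0 \<theta>) (ZL \<theta>)"
    "\<And>\<theta>. T_regular L w (Z \<theta>) (Z0 \<theta>) (ZL \<theta>) \<Longrightarrow> zero_sum_free L w (Z \<theta>) (Z0 \<theta>) (ZL \<theta>) \<Longrightarrow>
       (\<And>v. sum (T_op L w (Z \<theta>) (Z0 \<theta>) (ZL \<theta>) v) (LP L) = sum v (LP L)) \<Longrightarrow> d \<theta> \<noteq> 0"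
proof -
  \<comment> \<open>Any link pattern would do: it only carries the rank one term.\<close>
  define \<gamma> where "\<gamma> = replicate L Cls"
  have \<gamma>: "\<gamma> \<in> LP L" by (simp add: \<gamma>_def LP_def)
  define D where "D \<theta> = tden L w (Z \<theta>) (Z0 \<theta>) (ZL \<theta>)" for \<theta>
  define T where "T \<theta> = T_op L w (Z \<theta>) (Z0 \<theta>) (ZL \<theta>)" for \<theta>
  define A where "A \<theta> \<beta> \<alpha> = (if \<alpha> = \<beta> then D \<theta> else 0)
    - (\<Sum>C\<in>configs L. wnum L w (Z \<theta>) (Z0 \<theta>) (ZL \<theta>) C * (if out_pattern L C \<alpha> = \<beta> then 1 else 0))
    + (if \<beta> = \<gamma> then D \<theta> else 0)" for \<theta> and \<alpha> \<beta> :: "bracket list"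
  note u = lunit_divide lunit_mult lunit_const Z Z0 ZL
  have D: "D \<in> lfun V" unfolding D_def[abs_def] tden_def
    by (intro lfun.mult lfun_prod lfun_br' lfun_kfun u)
  have wn: "(\<lambda>\<theta>. wnum L w (Z \<theta>) (Z0 \<theta>) (ZL \<theta>) C) \<in> lfun V" for C
  proof (cases C)
    case (fields A B l r)
    show ?thesis unfolding fields wnum.simps
      by (intro lfun.mult lfun_prod lfun_if lfun_minus lfun_br' lfun_kfun lfun.const u)
  qed
  have Al: "(\<lambda>\<theta>. A \<theta> \<beta> \<alpha>) \<in> lfun V" for \<alpha> \<beta>
    unfolding A_def by (intro lfun.add lfun_diff lfun_sum lfun.mult wn lfun.const lfun_if D)
  have "\<exists>d\<in>lfun V. \<forall>\<theta>. d \<theta> \<noteq> 0 \<longleftrightarrow> (\<forall>v. (\<forall>\<beta>\<in>LP L. (\<Sum>\<alpha>\<in>LP L. A \<theta> \<beta> \<alpha> * v \<alpha>) = 0) \<longrightarrow> (\<forall>\<beta>\<in>LP L. v \<beta> = 0))"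
    by (rule lfun_kernel[OF finite_LP Al])
  then obtain d where d: "d \<in> lfun V" and
    d2: "\<forall>\<theta>. d \<theta> \<noteq> 0 \<longleftrightarrow> (\<forall>v. (\<forall>\<beta>\<in>LP L. (\<Sum>\<alpha>\<in>LP L. A \<theta> \<beta> \<alpha> * v \<alpha>) = 0) \<longrightarrow> (\<forall>\<beta>\<in>LP L. v \<beta> = 0))"
    by (rule bexE)
  have A: "(\<Sum>\<alpha>\<in>LP L. A \<theta> \<beta> \<alpha> * v \<alpha>) = D \<theta> * (v \<beta> - T \<theta> v \<beta> + (if \<beta> = \<gamma> then sum v (LP L) else 0))"
    if "\<beta> \<in> LP L" "D \<theta> \<noteq> 0" for \<theta> \<beta> v
  proof -
    have "D \<theta> * T \<theta> v \<beta> = (\<Sum>\<alpha>\<in>LP L. v \<alpha> * (\<Sum>C\<in>configs L. wnum L w (Z \<theta>) (Z0 \<theta>) (ZL \<theta>) C * (if out_pattern L C \<alpha> = \<beta> then 1 else 0)))"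
      using that unfolding T_def T_op_sum[OF that(1)] D_def sum_distrib_left
      by (intro sum.cong refl) (simp add: weight_wnum[symmetric])
    moreover have "(\<Sum>\<alpha>\<in>LP L. (if \<alpha> = \<beta> then D \<theta> else 0) * v \<alpha>) = D \<theta> * v \<beta>"
      using that(1) by (simp add: if_distrib[of "\<lambda>x. x * _"] cong: if_cong)
    ultimately show ?thesis unfolding A_def
      by (simp add: algebra_simps sum.distrib sum_subtractf sum_distrib_left)
  qed
  show thesis
  proof (rule that[of "\<lambda>\<theta>. D \<theta> * d \<theta>"])
    show "(\<lambda>\<theta>. D \<theta> * d \<theta>) \<in> lfun V" by (intro lfun.mult D d)
  next
    fix \<theta> assume nz: "D \<theta> * d \<theta> \<noteq> 0"
    have "\<forall>\<alpha>\<in>LP L. v \<alpha> = 0" if v: "vec_eq L (T \<theta> v) v" "sum v (LP L) = 0" for v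
    proof -
      have "(\<Sum>\<alpha>\<in>LP L. A \<theta> \<beta> \<alpha> * v \<alpha>) = 0" if "\<beta> \<in> LP L" for \<beta>
        using A[OF that, of \<theta> v] nz v that by (simp add: vec_eq_def)
      thus ?thesis using d2[rule_format, of \<theta>] nz by simp
    qed
    thus "T_regular L w (Z \<theta>) (Z0 \<theta>) (ZL \<theta>) \<and> zero_sum_free L w (Z \<theta>) (Z0 \<theta>) (ZL \<theta>)"
      using nz w by (simp add: T_regular_tden zero_sum_free_def T_def D_def)
  next
    fix \<theta> assume r: "T_regular L w (Z \<theta>) (Z0 \<theta>) (ZL \<theta>)" and f: "zero_sum_free L w (Z \<theta>) (Z0 \<theta>) (ZL \<theta>)"
      and s: "\<And>v. sum (T_op L w (Z \<theta>) (Z0 \<theta>) (ZL \<theta>) v) (LP L) = sum v (LP L)"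
    have D0: "D \<theta> \<noteq> 0" using r by (simp add: T_regular_tden D_def)
    have "\<forall>\<beta>\<in>LP L. v \<beta> = 0" if "\<forall>\<beta>\<in>LP L. (\<Sum>\<alpha>\<in>LP L. A \<theta> \<beta> \<alpha> * v \<alpha>) = 0" for v
    proof -
      have eq: "v \<beta> - T \<theta> v \<beta> + (if \<beta> = \<gamma> then sum v (LP L) else 0) = 0" if "\<beta> \<in> LP L" for \<beta>
        using A[OF that D0, of v] D0 \<open>\<forall>\<beta>\<in>LP L. _ = 0\<close> that by simp
      have "(\<Sum>\<beta>\<in>LP L. v \<beta> - T \<theta> v \<beta> + (if \<beta> = \<gamma> then sum v (LP L) else 0)) = sum v (LP L)"
        using \<gamma> s[of v] by (simp add: sum.distrib sum_subtractf T_def)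
      hence s0: "sum v (LP L) = 0" using eq by simp
      have "T \<theta> v \<beta> = v \<beta>" if "\<beta> \<in> LP L" for \<beta> using eq[OF that] s0 by (auto split: if_splits)
      hence "vec_eq L (T \<theta> v) v" by (simp add: vec_eq_def)
      thus ?thesis using f s0 by (simp add: zero_sum_free_def T_def)
    qed
    thus "D \<theta> * d \<theta> \<noteq> 0" using D0 d2[rule_format, of \<theta>] by simp
  qed
qed

section \<open>The exchange argument\<close>

lemma torus_upd: "z \<in> torus \<Longrightarrow> x \<noteq> 0 \<Longrightarrow> z(i := x) \<in> torus"
  by (simp add: torus_def)

lemma torusD: "z \<in> torus \<Longrightarrow> z i \<noteq> 0"
  by (simp add: torus_def)

lemma one_torus: "(\<lambda>_. 1) \<in> torus"
  by (simp add: torus_def)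

lemma lfun_mult_zero:
  assumes "f \<in> lfun V" "g \<in> lfun V" "\<And>z. z \<in> torus \<Longrightarrow> f z * g z = 0" "z0 \<in> torus" "f z0 \<noteq> 0" "z \<in> torus"
  shows "g z = 0"
proof (rule ccontr)
  assume "g z \<noteq> 0"
  show False
    by (rule lfun_mult_nonzero[OF assms(1,2,4,5,6) \<open>g z \<noteq> 0\<close>]) (use assms(3) in force)
qed

lemma lunitD: "f \<in> lunit V \<Longrightarrow> f \<in> lfun V" "f \<in> lunit V \<Longrightarrow> (\<lambda>z. inverse (f z)) \<in> lfun V"
  by (simp_all add: lunit_def)

lemma lfun_subst:
  assumes "f \<in> lfun V" "\<And>j. j \<in> V \<Longrightarrow> (\<lambda>z. \<tau> z j) \<in> lunit W"
  shows "(\<lambda>z. f (\<tau> z)) \<in> lfun W"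
  by (rule lfun_comp[OF assms(1)]) (use assms(2) in \<open>auto dest: lunitD\<close>)

lemma lunit_upd: "\<mu> \<in> lunit V \<Longrightarrow> j \<in> V \<Longrightarrow> (\<lambda>z. (z(i := \<mu> z)) j) \<in> lunit V"
  by (cases "j = i") (simp_all add: lunit_var)

lemma lfun_upd: "f \<in> lfun V \<Longrightarrow> \<mu> \<in> lunit V \<Longrightarrow> (\<lambda>z. f (z(i := \<mu> z))) \<in> lfun V"
  by (rule lfun_subst[of f V "\<lambda>z. z(i := \<mu> z)"]) (auto intro: lunit_upd simp del: fun_upd_apply)

lemma generically_lfun:
  assumes "f \<in> lfun V" "z0 \<in> torus" "f z0 \<noteq> 0" "\<And>x. x \<in> torus \<Longrightarrow> f x \<noteq> 0 \<Longrightarrow> P x"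
    and "\<And>x y. (\<forall>i\<in>V. x i = y i) \<Longrightarrow> P x \<Longrightarrow> P y"
  shows "generically V P"
proof -
  obtain p where p: "p \<in> laurent_in V" "\<forall>z\<in>torus. leval p z = f z" using lfun_leval[OF assms(1)] by blast
  have "leval p z0 \<noteq> 0" using p assms(2,3) by simp
  hence p0: "p \<noteq> 0" by auto
  have "P x" if x: "\<forall>i\<in>V. x i \<noteq> 0" "leval p x \<noteq> 0" for x
  proof -
    \<comment> \<open>The coordinates outside \<open>V\<close> are unconstrained and may be 0;
      setting them to 1 reaches the torus without changing any value of interest.\<close>
    define y where "y i = (if i \<in> V then x i else 1)" for i
    have y: "y \<in> torus" using x by (simp add: torus_def y_def)
    have "leval p x = leval p y" by (rule leval_cong[OF p(1)]) (simp add: y_def)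
    hence "P y" using x p(2) y assms(4) by simp
    thus ?thesis by (rule assms(5)[rotated]) (simp add: y_def)
  qed
  thus ?thesis unfolding generically_def using p(1) p0 by blast
qed

lemma generically_mono: "generically V P \<Longrightarrow> (\<And>x. \<forall>i\<in>V. x i \<noteq> 0 \<Longrightarrow> P x \<Longrightarrow> Q x) \<Longrightarrow> generically V Q"
  unfolding generically_def by blast

lemma generically_conj:
  assumes "generically V P" "generically V Q"
  shows "generically V (\<lambda>x. P x \<and> Q x)"
proof -
  obtain p where p: "p \<in> laurent_in V" "p \<noteq> 0" "\<And>x. \<forall>i\<in>V. x i \<noteq> 0 \<Longrightarrow> leval p x \<noteq> 0 \<Longrightarrow> P x"
    using assms(1) unfolding generically_def by blast
  obtain r where r: "r \<in> laurent_in V" "r \<noteq> 0" "\<And>x. \<forall>i\<in>V. x i \<noteq> 0 \<Longrightarrow> leval r x \<noteq> 0 \<Longrightarrow> Q x"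
    using assms(2) unfolding generically_def by blast
  obtain z1 where z1: "z1 \<in> torus" "leval p z1 \<noteq> 0" using p(2) leval_eq_0[of p] by blast
  obtain z2 where z2: "z2 \<in> torus" "leval r z2 \<noteq> 0" using r(2) leval_eq_0[of r] by blast
  obtain z where z: "z \<in> torus" "leval p z \<noteq> 0" "leval r z \<noteq> 0"
    using lfun_mult_nonzero[OF leval_lfun[OF p(1)] leval_lfun[OF r(1)] z1 z2] by blast
  have "leval (p * r) z \<noteq> 0" using z by (simp add: leval_mult)
  hence pr: "p * r \<noteq> 0" by auto
  have "P x \<and> Q x" if x: "\<forall>i\<in>V. x i \<noteq> 0" "leval (p * r) x \<noteq> 0" for x
  proof -
    define y where "y i = (if i \<in> V then x i else 1)" for i
    have y: "y \<in> torus" using x by (simp add: torus_def y_def)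
    have e: "leval s x = leval s y" if "s \<in> laurent_in V" for s
      by (rule leval_cong[OF that]) (simp add: y_def)
    have "leval (p * r) x = leval p x * leval r x"
      using e[OF laurent_in_closed(4)[OF p(1) r(1)]] e[OF p(1)] e[OF r(1)] y by (simp add: leval_mult)
    thus ?thesis using x p(3) r(3) by auto
  qed
  thus ?thesis unfolding generically_def using laurent_in_closed(4)[OF p(1) r(1)] pr by blast
qed

lemma generically_True: "generically V (\<lambda>_. True)"
  by (rule generically_lfun[of "\<lambda>_. 1" V "\<lambda>_. 1"]) (auto intro: lfun.const one_torus)

lemma generically_ball: "finite I \<Longrightarrow> (\<And>i. i \<in> I \<Longrightarrow> generically V (P i)) \<Longrightarrow> generically V (\<lambda>x. \<forall>i\<in>I. P i x)"
  by (induction I rule: finite_induct) (auto intro: generically_True generically_conj)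

text \<open>The factor theorem is applied once per root. As \<open>\<nu>\<close> is nonzero and the
  constants in \<open>C\<close> are distinct, the factors already split off do not vanish on the
  next root, so the remaining factor \<open>H\<close> does.\<close>

lemma lfun_factors:
  assumes "finite C" "f \<in> lfun V" "i \<in> V" "\<nu> \<in> lunit V" "\<And>z. z \<in> torus \<Longrightarrow> \<nu> z \<noteq> 0" "\<And>z x. \<nu> (z(i := x)) = \<nu> z" "0 \<notin> C"
    and "\<And>c z. c \<in> C \<Longrightarrow> z \<in> torus \<Longrightarrow> f (z(i := c * \<nu> z)) = 0"
  shows "\<exists>H\<in>lfun V. \<forall>z\<in>torus. f z = (\<Prod>c\<in>C. z i - c * \<nu> z) * H z"
  using assms
proof (induction C rule: finite_induct)
  case empty
  thus ?case by auto
next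
  case (insert a C)
  then obtain H where H: "H \<in> lfun V" "\<forall>z\<in>torus. f z = (\<Prod>c\<in>C. z i - c * \<nu> z) * H z" by auto
  have a: "a \<noteq> 0" using insert.prems by auto
  have \<mu>: "(\<lambda>z. a * \<nu> z) \<in> lunit V" using insert.prems by (intro lunit_mult lunit_const)
  obtain G where G: "G \<in> lfun V" "\<forall>z\<in>torus. a * \<nu> z \<noteq> 0 \<longrightarrow> H z - H (z(i := a * \<nu> z)) = (z i - a * \<nu> z) * G z"
    using lfun_factor[OF H(1) lunitD[OF \<mu>]] by blast
  have "f z = (\<Prod>c\<in>insert a C. z i - c * \<nu> z) * G z" if z: "z \<in> torus" for z
  proof -
    let ?y = "z(i := a * \<nu> z)"
    have nz: "\<nu> z \<noteq> 0" using z insert.prems by blast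
    have y: "?y \<in> torus" using z nz a by (simp add: torus_upd)
    have "f ?y = (\<Prod>c\<in>C. a * \<nu> z - c * \<nu> z) * H ?y" using H(2) y insert.prems(5)[of z "a * \<nu> z"] by (simp del: fun_upd_apply add: fun_upd_same)
    moreover have "f ?y = 0" using insert.prems z by blast
    moreover have "(\<Prod>c\<in>C. a * \<nu> z - c * \<nu> z) \<noteq> 0"
      using insert.hyps nz by (auto simp: prod_zero_iff)
    ultimately have "H ?y = 0" by simp
    have "a * \<nu> z \<noteq> 0" using nz a by simp
    with G(2) z have "H z - H ?y = (z i - a * \<nu> z) * G z" by blast
    with \<open>H ?y = 0\<close> have "H z = (z i - a * \<nu> z) * G z" by simp
    thus ?thesis using H(2) z insert.hyps by simp
  qed
  thus ?case using G(1) by blast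
qed

section \<open>Freeness on hypersurfaces for generic boundary parameters\<close>

lemma weight_cong:
  assumes "\<And>j. j \<in> {1..L} \<Longrightarrow> z j = z' j"
  shows "weight L w z \<zeta>0 \<zeta>L C = weight L w z' \<zeta>0 \<zeta>L C"
proof (cases C)
  case (fields A B l r)
  show ?thesis unfolding fields weight.simps
    by (intro arg_cong2[of _ _ _ _ "(*)"] refl prod.cong) (simp_all only: assms)
qed

lemma T_op_cong:
  assumes "\<And>j. j \<in> {1..L} \<Longrightarrow> z j = z' j"
  shows "T_op L w z \<zeta>0 \<zeta>L = T_op L w z' \<zeta>0 \<zeta>L"
proof -
  have "weight L w z \<zeta>0 \<zeta>L = weight L w z' \<zeta>0 \<zeta>L" by (intro ext weight_cong assms)
  thus ?thesis by (simp only: T_op_def[abs_def])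
qed

lemma zero_sum_free_cong:
  "(\<And>j. j \<in> {1..L} \<Longrightarrow> z j = z' j) \<Longrightarrow> zero_sum_free L w z \<zeta>0 \<zeta>L = zero_sum_free L w z' \<zeta>0 \<zeta>L"
  unfolding zero_sum_free_def by (simp only: T_op_cong[of L z z'])

lemma T_regular_cong:
  "(\<And>j. j \<in> {1..L} \<Longrightarrow> z j = z' j) \<Longrightarrow> T_regular L w z \<zeta>0 \<zeta>L = T_regular L w z' \<zeta>0 \<zeta>L"
  unfolding T_regular_def by simp

text \<open>The hypersurface \<open>z i = \<mu> z\<close> is parametrised by the torus itself, whose
  coordinate \<open>i\<close> is overwritten; the choice \<open>\<mu> z = z i\<close> gives the
  whole torus.\<close>

definition free_locus :: "nat \<Rightarrow> complex \<Rightarrow> complex \<Rightarrow> complex \<Rightarrow> nat \<Rightarrow> ((nat \<Rightarrow> complex) \<Rightarrow> complex) \<Rightarrow> bool" where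
  "free_locus L w \<zeta>0 \<zeta>L i \<mu> \<longleftrightarrow> (\<exists>d\<in>lfun {1..L}. (\<exists>z\<in>torus. d z \<noteq> 0) \<and>
     (\<forall>z\<in>torus. d z \<noteq> 0 \<longrightarrow> T_regular L w (z(i := \<mu> z)) \<zeta>0 \<zeta>L \<and> zero_sum_free L w (z(i := \<mu> z)) \<zeta>0 \<zeta>L))"

text \<open>The boundary parameters become variables \<open>0\<close> and \<open>Suc L\<close>
  beside the \<open>z_j\<close>, so one Laurent function \<open>d\<close> governs everything, and it
  is nonzero at the special point. Freezing the \<open>z_j\<close> at \<open>zs\<close> gives a
  nonzero function of the boundary parameters; wherever that is nonzero, freezing the boundary
  parameters instead leaves a nonzero function of \<open>z\<close>.\<close>

lemma free_locus_generically:
  assumes L: "1 \<le> L" and w: "w\<^sup>2 = - q" and i: "i \<in> {1..L}" and k: "k \<le> L"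
    and \<mu>: "(\<lambda>\<theta>. \<mu> (\<theta> 0) (\<theta> (Suc L)) \<theta>) \<in> lunit {0..Suc L}"
    and loc: "\<And>a b z x y. \<mu> a b (z(0 := x, Suc L := y)) = \<mu> a b z"
    and zs: "zs \<in> torus" "\<And>j. 1 \<le> j \<Longrightarrow> j \<le> k \<Longrightarrow> (zs(i := \<mu> a b zs)) j = w"
      "\<And>j. k < j \<Longrightarrow> j \<le> L \<Longrightarrow> (zs(i := \<mu> a b zs)) j = w / q"
    and ab: "a = w \<or> a = inverse w" "b = w / q \<or> b = q / w"
  shows "generically {0, L} (\<lambda>\<zeta>. free_locus L w (\<zeta> 0) (\<zeta> L) i (\<mu> (\<zeta> 0) (\<zeta> L)))"
proof -
  have w0: "w \<noteq> 0" using w by auto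
  have ab0: "a \<noteq> 0" "b \<noteq> 0" using ab w0 by auto
  define Z where "Z \<theta> = \<theta>(i := \<mu> (\<theta> 0) (\<theta> (Suc L)) \<theta>)" for \<theta>
  have Z: "(\<lambda>\<theta>. Z \<theta> j) \<in> lunit {0..Suc L}" if "j \<in> {1..L}" for j
    using lunit_upd[OF \<mu>, of j i] that by (simp add: Z_def)
  obtain d where d: "d \<in> lfun {0..Suc L}"
    "\<And>\<theta>. d \<theta> \<noteq> 0 \<Longrightarrow> T_regular L w (Z \<theta>) (\<theta> 0) (\<theta> (Suc L)) \<and> zero_sum_free L w (Z \<theta>) (\<theta> 0) (\<theta> (Suc L))"
    "\<And>\<theta>. T_regular L w (Z \<theta>) (\<theta> 0) (\<theta> (Suc L)) \<Longrightarrow> zero_sum_free L w (Z \<theta>) (\<theta> 0) (\<theta> (Suc L)) \<Longrightarrow>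
       (\<And>v. sum (T_op L w (Z \<theta>) (\<theta> 0) (\<theta> (Suc L)) v) (LP L) = sum v (LP L)) \<Longrightarrow> d \<theta> \<noteq> 0"
    by (rule zero_sum_free_det[OF L w0 Z, where ?Z0.0 = "\<lambda>\<theta>. \<theta> 0" and ZL = "\<lambda>\<theta>. \<theta> (Suc L)"]) (auto intro: lunit_var)
  define \<theta>s where "\<theta>s = zs(0 := a, Suc L := b)"
  have \<theta>s: "\<theta>s 0 = a" "\<theta>s (Suc L) = b" "Z \<theta>s j = (zs(i := \<mu> a b zs)) j" if "j \<in> {1..L}" for j
    using that i by (auto simp: \<theta>s_def Z_def loc)
  have L1: "1 \<in> {1..L}" using L by simp
  have zA: "Z \<theta>s j = w" if "1 \<le> j" "j \<le> k" for j using \<theta>s(3)[of j] zs(2)[OF that] that k by simp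
  have zB: "Z \<theta>s j = w / q" if "k < j" "j \<le> L" for j using \<theta>s(3)[of j] zs(3)[OF that] that k by simp
  have nz: "d \<theta>s \<noteq> 0"
  proof (rule d(3))
    show "T_regular L w (Z \<theta>s) (\<theta>s 0) (\<theta>s (Suc L))"
      unfolding \<theta>s(1,2)[OF L1] by (rule T_special(1)[OF L k w zA zB ab])
    show "zero_sum_free L w (Z \<theta>s) (\<theta>s 0) (\<theta>s (Suc L))"
      unfolding \<theta>s(1,2)[OF L1] by (rule zero_sum_free_special(2)[OF L k w zA zB ab])
    fix v :: Defs.vec
    show "sum (T_op L w (Z \<theta>s) (\<theta>s 0) (\<theta>s (Suc L)) v) (LP L) = sum v (LP L)"
      using sum_T_op[of "\<lambda>_. 1" L w "Z \<theta>s" a b v] zero_sum_free_special(1)[where z = "Z \<theta>s" and v = v and \<phi> = "\<lambda>_. 1", OF L k w zA zB ab]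
      unfolding \<theta>s(1,2)[OF L1] by simp
  qed
  \<comment> \<open>Outside this proof the index \<open>L\<close> labels both \<open>z_L\<close> and
    the right boundary parameter; here the latter is moved to \<open>Suc L\<close>.\<close>
  define ev where "ev \<zeta> j = (if j = 0 then \<zeta> 0 else if j = Suc L then \<zeta> L else zs j)" for \<zeta> :: "nat \<Rightarrow> complex" and j
  show ?thesis
  proof (rule generically_lfun[of "\<lambda>\<zeta>. d (ev \<zeta>)" _ "\<lambda>j. if j = 0 then a else if j = L then b else 1"])
    show "(\<lambda>\<zeta>. d (ev \<zeta>)) \<in> lfun {0, L}"
    proof (rule lfun_subst[OF d(1)])
      fix j
      consider "j = 0" | "j = Suc L" | "j \<noteq> 0 \<and> j \<noteq> Suc L" by blast
      thus "(\<lambda>\<zeta>. ev \<zeta> j) \<in> lunit {0, L}" by cases (auto simp: ev_def intro: lunit_var lunit_const)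
    qed
    show "(\<lambda>j. if j = 0 then a else if j = L then b else 1) \<in> torus" using ab0 by (simp add: torus_def)
    have "ev (\<lambda>j. if j = 0 then a else if j = L then b else 1) = \<theta>s"
      using L by (auto simp: ev_def \<theta>s_def fun_eq_iff)
    thus "d (ev (\<lambda>j. if j = 0 then a else if j = L then b else 1)) \<noteq> 0" using nz by simp
  next
    fix x :: "nat \<Rightarrow> complex" assume x: "x \<in> torus" "d (ev x) \<noteq> 0"
    define d' where "d' z = d (z(0 := x 0, Suc L := x L))" for z
    have "d' \<in> lfun {1..L}" unfolding d'_def[abs_def]
    proof (rule lfun_subst[OF d(1)])
      fix j assume j: "j \<in> {0..Suc L}"
      consider "j = 0" | "j = Suc L" | "j \<in> {1..L}" using j by fastforce
      thus "(\<lambda>z. (z(0 := x 0, Suc L := x L)) j) \<in> lunit {1..L}" by cases (auto intro: lunit_var lunit_const)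
    qed
    moreover have "zs(0 := x 0, Suc L := x L) = ev x" by (auto simp: ev_def fun_eq_iff)
    hence "d' zs \<noteq> 0" using x by (simp add: d'_def)
    moreover have "T_regular L w (z(i := \<mu> (x 0) (x L) z)) (x 0) (x L) \<and> zero_sum_free L w (z(i := \<mu> (x 0) (x L) z)) (x 0) (x L)"
      if "d' z \<noteq> 0" for z
    proof -
      let ?\<theta> = "z(0 := x 0, Suc L := x L)"
      have e: "Z ?\<theta> j = (z(i := \<mu> (x 0) (x L) z)) j" if "j \<in> {1..L}" for j
        using that by (auto simp: Z_def loc)
      have "T_regular L w (Z ?\<theta>) (x 0) (x L) \<and> zero_sum_free L w (Z ?\<theta>) (x 0) (x L)"
        using d(2)[of ?\<theta>] that by (simp add: d'_def)
      thus ?thesis using T_regular_cong[of L "Z ?\<theta>" "z(i := \<mu> (x 0) (x L) z)", OF e]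
          zero_sum_free_cong[of L "Z ?\<theta>" "z(i := \<mu> (x 0) (x L) z)", OF e] by metis
    qed
    ultimately show "free_locus L w (x 0) (x L) i (\<mu> (x 0) (x L))"
      unfolding free_locus_def using zs(1) by blast
  qed auto
qed

locale good_ground_state =
  fixes L :: nat and w \<zeta>0 \<zeta>L :: complex and \<Psi> :: lvec
  assumes L: "1 \<le> L" and \<zeta>: "\<zeta>0 \<noteq> 0" "\<zeta>L \<noteq> 0" and gs: "ground_state L \<zeta>0 \<zeta>L \<Psi>"
    and free: "free_locus L w \<zeta>0 \<zeta>L 1 (\<lambda>z. z 1)"
begin

definition S :: "(nat \<Rightarrow> complex) \<Rightarrow> complex" where
  "S z = (\<Sum>\<alpha>\<in>LP L. leval (\<Psi> \<alpha>) z)"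

lemma Psi_in: "\<alpha> \<in> LP L \<Longrightarrow> \<Psi> \<alpha> \<in> laurent_in {1..L}"
  using gs by (simp add: ground_state_def)

lemma Psi_lfun: "\<alpha> \<in> LP L \<Longrightarrow> leval (\<Psi> \<alpha>) \<in> lfun {1..L}"
  by (rule leval_lfun[OF Psi_in])

lemma S_lfun: "S \<in> lfun {1..L}"
  unfolding S_def[abs_def] by (intro lfun_sum Psi_lfun)

lemma fixed: "z \<in> torus \<Longrightarrow> fixed_vec L z \<zeta>0 \<zeta>L (\<lambda>\<alpha>. leval (\<Psi> \<alpha>) z)"
  using gs by (simp add: ground_state_def vec_at_def[abs_def] torus_def)

lemma coprime: "g \<in> laurent_in {1..L} \<Longrightarrow> (\<And>\<alpha>. \<alpha> \<in> LP L \<Longrightarrow> g dvd \<Psi> \<alpha>) \<Longrightarrow> g dvd 1"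
  using gs by (simp add: ground_state_def coprime_components_def)

text \<open>Otherwise \<open>z i - \<mu> z\<close> would divide all components. It is not a unit,
  since it vanishes at a point of the locus; for this, \<open>\<mu>\<close> must keep its value when
  \<open>z i\<close> is overwritten by it.\<close>

lemma Psi_locus_nonzero:
  assumes i: "i \<in> {1..L}" and \<mu>: "\<mu> \<in> lunit {1..L}" "\<And>z. z \<in> torus \<Longrightarrow> \<mu> z \<noteq> 0" "\<And>z. \<mu> (z(i := \<mu> z)) = \<mu> z"
  shows "\<exists>\<alpha>\<in>LP L. \<exists>z\<in>torus. leval (\<Psi> \<alpha>) (z(i := \<mu> z)) \<noteq> 0"
proof (rule ccontr)
  assume "\<not> ?thesis"
  hence zero: "leval (\<Psi> \<alpha>) (z(i := \<mu> z)) = 0" if "\<alpha> \<in> LP L" "z \<in> torus" for \<alpha> z using that by blast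
  have "(\<lambda>z. z i - \<mu> z) \<in> lfun {1..L}" using i \<mu> by (intro lfun_diff lfun.var lunitD)
  then obtain g where g: "g \<in> laurent_in {1..L}" "\<forall>z\<in>torus. leval g z = z i - \<mu> z" using lfun_leval by blast
  have "g dvd \<Psi> \<alpha>" if \<alpha>: "\<alpha> \<in> LP L" for \<alpha>
  proof -
    obtain G where G: "G \<in> lfun {1..L}"
      "\<forall>z\<in>torus. \<mu> z \<noteq> 0 \<longrightarrow> leval (\<Psi> \<alpha>) z - leval (\<Psi> \<alpha>) (z(i := \<mu> z)) = (z i - \<mu> z) * G z"
      using lfun_factor[OF Psi_lfun[OF \<alpha>] lunitD[OF \<mu>(1)]] by blast
    obtain r where r: "\<forall>z\<in>torus. leval r z = G z" using lfun_leval[OF G(1)] by blast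
    have "\<Psi> \<alpha> = g * r"
      by (rule leval_eqI) (use G(2) r g \<mu>(2) zero[OF \<alpha>] in \<open>simp add: leval_mult\<close>)
    thus ?thesis by simp
  qed
  hence "g dvd 1" by (rule coprime[OF g(1)])
  then obtain h where h: "1 = g * h" by (rule dvdE)
  let ?o = "\<lambda>_. 1 :: complex"
  let ?y = "?o(i := \<mu> ?o)"
  have y: "?y \<in> torus" by (rule torus_upd[OF one_torus \<mu>(2)[OF one_torus]])
  have "leval g ?y = ?y i - \<mu> ?y" using g(2) y by blast
  also have "\<dots> = 0" unfolding \<mu>(3) by simp
  finally have "leval (g * h) ?y = 0" unfolding leval_mult[OF y] by simp
  thus False unfolding h[symmetric] by simp
qed

text \<open>A component of \<open>\<Psi>\<close> and the function \<open>d\<close> are nonzero over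
  a common point of the locus; there \<open>\<Psi>\<close> is a nonzero fixed vector, so its sum
  cannot vanish.\<close>

lemma S_locus_nonzero:
  assumes i: "i \<in> {1..L}" and \<mu>: "\<mu> \<in> lunit {1..L}" "\<And>z. z \<in> torus \<Longrightarrow> \<mu> z \<noteq> 0" "\<And>z. \<mu> (z(i := \<mu> z)) = \<mu> z"
    and f: "free_locus L w \<zeta>0 \<zeta>L i \<mu>"
  shows "\<exists>z\<in>torus. S (z(i := \<mu> z)) \<noteq> 0"
proof -
  obtain \<alpha> z1 where \<alpha>: "\<alpha> \<in> LP L" "z1 \<in> torus" "leval (\<Psi> \<alpha>) (z1(i := \<mu> z1)) \<noteq> 0"
    using Psi_locus_nonzero[of i \<mu>, OF i \<mu>] by blast
  obtain d z2 where d: "d \<in> lfun {1..L}" "z2 \<in> torus" "d z2 \<noteq> 0"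
    "\<And>z. z \<in> torus \<Longrightarrow> d z \<noteq> 0 \<Longrightarrow> T_regular L w (z(i := \<mu> z)) \<zeta>0 \<zeta>L \<and> zero_sum_free L w (z(i := \<mu> z)) \<zeta>0 \<zeta>L"
    using f unfolding free_locus_def by blast
  obtain z where z: "z \<in> torus" "leval (\<Psi> \<alpha>) (z(i := \<mu> z)) \<noteq> 0" "d z \<noteq> 0"
    using lfun_mult_nonzero[OF lfun_upd[OF Psi_lfun[OF \<alpha>(1)] \<mu>(1)] d(1) \<alpha>(2,3) d(2,3)] by blast
  let ?y = "z(i := \<mu> z)"
  have y: "?y \<in> torus" using z \<mu> by (simp add: torus_upd)
  have "vec_eq L (T_op L w ?y \<zeta>0 \<zeta>L (\<lambda>\<alpha>. leval (\<Psi> \<alpha>) ?y)) (\<lambda>\<alpha>. leval (\<Psi> \<alpha>) ?y)"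
    using fixed[OF y] d(4)[OF z(1,3)] by (simp add: fixed_vec_def)
  hence "S ?y \<noteq> 0" using d(4)[OF z(1,3)] \<alpha>(1) z(2) unfolding zero_sum_free_def S_def by blast
  thus ?thesis using z by blast
qed

lemma S_nonzero: "\<exists>z\<in>torus. S z \<noteq> 0"
  using S_locus_nonzero[of 1 "\<lambda>z. z 1"] L free by (auto simp: lunit_var torusD)

text \<open>Below, \<open>N\<close> is \<open>b\<close> times the image of \<open>\<Psi>\<close> under \<^const>\<open>R_op\<close> or \<^const>\<open>K_op\<close>, and
  \<open>z i = c * \<nu> z\<close>, for \<open>c \<in> C\<close>, are the zeros of \<open>b \<circ> \<tau>\<close>.\<close>

lemma exchange:
  assumes \<tau>: "\<And>z. z \<in> torus \<Longrightarrow> \<tau> z \<in> torus" "\<And>z. z \<in> torus \<Longrightarrow> \<tau> (\<tau> z) = z"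
      "\<And>j. j \<in> {1..L} \<Longrightarrow> (\<lambda>z. \<tau> z j) \<in> lunit {1..L}" "\<And>j. (\<lambda>z. \<tau> z j) \<in> lunit UNIV"
    and b: "b \<in> lfun {1..L}" "z0 \<in> torus" "b z0 \<noteq> 0"
    and N: "\<And>\<alpha>. \<alpha> \<in> LP L \<Longrightarrow> N \<alpha> \<in> lfun {1..L}"
    and fx: "\<And>z. z \<in> torus \<Longrightarrow> b z \<noteq> 0 \<Longrightarrow> fixed_vec L (\<tau> z) \<zeta>0 \<zeta>L (\<lambda>\<alpha>. N \<alpha> z / b z)"
    and sm: "\<And>z. z \<in> torus \<Longrightarrow> (\<Sum>\<alpha>\<in>LP L. N \<alpha> z) = b z * S z"
    and i: "i \<in> {1..L}" and \<nu>: "\<nu> \<in> lunit {1..L}" "\<And>z. z \<in> torus \<Longrightarrow> \<nu> z \<noteq> 0" "\<And>z x. \<nu> (z(i := x)) = \<nu> z"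
    and C: "finite C" "0 \<notin> C"
    and e: "e \<in> lunit {1..L}" "\<And>z. z \<in> torus \<Longrightarrow> e z \<noteq> 0"
      "\<And>z. z \<in> torus \<Longrightarrow> b (\<tau> z) = e z * (\<Prod>c\<in>C. z i - c * \<nu> z)"
    and SC: "\<And>c. c \<in> C \<Longrightarrow> \<exists>z\<in>torus. S (z(i := c * \<nu> z)) \<noteq> 0"
  obtains m c where "keys m \<subseteq> {1..L}" "c \<noteq> 0"
    "\<And>\<alpha> z. \<alpha> \<in> LP L \<Longrightarrow> z \<in> torus \<Longrightarrow> N \<alpha> z = b z * (c * meval m z) * leval (\<Psi> \<alpha>) (\<tau> z)"
proof -
  let ?V = "{1..L}"
  let ?\<psi> = "\<lambda>\<alpha>. leval (\<Psi> \<alpha>)"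
  have twist: "(\<lambda>z. f (\<tau> z)) \<in> lfun ?V" if "f \<in> lfun ?V" for f
    by (rule lfun_subst[OF that \<tau>(3)])
  note \<psi>\<tau> = twist[OF Psi_lfun] and S\<tau> = twist[OF S_lfun] and b\<tau> = twist[OF b(1)]
  obtain y0 where y0: "y0 \<in> torus" "S y0 \<noteq> 0" using S_nonzero by blast
  have Sy0: "S (\<tau> (\<tau> y0)) \<noteq> 0" using y0 \<tau> by simp
  obtain d z1 where d: "d \<in> lfun ?V" "z1 \<in> torus" "d z1 \<noteq> 0"
    "\<And>z. z \<in> torus \<Longrightarrow> d z \<noteq> 0 \<Longrightarrow> T_regular L w z \<zeta>0 \<zeta>L \<and> zero_sum_free L w z \<zeta>0 \<zeta>L"
    using free unfolding free_locus_def fun_upd_triv by blast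
  have dz1: "d (\<tau> (\<tau> z1)) \<noteq> 0" using d \<tau> by simp
  obtain z2 where z2: "z2 \<in> torus" "b z2 \<noteq> 0" "d (\<tau> z2) \<noteq> 0"
    by (rule lfun_mult_nonzero[OF b(1) twist[OF d(1)] b(2,3) \<tau>(1)[OF d(2)] dz1])
  \<comment> \<open>Both \<open>N / b\<close> at \<open>z\<close> and \<open>\<Psi>\<close> at
    \<open>\<tau> z\<close> are fixed for the parameters \<open>\<tau> z\<close>, with sums
    \<open>S z\<close> and \<open>S (\<tau> z)\<close>. The combination \<open>v\<close> of the two
    has sum zero, so it vanishes at generic points; clearing \<open>b\<close> extends the equation
    to the whole torus.\<close>
  have main: "N \<alpha> z * S (\<tau> z) = b z * S z * ?\<psi> \<alpha> (\<tau> z)" if \<alpha>: "\<alpha> \<in> LP L" and z: "z \<in> torus" for \<alpha> z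
  proof -
    have "N \<alpha> z * S (\<tau> z) - b z * S z * ?\<psi> \<alpha> (\<tau> z) = 0"
    proof (rule lfun_mult_zero[where z = z and z0 = z2 and f = "\<lambda>z. b z * d (\<tau> z)" and V = ?V
          and g = "\<lambda>z. N \<alpha> z * S (\<tau> z) - b z * S z * ?\<psi> \<alpha> (\<tau> z)"])
      show "(\<lambda>z. b z * d (\<tau> z)) \<in> lfun ?V" by (intro lfun.mult b twist d)
      show "(\<lambda>z. N \<alpha> z * S (\<tau> z) - b z * S z * ?\<psi> \<alpha> (\<tau> z)) \<in> lfun ?V"
        by (intro lfun_diff lfun.mult b N \<alpha> S\<tau> \<psi>\<tau> S_lfun)
      fix z assume z: "z \<in> torus"
      have "N \<alpha> z * S (\<tau> z) - b z * S z * ?\<psi> \<alpha> (\<tau> z) = 0" if nz: "b z \<noteq> 0" "d (\<tau> z) \<noteq> 0"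
      proof -
        define v where "v \<beta> = N \<beta> z / b z * S (\<tau> z) - ?\<psi> \<beta> (\<tau> z) * S z" for \<beta>
        have r: "T_regular L w (\<tau> z) \<zeta>0 \<zeta>L" "zero_sum_free L w (\<tau> z) \<zeta>0 \<zeta>L" using d(4)[OF \<tau>(1)[OF z] nz(2)] by auto
        have f1: "vec_eq L (T_op L w (\<tau> z) \<zeta>0 \<zeta>L (\<lambda>\<alpha>. N \<alpha> z / b z)) (\<lambda>\<alpha>. N \<alpha> z / b z)"
          using fx[OF z nz(1)] r by (simp add: fixed_vec_def)
        have f2: "vec_eq L (T_op L w (\<tau> z) \<zeta>0 \<zeta>L (\<lambda>\<alpha>. ?\<psi> \<alpha> (\<tau> z))) (\<lambda>\<alpha>. ?\<psi> \<alpha> (\<tau> z))"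
          using fixed[OF \<tau>(1)[OF z]] r by (simp add: fixed_vec_def)
        have "T_op L w (\<tau> z) \<zeta>0 \<zeta>L v \<beta> = v \<beta>" if \<beta>: "\<beta> \<in> LP L" for \<beta>
        proof -
          have "T_op L w (\<tau> z) \<zeta>0 \<zeta>L v \<beta> = T_op L w (\<tau> z) \<zeta>0 \<zeta>L (\<lambda>\<alpha>. N \<alpha> z / b z) \<beta> * S (\<tau> z) -
              T_op L w (\<tau> z) \<zeta>0 \<zeta>L (\<lambda>\<alpha>. ?\<psi> \<alpha> (\<tau> z)) \<beta> * S z"
            unfolding T_op_sum[OF \<beta>] v_def sum_distrib_right sum_subtractf[symmetric]
            by (intro sum.cong refl) (simp add: algebra_simps)
          thus ?thesis using f1 f2 \<beta> by (simp add: vec_eq_def v_def)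
        qed
        hence "vec_eq L (T_op L w (\<tau> z) \<zeta>0 \<zeta>L v) v" by (simp add: vec_eq_def)
        moreover have "sum v (LP L) = 0"
        proof -
          have "sum v (LP L) = (\<Sum>\<beta>\<in>LP L. N \<beta> z) / b z * S (\<tau> z) - S (\<tau> z) * S z"
            unfolding v_def S_def[of "\<tau> z"] by (simp add: sum_subtractf sum_distrib_right sum_divide_distrib)
          thus ?thesis using sm[OF z] nz by simp
        qed
        ultimately have "v \<alpha> = 0" using r(2) \<alpha> unfolding zero_sum_free_def by blast
        thus ?thesis using nz by (simp add: v_def field_simps)
      qed
      thus "b z * d (\<tau> z) * (N \<alpha> z * S (\<tau> z) - b z * S z * ?\<psi> \<alpha> (\<tau> z)) = 0" by auto
    qed (use z z2 in auto)
    thus ?thesis by simp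
  qed
  obtain S' where S': "S' \<in> laurent_in ?V" "\<forall>z\<in>torus. leval S' z = S (\<tau> z)" using lfun_leval[OF S\<tau>] by blast
  have "(\<lambda>z. b z * S z) \<in> lfun ?V" by (intro lfun.mult b S_lfun)
  then obtain bS where bS: "bS \<in> laurent_in ?V" "\<forall>z\<in>torus. leval bS z = b z * S z" using lfun_leval by blast
  have "\<forall>\<alpha>\<in>LP L. \<exists>p. p \<in> laurent_in ?V \<and> (\<forall>z\<in>torus. leval p z = N \<alpha> z)" using lfun_leval[OF N] by blast
  then obtain N' where N': "\<forall>\<alpha>\<in>LP L. N' \<alpha> \<in> laurent_in ?V \<and> (\<forall>z\<in>torus. leval (N' \<alpha>) z = N \<alpha> z)"
    unfolding bchoice_iff by blast
  have "\<forall>\<alpha>\<in>LP L. \<exists>p. p \<in> laurent_in ?V \<and> (\<forall>z\<in>torus. leval p z = ?\<psi> \<alpha> (\<tau> z))" using lfun_leval[OF \<psi>\<tau>] by blast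
  then obtain X where X: "\<forall>\<alpha>\<in>LP L. X \<alpha> \<in> laurent_in ?V \<and> (\<forall>z\<in>torus. leval (X \<alpha>) z = ?\<psi> \<alpha> (\<tau> z))"
    unfolding bchoice_iff by blast
  have "leval S' (\<tau> y0) \<noteq> 0" using S'(2) \<tau>(1)[OF y0(1)] Sy0 by simp
  hence S'0: "S' \<noteq> 0" by auto
  have cop: "g dvd 1" if g: "g \<in> laurent_in ?V" "\<And>\<alpha>. \<alpha> \<in> LP L \<Longrightarrow> g dvd X \<alpha>" for g
  proof -
    \<comment> \<open>The cofactor of a divisor may involve variables outside \<open>{1..L}\<close>,
      so the twist by \<open>\<tau>\<close> is needed for arbitrary Laurent polynomials.\<close>
    have tw: "\<exists>r'. \<forall>z\<in>torus. leval r' z = leval r (\<tau> z)" for r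
    proof -
      have "r \<in> laurent_in UNIV" by (simp add: laurent_in_def)
      hence "(\<lambda>z. leval r (\<tau> z)) \<in> lfun UNIV" by (rule lfun_subst[OF leval_lfun \<tau>(4)])
      thus ?thesis using lfun_leval by blast
    qed
    obtain g' where g': "g' \<in> laurent_in ?V" "\<forall>z\<in>torus. leval g' z = leval g (\<tau> z)"
      using lfun_leval[OF twist[OF leval_lfun[OF g(1)]]] by blast
    have "g' dvd \<Psi> \<alpha>" if \<alpha>: "\<alpha> \<in> LP L" for \<alpha>
    proof -
      obtain r where r: "X \<alpha> = g * r" using g(2)[OF \<alpha>] by (rule dvdE)
      obtain r' where r': "\<forall>z\<in>torus. leval r' z = leval r (\<tau> z)" using tw by blast
      have "\<Psi> \<alpha> = g' * r'"
      proof (rule leval_eqI)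
        fix z assume z: "z \<in> torus"
        have "leval (g' * r') z = leval (X \<alpha>) (\<tau> z)" using z g'(2) r' \<tau>(1)[OF z] by (simp add: leval_mult r)
        thus "?\<psi> \<alpha> z = leval (g' * r') z" using X \<alpha> \<tau>(1,2)[OF z] by simp
      qed
      thus ?thesis by simp
    qed
    hence "g' dvd 1" by (rule coprime[OF g'(1)])
    then obtain h where h: "1 = g' * h" by (rule dvdE)
    obtain h' where h': "\<forall>z\<in>torus. leval h' z = leval h (\<tau> z)" using tw by blast
    have "1 = g * h'"
    proof (rule leval_eqI)
      fix z assume z: "z \<in> torus"
      have "leval (g * h') z = leval (g' * h) (\<tau> z)" using z g'(2) h' \<tau>(1,2)[OF z] by (simp add: leval_mult)
      thus "leval 1 z = leval (g * h') z" by (simp flip: h)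
    qed
    thus ?thesis by (rule dvdI)
  qed
  have eq: "S' * N' \<alpha> = bS * X \<alpha>" if "\<alpha> \<in> LP L" for \<alpha>
    by (rule leval_eqI) (use S' bS N' X main that in \<open>simp add: leval_mult mult.commute\<close>)
  \<comment> \<open>As the twisted components are again coprime, proportionality turns into
    divisibility: \<open>u\<close> is the quotient of \<open>b * S\<close> by the twisted
    sum.\<close>
  obtain u where u: "u \<in> laurent_in ?V" "bS = S' * u"
    by (rule coprime_dvd[where V = ?V and I = "LP L" and A = S' and B = bS and N = N' and X = X])
      (use S' bS N' X S'0 eq cop in auto)
  define U where "U z = leval u (\<tau> z)" for z
  have U: "U \<in> lfun ?V" unfolding U_def[abs_def] by (rule twist[OF leval_lfun[OF u(1)]])
  have bSu: "b z * S z = S (\<tau> z) * leval u z" if "z \<in> torus" for z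
    using arg_cong[OF u(2), of "\<lambda>p. leval p z"] that S' bS by (simp add: leval_mult)
  have bSU: "b (\<tau> z) * S (\<tau> z) = S z * U z" if "z \<in> torus" for z
    using bSu[OF \<tau>(1)[OF that]] \<tau>(2)[OF that] by (simp add: U_def)
  have Nu: "N \<alpha> z - leval u z * ?\<psi> \<alpha> (\<tau> z) = 0" if \<alpha>: "\<alpha> \<in> LP L" and z: "z \<in> torus" for \<alpha> z
  proof (rule lfun_mult_zero[OF S\<tau> _ _ \<tau>(1)[OF y0(1)] Sy0 z])
    show "(\<lambda>z. N \<alpha> z - leval u z * ?\<psi> \<alpha> (\<tau> z)) \<in> lfun ?V"
      by (intro lfun_diff lfun.mult N \<alpha> \<psi>\<tau> leval_lfun[OF u(1)])
    fix z assume z: "z \<in> torus"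
    show "S (\<tau> z) * (N \<alpha> z - leval u z * ?\<psi> \<alpha> (\<tau> z)) = 0"
      using main[OF \<alpha> z] bSu[OF z] by (simp add: algebra_simps)
  qed
  \<comment> \<open>On a zero of \<open>b \<circ> \<tau>\<close> the relation \<open>bSU\<close>
    leaves \<open>S * U = 0\<close>, and \<open>SC\<close> says that \<open>S\<close> is not
    identically zero there. So \<open>U\<close> contains every linear factor of
    \<open>b \<circ> \<tau>\<close>, and the quotient \<open>t\<close> is a Laurent
    function.\<close>
  have "U (z(i := c * \<nu> z)) = 0" if c: "c \<in> C" and z: "z \<in> torus" for c z
  proof -
    have \<mu>: "(\<lambda>z. c * \<nu> z) \<in> lunit ?V" by (intro lunit_mult lunit_const \<nu>)
    obtain z3 where z3: "z3 \<in> torus" "S (z3(i := c * \<nu> z3)) \<noteq> 0" using SC[OF c] by blast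
    have c0: "c \<noteq> 0" using c C by auto
    show ?thesis
    proof (rule lfun_mult_zero[OF lfun_upd[OF S_lfun \<mu>] lfun_upd[OF U \<mu>] _ z3 z])
      fix z assume z: "z \<in> torus"
      let ?y = "z(i := c * \<nu> z)"
      have y: "?y \<in> torus" using z \<nu>(2)[OF z] c0 by (simp add: torus_upd)
      have "(\<Prod>c\<in>C. ?y i - c * \<nu> ?y) = 0"
        by (rule prod_zero[OF C(1)], rule bexI[OF _ c]) (simp only: \<nu>(3) fun_upd_same diff_self)
      thus "S ?y * U ?y = 0" using bSU[OF y] e(3)[OF y] by simp
    qed
  qed
  hence "\<exists>H\<in>lfun ?V. \<forall>z\<in>torus. U z = (\<Prod>c\<in>C. z i - c * \<nu> z) * H z"
    by (intro lfun_factors[OF C(1) U i \<nu>(1)]) (use \<nu> C in \<open>auto simp del: fun_upd_apply\<close>)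
  then obtain H where H: "H \<in> lfun ?V" "\<forall>z\<in>torus. U z = (\<Prod>c\<in>C. z i - c * \<nu> z) * H z" by blast
  define t where "t z = inverse (e z) * H z" for z
  have t: "t \<in> lfun ?V" unfolding t_def[abs_def] by (intro lfun.mult lunitD e H)
  have Ut: "U z = b (\<tau> z) * t z" if "z \<in> torus" for z
    using H(2) e(2,3)[OF that] that by (simp add: t_def)
  have b\<tau>0: "b (\<tau> (\<tau> z0)) \<noteq> 0" using b \<tau> by simp
  have St: "S (\<tau> z) - S z * t z = 0" if z: "z \<in> torus" for z
  proof (rule lfun_mult_zero[OF b\<tau> _ _ \<tau>(1)[OF b(2)] b\<tau>0 z])
    show "(\<lambda>z. S (\<tau> z) - S z * t z) \<in> lfun ?V" by (intro lfun_diff lfun.mult S\<tau> S_lfun t)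
    fix z assume "z \<in> torus"
    thus "b (\<tau> z) * (S (\<tau> z) - S z * t z) = 0" using bSU Ut by (simp add: algebra_simps)
  qed
  have tt: "1 - t z * t (\<tau> z) = 0" if z: "z \<in> torus" for z
  proof (rule lfun_mult_zero[OF S_lfun _ _ y0 z])
    show "(\<lambda>z. 1 - t z * t (\<tau> z)) \<in> lfun ?V" by (intro lfun_diff lfun.mult lfun.const t twist)
    fix z assume z: "z \<in> torus"
    have "S z = S (\<tau> z) * t (\<tau> z)" using St[OF \<tau>(1)[OF z]] \<tau>(2)[OF z] by simp
    moreover have "S (\<tau> z) = S z * t z" using St[OF z] by simp
    ultimately have "S z = S z * t z * t (\<tau> z)" by metis
    thus "S z * (1 - t z * t (\<tau> z)) = 0" by (simp add: algebra_simps)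
  qed
  obtain p where p: "p \<in> laurent_in ?V" "\<forall>z\<in>torus. leval p z = t (\<tau> z)" using lfun_leval[OF twist[OF t]] by blast
  obtain r where r: "\<forall>z\<in>torus. leval r z = t z" using lfun_leval[OF t] by blast
  have "p * r = 1"
    by (rule leval_eqI) (use p r tt in \<open>simp add: leval_mult mult.commute\<close>)
  then obtain m c where mc: "p = single m c" "c \<noteq> 0" by (rule laurent_unit_monomial)
  show thesis
  proof (rule that[of m c])
    show "keys m \<subseteq> ?V" using p(1) mc by (simp add: laurent_in_def)
    show "c \<noteq> 0" by fact
    fix \<alpha> z assume \<alpha>: "\<alpha> \<in> LP L" and z: "z \<in> torus"
    have "leval u z = U (\<tau> z)" using \<tau>(2)[OF z] by (simp add: U_def)
    also have "\<dots> = b z * t (\<tau> z)" using Ut[OF \<tau>(1)[OF z]] \<tau>(2)[OF z] by simp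
    also have "t (\<tau> z) = c * meval m z" using p(2) z by (simp add: mc leval_single flip: p(2))
    finally show "N \<alpha> z = b z * (c * meval m z) * ?\<psi> \<alpha> (\<tau> z)" using Nu[OF \<alpha> z] by simp
  qed
qed

end

section \<open>Degrees and the individual exchange relations\<close>

lemma lunit_minus: "f \<in> lunit V \<Longrightarrow> (\<lambda>z. - f z) \<in> lunit V"
  by (simp add: lunit_def lfun_minus)

lemma meval_lfun: "keys m \<subseteq> V \<Longrightarrow> meval m \<in> lfun V"
  using leval_lfun[OF laurent_in_single[of m V 1]] by (simp add: leval_single[abs_def])

lemma meval_upd:
  assumes "z \<in> torus"
  shows "meval m (z(i := x)) = meval m z * (x / z i) powi lookup m i"
proof -
  let ?a = "(\<lambda>_. 1 :: complex)(i := x / z i)"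
  have "z(i := x) = (\<lambda>j. ?a j * z j)" using torusD[OF assms] by (auto simp: fun_eq_iff)
  hence "meval m (z(i := x)) = meval m ?a * meval m z" by (simp only: meval_mult)
  also have "\<dots> = meval m z * meval m ?a" by (rule mult.commute)
  also have "meval m ?a = (\<Prod>j\<in>insert i (keys m). ?a j powi lookup m j)" by (rule meval_superset) auto
  also have "\<dots> = (x / z i) powi lookup m i"
    by (subst prod.insert_remove) (auto intro!: prod.neutral)
  finally show ?thesis .
qed

lemma single_eq_one:
  assumes "single n c = (1 :: laurent)"
  shows "n = 0" "c = 1"
proof -
  have "lookup (single n c) 0 = (1 :: complex)" unfolding assms by (simp add: lookup_one)
  thus "n = 0" "c = 1" by (auto simp: lookup_single when_def split: if_splits)
qed

text \<open>The weight \<open>wt\<close> will be the exponent of one variable or its negative, so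
  that highest and lowest exponents are treated alike.\<close>

definition deg_le :: "((nat \<Rightarrow>\<^sub>0 int) \<Rightarrow> int) \<Rightarrow> laurent \<Rightarrow> int \<Rightarrow> bool" where
  "deg_le wt p B \<longleftrightarrow> (\<forall>k\<in>keys p. wt k \<le> B)"

lemma deg_le_add: "deg_le wt p B \<Longrightarrow> deg_le wt r B \<Longrightarrow> deg_le wt (p + r) B"
  using Poly_Mapping.keys_add[of p r] unfolding deg_le_def by blast

lemma deg_le_sum: "(\<And>i. i \<in> I \<Longrightarrow> deg_le wt (f i) B) \<Longrightarrow> deg_le wt (sum f I) B"
  by (induction I rule: infinite_finite_induct) (auto intro: deg_le_add simp: deg_le_def[of _ 0])

lemma deg_le_single: "wt n \<le> B \<Longrightarrow> deg_le wt (single n c) B"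
  by (simp add: deg_le_def)

lemma deg_le_mult:
  assumes "\<And>m n. wt (m + n) = wt m + wt n" "deg_le wt p a" "deg_le wt r b"
  shows "deg_le wt (p * r) (a + b)"
  unfolding deg_le_def
proof
  fix k assume "k \<in> keys (p * r)"
  then obtain m n where "k = m + n" "m \<in> keys p" "n \<in> keys r" using keys_mult[of p r] by blast
  thus "wt k \<le> a + b" using assms by (simp add: deg_le_def add_mono)
qed

text \<open>The first factor has one monomial of strictly maximal weight, so its product with a top
  monomial of \<open>r\<close> cannot cancel.\<close>

lemma deg_factor:
  fixes R r :: laurent and wt :: "(nat \<Rightarrow>\<^sub>0 int) \<Rightarrow> int"
  assumes add: "\<And>m n. wt (m + n) = wt m + wt n" and x: "x \<noteq> 0"
    and R: "\<And>n. n \<in> keys R \<Longrightarrow> wt n < wt a" and n: "n \<in> keys r"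
    and B: "deg_le wt ((single a x + R) * r) B"
  shows "wt a + wt n \<le> B"
proof -
  let ?P = "single a x + R"
  have fin: "finite (wt ` keys r)" by simp
  have "Max (wt ` keys r) \<in> wt ` keys r" by (rule Max_in[OF fin]) (use n in auto)
  then obtain b where b: "b \<in> keys r" "wt b = Max (wt ` keys r)" by auto
  have top: "wt k \<le> wt b" if "k \<in> keys r" for k using that fin b(2) by simp
  have "a \<notin> keys R" using R by blast
  hence la: "lookup ?P a = x" by (simp add: lookup_add lookup_single in_keys_iff)
  have "lookup (?P * r) (a + b) = lookup ?P a * lookup r b"
  proof (rule lookup_mult_extreme[OF add _ _ b(1) top])
    show "a \<in> keys ?P" using la x by (simp add: in_keys_iff)
    fix k assume "k \<in> keys ?P" "k \<noteq> a"
    thus "wt k < wt a" using R Poly_Mapping.keys_add[of "single a x" R] by (auto split: if_splits)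
  qed
  hence "a + b \<in> keys (?P * r)" using la x b(1) by (simp add: in_keys_iff)
  hence "wt a + wt b \<le> B" using B add by (auto simp: deg_le_def)
  thus ?thesis using top[OF n] by simp
qed

text \<open>The numerators of the two coefficients of K add up to the denominator;
  \<open>br_sum\<close> is the same for R. As generators preserve coefficient sums, so do R and K,
  which is the hypothesis \<open>sm\<close> of \<open>exchange\<close>.\<close>

lemma kfun_sum:
  assumes "x \<noteq> 0" "\<zeta> \<noteq> 0"
  shows "kfun x \<zeta> + br (inverse q) * br (x\<^sup>2) = kfun (1 / x) \<zeta>"
proof -
  have "inverse (inverse q) = q" by simp
  hence b: "br (inverse q) = q\<^sup>2 - q" by (simp add: br_def inverse_q[symmetric])
  have i: "1 / x = inverse x" "inverse x \<noteq> 0" using assms by (auto simp: field_simps)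
  show ?thesis unfolding i(1) kfun_expand[OF assms] kfun_expand[OF i(2) assms(2)] b br_def[of "x\<^sup>2"]
    by (simp add: power_inverse algebra_simps)
qed

lemma br_sum: "x \<noteq> 0 \<Longrightarrow> br (q / x) - br x = br (q * x)"
proof -
  assume x: "x \<noteq> 0"
  have "q\<^sup>2 = (q\<^sup>2 + q + 1) - 1 - q" by simp
  hence q2: "q\<^sup>2 = - 1 - q" unfolding q_cubic by simp
  have e: "br (q / x) = q * inverse x - q\<^sup>2 * x" "br (q * x) = q * x - q\<^sup>2 * inverse x"
    by (simp_all add: br_def divide_inverse inverse_q mult.commute)
  show ?thesis unfolding e br_def[of x] q2 by (simp add: algebra_simps)
qed

lemma gen_op_cong: "(\<And>\<alpha>. \<alpha> \<in> LP L \<Longrightarrow> u \<alpha> = v \<alpha>) \<Longrightarrow> gen_op L k u \<beta> = gen_op L k v \<beta>"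
  unfolding gen_op_def by (rule sum.cong) auto

context good_ground_state
begin

text \<open>Covers R and K at once: with the denominator cleared, each consists of an identity part
  and a generator part with Laurent coefficients.\<close>

definition Nv :: "nat \<Rightarrow> ((nat \<Rightarrow> complex) \<Rightarrow> complex) \<Rightarrow> ((nat \<Rightarrow> complex) \<Rightarrow> complex) \<Rightarrow> bracket list \<Rightarrow> (nat \<Rightarrow> complex) \<Rightarrow> complex" where
  "Nv k c1 c2 \<beta> z = c1 z * leval (\<Psi> \<beta>) z + c2 z * gen_op L k (\<lambda>\<alpha>. leval (\<Psi> \<alpha>) z) \<beta>"

lemma Nv_lfun: "c1 \<in> lfun {1..L} \<Longrightarrow> c2 \<in> lfun {1..L} \<Longrightarrow> \<beta> \<in> LP L \<Longrightarrow> Nv k c1 c2 \<beta> \<in> lfun {1..L}"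
  unfolding Nv_def[abs_def] gen_op_def by (intro lfun.add lfun.mult lfun_sum Psi_lfun) auto

lemma Nv_sum:
  assumes "k \<le> L"
  shows "(\<Sum>\<beta>\<in>LP L. Nv k c1 c2 \<beta> z) = (c1 z + c2 z) * S z"
  using sum_gen_op[OF L assms, of "\<lambda>_. 1" "\<lambda>\<alpha>. leval (\<Psi> \<alpha>) z"]
  by (simp add: Nv_def sum.distrib sum_distrib_left[symmetric] S_def distrib_right)

text \<open>Where the exchange operator acts as the identity, the exchange relation says that
  \<open>\<Psi>\<close> equals a monomial times itself. Some component of a coprime vector does not
  vanish identically on the locus, so the monomial is 1 there.\<close>

lemma monomial_on_locus:
  assumes i: "i \<in> {1..L}" and \<mu>: "\<mu> \<in> lunit {1..L}" "\<And>z. z \<in> torus \<Longrightarrow> \<mu> z \<noteq> 0" "\<And>z. \<mu> (z(i := \<mu> z)) = \<mu> z"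
    and m: "keys m \<subseteq> {1..L}"
    and eq: "\<And>\<alpha> z. \<alpha> \<in> LP L \<Longrightarrow> z \<in> torus \<Longrightarrow>
      leval (\<Psi> \<alpha>) (z(i := \<mu> z)) = c * meval m (z(i := \<mu> z)) * leval (\<Psi> \<alpha>) (z(i := \<mu> z))"
    and z: "z \<in> torus"
  shows "c * meval m (z(i := \<mu> z)) = 1"
proof -
  obtain \<alpha> z1 where \<alpha>: "\<alpha> \<in> LP L" "z1 \<in> torus" "leval (\<Psi> \<alpha>) (z1(i := \<mu> z1)) \<noteq> 0"
    using Psi_locus_nonzero[of i \<mu>, OF i \<mu>] by blast
  have "1 - c * meval m (z(i := \<mu> z)) = 0"
  proof (rule lfun_mult_zero[OF lfun_upd[OF Psi_lfun[OF \<alpha>(1)] \<mu>(1)] _ _ \<alpha>(2,3) z])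
    show "(\<lambda>z. 1 - c * meval m (z(i := \<mu> z))) \<in> lfun {1..L}"
      by (intro lfun_diff lfun.mult lfun.const lfun_upd[OF meval_lfun[OF m] \<mu>(1)])
    fix z assume z: "z \<in> torus"
    show "leval (\<Psi> \<alpha>) (z(i := \<mu> z)) * (1 - c * meval m (z(i := \<mu> z))) = 0"
      using eq[OF \<alpha>(1) z] by (simp add: right_diff_distrib mult.commute del: fun_upd_apply)
  qed
  thus ?thesis by simp
qed

text \<open>The exchange argument applies to the change of sign of \<open>z_i\<close> with
  denominator 1 and an empty set of roots. Applying the resulting factor twice gives
  \<open>m + m = 0\<close>, so \<open>m = 0\<close> and the constant is a sign.\<close>

lemma parity:
  assumes i: "i \<in> {1..L}"
  shows "\<exists>\<sigma>. \<sigma> * \<sigma> = 1 \<and> (\<forall>\<alpha>\<in>LP L. \<forall>z\<in>torus. leval (\<Psi> \<alpha>) z = \<sigma> * leval (\<Psi> \<alpha>) (z(i := - z i)))"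
proof -
  define \<tau> where "\<tau> z = z(i := - z i)" for z :: "nat \<Rightarrow> complex"
  have lu: "(\<lambda>z. \<tau> z j) \<in> lunit V" if "i \<in> V" "j \<in> V" for j V
    unfolding \<tau>_def by (intro lunit_upd lunit_minus lunit_var that)
  have \<tau>: "\<tau> z \<in> torus" "\<tau> (\<tau> z) = z" if "z \<in> torus" for z
    using that by (auto simp: \<tau>_def torus_def fun_eq_iff)
  obtain m c where mc: "keys m \<subseteq> {1..L}" "c \<noteq> 0"
    "\<And>\<alpha> z. \<alpha> \<in> LP L \<Longrightarrow> z \<in> torus \<Longrightarrow> leval (\<Psi> \<alpha>) z = 1 * (c * meval m z) * leval (\<Psi> \<alpha>) (\<tau> z)"
  proof (rule exchange[of \<tau> "\<lambda>_. 1" "\<lambda>_. 1" "\<lambda>\<alpha>. leval (\<Psi> \<alpha>)" i "\<lambda>_. 1" "{}" "\<lambda>_. 1", OF \<tau>])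
    show "fixed_vec L (\<tau> z) \<zeta>0 \<zeta>L (\<lambda>\<alpha>. leval (\<Psi> \<alpha>) z / 1)" if "z \<in> torus" for z
      using fixed_vec_uminus[OF fixed[OF that]] by (simp add: \<tau>_def)
    show "leval (\<Psi> \<alpha>) \<in> lfun {1..L}" if "\<alpha> \<in> LP L" for \<alpha> by (rule Psi_lfun[OF that])
  qed (use i in \<open>auto intro!: lu lfun.const lunit_const Psi_lfun one_torus simp: S_def\<close>)
  obtain z1 where z1: "z1 \<in> torus" "S z1 \<noteq> 0" using S_nonzero by blast
  obtain \<alpha> where "\<alpha> \<in> LP L" "leval (\<Psi> \<alpha>) z1 \<noteq> 0"
    using z1(2) unfolding S_def by (rule sum.not_neutral_contains_not_neutral)
  note \<alpha> = this(1) z1(1) this(2)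
  have cc: "c * meval m z * (c * meval m (\<tau> z)) = 1" if z: "z \<in> torus" for z
  proof -
    have "1 - c * meval m z * (c * meval m (\<tau> z)) = 0"
    proof (rule lfun_mult_zero[OF Psi_lfun[OF \<alpha>(1)] _ _ \<alpha>(2,3) z])
      show "(\<lambda>z. 1 - c * meval m z * (c * meval m (\<tau> z))) \<in> lfun {1..L}"
        by (intro lfun_diff lfun.mult lfun.const meval_lfun[OF mc(1)] lfun_subst[OF meval_lfun[OF mc(1)] lu] i)
      fix z assume z: "z \<in> torus"
      have "leval (\<Psi> \<alpha>) z = (c * meval m z) * ((c * meval m (\<tau> z)) * leval (\<Psi> \<alpha>) z)"
        using mc(3)[OF \<alpha>(1) z] mc(3)[OF \<alpha>(1) \<tau>(1)[OF z]] \<tau>(2)[OF z] by simp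
      thus "leval (\<Psi> \<alpha>) z * (1 - c * meval m z * (c * meval m (\<tau> z))) = 0" by (simp add: algebra_simps)
    qed
    thus ?thesis by simp
  qed
  have "leval (single (m + m) (c * c * (- 1) powi lookup m i)) z = leval 1 z" if z: "z \<in> torus" for z
    unfolding leval_single meval_add[OF z] leval_1
    using cc[OF z] torusD[OF z, of i] meval_upd[OF z, of m i "- z i"] by (simp add: \<tau>_def mult_ac)
  hence one: "single (m + m) (c * c * (- 1) powi lookup m i) = (1 :: laurent)" by (rule leval_eqI)
  have "m = 0"
  proof (rule poly_mapping_eqI)
    fix k
    have "lookup m k + lookup m k = lookup (m + m) k" by (rule lookup_add[symmetric])
    also have "\<dots> = 0" unfolding single_eq_one(1)[OF one] by simp
    finally show "lookup m k = lookup 0 k" by simp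
  qed
  hence "c * c = 1" using single_eq_one(2)[OF one] by simp
  thus ?thesis using mc(3) \<open>m = 0\<close> by (intro exI[of _ c]) (auto simp: \<tau>_def)
qed

text \<open>Parity relates the values of \<open>S\<close> on the two loci by a sign, so only one
  root out of each pair of opposite ones has to be reached by a special point.\<close>

lemma S_locus_uminus:
  assumes i: "i \<in> {1..L}" and \<nu>: "\<And>z. z \<in> torus \<Longrightarrow> \<nu> z \<noteq> 0" and c: "c \<noteq> 0"
    and S: "\<exists>z\<in>torus. S (z(i := c * \<nu> z)) \<noteq> 0"
  shows "\<exists>z\<in>torus. S (z(i := - c * \<nu> z)) \<noteq> 0"
proof -
  obtain z where z: "z \<in> torus" "S (z(i := c * \<nu> z)) \<noteq> 0" using S by blast
  obtain \<sigma> where \<sigma>: "\<And>\<alpha> z. \<alpha> \<in> LP L \<Longrightarrow> z \<in> torus \<Longrightarrow> leval (\<Psi> \<alpha>) z = \<sigma> * leval (\<Psi> \<alpha>) (z(i := - z i))"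
    using parity[OF i] by blast
  let ?y = "z(i := c * \<nu> z)"
  have y: "?y \<in> torus" using z \<nu> c by (simp add: torus_upd)
  have "S ?y = \<sigma> * S (?y(i := - ?y i))" unfolding S_def sum_distrib_left by (intro sum.cong refl \<sigma> y)
  hence "S (z(i := - c * \<nu> z)) \<noteq> 0" using z(2) by auto
  thus ?thesis using z(1) by blast
qed

text \<open>Here \<open>A\<close> is the action of \<open>\<tau>\<close> on exponents, and
  \<open>d\<close> is the exponent of the argument of R or of the square of the argument of K, up to
  inversion. On the left the coefficients raise weights by at most \<open>\<bar>wt d\<bar>\<close>;
  on the right the factor in front has a single monomial of top weight and raises them by exactly
  this amount. The difference bounds the monomial \<open>m\<close> times the twisted vector.\<close>

lemma degree:
  fixes wt :: "(nat \<Rightarrow>\<^sub>0 int) \<Rightarrow> int"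
  assumes add: "\<And>m n. wt (m + n) = wt m + wt n" and d: "wt d \<noteq> 0" and xy: "x \<noteq> 0" "y \<noteq> 0"
    and \<tau>: "\<And>z n. z \<in> torus \<Longrightarrow> meval n (\<tau> z) = meval (A n) z" "\<And>n. A (A n) = n"
    and eq: "\<And>\<beta> z. \<beta> \<in> LP L \<Longrightarrow> z \<in> torus \<Longrightarrow>
      Nv k (\<lambda>z. x / meval d z + y * meval d z + v) (\<lambda>z. g * (meval d z - 1 / meval d z)) \<beta> z
      = (x * meval d z + y / meval d z + v) * meval m z * leval (\<Psi> \<beta>) (\<tau> z)"
    and E: "\<And>\<beta>. \<beta> \<in> LP L \<Longrightarrow> deg_le wt (\<Psi> \<beta>) E"
    and \<beta>: "\<beta> \<in> LP L" and n: "n \<in> keys (\<Psi> \<beta>)"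
  shows "wt m + wt (A n) \<le> E"
proof -
  have wt0: "wt 0 = 0" using add[of 0 0] by simp
  have wtm: "wt (- k) = - wt k" for k using add[of k "- k"] wt0 by simp
  have md: "meval (- d) z = 1 / meval d z" if "z \<in> torus" for z
    using meval_add[OF that, of d "- d"] meval_nz[OF that, of d] by (simp add: field_simps)
  define C1 where "C1 = single (- d) x + single d y + single 0 v"
  define C2 where "C2 = single d g + single (- d) (- g)"
  define G where "G = (\<Sum>\<alpha> | \<alpha> \<in> LP L \<and> gen L k \<alpha> = \<beta>. \<Psi> \<alpha>)"
  define X where "X = (\<Sum>n\<in>keys (\<Psi> \<beta>). single (A n) (lookup (\<Psi> \<beta>) n))"
  define P where "P = single (d + m) x + single (m - d) y + single m v"
  have X: "leval X z = leval (\<Psi> \<beta>) (\<tau> z)" if "z \<in> torus" for z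
    unfolding X_def leval_sum leval_single leval_meval[of "\<Psi> \<beta>"] using \<tau>(1)[OF that] by simp
  \<comment> \<open>As an involution \<open>A\<close> is injective, so the twist merges no monomials
    and \<open>A n\<close> survives in \<open>X\<close>.\<close>
  have inj: "A a = A b \<longleftrightarrow> a = b" for a b using \<tau>(2) by metis
  have "lookup X (A n) = lookup (\<Psi> \<beta>) n"
    unfolding X_def lookup_sum lookup_single inj using n by (simp add: when_def)
  hence An: "A n \<in> keys X" using n by (simp add: in_keys_iff)
  have NP: "C1 * \<Psi> \<beta> + C2 * G = P * X"
  proof (rule leval_eqI)
    fix z assume z: "z \<in> torus"
    have "leval G z = gen_op L k (\<lambda>\<alpha>. leval (\<Psi> \<alpha>) z) \<beta>" by (simp add: G_def leval_sum gen_op_def)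
    hence "leval (C1 * \<Psi> \<beta> + C2 * G) z =
        Nv k (\<lambda>z. x / meval d z + y * meval d z + v) (\<lambda>z. g * (meval d z - 1 / meval d z)) \<beta> z"
      using z by (simp add: leval_add leval_mult Nv_def C1_def C2_def leval_single md algebra_simps)
    also have "\<dots> = (x * meval d z + y / meval d z + v) * meval m z * leval (\<Psi> \<beta>) (\<tau> z)" by (rule eq[OF \<beta> z])
    also have "\<dots> = leval P z * leval X z"
      using meval_add[OF z, of m "- d"] z
      by (simp add: X[OF z] P_def leval_add leval_single meval_add md algebra_simps)
    finally show "leval (C1 * \<Psi> \<beta> + C2 * G) z = leval (P * X) z" using z by (simp add: leval_mult)
  qed
  have "deg_le wt (C1 * \<Psi> \<beta> + C2 * G) (\<bar>wt d\<bar> + E)"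
    unfolding C1_def C2_def G_def
    by (intro deg_le_add deg_le_mult add deg_le_single deg_le_sum E \<beta>) (auto simp: wtm wt0 intro: E)
  hence B: "deg_le wt (P * X) (\<bar>wt d\<bar> + E)" by (simp add: NP)
  show ?thesis
  proof (cases "wt d > 0")
    case True
    have "wt (d + m) + wt (A n) \<le> \<bar>wt d\<bar> + E"
    proof (rule deg_factor[OF add xy(1) _ An])
      show "deg_le wt ((single (d + m) x + (single (m - d) y + single m v)) * X) (\<bar>wt d\<bar> + E)"
        using B by (simp add: P_def add.assoc)
      fix k assume "k \<in> keys (single (m - d) y + single m v)"
      hence "k = m - d \<or> k = m" using Poly_Mapping.keys_add[of "single (m - d) y" "single m v"] by (auto split: if_splits)
      thus "wt k < wt (d + m)" using True add[of d m] add[of m "- d"] wtm[of d] by auto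
    qed
    thus ?thesis using True add[of d m] by simp
  next
    case False
    have "wt (m - d) + wt (A n) \<le> \<bar>wt d\<bar> + E"
    proof (rule deg_factor[OF add xy(2) _ An])
      show "deg_le wt ((single (m - d) y + (single (d + m) x + single m v)) * X) (\<bar>wt d\<bar> + E)"
        using B by (simp add: P_def add_ac)
      fix k assume "k \<in> keys (single (d + m) x + single m v)"
      hence "k = d + m \<or> k = m" using Poly_Mapping.keys_add[of "single (d + m) x" "single m v"] by (auto split: if_splits)
      thus "wt k < wt (m - d)" using False d add[of d m] add[of m "- d"] wtm[of d] by auto
    qed
    thus ?thesis using False add[of m "- d"] wtm[of d] by simp
  qed
qed

lemma Nv_cong: "c1 z = c1' z \<Longrightarrow> c2 z = c2' z \<Longrightarrow> Nv k c1 c2 \<beta> z = Nv k c1' c2' \<beta> z"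
  by (simp add: Nv_def)

lemma exponents_finite: "finite (exponents L \<Psi> j)"
proof -
  have "exponents L \<Psi> j = (\<Union>\<alpha>\<in>LP L. (\<lambda>m. lookup m j) ` keys (\<Psi> \<alpha>))" by (auto simp: exponents_def)
  thus ?thesis by simp
qed

lemma exponents_nonempty: "exponents L \<Psi> j \<noteq> {}"
proof -
  obtain z where "S z \<noteq> 0" using S_nonzero by blast
  then obtain \<alpha> where \<alpha>: "\<alpha> \<in> LP L" "leval (\<Psi> \<alpha>) z \<noteq> 0" unfolding S_def by (rule sum.not_neutral_contains_not_neutral)
  hence "keys (\<Psi> \<alpha>) \<noteq> {}" by auto
  then obtain n where "n \<in> keys (\<Psi> \<alpha>)" by (metis ex_in_conv)
  hence "lookup n j \<in> exponents L \<Psi> j" using \<alpha>(1) by (auto simp: exponents_def)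
  thus ?thesis by blast
qed

lemma centred_bounds:
  assumes "centred L \<Psi>" "j \<in> {1..L}"
  defines "M \<equiv> Max (exponents L \<Psi> j)"
  shows "\<And>\<beta>. \<beta> \<in> LP L \<Longrightarrow> deg_le (\<lambda>n. lookup n j) (\<Psi> \<beta>) M"
    "\<And>\<beta>. \<beta> \<in> LP L \<Longrightarrow> deg_le (\<lambda>n. - lookup n j) (\<Psi> \<beta>) M"
    "\<exists>\<beta>\<in>LP L. \<exists>n\<in>keys (\<Psi> \<beta>). lookup n j = M" "\<exists>\<beta>\<in>LP L. \<exists>n\<in>keys (\<Psi> \<beta>). lookup n j = - M"
  unfolding M_def
proof -
  let ?M = "Max (exponents L \<Psi> j)"
  have mn: "Min (exponents L \<Psi> j) = - ?M" using assms by (simp add: centred_def)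
  have e: "lookup n j \<in> exponents L \<Psi> j" if "\<beta> \<in> LP L" "n \<in> keys (\<Psi> \<beta>)" for \<beta> n using that by (auto simp: exponents_def)
  show "deg_le (\<lambda>n. lookup n j) (\<Psi> \<beta>) ?M" if "\<beta> \<in> LP L" for \<beta>
    using Max_ge[OF exponents_finite e[OF that]] by (simp add: deg_le_def)
  show "deg_le (\<lambda>n. - lookup n j) (\<Psi> \<beta>) ?M" if "\<beta> \<in> LP L" for \<beta>
    using Min_le[OF exponents_finite e[OF that]] mn by (fastforce simp: deg_le_def)
  show "\<exists>\<beta>\<in>LP L. \<exists>n\<in>keys (\<Psi> \<beta>). lookup n j = ?M"
    using Max_in[OF exponents_finite exponents_nonempty, of j] unfolding exponents_def by force
  show "\<exists>\<beta>\<in>LP L. \<exists>n\<in>keys (\<Psi> \<beta>). lookup n j = - ?M"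
    using Min_in[OF exponents_finite exponents_nonempty, of j] unfolding mn unfolding exponents_def by force
qed

text \<open>The roots of the twisted denominator are \<open>z_i = q z_(i+1)\<close> and its
  negative; the special points reach the first, parity the second. On \<open>z_i = z_(i+1)\<close>
  the operator is the identity, which reduces the monomial factor to a power of
  \<open>z_i / z_(i+1)\<close>.\<close>

lemma bulk_exchange:
  assumes i: "1 \<le> i" "i < L" and fr: "free_locus L w \<zeta>0 \<zeta>L i (\<lambda>z. q * z (i + 1))"
  shows "\<exists>r :: int. \<forall>\<beta>\<in>LP L. \<forall>z\<in>torus.
    Nv i (\<lambda>z. br (q / (z i / z (i + 1)))) (\<lambda>z. - br (z i / z (i + 1))) \<beta> z =
    br (q * (z i / z (i + 1))) * meval (single i r + single (i + 1) (- r)) z * leval (\<Psi> \<beta>) (z(i := z (i + 1), i + 1 := z i))"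
proof -
  define \<tau> where "\<tau> z = z(i := z (i + 1), i + 1 := z i)" for z :: "nat \<Rightarrow> complex"
  define b where "b z = br (q * (z i / z (i + 1)))" for z :: "nat \<Rightarrow> complex"
  define N where "N = Nv i (\<lambda>z. br (q / (z i / z (i + 1)))) (\<lambda>z. - br (z i / z (i + 1)))"
  have iV: "i \<in> {1..L}" "i + 1 \<in> {1..L}" using i by auto
  have \<tau>: "\<tau> z \<in> torus" "\<tau> (\<tau> z) = z" if "z \<in> torus" for z
    using that by (auto simp: \<tau>_def torus_def fun_eq_iff)
  have lu: "(\<lambda>z. \<tau> z j) \<in> lunit V" if "i \<in> V" "i + 1 \<in> V" "j \<in> V" for j V
    using that by (cases "j = i"; cases "j = i + 1") (auto simp: \<tau>_def intro: lunit_var)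
  have ux: "(\<lambda>z. z i / z (i + 1)) \<in> lunit {1..L}" by (intro lunit_divide lunit_var iV)
  have qq: "q \<noteq> - q" using q_nz by (metis add.inverse_inverse add_eq_0_iff mult_2 mult_eq_0_iff zero_neq_numeral)
  obtain m c where mc: "keys m \<subseteq> {1..L}" "c \<noteq> 0"
    "\<And>\<beta> z. \<beta> \<in> LP L \<Longrightarrow> z \<in> torus \<Longrightarrow> N \<beta> z = b z * (c * meval m z) * leval (\<Psi> \<beta>) (\<tau> z)"
  proof (rule exchange[of \<tau> b "\<lambda>_. 1" N i "\<lambda>z. z (i + 1)" "{q, - q}" "\<lambda>z. - inverse (q * (z i * z (i + 1)))", OF \<tau>])
    show "b \<in> lfun {1..L}" unfolding b_def[abs_def] by (intro lfun_br' lunit_mult lunit_const ux)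
    show "N \<beta> \<in> lfun {1..L}" if "\<beta> \<in> LP L" for \<beta>
      unfolding N_def by (intro Nv_lfun lfun_minus lfun_br' lunit_divide lunit_const lunit_var iV that)
    show "fixed_vec L (\<tau> z) \<zeta>0 \<zeta>L (\<lambda>\<alpha>. N \<alpha> z / b z)" if "z \<in> torus" for z
    proof -
      have "(\<lambda>\<alpha>. N \<alpha> z / b z) = R_op L i (z i / z (i + 1)) (\<lambda>\<alpha>. leval (\<Psi> \<alpha>) z)"
        by (simp add: fun_eq_iff N_def Nv_def R_op_def b_def)
      thus ?thesis using fixed_vec_R[OF i torusD[OF that] torusD[OF that] fixed[OF that]] by (simp only: \<tau>_def)
    qed
    show "(\<Sum>\<alpha>\<in>LP L. N \<alpha> z) = b z * S z" if "z \<in> torus" for z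
    proof -
      have "z i / z (i + 1) \<noteq> 0" using torusD[OF that] by simp
      from br_sum[OF this] show ?thesis unfolding N_def b_def by (subst Nv_sum) (use i in auto)
    qed
    show "b (\<tau> z) = - inverse (q * (z i * z (i + 1))) * (\<Prod>c\<in>{q, - q}. z i - c * z (i + 1))" if "z \<in> torus" for z
    proof -
      have nz: "z i \<noteq> 0" "z (i + 1) \<noteq> 0" using torusD[OF that] by auto
      have "b (\<tau> z) = br (q * (z (i + 1) / z i))" by (simp add: b_def \<tau>_def)
      also have "\<dots> = - inverse (q * (z i * z (i + 1))) * ((z i - q * z (i + 1)) * (z i + q * z (i + 1)))"
        using nz unfolding br_def by (simp add: field_simps)
      finally show ?thesis using qq by simp
    qed
    have S1: "\<exists>z\<in>torus. S (z(i := q * z (i + 1))) \<noteq> 0"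
      by (rule S_locus_nonzero[of i "\<lambda>z. q * z (i + 1)", OF iV(1) _ _ _ fr])
        (auto intro!: lunit_mult lunit_const lunit_var iV simp: torusD simp del: One_nat_def)
    show "\<exists>z\<in>torus. S (z(i := c * z (i + 1))) \<noteq> 0" if "c \<in> {q, - q}" for c
      using that S1 S_locus_uminus[of i "\<lambda>z. z (i + 1)" q, OF iV(1) _ q_nz S1] by (auto simp: torusD)
    show "(\<lambda>z. - inverse (q * (z i * z (i + 1)))) \<in> lunit {1..L}"
      by (intro lunit_minus lunit_inverse lunit_mult lunit_const lunit_var iV)
    show "(\<lambda>z. \<tau> z j) \<in> lunit {1..L}" if "j \<in> {1..L}" for j by (rule lu[OF iV that])
    show "(\<lambda>z. z (i + 1)) \<in> lunit {1..L}" by (rule lunit_var[OF iV(2)])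
  qed (use iV in \<open>auto intro!: lu simp: torusD b_def one_torus\<close>)
  have one: "c * meval m (z(i := z (i + 1))) = 1" if z: "z \<in> torus" for z
  proof (rule monomial_on_locus[of i "\<lambda>z. z (i + 1)", OF iV(1) lunit_var[OF iV(2)] _ _ mc(1) _ z])
    fix \<alpha> and z :: "nat \<Rightarrow> complex" assume \<alpha>: "\<alpha> \<in> LP L" and z: "z \<in> torus"
    let ?y = "z(i := z (i + 1))"
    have y: "?y \<in> torus" using z by (simp add: torus_upd torusD)
    have x: "?y i / ?y (i + 1) = 1" using torusD[OF z] by simp
    have "\<tau> ?y = ?y" by (simp add: \<tau>_def fun_eq_iff)
    moreover have "b ?y = br q" unfolding b_def x by simp
    moreover have "N \<alpha> ?y = br q * leval (\<Psi> \<alpha>) ?y" unfolding N_def Nv_def x by (simp add: br_def)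
    ultimately have "br q * leval (\<Psi> \<alpha>) ?y = br q * (c * meval m ?y * leval (\<Psi> \<alpha>) ?y)"
      using mc(3)[OF \<alpha> y] by (simp only: mult.assoc)
    thus "leval (\<Psi> \<alpha>) ?y = c * meval m ?y * leval (\<Psi> \<alpha>) ?y" using br_q_nz by (simp only: mult_cancel_left) blast
  qed (auto simp: torusD)
  define r where "r = lookup m i"
  have "single (m + (single i (- r) + single (i + 1) r)) c = (1 :: laurent)"
  proof (rule leval_eqI)
    fix z assume z: "z \<in> torus"
    have "meval m (z(i := z (i + 1))) = meval (m + (single i (- r) + single (i + 1) r)) z"
      unfolding meval_upd[OF z] using z torusD[OF z]
      by (simp add: meval_add meval_single r_def power_int_divide_distrib power_int_minus field_simps)
    thus "leval (single (m + (single i (- r) + single (i + 1) r)) c) z = leval 1 z"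
      using one[OF z] by (simp add: leval_single)
  qed
  note s1 = single_eq_one[OF this]
  have m: "m = single i r + single (i + 1) (- r)"
  proof -
    have "m = - (single i (- r) + single (i + 1) r)" using s1(1) by (simp add: add_eq_0_iff2)
    thus ?thesis by (simp add: single_uminus)
  qed
  show ?thesis
  proof (intro exI[of _ r] ballI)
    fix \<beta> z assume "\<beta> \<in> LP L" "z \<in> torus"
    from mc(3)[OF this] show "Nv i (\<lambda>z. br (q / (z i / z (i + 1)))) (\<lambda>z. - br (z i / z (i + 1))) \<beta> z =
      br (q * (z i / z (i + 1))) * meval (single i r + single (i + 1) (- r)) z * leval (\<Psi> \<beta>) (z(i := z (i + 1), i + 1 := z i))"
      unfolding N_def b_def \<tau>_def s1(2) by (simp only: m[symmetric] mult_1)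
  qed
qed

text \<open>The twist interchanges the exponents of \<open>z_i\<close> and \<open>z_(i+1)\<close>,
  whose extreme values are \<open>M\<close>, \<open>- M\<close> and \<open>M'\<close>,
  \<open>- M'\<close> by centring. Comparing highest and lowest exponents of both variables bounds
  \<open>r\<close> and \<open>- r\<close> by \<open>M - M'\<close> and by \<open>M' - M\<close>, so
  \<open>r = 0\<close>.\<close>

lemma bulk_centred:
  assumes i: "1 \<le> i" "i < L" and fr: "free_locus L w \<zeta>0 \<zeta>L i (\<lambda>z. q * z (i + 1))" and cen: "centred L \<Psi>"
    and \<beta>: "\<beta> \<in> LP L" and z: "z \<in> torus"
  shows "Nv i (\<lambda>z. br (q / (z i / z (i + 1)))) (\<lambda>z. - br (z i / z (i + 1))) \<beta> z =
    br (q * (z i / z (i + 1))) * leval (\<Psi> \<beta>) (z(i := z (i + 1), i + 1 := z i))"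
proof -
  define A where "A n = n + (single i (lookup n (i + 1) - lookup n i) + single (i + 1) (lookup n i - lookup n (i + 1)))" for n :: "nat \<Rightarrow>\<^sub>0 int"
  define d :: "nat \<Rightarrow>\<^sub>0 int" where "d = single i 1 + single (i + 1) (- 1)"
  obtain r where r: "\<forall>\<beta>\<in>LP L. \<forall>z\<in>torus.
    Nv i (\<lambda>z. br (q / (z i / z (i + 1)))) (\<lambda>z. - br (z i / z (i + 1))) \<beta> z =
    br (q * (z i / z (i + 1))) * meval (single i r + single (i + 1) (- r)) z * leval (\<Psi> \<beta>) (z(i := z (i + 1), i + 1 := z i))"
    using bulk_exchange[OF i fr] by (rule exE)
  let ?m = "single i r + single (i + 1) (- r)"
  have iV: "i \<in> {1..L}" "i + 1 \<in> {1..L}" using i by auto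
  define M where "M = Max (exponents L \<Psi> i)"
  note M = centred_bounds[OF cen iV(1), folded M_def]
  define M' where "M' = Max (exponents L \<Psi> (i + 1))"
  note M' = centred_bounds[OF cen iV(2), folded M'_def]
  have lA: "lookup (A n) i = lookup n (i + 1)" "lookup (A n) (i + 1) = lookup n i" for n
    by (simp_all add: A_def lookup_add lookup_single)
  have lm: "lookup ?m i = r" "lookup ?m (i + 1) = - r" "lookup d i = 1" "lookup d (i + 1) = - 1"
    by (simp_all add: d_def lookup_add lookup_single)
  have main: "wt ?m + wt (A n) \<le> E"
    if "\<And>m n. wt (m + n) = wt m + wt n" "wt d \<noteq> 0" "\<And>\<beta>. \<beta> \<in> LP L \<Longrightarrow> deg_le wt (\<Psi> \<beta>) E" "\<beta> \<in> LP L" "n \<in> keys (\<Psi> \<beta>)" for wt E \<beta> n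
  proof (rule degree[where wt = wt and d = d and x = q and y = "- inverse q" and v = 0 and g = "- 1" and k = i
        and \<tau> = "\<lambda>z. z(i := z (i + 1), i + 1 := z i)" and A = A, OF that(1,2) _ _ _ _ _ that(3,4,5)])
    fix z n assume z: "z \<in> torus"
    have z': "z(i := z (i + 1)) \<in> torus" using z by (simp add: torus_upd torusD)
    show "meval n (z(i := z (i + 1), i + 1 := z i)) = meval (A n) z"
      unfolding meval_upd[OF z'] meval_upd[OF z] A_def using z torusD[OF z]
      by (simp add: meval_add meval_single power_int_divide_distrib power_int_diff field_simps)
  next
    fix n show "A (A n) = n"
      unfolding A_def[of "A n"] lA by (rule poly_mapping_eqI) (simp add: A_def lookup_add lookup_single when_def)
  next
    fix \<beta> z assume b: "\<beta> \<in> LP L" and z: "z \<in> torus"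
    have X: "meval d z = z i / z (i + 1)" using z by (simp add: d_def meval_add meval_single power_int_minus divide_inverse)
    have nz: "z i \<noteq> 0" "z (i + 1) \<noteq> 0" using torusD[OF z] by auto
    have "Nv i (\<lambda>z. q / meval d z + - inverse q * meval d z + 0) (\<lambda>z. - 1 * (meval d z - 1 / meval d z)) \<beta> z =
        Nv i (\<lambda>z. br (q / (z i / z (i + 1)))) (\<lambda>z. - br (z i / z (i + 1))) \<beta> z"
      by (rule Nv_cong) (use nz in \<open>simp_all add: X br_def divide_inverse mult_ac\<close>)
    also have "\<dots> = (q * meval d z + - inverse q / meval d z + 0) * meval ?m z * leval (\<Psi> \<beta>) (z(i := z (i + 1), i + 1 := z i))"
      unfolding r[rule_format, OF b z] X by (simp add: br_def divide_inverse mult_ac)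
    finally show "Nv i (\<lambda>z. q / meval d z + - inverse q * meval d z + 0) (\<lambda>z. - 1 * (meval d z - 1 / meval d z)) \<beta> z =
      (q * meval d z + - inverse q / meval d z + 0) * meval ?m z * leval (\<Psi> \<beta>) (z(i := z (i + 1), i + 1 := z i))" .
  qed auto
  have add: "lookup (m + n) j = lookup m j + lookup n j" "- lookup (m + n) j = - lookup m j + - lookup n j"
    for m n :: "nat \<Rightarrow>\<^sub>0 int" and j by (simp_all add: lookup_add)
  have "r + M' \<le> M"
  proof -
    from M'(3) obtain \<beta> n where b: "\<beta> \<in> LP L" "n \<in> keys (\<Psi> \<beta>)" "lookup n (i + 1) = M'" by blast
    show ?thesis using main[of "\<lambda>n. lookup n i", OF add(1) _ M(1) b(1,2)] b(3) unfolding lA lm by simp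
  qed
  moreover have "- r + M \<le> M'"
  proof -
    from M(3) obtain \<beta> n where b: "\<beta> \<in> LP L" "n \<in> keys (\<Psi> \<beta>)" "lookup n i = M" by blast
    show ?thesis using main[of "\<lambda>n. lookup n (i + 1)", OF add(1) _ M'(1) b(1,2)] b(3) unfolding lA lm by simp
  qed
  moreover have "- r + M' \<le> M"
  proof -
    from M'(4) obtain \<beta> n where b: "\<beta> \<in> LP L" "n \<in> keys (\<Psi> \<beta>)" "lookup n (i + 1) = - M'" by blast
    show ?thesis using main[of "\<lambda>n. - lookup n i", OF add(2) _ M(2) b(1,2)] b(3) unfolding lA lm by simp
  qed
  moreover have "r + M \<le> M'"
  proof -
    from M(4) obtain \<beta> n where b: "\<beta> \<in> LP L" "n \<in> keys (\<Psi> \<beta>)" "lookup n i = - M" by blast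
    show ?thesis using main[of "\<lambda>n. - lookup n (i + 1)", OF add(2) _ M'(2) b(1,2)] b(3) unfolding lA lm by simp
  qed
  ultimately have "r = 0" by linarith
  thus ?thesis using r[rule_format, OF \<beta> z] by simp
qed

lemma prod_pm:
  fixes a a' x :: complex
  assumes "a \<noteq> 0" "a' \<noteq> 0" "a\<^sup>2 \<noteq> a'\<^sup>2"
  shows "(\<Prod>c\<in>{a, - a, a', - a'}. x - c * 1) = (x\<^sup>2 - a\<^sup>2) * (x\<^sup>2 - a'\<^sup>2)"
proof -
  have "a \<noteq> - a" "a' \<noteq> - a'" using assms by (simp_all add: eq_neg_iff_add_eq_0)
  moreover have "a \<noteq> a'" "a \<noteq> - a'" "- a \<noteq> a'" "- a \<noteq> - a'" using assms(3) by auto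
  ultimately show ?thesis by (simp add: power2_eq_square algebra_simps)
qed

text \<open>The flag \<open>\<delta>\<close> unites the two edges: \<open>\<kappa>\<close> is
  \<open>z_1\<close> on the left and \<open>1 / z_L\<close> on the right, and \<open>a\<close>,
  \<open>a'\<close> with their negatives are the roots of the denominator after inversion. The
  condition \<open>\<zeta> ^ 4 \<noteq> 1\<close> keeps these four apart, and
  \<open>kfun 1 \<zeta> \<noteq> 0\<close> makes K the identity at \<open>z_j = 1\<close>, which
  leaves a power of \<open>z_j\<close>.\<close>

lemma edge_exchange:
  fixes \<delta> :: bool
  defines "\<kappa> \<equiv> \<lambda>j (z :: nat \<Rightarrow> complex). if \<delta> then z j else 1 / z j"
  assumes j: "j \<in> {1..L}" and k: "k \<le> L" and z0: "\<zeta> \<noteq> 0" "\<zeta> ^ 4 \<noteq> 1" "kfun 1 \<zeta> \<noteq> 0"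
    and fx: "\<And>z. z \<in> torus \<Longrightarrow> fixed_vec L (z(j := 1 / z j)) \<zeta>0 \<zeta>L (K_op L k (1 / \<kappa> j z) \<zeta> (\<lambda>\<alpha>. leval (\<Psi> \<alpha>) z))"
    and aa: "if \<delta> then a = 1 / (q * \<zeta>) \<and> a' = \<zeta> / q else a = q * \<zeta> \<and> a' = q / \<zeta>"
    and fr: "free_locus L w \<zeta>0 \<zeta>L j (\<lambda>_. a)" "free_locus L w \<zeta>0 \<zeta>L j (\<lambda>_. a')"
  shows "\<exists>r :: int. \<forall>\<beta>\<in>LP L. \<forall>z\<in>torus.
    Nv k (\<lambda>z. kfun (1 / \<kappa> j z) \<zeta>) (\<lambda>z. br (inverse q) * br ((1 / \<kappa> j z)\<^sup>2)) \<beta> z =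
    kfun (\<kappa> j z) \<zeta> * meval (single j r) z * leval (\<Psi> \<beta>) (z(j := 1 / z j))"
proof -
  define \<tau> where "\<tau> z = z(j := 1 / z j)" for z :: "nat \<Rightarrow> complex"
  define b where "b z = kfun (\<kappa> j z) \<zeta>" for z :: "nat \<Rightarrow> complex"
  define N where "N = Nv k (\<lambda>z. kfun (1 / \<kappa> j z) \<zeta>) (\<lambda>z. br (inverse q) * br ((1 / \<kappa> j z)\<^sup>2))"
  define e where "e z = (if \<delta> then (q / z j)\<^sup>2 else (1 / (q * z j))\<^sup>2)" for z :: "nat \<Rightarrow> complex"
  have a0: "a \<noteq> 0" "a' \<noteq> 0" using aa z0 by (auto split: if_splits)
  have \<zeta>4: "\<zeta>\<^sup>2 * \<zeta>\<^sup>2 \<noteq> 1" using z0(2) by (simp flip: power_add)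
  have a2: "a\<^sup>2 \<noteq> a'\<^sup>2"
  proof (cases \<delta>)
    case True
    hence "a\<^sup>2 * (q * \<zeta>)\<^sup>2 = 1" "a'\<^sup>2 * (q * \<zeta>)\<^sup>2 = \<zeta>\<^sup>2 * \<zeta>\<^sup>2"
      using aa z0(1) by (simp_all add: power_divide power_mult_distrib)
    thus ?thesis using \<zeta>4 by metis
  next
    case False
    hence "a\<^sup>2 * (\<zeta> / q)\<^sup>2 = \<zeta>\<^sup>2 * \<zeta>\<^sup>2" "a'\<^sup>2 * (\<zeta> / q)\<^sup>2 = 1"
      using aa z0(1) by (simp_all add: power_divide power_mult_distrib)
    thus ?thesis using \<zeta>4 by metis
  qed
  have \<tau>: "\<tau> z \<in> torus" "\<tau> (\<tau> z) = z" if "z \<in> torus" for z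
    using that by (auto simp: \<tau>_def torus_def fun_eq_iff)
  have lu: "(\<lambda>z. \<tau> z i) \<in> lunit V" if "j \<in> V" "i \<in> V" for i V
    unfolding \<tau>_def by (intro lunit_upd lunit_divide lunit_const lunit_var that)
  have l\<kappa>: "\<kappa> j \<in> lunit {1..L}" unfolding \<kappa>_def
    by (cases \<delta>) (simp_all only: if_True if_False, intro lunit_var j, intro lunit_divide lunit_const lunit_var j)
  have \<kappa>0: "\<kappa> j z \<noteq> 0" if "z \<in> torus" for z using torusD[OF that, of j] by (simp add: \<kappa>_def)
  have \<kappa>\<tau>: "\<kappa> j (\<tau> z) = 1 / \<kappa> j z" for z by (simp add: \<kappa>_def \<tau>_def)
  have le: "e \<in> lunit {1..L}" unfolding e_def[abs_def] power2_eq_square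
    by (cases \<delta>) (simp_all only: if_True if_False, (intro lunit_mult lunit_divide lunit_const lunit_var j)+)
  obtain m c where mc: "keys m \<subseteq> {1..L}" "c \<noteq> 0"
    "\<And>\<beta> z. \<beta> \<in> LP L \<Longrightarrow> z \<in> torus \<Longrightarrow> N \<beta> z = b z * (c * meval m z) * leval (\<Psi> \<beta>) (\<tau> z)"
  proof (rule exchange[of \<tau> b "\<lambda>_. 1" N j "\<lambda>_. 1" "{a, - a, a', - a'}" e, OF \<tau>])
    show "b \<in> lfun {1..L}" unfolding b_def[abs_def] by (intro lfun_kfun lunit_const l\<kappa>)
    show "N \<beta> \<in> lfun {1..L}" if "\<beta> \<in> LP L" for \<beta>
      unfolding N_def power2_eq_square by (intro Nv_lfun lfun.mult lfun.const lfun_br' lfun_kfun lunit_mult lunit_divide lunit_const l\<kappa> that)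
    show "fixed_vec L (\<tau> z) \<zeta>0 \<zeta>L (\<lambda>\<alpha>. N \<alpha> z / b z)" if "z \<in> torus" for z
    proof -
      have "(\<lambda>\<alpha>. N \<alpha> z / b z) = K_op L k (1 / \<kappa> j z) \<zeta> (\<lambda>\<alpha>. leval (\<Psi> \<alpha>) z)"
        by (simp add: fun_eq_iff N_def Nv_def K_op_def b_def)
      thus ?thesis using fx[OF that] by (simp only: \<tau>_def)
    qed
    show "(\<Sum>\<alpha>\<in>LP L. N \<alpha> z) = b z * S z" if "z \<in> torus" for z
    proof -
      have "1 / \<kappa> j z \<noteq> 0" using \<kappa>0[OF that] by simp
      from kfun_sum[OF this z0(1)] show ?thesis unfolding N_def b_def by (subst Nv_sum[OF k]) simp
    qed
    show "b (\<tau> z) = e z * (\<Prod>c\<in>{a, - a, a', - a'}. z j - c * 1)" if "z \<in> torus" for z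
    proof -
      have nz: "z j \<noteq> 0" using torusD[OF that] by auto
      have "b (\<tau> z) = kfun (1 / \<kappa> j z) \<zeta>" by (simp add: b_def \<kappa>\<tau>)
      also have "\<dots> = e z * (((z j)\<^sup>2 - a\<^sup>2) * ((z j)\<^sup>2 - a'\<^sup>2))"
      proof (cases \<delta>)
        case True
        hence aa': "a = 1 / (q * \<zeta>)" "a' = \<zeta> / q" using aa by auto
        show ?thesis using True nz z0(1) unfolding \<kappa>_def e_def kfun_def br_def aa' by (simp add: field_simps power2_eq_square)
      next
        case False
        hence aa': "a = q * \<zeta>" "a' = q / \<zeta>" using aa by auto
        show ?thesis using False nz z0(1) unfolding \<kappa>_def e_def kfun_def br_def aa' by (simp add: field_simps power2_eq_square)
      qed
      finally show ?thesis unfolding prod_pm[OF a0 a2] .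
    qed
    have S1: "\<exists>z\<in>torus. S (z(j := u * 1)) \<noteq> 0" if "free_locus L w \<zeta>0 \<zeta>L j (\<lambda>_. u)" "u \<noteq> 0" for u
      using S_locus_nonzero[of j "\<lambda>_. u", OF j lunit_const _ _ that(1)] that(2) by simp
    note S2 = S_locus_uminus[of j "\<lambda>_. 1", OF j _ _ S1]
    show "\<exists>z\<in>torus. S (z(j := c * 1)) \<noteq> 0" if "c \<in> {a, - a, a', - a'}" for c
      using that S1[OF fr(1) a0(1)] S1[OF fr(2) a0(2)] S2[OF _ a0(1) fr(1) a0(1)] S2[OF _ a0(2) fr(2) a0(2)] by auto
    show "b (\<lambda>_. 1) \<noteq> 0" using z0(3) by (simp add: b_def \<kappa>_def)
    show "(\<lambda>z. \<tau> z i) \<in> lunit {1..L}" if "i \<in> {1..L}" for i by (rule lu[OF j that])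
    show "e z \<noteq> 0" if "z \<in> torus" for z using torusD[OF that, of j] by (simp add: e_def)
  qed (use j a0 le in \<open>auto intro!: lu lunit_const simp: one_torus\<close>)
  have one: "c * meval m (z(j := 1)) = 1" if z: "z \<in> torus" for z
  proof (rule monomial_on_locus[of j "\<lambda>z. 1", OF j lunit_const _ _ mc(1) _ z])
    fix \<alpha> and z :: "nat \<Rightarrow> complex" assume \<alpha>: "\<alpha> \<in> LP L" and z: "z \<in> torus"
    let ?y = "z(j := 1)"
    have y: "?y \<in> torus" using z by (simp add: torus_upd)
    have x: "\<kappa> j ?y = 1" by (simp add: \<kappa>_def)
    have "\<tau> ?y = ?y" by (simp add: \<tau>_def fun_eq_iff)
    moreover have "b ?y = kfun 1 \<zeta>" unfolding b_def x by simp
    moreover have "N \<alpha> ?y = kfun 1 \<zeta> * leval (\<Psi> \<alpha>) ?y" unfolding N_def Nv_def x by (simp add: br_def)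
    ultimately have "kfun 1 \<zeta> * leval (\<Psi> \<alpha>) ?y = kfun 1 \<zeta> * (c * meval m ?y * leval (\<Psi> \<alpha>) ?y)"
      using mc(3)[OF \<alpha> y] by (simp only: mult.assoc)
    thus "leval (\<Psi> \<alpha>) ?y = c * meval m ?y * leval (\<Psi> \<alpha>) ?y" using z0(3) by (simp only: mult_cancel_left) blast
  qed auto
  define r where "r = lookup m j"
  have "single (m + single j (- r)) c = (1 :: laurent)"
  proof (rule leval_eqI)
    fix z assume z: "z \<in> torus"
    have "meval m (z(j := 1)) = meval (m + single j (- r)) z"
      unfolding meval_upd[OF z] using z torusD[OF z]
      by (simp add: meval_add meval_single r_def power_int_divide_distrib power_int_minus field_simps)
    thus "leval (single (m + single j (- r)) c) z = leval 1 z"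
      using one[OF z] by (simp add: leval_single)
  qed
  note s1 = single_eq_one[OF this]
  have m: "m = single j r"
  proof -
    have "m = - single j (- r)" using s1(1) by (simp add: add_eq_0_iff2)
    thus ?thesis by (simp add: single_uminus)
  qed
  show ?thesis
  proof (intro exI[of _ r] ballI)
    fix \<beta> z assume "\<beta> \<in> LP L" "z \<in> torus"
    from mc(3)[OF this] show "Nv k (\<lambda>z. kfun (1 / \<kappa> j z) \<zeta>) (\<lambda>z. br (inverse q) * br ((1 / \<kappa> j z)\<^sup>2)) \<beta> z =
        kfun (\<kappa> j z) \<zeta> * meval (single j r) z * leval (\<Psi> \<beta>) (z(j := 1 / z j))"
      unfolding N_def b_def \<tau>_def s1(2) by (simp only: m[symmetric] mult_1)
  qed
qed

text \<open>Inversion negates the exponents of \<open>z_j\<close>, so it preserves the extreme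
  exponents of a centred vector; comparing them at both ends gives \<open>r \<le> 0\<close> and
  \<open>- r \<le> 0\<close>.\<close>

lemma edge_centred:
  fixes \<delta> :: bool
  defines "\<kappa> \<equiv> \<lambda>j (z :: nat \<Rightarrow> complex). if \<delta> then z j else 1 / z j"
  assumes j: "j \<in> {1..L}" and k: "k \<le> L" and z0: "\<zeta> \<noteq> 0" "\<zeta> ^ 4 \<noteq> 1" "kfun 1 \<zeta> \<noteq> 0"
    and fx: "\<And>z. z \<in> torus \<Longrightarrow> fixed_vec L (z(j := 1 / z j)) \<zeta>0 \<zeta>L (K_op L k (1 / \<kappa> j z) \<zeta> (\<lambda>\<alpha>. leval (\<Psi> \<alpha>) z))"
    and aa: "if \<delta> then a = 1 / (q * \<zeta>) \<and> a' = \<zeta> / q else a = q * \<zeta> \<and> a' = q / \<zeta>"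
    and fr: "free_locus L w \<zeta>0 \<zeta>L j (\<lambda>_. a)" "free_locus L w \<zeta>0 \<zeta>L j (\<lambda>_. a')"
    and cen: "centred L \<Psi>" and \<beta>: "\<beta> \<in> LP L" and z: "z \<in> torus"
  shows "Nv k (\<lambda>z. kfun (1 / \<kappa> j z) \<zeta>) (\<lambda>z. br (inverse q) * br ((1 / \<kappa> j z)\<^sup>2)) \<beta> z =
    kfun (\<kappa> j z) \<zeta> * leval (\<Psi> \<beta>) (z(j := 1 / z j))"
proof -
  define A where "A n = n + single j (- 2 * lookup n j)" for n :: "nat \<Rightarrow>\<^sub>0 int"
  define d :: "nat \<Rightarrow>\<^sub>0 int" where "d = single j (if \<delta> then 2 else - 2)"
  obtain r where r: "\<forall>\<beta>\<in>LP L. \<forall>z\<in>torus.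
    Nv k (\<lambda>z. kfun (1 / \<kappa> j z) \<zeta>) (\<lambda>z. br (inverse q) * br ((1 / \<kappa> j z)\<^sup>2)) \<beta> z =
    kfun (\<kappa> j z) \<zeta> * meval (single j r) z * leval (\<Psi> \<beta>) (z(j := 1 / z j))"
    using edge_exchange[OF j k z0 fx[unfolded \<kappa>_def] aa fr] unfolding \<kappa>_def by (rule exE)
  define M where "M = Max (exponents L \<Psi> j)"
  note M = centred_bounds[OF cen j, folded M_def]
  have lA: "lookup (A n) j = - lookup n j" for n by (simp add: A_def lookup_add lookup_single)
  have lm: "lookup (single j r) j = r" "lookup d j = (if \<delta> then 2 else - 2)" by (simp_all add: d_def lookup_single)
  let ?v = "- (\<zeta>\<^sup>2 + (inverse \<zeta>)\<^sup>2)"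
  have main: "wt (single j r) + wt (A n) \<le> M"
    if "\<And>m n. wt (m + n) = wt m + wt n" "wt d \<noteq> 0" "\<And>\<beta>. \<beta> \<in> LP L \<Longrightarrow> deg_le wt (\<Psi> \<beta>) M" "\<beta> \<in> LP L" "n \<in> keys (\<Psi> \<beta>)" for wt \<beta> n
  proof (rule degree[where wt = wt and d = d and x = q and y = "q\<^sup>2" and v = ?v and g = "- br (inverse q)" and k = k
        and \<tau> = "\<lambda>z. z(j := 1 / z j)" and A = A, OF that(1,2) _ _ _ _ _ that(3,4,5)])
    fix z n assume z: "z \<in> torus"
    have p2: "1 / z j / z j = z j powi (- 2)" by (simp add: power_int_minus divide_inverse power2_eq_square)
    show "meval n (z(j := 1 / z j)) = meval (A n) z"
      unfolding meval_upd[OF z] p2 power_int_mult[symmetric] A_def meval_add[OF z] meval_single by (rule refl)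
  next
    fix n show "A (A n) = n"
      unfolding A_def[of "A n"] lA by (rule poly_mapping_eqI) (simp add: A_def lookup_add lookup_single when_def)
  next
    fix \<beta> z assume b: "\<beta> \<in> LP L" and z: "z \<in> torus"
    have nz: "z j \<noteq> 0" using torusD[OF z] by auto
    have X: "meval d z = (\<kappa> j z)\<^sup>2" by (simp add: d_def meval_single \<kappa>_def power_int_minus power_divide divide_inverse power_inverse)
    have \<kappa>0: "\<kappa> j z \<noteq> 0" "1 / \<kappa> j z \<noteq> 0" using nz by (auto simp: \<kappa>_def)
    have "Nv k (\<lambda>z. q / meval d z + q\<^sup>2 * meval d z + ?v) (\<lambda>z. - br (inverse q) * (meval d z - 1 / meval d z)) \<beta> z =
        Nv k (\<lambda>z. kfun (1 / \<kappa> j z) \<zeta>) (\<lambda>z. br (inverse q) * br ((1 / \<kappa> j z)\<^sup>2)) \<beta> z"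
    proof (rule Nv_cong)
      show "q / meval d z + q\<^sup>2 * meval d z + ?v = kfun (1 / \<kappa> j z) \<zeta>"
        unfolding kfun_expand[OF \<kappa>0(2) z0(1)] X by (simp add: power_divide)
      show "- br (inverse q) * (meval d z - 1 / meval d z) = br (inverse q) * br ((1 / \<kappa> j z)\<^sup>2)"
        unfolding X br_def[of "(1 / \<kappa> j z)\<^sup>2"] by (simp add: power_divide algebra_simps)
    qed
    also have "\<dots> = (q * meval d z + q\<^sup>2 / meval d z + ?v) * meval (single j r) z * leval (\<Psi> \<beta>) (z(j := 1 / z j))"
      unfolding r[rule_format, OF b z] X kfun_expand[OF \<kappa>0(1) z0(1)] by (simp add: power_divide divide_inverse power_inverse)
    finally show "Nv k (\<lambda>z. q / meval d z + q\<^sup>2 * meval d z + ?v) (\<lambda>z. - br (inverse q) * (meval d z - 1 / meval d z)) \<beta> z =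
      (q * meval d z + q\<^sup>2 / meval d z + ?v) * meval (single j r) z * leval (\<Psi> \<beta>) (z(j := 1 / z j))" .
  qed auto
  have add: "lookup (m + n) j = lookup m j + lookup n j" "- lookup (m + n) j = - lookup m j + - lookup n j"
    for m n :: "nat \<Rightarrow>\<^sub>0 int" and j by (simp_all add: lookup_add)
  have "r + M \<le> M"
  proof -
    from M(4) obtain \<beta> n where b: "\<beta> \<in> LP L" "n \<in> keys (\<Psi> \<beta>)" "lookup n j = - M" by blast
    show ?thesis using main[of "\<lambda>n. lookup n j", OF add(1) _ M(1) b(1,2)] b(3) unfolding lA lm by simp
  qed
  moreover have "- r + M \<le> M"
  proof -
    from M(3) obtain \<beta> n where b: "\<beta> \<in> LP L" "n \<in> keys (\<Psi> \<beta>)" "lookup n j = M" by blast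
    show ?thesis using main[of "\<lambda>n. - lookup n j", OF add(2) _ M(2) b(1,2)] b(3) unfolding lA lm by simp
  qed
  ultimately have "r = 0" by linarith
  thus ?thesis using r[rule_format, OF \<beta> z] by simp
qed

end

section \<open>The q-deformed Knizhnik--Zamolodchikov equation\<close>

lemma lookup_single_mult: "lookup (single m 1 * p) k = lookup p (k - m)" for p :: laurent
proof -
  have "single m 1 * p = (\<Sum>n\<in>keys p. single (m + n) (lookup p n))"
    by (subst sum_single[of p]) (simp add: sum_distrib_left mult_single)
  hence "lookup (single m 1 * p) k = (\<Sum>n\<in>keys p. lookup p n when m + n = k)"
    by (simp add: lookup_sum lookup_single)
  also have "\<dots> = (\<Sum>n\<in>keys p. if n = k - m then lookup p n else 0)"
    by (intro sum.cong refl) (auto simp: when_def)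
  also have "\<dots> = lookup p (k - m)" by (simp add: in_keys_iff)
  finally show ?thesis .
qed

lemma fixed_vec_scale:
  assumes "fixed_vec L z a b v" "\<And>\<alpha>. \<alpha> \<in> LP L \<Longrightarrow> u \<alpha> = c * v \<alpha>"
  shows "fixed_vec L z a b u"
  unfolding fixed_vec_def vec_eq_def
proof (intro allI impI ballI)
  fix w \<beta> assume w: "T_regular L w z a b" and \<beta>: "\<beta> \<in> LP L"
  have "T_op L w z a b u \<beta> = c * T_op L w z a b v \<beta>"
    unfolding T_op_sum[OF \<beta>] sum_distrib_left by (intro sum.cong refl) (simp add: assms(2) mult.assoc flip: sum_distrib_left)
  thus "T_op L w z a b u \<beta> = u \<beta>" using assms(1) w \<beta> assms(2)[OF \<beta>] by (simp add: fixed_vec_def vec_eq_def)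
qed

lemma ground_state_monomial_mult:
  assumes gs: "ground_state L \<zeta>0 \<zeta>L \<Psi>" and m: "keys m \<subseteq> {1..L}"
  shows "ground_state L \<zeta>0 \<zeta>L (monomial_mult m \<Psi>)"
  unfolding ground_state_def
proof (intro conjI ballI allI impI)
  have in_V: "\<Psi> \<alpha> \<in> laurent_in {1..L}" if "\<alpha> \<in> LP L" for \<alpha> using gs that by (simp add: ground_state_def)
  show "monomial_mult m \<Psi> \<alpha> \<in> laurent_in {1..L}" if "\<alpha> \<in> LP L" for \<alpha>
    unfolding monomial_mult_def by (intro laurent_in_closed(4) laurent_in_single m in_V that)
  show "coprime_components L (monomial_mult m \<Psi>)" unfolding coprime_components_def
  proof (intro ballI impI)
    fix g assume g: "g \<in> laurent_in {1..L}" "\<forall>\<alpha>\<in>LP L. g dvd monomial_mult m \<Psi> \<alpha>"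
    have "g dvd \<Psi> \<alpha>" if "\<alpha> \<in> LP L" for \<alpha>
    proof -
      have "g dvd single (- m) 1 * (single m 1 * \<Psi> \<alpha>)" using g(2) that by (simp add: monomial_mult_def)
      also have "\<dots> = (single m 1 * single (- m) 1) * \<Psi> \<alpha>" by (simp only: mult_ac)
      also have "\<dots> = \<Psi> \<alpha>" unfolding monomial_inverse by simp
      finally show ?thesis .
    qed
    thus "g dvd 1" using gs g(1) by (simp add: ground_state_def coprime_components_def)
  qed
  fix z :: "nat \<Rightarrow> complex" assume z: "\<forall>i\<in>{1..L}. z i \<noteq> 0"
  define y where "y i = (if i \<in> {1..L} then z i else 1)" for i
  have y: "y \<in> torus" using z by (simp add: torus_def y_def)
  have sc: "vec_at (monomial_mult m \<Psi>) z \<alpha> = meval m y * vec_at \<Psi> z \<alpha>" if "\<alpha> \<in> LP L" for \<alpha>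
  proof -
    have e: "leval p z = leval p y" if "p \<in> laurent_in {1..L}" for p
      by (rule leval_cong[OF that]) (simp add: y_def)
    have "single m 1 * \<Psi> \<alpha> \<in> laurent_in {1..L}" by (intro laurent_in_closed(4) laurent_in_single m in_V that)
    from e[OF this] show ?thesis
      by (simp add: vec_at_def monomial_mult_def e[OF in_V[OF that]] leval_mult[OF y] leval_single)
  qed
  have fv: "fixed_vec L z \<zeta>0 \<zeta>L (vec_at \<Psi> z)" using gs z by (simp add: ground_state_def)
  show "fixed_vec L z \<zeta>0 \<zeta>L (vec_at (monomial_mult m \<Psi>) z)" by (rule fixed_vec_scale[OF fv sc])
qed

text \<open>The loci are the roots, up to sign, of the denominators after the exchange. The
  condition at \<open>\<i>\<close> concerns the point where inverting \<open>z_L\<close> coincides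
  with changing its sign; it decides the parity in \<open>z_L\<close>.\<close>

locale generic_ground_state = good_ground_state +
  assumes free_bulk: "\<And>i. i \<in> {1..<L} \<Longrightarrow> free_locus L w \<zeta>0 \<zeta>L i (\<lambda>z. q * z (i + 1))"
    and free_left: "free_locus L w \<zeta>0 \<zeta>L 1 (\<lambda>_. 1 / (q * \<zeta>0))" "free_locus L w \<zeta>0 \<zeta>L 1 (\<lambda>_. \<zeta>0 / q)"
    and free_right: "free_locus L w \<zeta>0 \<zeta>L L (\<lambda>_. q * \<zeta>L)" "free_locus L w \<zeta>0 \<zeta>L L (\<lambda>_. q / \<zeta>L)"
    and nondegenerate: "\<zeta>0 ^ 4 \<noteq> 1" "kfun 1 \<zeta>0 \<noteq> 0" "\<zeta>L ^ 4 \<noteq> 1" "kfun 1 \<zeta>L \<noteq> 0" "kfun \<i> \<zeta>L \<noteq> 0"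
begin

lemma left_equation:
  assumes "centred L \<Psi>" "\<beta> \<in> LP L" "z \<in> torus" "kfun (z 1) \<zeta>0 \<noteq> 0"
  shows "K_op L 0 (1 / z 1) \<zeta>0 (\<lambda>\<alpha>. leval (\<Psi> \<alpha>) z) \<beta> = leval (\<Psi> \<beta>) (z(1 := 1 / z 1))"
proof -
  have L1: "1 \<in> {1..L}" using L by simp
  have fx: "fixed_vec L (y(1 := 1 / y 1)) \<zeta>0 \<zeta>L (K_op L 0 (1 / (if True then y 1 else 1 / y 1)) \<zeta>0 (\<lambda>\<alpha>. leval (\<Psi> \<alpha>) y))"
    if "y \<in> torus" for y
    unfolding if_True by (rule fixed_vec_K0[OF L torusD[OF that] \<zeta>(1) fixed[OF that]])
  note eq = edge_centred[where \<delta> = True and a = "1 / (q * \<zeta>0)" and a' = "\<zeta>0 / q",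
      OF L1 le0 \<zeta>(1) nondegenerate(1,2) fx _ free_left assms(1-3), unfolded if_True, simplified simp_thms]
  have "Nv 0 (\<lambda>z. kfun (1 / z 1) \<zeta>0) (\<lambda>z. br (inverse q) * br ((1 / z 1)\<^sup>2)) \<beta> z = kfun (z 1) \<zeta>0 * leval (\<Psi> \<beta>) (z(1 := 1 / z 1))"
    by (rule eq) simp_all
  thus ?thesis using assms(4) by (simp add: K_op_def Nv_def field_simps)
qed

lemma right_Nv:
  assumes "centred L \<Psi>" "\<beta> \<in> LP L" "z \<in> torus"
  shows "Nv L (\<lambda>z. kfun (z L) \<zeta>L) (\<lambda>z. br (inverse q) * br ((z L)\<^sup>2)) \<beta> z = kfun (1 / z L) \<zeta>L * leval (\<Psi> \<beta>) (z(L := 1 / z L))"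
proof -
  have LL: "L \<in> {1..L}" using L by simp
  have i: "1 / (1 / x) = x" for x :: complex by simp
  have fx: "fixed_vec L (y(L := 1 / y L)) \<zeta>0 \<zeta>L (K_op L L (1 / (if False then y L else 1 / y L)) \<zeta>L (\<lambda>\<alpha>. leval (\<Psi> \<alpha>) y))"
    if "y \<in> torus" for y
    unfolding if_False i by (rule fixed_vec_KL[OF L torusD[OF that] \<zeta>(2) fixed[OF that]])
  note eq = edge_centred[where \<delta> = False and a = "q * \<zeta>L" and a' = "q / \<zeta>L",
      OF LL le_refl \<zeta>(2) nondegenerate(3,4) fx _ free_right assms, unfolded if_False i, simplified simp_thms]
  show ?thesis by (rule eq) simp_all
qed

lemma right_equation:
  assumes "centred L \<Psi>" "\<beta> \<in> LP L" "z \<in> torus" "kfun (1 / z L) \<zeta>L \<noteq> 0"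
  shows "K_op L L (z L) \<zeta>L (\<lambda>\<alpha>. leval (\<Psi> \<alpha>) z) \<beta> = leval (\<Psi> \<beta>) (z(L := 1 / z L))"
  using right_Nv[OF assms(1-3)] assms(4) by (simp add: K_op_def Nv_def field_simps)

text \<open>At \<open>z_L = \<i>\<close> inversion is a change of sign and \<open>K_L\<close> acts
  as the identity, so the parity sign in \<open>z_L\<close> must be 1. For
  \<open>s\<^sup>2 = - 1\<close> the operator \<open>\<pi>_L\<close> sends \<open>z_L\<close> to
  \<open>- 1 / z_L\<close>, and evenness reconciles this with the relation for
  \<open>1 / z_L\<close>.\<close>

lemma right_even:
  assumes cen: "centred L \<Psi>" and "\<alpha> \<in> LP L" "z \<in> torus"
  shows "leval (\<Psi> \<alpha>) (z(L := - z L)) = leval (\<Psi> \<alpha>) z"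
proof -
  have LL: "L \<in> {1..L}" using L by simp
  obtain \<sigma> where \<sigma>: "\<forall>\<alpha>\<in>LP L. \<forall>z\<in>torus. leval (\<Psi> \<alpha>) z = \<sigma> * leval (\<Psi> \<alpha>) (z(L := - z L))" using parity[OF LL] by blast
  obtain \<beta> y0 where \<beta>: "\<beta> \<in> LP L" "y0 \<in> torus" "leval (\<Psi> \<beta>) (y0(L := \<i>)) \<noteq> 0"
    using Psi_locus_nonzero[of L "\<lambda>_. \<i>", OF LL lunit_const] by auto
  define y where "y = y0(L := \<i>)"
  have y: "y \<in> torus" "y L = \<i>" "1 / y L = - y L" using \<beta>(2) by (auto simp: y_def torus_upd)
  have k: "kfun (- \<i>) \<zeta>L = kfun \<i> \<zeta>L" by (simp add: kfun_def br_minus)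
  have "kfun \<i> \<zeta>L * leval (\<Psi> \<beta>) y = kfun \<i> \<zeta>L * leval (\<Psi> \<beta>) (y(L := - y L))"
    using right_Nv[OF cen \<beta>(1) y(1)] unfolding y(3) unfolding Nv_def y(2) k by (simp add: br_def)
  hence "leval (\<Psi> \<beta>) y = leval (\<Psi> \<beta>) (y(L := - y L))" using nondegenerate(5) by simp
  moreover have "leval (\<Psi> \<beta>) y = \<sigma> * leval (\<Psi> \<beta>) (y(L := - y L))" using \<sigma> \<beta>(1) y(1) by blast
  ultimately have "\<sigma> = 1" using \<beta>(3) unfolding y_def[symmetric] by (metis mult_cancel_right1)
  thus ?thesis using \<sigma> assms by simp
qed

lemma bulk_equation:
  assumes "i \<in> {1..<L}" "centred L \<Psi>" "\<beta> \<in> LP L" "z \<in> torus" "br (q * (z i / z (i + 1))) \<noteq> 0"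
  shows "R_op L i (z i / z (i + 1)) (\<lambda>\<alpha>. leval (\<Psi> \<alpha>) z) \<beta> = leval (\<Psi> \<beta>) (z(i := z (i + 1), i + 1 := z i))"
proof -
  have "1 \<le> i" "i < L" using assms(1) by auto
  from bulk_centred[OF this free_bulk[OF assms(1)] assms(2-4)] show ?thesis
    unfolding R_op_def Nv_def using assms(5) by (simp add: divide_eq_eq mult.commute)
qed

lemma centred_qKZ:
  assumes s: "s ^ 4 = 1" and cen: "centred L \<Psi>"
  shows "qKZ L s \<zeta>0 \<zeta>L \<Psi>"
  unfolding qKZ_def
proof (intro allI impI)
  fix z :: "nat \<Rightarrow> complex" assume z: "\<forall>i\<in>{1..L}. z i \<noteq> 0"
  define y where "y i = (if i \<in> {1..L} then z i else 1)" for i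
  have y: "y \<in> torus" using z by (simp add: torus_def y_def)
  have yz: "y i = z i" if "i \<in> {1..L}" for i using that by (simp add: y_def)
  have e: "leval (\<Psi> \<alpha>) x = leval (\<Psi> \<alpha>) x'" if "\<alpha> \<in> LP L" "\<And>i. i \<in> {1..L} \<Longrightarrow> x i = x' i" for \<alpha> x x'
    by (rule leval_cong[OF Psi_in[OF that(1)] that(2)])
  have va: "vec_at \<Psi> z \<alpha> = leval (\<Psi> \<alpha>) y" if "\<alpha> \<in> LP L" for \<alpha>
    unfolding vec_at_def by (rule e[OF that]) (simp add: y_def)
  have ge: "gen_op L k (vec_at \<Psi> z) \<beta> = gen_op L k (\<lambda>\<alpha>. leval (\<Psi> \<alpha>) y) \<beta>" for k \<beta>
    by (rule gen_op_cong) (rule va)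
  have R: "R_op L i x (vec_at \<Psi> z) \<beta> = R_op L i x (\<lambda>\<alpha>. leval (\<Psi> \<alpha>) y) \<beta>"
    and K: "K_op L i x \<xi> (vec_at \<Psi> z) \<beta> = K_op L i x \<xi> (\<lambda>\<alpha>. leval (\<Psi> \<alpha>) y) \<beta>" if "\<beta> \<in> LP L" for i x \<xi> \<beta>
    unfolding R_op_def K_op_def ge va[OF that] by simp_all
  have L1: "1 \<in> {1..L}" "L \<in> {1..L}" using L by auto
  have bulk: "vec_eq L (R_op L i (z i / z (i + 1)) (vec_at \<Psi> z)) (pi_op L s i (vec_at \<Psi>) z)"
    if i: "i \<in> {1..<L}" and nz: "br (q * (z i / z (i + 1))) \<noteq> 0" for i
    unfolding vec_eq_def
  proof
    fix \<beta> assume \<beta>: "\<beta> \<in> LP L"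
    have yi: "y i = z i" "y (i + 1) = z (i + 1)" using i by (auto intro: yz)
    have "R_op L i (z i / z (i + 1)) (vec_at \<Psi> z) \<beta> = leval (\<Psi> \<beta>) (y(i := y (i + 1), i + 1 := y i))"
      unfolding R[OF \<beta>] using bulk_equation[OF i cen \<beta> y] nz unfolding yi by blast
    also have "\<dots> = leval (\<Psi> \<beta>) (z(i := z (i + 1), i + 1 := z i))"
      unfolding yi by (rule e[OF \<beta>]) (simp add: y_def)
    also have "\<dots> = pi_op L s i (vec_at \<Psi>) z \<beta>" using i by (simp add: pi_op_def vec_at_def)
    finally show "R_op L i (z i / z (i + 1)) (vec_at \<Psi> z) \<beta> = pi_op L s i (vec_at \<Psi>) z \<beta>" .
  qed
  have left: "vec_eq L (K_op L 0 (1 / z 1) \<zeta>0 (vec_at \<Psi> z)) (pi_op L s 0 (vec_at \<Psi>) z)"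
    if nz: "kfun (z 1) \<zeta>0 \<noteq> 0"
    unfolding vec_eq_def
  proof
    fix \<beta> assume \<beta>: "\<beta> \<in> LP L"
    note y1 = yz[OF L1(1)]
    have "K_op L 0 (1 / z 1) \<zeta>0 (vec_at \<Psi> z) \<beta> = leval (\<Psi> \<beta>) (y(1 := 1 / y 1))"
      unfolding K[OF \<beta>] using left_equation[OF cen \<beta> y] nz unfolding y1 by blast
    also have "\<dots> = leval (\<Psi> \<beta>) (z(1 := 1 / z 1))"
      unfolding y1 by (rule e[OF \<beta>]) (simp add: y_def)
    also have "\<dots> = pi_op L s 0 (vec_at \<Psi>) z \<beta>" by (simp add: pi_op_def vec_at_def)
    finally show "K_op L 0 (1 / z 1) \<zeta>0 (vec_at \<Psi> z) \<beta> = pi_op L s 0 (vec_at \<Psi>) z \<beta>" .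
  qed
  have right: "vec_eq L (K_op L L (s * z L) (s * \<zeta>L) (vec_at \<Psi> z)) (pi_op L s L (vec_at \<Psi>) z)"
    if nz: "kfun (1 / (s * z L)) (s * \<zeta>L) \<noteq> 0"
    unfolding vec_eq_def
  proof
    fix \<beta> assume \<beta>: "\<beta> \<in> LP L"
    note yL = yz[OF L1(2)]
    have s0: "s \<noteq> 0" using s by auto
    have "s\<^sup>2 * s\<^sup>2 = 1" using s by (simp flip: power_add)
    hence s2: "s\<^sup>2 = 1 \<or> s\<^sup>2 = - 1" by (metis power2_eq_1_iff power2_eq_square)
    have zL: "z L \<noteq> 0" using z L1(2) by blast
    \<comment> \<open>As \<open>s\<^sup>2\<close> is a sign, multiplying both arguments of
      \<open>kfun\<close> by \<open>s\<close> scales it by \<open>s\<^sup>2\<close>, and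
      \<open>br\<close> of the squared argument scales likewise. The factor cancels, so
      \<open>K_L\<close> does not depend on \<open>s\<close>.\<close>
    have bs: "br (s\<^sup>2 * x) = s\<^sup>2 * br x" for x using s2 br_minus[of x] by auto
    have k1: "kfun (s * x) (s * \<zeta>L) = s\<^sup>2 * kfun x \<zeta>L" for x
    proof -
      have "s * x / (q * (s * \<zeta>L)) = x / (q * \<zeta>L)" "s * x * (s * \<zeta>L) / q = s\<^sup>2 * (x * \<zeta>L / q)"
        using s0 by (simp_all add: power2_eq_square)
      from this show ?thesis unfolding kfun_def by (simp only: bs mult_ac)
    qed
    have "s * (s * s\<^sup>2) = 1" using \<open>s\<^sup>2 * s\<^sup>2 = 1\<close> by (simp add: power2_eq_square mult.assoc)
    hence "inverse s = s * s\<^sup>2" by (rule inverse_unique)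
    hence "1 / (s * z L) = s * (s\<^sup>2 * (1 / z L))" by (simp add: divide_inverse mult.assoc)
    hence "kfun (1 / (s * z L)) (s * \<zeta>L) = kfun (s * (s\<^sup>2 * (1 / z L))) (s * \<zeta>L)" by (simp only:)
    also have "\<dots> = s\<^sup>2 * kfun (s\<^sup>2 * (1 / z L)) \<zeta>L" by (rule k1)
    also have "kfun (s\<^sup>2 * (1 / z L)) \<zeta>L = kfun (1 / z L) \<zeta>L" using s2 by (auto simp: kfun_def br_minus)
    finally have k2: "kfun (1 / (s * z L)) (s * \<zeta>L) = s\<^sup>2 * kfun (1 / z L) \<zeta>L" .
    have b2: "br ((s * z L)\<^sup>2) = s\<^sup>2 * br ((z L)\<^sup>2)" unfolding power_mult_distrib by (rule bs)
    have nz': "kfun (1 / z L) \<zeta>L \<noteq> 0" using nz k2 by auto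
    have "K_op L L (s * z L) (s * \<zeta>L) (vec_at \<Psi> z) \<beta> = K_op L L (z L) \<zeta>L (vec_at \<Psi> z) \<beta>"
      unfolding K_op_def k1 k2 b2 using s0 nz' by (simp add: field_simps)
    also have "\<dots> = leval (\<Psi> \<beta>) (y(L := 1 / y L))"
      unfolding K[OF \<beta>] using right_equation[OF cen \<beta> y] nz' unfolding yL by blast
    also have "\<dots> = leval (\<Psi> \<beta>) (y(L := 1 / (s\<^sup>2 * y L)))"
    proof (cases "s\<^sup>2 = 1")
      case False
      hence s2': "s\<^sup>2 = - 1" using s2 by blast
      have y': "y(L := 1 / y L) \<in> torus" using y by (simp add: torus_upd torusD)
      have "y(L := 1 / (s\<^sup>2 * y L)) = (y(L := 1 / y L))(L := - (y(L := 1 / y L)) L)" unfolding s2' by (simp add: fun_eq_iff)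
      thus ?thesis using right_even[OF cen \<beta> y'] by (simp only:)
    qed simp
    also have "\<dots> = leval (\<Psi> \<beta>) (z(L := 1 / (s\<^sup>2 * z L)))"
      unfolding yL by (rule e[OF \<beta>]) (simp add: y_def)
    also have "\<dots> = pi_op L s L (vec_at \<Psi>) z \<beta>" using L by (simp add: pi_op_def vec_at_def)
    finally show "K_op L L (s * z L) (s * \<zeta>L) (vec_at \<Psi> z) \<beta> = pi_op L s L (vec_at \<Psi>) z \<beta>" .
  qed
  show "(\<forall>i\<in>{1..<L}. br (q * (z i / z (i + 1))) \<noteq> 0 \<longrightarrow>
           vec_eq L (R_op L i (z i / z (i + 1)) (vec_at \<Psi> z)) (pi_op L s i (vec_at \<Psi>) z)) \<and>
        (kfun (z 1) \<zeta>0 \<noteq> 0 \<longrightarrow>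
           vec_eq L (K_op L 0 (1 / z 1) \<zeta>0 (vec_at \<Psi> z)) (pi_op L s 0 (vec_at \<Psi>) z)) \<and>
        (kfun (1 / (s * z L)) (s * \<zeta>L) \<noteq> 0 \<longrightarrow>
           vec_eq L (K_op L L (s * z L) (s * \<zeta>L) (vec_at \<Psi> z)) (pi_op L s L (vec_at \<Psi>) z))"
    by (intro conjI ballI impI bulk left right)
qed

text \<open>Comparing coefficients in \<open>parity\<close> ties the sign of \<open>- 1\<close> to
  the power of each occurring exponent to the same \<open>\<sigma>\<close>. Hence the smallest and
  the largest exponent have an even sum, and an integral shift can make the range symmetric.\<close>

lemma exponents_parity:
  assumes i: "i \<in> {1..L}" and a: "a \<in> exponents L \<Psi> i" and b: "b \<in> exponents L \<Psi> i"
  shows "even (a + b)"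
proof -
  obtain \<sigma> where \<sigma>: "\<forall>\<alpha>\<in>LP L. \<forall>z\<in>torus. leval (\<Psi> \<alpha>) z = \<sigma> * leval (\<Psi> \<alpha>) (z(i := - z i))" using parity[OF i] by blast
  have key: "\<sigma> * (- 1) powi c = 1" if c: "c \<in> exponents L \<Psi> i" for c
  proof -
    obtain m \<alpha> where m: "\<alpha> \<in> LP L" "m \<in> keys (\<Psi> \<alpha>)" "c = lookup m i" using c by (auto simp: exponents_def)
    have eq: "\<Psi> \<alpha> = (\<Sum>n\<in>keys (\<Psi> \<alpha>). single n (\<sigma> * (- 1) powi lookup n i * lookup (\<Psi> \<alpha>) n))"
    proof (rule leval_eqI)
      fix z assume z: "z \<in> torus"
      have "leval (\<Psi> \<alpha>) z = \<sigma> * leval (\<Psi> \<alpha>) (z(i := - z i))" using \<sigma> m(1) z by blast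
      also have "\<dots> = (\<Sum>n\<in>keys (\<Psi> \<alpha>). \<sigma> * (- 1) powi lookup n i * lookup (\<Psi> \<alpha>) n * meval n z)"
        unfolding leval_meval sum_distrib_left meval_upd[OF z] using torusD[OF z, of i]
        by (intro sum.cong refl) (simp add: mult_ac)
      finally show "leval (\<Psi> \<alpha>) z = leval (\<Sum>n\<in>keys (\<Psi> \<alpha>). single n (\<sigma> * (- 1) powi lookup n i * lookup (\<Psi> \<alpha>) n)) z"
        by (simp add: leval_sum leval_single)
    qed
    have "lookup (\<Psi> \<alpha>) m = \<sigma> * (- 1) powi c * lookup (\<Psi> \<alpha>) m"
      using arg_cong[OF eq, of "\<lambda>p. lookup p m"] m(2,3) by (simp add: lookup_sum lookup_single when_def)
    thus ?thesis using m(2) by (simp add: in_keys_iff)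
  qed
  have "\<sigma> \<noteq> 0" using key[OF a] by auto
  moreover have "\<sigma> * (- 1) powi a = \<sigma> * (- 1) powi b" using key[OF a] key[OF b] by simp
  ultimately have "(- 1 :: complex) powi a = (- 1) powi b" by simp
  thus ?thesis by (simp add: power_int_minus_left split: if_splits)
qed

lemma centring_monomial: "\<exists>m. keys m \<subseteq> {1..L} \<and> centred L (monomial_mult m \<Psi>)"
proof -
  define e where "e i = - ((Min (exponents L \<Psi> i) + Max (exponents L \<Psi> i)) div 2)" for i
  define m where "m = (\<Sum>i\<in>{1..L}. single i (e i))"
  have lm: "lookup m i = e i" if "i \<in> {1..L}" for i using that by (simp add: m_def lookup_sum lookup_single when_def)
  have "keys m \<subseteq> (\<Union>i\<in>{1..L}. keys (single i (e i)))" unfolding m_def by (rule keys_sum)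
  hence km: "keys m \<subseteq> {1..L}" by (auto split: if_splits)
  have "centred L (monomial_mult m \<Psi>)" unfolding centred_def
  proof
    fix i assume i: "i \<in> {1..L}"
    let ?E = "exponents L \<Psi> i"
    note fin = exponents_finite[of i] and ne = exponents_nonempty[of i]
    have "exponents L (monomial_mult m \<Psi>) i = (\<lambda>x. x + e i) ` ?E"
    proof (intro equalityI subsetI)
      fix x assume "x \<in> exponents L (monomial_mult m \<Psi>) i"
      then obtain k \<alpha> where k: "\<alpha> \<in> LP L" "k \<in> keys (single m 1 * \<Psi> \<alpha>)" "x = lookup k i"
        by (auto simp: exponents_def monomial_mult_def)
      hence "k - m \<in> keys (\<Psi> \<alpha>)" by (simp add: in_keys_iff lookup_single_mult)
      hence "lookup (k - m) i \<in> ?E" using k(1) by (auto simp: exponents_def)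
      moreover have "x = lookup (k - m) i + e i" using k(3) lm[OF i] by (simp add: lookup_minus)
      ultimately show "x \<in> (\<lambda>x. x + e i) ` ?E" by blast
    next
      fix x assume "x \<in> (\<lambda>x. x + e i) ` ?E"
      then obtain k \<alpha> where k: "\<alpha> \<in> LP L" "k \<in> keys (\<Psi> \<alpha>)" "x = lookup k i + e i" by (auto simp: exponents_def)
      hence "k + m \<in> keys (single m 1 * \<Psi> \<alpha>)" by (simp add: in_keys_iff lookup_single_mult)
      moreover have "x = lookup (k + m) i" using k(3) lm[OF i] by (simp add: lookup_add)
      ultimately show "x \<in> exponents L (monomial_mult m \<Psi>) i" using k(1) unfolding exponents_def monomial_mult_def by blast
    qed
    moreover have "Max ((\<lambda>x. x + e i) ` ?E) = Max ?E + e i" "Min ((\<lambda>x. x + e i) ` ?E) = Min ?E + e i"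
      using Max_add_commute[OF fin ne, of "\<lambda>x. x" "e i"] Min_add_commute[OF fin ne, of "\<lambda>x. x" "e i"] by simp_all
    moreover have "even (Min ?E + Max ?E)" by (intro exponents_parity[OF i] Min_in Max_in fin ne)
    hence "Min ?E + e i = - (Max ?E + e i)" unfolding e_def by presburger
    ultimately show "Min (exponents L (monomial_mult m \<Psi>) i) = - Max (exponents L (monomial_mult m \<Psi>) i)" by simp
  qed
  thus ?thesis using km by blast
qed

lemma monomial_mult_generic: "keys m \<subseteq> {1..L} \<Longrightarrow> generic_ground_state L w \<zeta>0 \<zeta>L (monomial_mult m \<Psi>)"
  by unfold_locales (use L \<zeta> free free_bulk free_left free_right nondegenerate ground_state_monomial_mult[OF gs] in auto)

end

theorem theorem2p1p2:
  fixes L :: nat and s :: complex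
  assumes "L \<ge> 1" and "s ^ 4 = 1"
  shows "generically {0, L} (\<lambda>\<zeta>. unique_fixed_vec L (\<zeta> 0) (\<zeta> L) \<longrightarrow>
           (\<forall>\<Psi>. ground_state L (\<zeta> 0) (\<zeta> L) \<Psi> \<longrightarrow>
              (centred L \<Psi> \<longrightarrow> qKZ L s (\<zeta> 0) (\<zeta> L) \<Psi>) \<and>
              (\<exists>m. Poly_Mapping.keys m \<subseteq> {1..L} \<and> centred L (monomial_mult m \<Psi>) \<and>
                   qKZ L s (\<zeta> 0) (\<zeta> L) (monomial_mult m \<Psi>))))"
proof -
  \<comment> \<open>Either square root serves: \<open>w\<^sup>2 = - q\<close> is all that the
    special points require.\<close>
  define w where "w = csqrt (- q)"
  have w: "w\<^sup>2 = - q" by (simp add: w_def)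
  have w0: "w \<noteq> 0" using w by auto
  note fl = free_locus_generically[OF assms(1) w]
  have g0: "generically {0, L} (\<lambda>\<zeta>. free_locus L w (\<zeta> 0) (\<zeta> L) 1 (\<lambda>z. z 1))"
    by (rule fl[of 1 0 "\<lambda>a b z. z 1" "\<lambda>_. w / q" w "w / q"])
      (use assms(1) w0 in \<open>auto intro: lunit_var simp: torus_def\<close>)
  have g1: "generically {0, L} (\<lambda>\<zeta>. \<forall>i\<in>{1..<L}. free_locus L w (\<zeta> 0) (\<zeta> L) i (\<lambda>z. q * z (i + 1)))"
  proof (rule generically_ball)
    fix i assume i: "i \<in> {1..<L}"
    \<comment> \<open>With \<open>w\<close> in the columns up to \<open>i\<close> and
      \<open>w / q\<close> beyond, the quotient of \<open>z_i\<close> and \<open>z_(i+1)\<close> is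
      \<open>q\<close>, so the special point lies on the divisor.\<close>
    show "generically {0, L} (\<lambda>\<zeta>. free_locus L w (\<zeta> 0) (\<zeta> L) i (\<lambda>z. q * z (i + 1)))"
      by (rule fl[of i i "\<lambda>a b z. q * z (i + 1)" "\<lambda>j. if j \<le> i then w else w / q" w "w / q"])
        (use i w0 in \<open>auto intro!: lunit_mult lunit_const lunit_var simp: torus_def\<close>)
  qed simp
  \<comment> \<open>On the left divisors all columns take the value \<open>w / q\<close>, which
    calls for \<open>\<zeta> 0 = inverse w\<close> here and \<open>\<zeta> 0 = w\<close> in the next
    case. On the right ones all columns take the value \<open>w\<close>, with
    \<open>\<zeta> L = w / q\<close> and then \<open>\<zeta> L = q / w\<close>.\<close>
  have g2: "generically {0, L} (\<lambda>\<zeta>. free_locus L w (\<zeta> 0) (\<zeta> L) 1 (\<lambda>_. 1 / (q * \<zeta> 0)))"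
    by (rule fl[of 1 0 "\<lambda>a b z. 1 / (q * a)" "\<lambda>_. w / q" "inverse w" "w / q"])
      (use assms(1) w0 in \<open>auto intro!: lunit_divide lunit_mult lunit_const lunit_var simp: torus_def field_simps\<close>)
  have g3: "generically {0, L} (\<lambda>\<zeta>. free_locus L w (\<zeta> 0) (\<zeta> L) 1 (\<lambda>_. \<zeta> 0 / q))"
    by (rule fl[of 1 0 "\<lambda>a b z. a / q" "\<lambda>_. w / q" w "w / q"])
      (use assms(1) w0 in \<open>auto intro!: lunit_divide lunit_mult lunit_const lunit_var simp: torus_def\<close>)
  have g4: "generically {0, L} (\<lambda>\<zeta>. free_locus L w (\<zeta> 0) (\<zeta> L) L (\<lambda>_. q * \<zeta> L))"
    by (rule fl[of L L "\<lambda>a b z. q * b" "\<lambda>_. w" w "w / q"])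
      (use assms(1) w0 in \<open>auto intro!: lunit_divide lunit_mult lunit_const lunit_var simp: torus_def\<close>)
  have g5: "generically {0, L} (\<lambda>\<zeta>. free_locus L w (\<zeta> 0) (\<zeta> L) L (\<lambda>_. q / \<zeta> L))"
    by (rule fl[of L L "\<lambda>a b z. q / b" "\<lambda>_. w" w "q / w"])
      (use assms(1) w0 in \<open>auto intro!: lunit_divide lunit_mult lunit_const lunit_var simp: torus_def\<close>)
  \<comment> \<open>At boundary parameter 1 the two values of \<open>kfun\<close> are -3 and -1, so
    neither function vanishes identically.\<close>
  have "q + q\<^sup>2 = (q\<^sup>2 + q + 1) - 1" by simp
  hence qq: "q + q\<^sup>2 = - 1" unfolding q_cubic by simp
  have "- q - q\<^sup>2 = - (q + q\<^sup>2)" by simp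
  hence "- q - q\<^sup>2 = 1" unfolding qq by simp
  with qq have k: "kfun 1 1 \<noteq> 0" "kfun \<i> 1 \<noteq> 0"
    by (simp_all add: kfun_expand)
  have n1: "generically {0, L} (\<lambda>\<zeta>. \<zeta> j ^ 4 \<noteq> 1)" if "j \<in> {0, L}" for j
    by (rule generically_lfun[of "\<lambda>\<zeta>. \<zeta> j ^ 4 - 1" _ "\<lambda>_. 2"])
      (use that in \<open>auto intro!: lfun_diff lfun_power lfun.intros simp: torus_def\<close>)
  have n2: "generically {0, L} (\<lambda>\<zeta>. kfun x (\<zeta> j) \<noteq> 0)" if "j \<in> {0, L}" "kfun x 1 \<noteq> 0" for j x
    by (rule generically_lfun[of "\<lambda>\<zeta>. kfun x (\<zeta> j)" _ "\<lambda>_. 1"])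
      (use that in \<open>auto intro!: lfun_kfun lunit_const lunit_var simp: torus_def\<close>)
  have j: "0 \<in> {0, L}" "L \<in> {0, L}" by auto
  have "generically {0, L} (\<lambda>\<zeta>. free_locus L w (\<zeta> 0) (\<zeta> L) 1 (\<lambda>z. z 1) \<and>
      (\<forall>i\<in>{1..<L}. free_locus L w (\<zeta> 0) (\<zeta> L) i (\<lambda>z. q * z (i + 1))) \<and>
      free_locus L w (\<zeta> 0) (\<zeta> L) 1 (\<lambda>_. 1 / (q * \<zeta> 0)) \<and> free_locus L w (\<zeta> 0) (\<zeta> L) 1 (\<lambda>_. \<zeta> 0 / q) \<and>
      free_locus L w (\<zeta> 0) (\<zeta> L) L (\<lambda>_. q * \<zeta> L) \<and> free_locus L w (\<zeta> 0) (\<zeta> L) L (\<lambda>_. q / \<zeta> L) \<and>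
      \<zeta> 0 ^ 4 \<noteq> 1 \<and> kfun 1 (\<zeta> 0) \<noteq> 0 \<and> \<zeta> L ^ 4 \<noteq> 1 \<and> kfun 1 (\<zeta> L) \<noteq> 0 \<and> kfun \<i> (\<zeta> L) \<noteq> 0)"
    by (intro generically_conj g0 g1 g2 g3 g4 g5 n1 n2 j k)
  thus ?thesis
  proof (rule generically_mono)
    fix \<zeta> :: "nat \<Rightarrow> complex"
    assume nz: "\<forall>i\<in>{0, L}. \<zeta> i \<noteq> 0" and good: "free_locus L w (\<zeta> 0) (\<zeta> L) 1 (\<lambda>z. z 1) \<and>
      (\<forall>i\<in>{1..<L}. free_locus L w (\<zeta> 0) (\<zeta> L) i (\<lambda>z. q * z (i + 1))) \<and>
      free_locus L w (\<zeta> 0) (\<zeta> L) 1 (\<lambda>_. 1 / (q * \<zeta> 0)) \<and> free_locus L w (\<zeta> 0) (\<zeta> L) 1 (\<lambda>_. \<zeta> 0 / q) \<and>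
      free_locus L w (\<zeta> 0) (\<zeta> L) L (\<lambda>_. q * \<zeta> L) \<and> free_locus L w (\<zeta> 0) (\<zeta> L) L (\<lambda>_. q / \<zeta> L) \<and>
      \<zeta> 0 ^ 4 \<noteq> 1 \<and> kfun 1 (\<zeta> 0) \<noteq> 0 \<and> \<zeta> L ^ 4 \<noteq> 1 \<and> kfun 1 (\<zeta> L) \<noteq> 0 \<and> kfun \<i> (\<zeta> L) \<noteq> 0"
    have main: "(centred L \<Psi> \<longrightarrow> qKZ L s (\<zeta> 0) (\<zeta> L) \<Psi>) \<and>
        (\<exists>m. keys m \<subseteq> {1..L} \<and> centred L (monomial_mult m \<Psi>) \<and> qKZ L s (\<zeta> 0) (\<zeta> L) (monomial_mult m \<Psi>))"
      if gs: "ground_state L (\<zeta> 0) (\<zeta> L) \<Psi>" for \<Psi>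
    proof -
      interpret generic_ground_state L w "\<zeta> 0" "\<zeta> L" \<Psi>
        by unfold_locales (use assms(1) nz good gs in auto)
      obtain m where m: "keys m \<subseteq> {1..L}" "centred L (monomial_mult m \<Psi>)" using centring_monomial by blast
      have "qKZ L s (\<zeta> 0) (\<zeta> L) (monomial_mult m \<Psi>)"
        by (rule generic_ground_state.centred_qKZ[OF monomial_mult_generic[OF m(1)] assms(2) m(2)])
      thus ?thesis using centred_qKZ[OF assms(2)] m by blast
    qed
    show "unique_fixed_vec L (\<zeta> 0) (\<zeta> L) \<longrightarrow>
           (\<forall>\<Psi>. ground_state L (\<zeta> 0) (\<zeta> L) \<Psi> \<longrightarrow>
              (centred L \<Psi> \<longrightarrow> qKZ L s (\<zeta> 0) (\<zeta> L) \<Psi>) \<and>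
              (\<exists>m. Poly_Mapping.keys m \<subseteq> {1..L} \<and> centred L (monomial_mult m \<Psi>) \<and>
                   qKZ L s (\<zeta> 0) (\<zeta> L) (monomial_mult m \<Psi>)))"
      using main by blast
  qed
qed

end
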